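(* Let $d\ge 2$ be an integer, let $q_\circ(d)=\frac{2(d+1)}{d-1}$, and let $q\in(2,\infty)\setminus\{q_\circ(d)\}$. Set $s_c(q,d)=\frac{d+1}{4}-\frac{d-1}{2q}$ if $2\le q<q_\circ(d)$ and $s_c(q,d)=\frac d2-\frac dq$ if $q\ge q_\circ(d)$. Then there is a constant $C$ (depending only on $d,q$) such that $$\Big\| \sup_{t \in (0,1)} \big|e^{it\sqrt{-\Delta}}f\big|\Big\|_{L^{q}(\mathbb{R}^d)} \le C \|f\|_{H^{s_c(q,d)}(\mathbb{R}^d)}$$ for all $f\in H^{s_c(q,d)}(\mathbb R^d)$.
   Context: The wave operator is $e^{it\sqrt{-\Delta}}f(x)=\frac1{(2\pi)^d}\int_{\mathbb R^d}e^{i(x\cdot\xi+t|\xi|)}\widehat f(\xi)\,d\xi$, with $\widehat f(\xi)=\int e^{-ix\cdot\xi}f(x)\,dx$. $H^s(\mathbb R^d)$ is the inhomogeneous $L^2$ Sobolev space with norm $\|(1-\Delta)^{s/2}f\|_{L^2}$. As usual, such a maximal estimate may be read as an a priori estimate for Schwartz functions $f$ with a constant independent of $f$, extended to the whole Sobolev space by density. *)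

theory Defs
  imports "HOL-Analysis.Analysis"
begin

section \<open>Schwartz functions and the Fourier transform\<close>

text \<open>\<open>iter_partial [b1, ..., bk] f\<close> is the iterated directional derivative of \<open>f\<close> along
  \<open>bk\<close>, ..., \<open>b1\<close>; for basis vectors these are the partial derivatives of order \<open>k\<close>.\<close>

primrec iter_partial ::
  "'a::euclidean_space list \<Rightarrow> ('a \<Rightarrow> complex) \<Rightarrow> 'a \<Rightarrow> complex" where
  "iter_partial [] f = f"
| "iter_partial (b # bs) f = (\<lambda>x. frechet_derivative (iter_partial bs f) (at x) b)"

text \<open>Differentiability of all iterated partial derivatives is smoothness; it has to be
  demanded because \<^const>\<open>frechet_derivative\<close> is an arbitrary value where the derivative does
  not exist.\<close>

definition schwartz :: "('a::euclidean_space \<Rightarrow> complex) \<Rightarrow> bool" where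
  "schwartz f \<longleftrightarrow> (\<forall>bs. set bs \<subseteq> Basis \<longrightarrow>
     (\<forall>x. iter_partial bs f differentiable (at x)) \<and>
     (\<forall>k::nat. bounded (range (\<lambda>x. (1 + norm x) ^ k *\<^sub>R iter_partial bs f x))))"

definition fourier :: "('a::euclidean_space \<Rightarrow> complex) \<Rightarrow> 'a \<Rightarrow> complex" where
  "fourier f \<xi> = (LINT x|lborel. cis (- (x \<bullet> \<xi>)) * f x)"

definition wave :: "real \<Rightarrow> ('a::euclidean_space \<Rightarrow> complex) \<Rightarrow> 'a \<Rightarrow> complex" where
  "wave t f x = (1 / (2 * pi) ^ DIM('a)) *\<^sub>R
     (LINT \<xi>|lborel. cis (x \<bullet> \<xi> + t * norm \<xi>) * fourier f \<xi>)"

section \<open>Lebesgue norms\<close>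

text \<open>The real power \<open>x\<^sup>p\<close> on \<open>[0, \<infinity>]\<close>, for exponents \<open>p > 0\<close>.\<close>

definition ennreal_rpow :: "ennreal \<Rightarrow> real \<Rightarrow> ennreal" where
  "ennreal_rpow x p = (if x = \<infinity> then \<infinity> else ennreal (enn2real x powr p))"

text \<open>The norm is defined for functions with values in \<open>[0, \<infinity>]\<close>, since it is applied to
  maximal functions, which need not be finite everywhere.\<close>

definition Lp_norm :: "real \<Rightarrow> ('a::euclidean_space \<Rightarrow> ennreal) \<Rightarrow> ennreal" where
  "Lp_norm p F = ennreal_rpow (\<integral>\<^sup>+x. ennreal_rpow (F x) p \<partial>lborel) (1 / p)"

definition L2_norm_fun :: "('a::euclidean_space \<Rightarrow> complex) \<Rightarrow> ennreal" where
  "L2_norm_fun f = Lp_norm 2 (\<lambda>x. ennreal (cmod (f x)))"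

definition L2_space :: "('a::euclidean_space \<Rightarrow> complex) set" where
  "L2_space = {f \<in> borel_measurable borel. L2_norm_fun f < \<infinity>}"

section \<open>Fourier multipliers on \<open>L\<^sup>2\<close> and Sobolev spaces\<close>

text \<open>\<open>g\<close> is the Fourier transform of the \<open>L\<^sup>2\<close> function \<open>f\<close> in the sense of tempered
  distributions.  It is determined by \<open>f\<close> up to a null set.\<close>

definition has_fourier_L2 ::
  "('a::euclidean_space \<Rightarrow> complex) \<Rightarrow> ('a \<Rightarrow> complex) \<Rightarrow> bool" where
  "has_fourier_L2 f g \<longleftrightarrow> f \<in> L2_space \<and> g \<in> L2_space \<and>
     (\<forall>\<phi>. schwartz \<phi> \<longrightarrow>
        (LINT x|lborel. f x * fourier \<phi> x) = (LINT \<xi>|lborel. g \<xi> * \<phi> \<xi>))"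

text \<open>\<open>h\<close> represents \<open>m(D) f\<close>, the element of \<open>L\<^sup>2\<close> whose Fourier transform is \<open>m\<close> times
  that of \<open>f\<close>.\<close>

definition is_fourier_multiplier ::
  "('a::euclidean_space \<Rightarrow> complex) \<Rightarrow> ('a \<Rightarrow> complex) \<Rightarrow> ('a \<Rightarrow> complex) \<Rightarrow> bool" where
  "is_fourier_multiplier m f h \<longleftrightarrow>
     (\<exists>g. has_fourier_L2 f g \<and> has_fourier_L2 h (\<lambda>\<xi>. m \<xi> * g \<xi>))"

text \<open>The symbol of \<open>(1 - \<Delta>)\<^bsup>s/2\<^esup>\<close>.\<close>

definition bessel_symbol :: "real \<Rightarrow> 'a::euclidean_space \<Rightarrow> complex" where
  "bessel_symbol s \<xi> = of_real ((1 + (norm \<xi>)\<^sup>2) powr (s / 2))"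

text \<open>The Sobolev space \<open>H\<^sup>s\<close> for \<open>s \<ge> 0\<close>, where \<open>H\<^sup>s \<subseteq> L\<^sup>2\<close>; its elements are given by
  Borel representatives.\<close>

definition sobolev_space :: "real \<Rightarrow> ('a::euclidean_space \<Rightarrow> complex) set" where
  "sobolev_space s = {f. \<exists>h. is_fourier_multiplier (bessel_symbol s) f h}"

text \<open>\<open>h = (1 - \<Delta>)\<^bsup>s/2\<^esup> f\<close> is unique up to a null set, so the choice is immaterial.\<close>

definition sobolev_norm :: "real \<Rightarrow> ('a::euclidean_space \<Rightarrow> complex) \<Rightarrow> ennreal" where
  "sobolev_norm s f = L2_norm_fun (SOME h. is_fourier_multiplier (bessel_symbol s) f h)"

section \<open>The wave operator on general data\<close>

text \<open>For \<open>f \<in> L\<^sup>2\<close> the function \<open>e\<^bsup>it\<surd>(-\<Delta>)\<^esup> f\<close> is determined only up to a null set, for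
  each single \<open>t\<close>, whereas the maximal function takes a supremum over uncountably many \<open>t\<close>.
  It is formed with a version that is continuous in \<open>t\<close> for almost every \<open>x\<close>; two such
  versions have the same maximal function almost everywhere.\<close>

definition is_wave_version ::
  "('a::euclidean_space \<Rightarrow> complex) \<Rightarrow> (real \<Rightarrow> 'a \<Rightarrow> complex) \<Rightarrow> bool" where
  "is_wave_version f u \<longleftrightarrow>
     (\<forall>t\<in>{0<..<1}. is_fourier_multiplier (\<lambda>\<xi>. cis (t * norm \<xi>)) f (u t)) \<and>
     (AE x in lborel. continuous_on {0<..<1} (\<lambda>t. u t x))"

definition maximal_fun ::
  "(real \<Rightarrow> 'a::euclidean_space \<Rightarrow> complex) \<Rightarrow> 'a \<Rightarrow> ennreal" where
  "maximal_fun u x = (SUP t\<in>{0<..<1}. ennreal (cmod (u t x)))"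

section \<open>Exponents\<close>

definition q_circ :: "nat \<Rightarrow> real" where
  "q_circ d = 2 * (real d + 1) / (real d - 1)"

definition s_c :: "real \<Rightarrow> nat \<Rightarrow> real" where
  "s_c q d = (if q < q_circ d then (real d + 1) / 4 - (real d - 1) / (2 * q)
              else real d / 2 - real d / q)"

end

theory Submission
  imports Defs "HOL-Probability.Probability" "HOL-Complex_Analysis.Complex_Analysis"
    "HOL-Real_Asymp.Real_Asymp"
begin

text \<open>Split the data into dyadic frequency shells. By the \<open>T T\<^sup>*\<close> method, a weak
  type estimate for the maximal function of one shell of frequency \<open>\<lambda>\<close> reduces to the quadratic form with
  kernel \<open>K (x - y, t(x) - t(y))\<close> on a level set, where the linearising time \<open>t(x)\<close> may be taken from a
  finite set. Localising with the weight \<open>e\<^bsup>-|\<xi>|/\<lambda>\<^esup>\<close> instead of a bump function makes \<open>K\<close> the Poisson kernel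
  at the complex time \<open>1/\<lambda> - i t\<close>, which is explicit. Time blocks of length \<open>1/(2\<lambda>)\<close> are treated by
  Schur's test, nearby blocks by Cauchy-Schwarz, and distant blocks by the dispersive bound.
  This yields sharp weak type estimates at the ends of each of the two segments on which the critical
  exponent is affine in \<open>1/q\<close>. Since its slope there is nonzero, the shells sum by a
  Marcinkiewicz type argument, without loss in the exponent.\<close>

text \<open>Every constant except the power of the frequency may be lost, so exact Plancherel is
  replaced by inequalities in both directions, obtained by testing the distributional definition
  against Gaussians. The Poisson kernel is computed at real times by subordination and continued
  analytically; its closed form is what makes the bounds uniform over the complex times. For a level
  set of measure m in a shell of frequency \<lambda>, with N blocks counted as nearby, the form is
  O(N m + \<lambda>^d N^(-(d-1)/2) m^2), and balancing the two terms in N produces the exponent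
  \<open>q_circ\<close>. There the critical exponent has a kink, while the summation requires one
  affine law on both sides of q; hence q \<noteq> \<open>q_circ\<close>. A further obstacle is that
  a general f has no canonical pointwise evolution. The summed shell bound settles this as well:
  where the shell maximal functions have a finite sum, the shell series converges uniformly in t,
  and its sum is a version continuous in t.\<close>

section \<open>Product integrals and Gaussian integrals\<close>

lemma borel_measurable_cis [measurable (raw)]:
  "f \<in> borel_measurable M \<Longrightarrow> (\<lambda>x. cis (f x)) \<in> borel_measurable M"
  unfolding cis_conv_exp by measurable

text \<open>By \<open>lborel_eq\<close>, Lebesgue measure is the image of a product of
  one-dimensional measures under the coordinate map, so Fubini for finite products applies.\<close>

lemma
  fixes f :: "'a::euclidean_space \<Rightarrow> real \<Rightarrow> 'c::{real_normed_field,banach,second_countable_topology}"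
  assumes int: "\<And>b. b \<in> Basis \<Longrightarrow> integrable lborel (f b)"
  shows integrable_prod_Basis: "integrable lborel (\<lambda>x::'a. \<Prod>b\<in>Basis. f b (x \<bullet> b))"
    and integral_prod_Basis:
      "(LINT x|lborel. (\<Prod>b\<in>Basis. f b (x \<bullet> b))) = (\<Prod>b\<in>Basis. (LINT y|lborel. f b y))"
proof -
  interpret product_sigma_finite "\<lambda>_::'a. lborel :: real measure"
    by standard
  let ?T = "\<lambda>y. \<Sum>b\<in>Basis. y b *\<^sub>R (b::'a)"
  have T: "?T \<in> measurable (\<Pi>\<^sub>M b\<in>Basis. lborel) borel"
    by measurable
  have inner_T: "?T y \<bullet> b = y b" if "b \<in> Basis" for y b
    using that by (simp add: inner_sum_left inner_Basis if_distrib cong: if_cong)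
  have meas: "(\<lambda>x::'a. \<Prod>b\<in>Basis. f b (x \<bullet> b)) \<in> borel_measurable borel"
    using int by (intro borel_measurable_prod) (auto intro: measurable_compose[rotated])
  have eq: "(\<Prod>b\<in>Basis. f b (?T y \<bullet> b)) = (\<Prod>b\<in>Basis. f b (y b))" for y
    by (intro prod.cong refl) (simp add: inner_T)
  show "integrable lborel (\<lambda>x::'a. \<Prod>b\<in>Basis. f b (x \<bullet> b))"
    unfolding lborel_eq[where 'a='a] integrable_distr_eq[OF T meas] eq
    by (intro product_integrable_prod int) auto
  show "(LINT x|lborel. (\<Prod>b\<in>Basis. f b (x \<bullet> b))) = (\<Prod>b\<in>Basis. (LINT y|lborel. f b y))"
    unfolding lborel_eq[where 'a='a] integral_distr[OF T meas] eq
    by (intro product_integral_prod int) auto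
qed

lemma
  fixes s \<xi> :: real
  assumes s: "s > 0"
  shows integrable_cis_gaussian_real: "integrable lborel (\<lambda>x. cis (x * \<xi>) * of_real (exp (- s * x\<^sup>2)))"
    and integral_cis_gaussian_real:
      "(LINT x|lborel. cis (x * \<xi>) * of_real (exp (- s * x\<^sup>2))) = of_real (sqrt (pi / s) * exp (- \<xi>\<^sup>2 / (4 * s)))"
proof -
  \<comment> \<open>Rescaling by c, with c^2 = 2 s, turns the Gaussian into the standard normal
    density, whose characteristic function is known.\<close>
  define c where "c = sqrt (2 * s)"
  have c: "c > 0" "c\<^sup>2 = 2 * s" using s by (auto simp: c_def)
  let ?g = "\<lambda>x. cis (x * \<xi>) * of_real (exp (- s * x\<^sup>2)) :: complex"
  have "integrable lborel (\<lambda>x. std_normal_density x * x ^ (2 * 0))"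
    using std_normal_moment_even[of 0] by (simp only: has_bochner_integral_iff)
  then have "integrable lborel (\<lambda>x. complex_of_real (std_normal_density x))"
    by simp
  then have "integrable lborel (\<lambda>x. complex_of_real (std_normal_density x) * cis (\<xi> / c * x))"
    by (rule Bochner_Integration.integrable_bound) (auto simp: norm_mult)
  then have i1: "integrable lborel (\<lambda>x. cis (\<xi> / c * (0 + c * x)) * of_real (std_normal_density (0 + c * x)))"
    using lborel_integrable_real_affine[of "\<lambda>x. of_real (std_normal_density x) * cis (\<xi> / c * x)" c 0] c
    by (simp add: mult.commute)
  have eq: "cis (\<xi> / c * (0 + c * x)) * of_real (std_normal_density (0 + c * x)) = of_real (1 / sqrt (2 * pi)) * ?g x" for x
    using c by (simp add: std_normal_density_def power_mult_distrib mult_ac)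
  have "integrable lborel (\<lambda>x. of_real (sqrt (2 * pi)) * (of_real (1 / sqrt (2 * pi)) * ?g x))"
    using i1[unfolded eq] by (rule integrable_mult_right)
  then show "integrable lborel ?g"
    by (simp add: field_simps)
  have "of_real (exp (- ((\<xi> / c)\<^sup>2) / 2)) = char std_normal_distribution (\<xi> / c)"
    by (simp add: char_std_normal_distribution)
  also have "\<dots> = (LINT x|lborel. std_normal_density x *\<^sub>R cis (\<xi> / c * x))"
    unfolding char_def by (subst integral_density) (auto simp: cis_conv_exp)
  also have "\<dots> = (LINT x|lborel. cis (\<xi> / c * x) * of_real (std_normal_density x))"
    by (simp add: scaleR_conv_of_real mult.commute)
  also have "\<dots> = \<bar>c\<bar> *\<^sub>R (LINT x|lborel. cis (\<xi> / c * (0 + c * x)) * of_real (std_normal_density (0 + c * x)))"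
    using c by (intro lborel_integral_real_affine) auto
  also have "\<dots> = of_real (c / sqrt (2 * pi)) * (LINT x|lborel. ?g x)"
    unfolding eq using c by (simp add: scaleR_conv_of_real)
  finally have "(LINT x|lborel. ?g x) = of_real (sqrt (2 * pi) / c) * of_real (exp (- ((\<xi> / c)\<^sup>2) / 2))"
    using c by (simp add: field_simps)
  also have "sqrt (2 * pi) / c = sqrt (pi / s)"
    unfolding c_def real_sqrt_divide[symmetric] using s by simp
  also have "- ((\<xi> / c)\<^sup>2) / 2 = - \<xi>\<^sup>2 / (4 * s)"
    using c by (simp add: power_divide)
  finally show "(LINT x|lborel. ?g x) = of_real (sqrt (pi / s) * exp (- \<xi>\<^sup>2 / (4 * s)))"
    by simp
qed

lemma cis_inner_eq_prod: "cis ((x::'a::euclidean_space) \<bullet> y) = (\<Prod>b\<in>Basis. cis ((x \<bullet> b) * (y \<bullet> b)))"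
proof -
  have "cis (sum f A) = (\<Prod>b\<in>A. cis (f b))" if "finite A" for f :: "'a \<Rightarrow> real" and A
    using that by induction (auto simp: cis_mult[symmetric])
  then show ?thesis
    by (subst euclidean_inner) auto
qed

lemma exp_norm_eq_prod: "exp (- s * (norm (x::'a::euclidean_space))\<^sup>2) = (\<Prod>b\<in>Basis. exp (- s * (x \<bullet> b)\<^sup>2))"
proof -
  have "(norm x)\<^sup>2 = (\<Sum>b\<in>Basis. (x \<bullet> b)\<^sup>2)"
    by (simp add: norm_eq_sqrt_inner euclidean_inner[of x x] power2_eq_square sum_nonneg)
  then have "- s * (norm x)\<^sup>2 = (\<Sum>b\<in>Basis. - s * (x \<bullet> b)\<^sup>2)"
    by (simp only: sum_distrib_left)
  then show ?thesis
    by (simp only: exp_sum[OF finite_Basis])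
qed

lemma
  fixes \<xi> :: "'a::euclidean_space"
  assumes s: "s > 0"
  shows integrable_cis_gaussian:
      "integrable lborel (\<lambda>x::'a. cis (x \<bullet> \<xi>) * of_real (exp (- s * (norm x)\<^sup>2)))"
    and integral_cis_gaussian:
      "(LINT x|lborel. cis (x \<bullet> \<xi>) * of_real (exp (- s * (norm x)\<^sup>2)))
        = of_real (sqrt (pi / s) ^ DIM('a) * exp (- (norm \<xi>)\<^sup>2 / (4 * s)))"
proof -
  let ?f = "\<lambda>b y. cis (y * (\<xi> \<bullet> b)) * of_real (exp (- s * y\<^sup>2)) :: complex"
  have eq: "cis (x \<bullet> \<xi>) * of_real (exp (- s * (norm x)\<^sup>2)) = (\<Prod>b\<in>Basis. ?f b (x \<bullet> b))" for x
    by (simp only: cis_inner_eq_prod exp_norm_eq_prod prod.distrib of_real_prod)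
  show "integrable lborel (\<lambda>x::'a. cis (x \<bullet> \<xi>) * of_real (exp (- s * (norm x)\<^sup>2)))"
    unfolding eq by (intro integrable_prod_Basis integrable_cis_gaussian_real s)
  have "(LINT x|lborel. cis (x \<bullet> \<xi>) * of_real (exp (- s * (norm x)\<^sup>2)))
      = (\<Prod>b\<in>Basis. of_real (sqrt (pi / s) * exp (- (\<xi> \<bullet> b)\<^sup>2 / (4 * s))))"
    unfolding eq
    by (subst integral_prod_Basis, intro integrable_cis_gaussian_real s)
       (simp only: integral_cis_gaussian_real[OF s])
  also have "\<dots> = of_real (sqrt (pi / s) ^ DIM('a) * (\<Prod>b\<in>Basis. exp (- (1 / (4 * s)) * (\<xi> \<bullet> b)\<^sup>2)))"
    by (simp add: prod.distrib)
  also have "\<dots> = of_real (sqrt (pi / s) ^ DIM('a) * exp (- (norm \<xi>)\<^sup>2 / (4 * s)))"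
    unfolding exp_norm_eq_prod[symmetric] by simp
  finally show "(LINT x|lborel. cis (x \<bullet> \<xi>) * of_real (exp (- s * (norm x)\<^sup>2)))
        = of_real (sqrt (pi / s) ^ DIM('a) * exp (- (norm \<xi>)\<^sup>2 / (4 * s)))" .
qed

lemma
  assumes s: "s > 0"
  shows integrable_gaussian: "integrable lborel (\<lambda>x::'a::euclidean_space. exp (- s * (norm x)\<^sup>2))"
    and integral_gaussian: "(LINT x|lborel. exp (- s * (norm (x::'a))\<^sup>2)) = sqrt (pi / s) ^ DIM('a)"
proof -
  have i: "integrable lborel (\<lambda>x::'a. complex_of_real (exp (- s * (norm x)\<^sup>2)))"
    using integrable_cis_gaussian[OF s, of "0::'a"] by simp
  then show "integrable lborel (\<lambda>x::'a. exp (- s * (norm x)\<^sup>2))"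
    by (simp only: complex_of_real_integrable_eq)
  have "complex_of_real (LINT x|lborel. exp (- s * (norm (x::'a))\<^sup>2)) = of_real (sqrt (pi / s) ^ DIM('a))"
    unfolding integral_complex_of_real[symmetric]
    using integral_cis_gaussian[OF s, of "0::'a"] by (simp del: integral_complex_of_real)
  then show "(LINT x|lborel. exp (- s * (norm (x::'a))\<^sup>2)) = sqrt (pi / s) ^ DIM('a)"
    by (simp only: of_real_eq_iff)
qed

text \<open>Each coordinate satisfies
  \<open>1 + (x \<bullet> b)\<^sup>2 \<le> (1 + norm x)\<^sup>2\<close>. Multiplying over the basis
  gives the exponent 2 d and domination by a product of one-dimensional integrable functions. This
  weight is the standard majorant for Schwartz functions below.\<close>

lemma integrable_polynomial_decay: "integrable lborel (\<lambda>x::'a::euclidean_space. 1 / (1 + norm x) ^ (2 * DIM('a)))"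
proof -
  have 1: "integrable lborel (\<lambda>x::real. inverse (1 + x\<^sup>2))"
    using integrable_inverse_1_plus_square by (simp add: set_integrable_def)
  have "integrable lborel (\<lambda>x::'a. \<Prod>b\<in>Basis. inverse (1 + (x \<bullet> b)\<^sup>2))"
    by (intro integrable_prod_Basis 1)
  then show ?thesis
  proof (rule Bochner_Integration.integrable_bound, measurable, intro AE_I2)
    fix x :: 'a
    have "(\<Prod>b\<in>(Basis::'a set). 1 + (x \<bullet> b)\<^sup>2) \<le> (\<Prod>b\<in>(Basis::'a set). (1 + norm x)\<^sup>2)"
    proof (intro prod_mono conjI)
      fix b :: 'a assume "b \<in> Basis"
      then have "\<bar>x \<bullet> b\<bar>\<^sup>2 \<le> (norm x)\<^sup>2" by (intro power_mono Basis_le_norm) auto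
      then show "1 + (x \<bullet> b)\<^sup>2 \<le> (1 + norm x)\<^sup>2" by (simp add: power2_sum add_increasing2)
    qed auto
    also have "\<dots> = (1 + norm x) ^ (2 * DIM('a))"
      by (simp add: power_mult power_even_eq)
    finally have "(\<Prod>b\<in>(Basis::'a set). 1 + (x \<bullet> b)\<^sup>2) \<le> (1 + norm x) ^ (2 * DIM('a))" .
    moreover have "(\<Prod>b\<in>(Basis::'a set). 1 + (x \<bullet> b)\<^sup>2) > 0"
      by (intro prod_pos) (auto simp: add_pos_nonneg)
    ultimately have "1 / (1 + norm x) ^ (2 * DIM('a)) \<le> 1 / (\<Prod>b\<in>(Basis::'a set). 1 + (x \<bullet> b)\<^sup>2)"
      by (intro divide_left_mono) auto
    also have "\<dots> = (\<Prod>b\<in>(Basis::'a set). inverse (1 + (x \<bullet> b)\<^sup>2))"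
      by (simp add: prod_dividef inverse_eq_divide)
    finally show "norm (1 / (1 + norm x) ^ (2 * DIM('a))) \<le> norm (\<Prod>b\<in>Basis. inverse (1 + (x \<bullet> b)\<^sup>2))"
      by simp
  qed
qed

section \<open>Reflection and translation invariance of Lebesgue measure, and limits of
  integrals\<close>

lemma distr_uminus_lborel: "distr lborel borel uminus = (lborel :: 'a::euclidean_space measure)"
  by (subst lborel_affine[of "-1" 0]) (auto simp: density_1 one_ennreal_def[symmetric])

lemma nn_integral_lborel_translate:
  fixes f :: "'a::euclidean_space \<Rightarrow> ennreal"
  assumes [measurable]: "f \<in> borel_measurable borel"
  shows "(\<integral>\<^sup>+x. f (a + x) \<partial>lborel) = (\<integral>\<^sup>+x. f x \<partial>lborel)"
  by (subst (2) lborel_distr_plus[of a, symmetric]) (simp add: nn_integral_distr)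

lemma nn_integral_lborel_reflect:
  fixes f :: "'a::euclidean_space \<Rightarrow> ennreal"
  assumes [measurable]: "f \<in> borel_measurable borel"
  shows "(\<integral>\<^sup>+x. f (a - x) \<partial>lborel) = (\<integral>\<^sup>+x. f x \<partial>lborel)"
proof -
  have "(\<integral>\<^sup>+x. f x \<partial>lborel) = (\<integral>\<^sup>+x. f (a + x) \<partial>lborel)"
    by (simp add: nn_integral_lborel_translate)
  also have "\<dots> = (\<integral>\<^sup>+x. f (a - x) \<partial>lborel)"
    by (subst distr_uminus_lborel[symmetric]) (simp add: nn_integral_distr)
  finally show ?thesis by simp
qed

lemma
  fixes f :: "'a::euclidean_space \<Rightarrow> 'b::{banach,second_countable_topology}"
  assumes [measurable]: "f \<in> borel_measurable borel"
  shows integral_lborel_reflect: "(LINT x|lborel. f (a - x)) = (LINT x|lborel. f x)"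
    and integrable_lborel_reflect: "integrable lborel (\<lambda>x. f (a - x)) \<longleftrightarrow> integrable lborel f"
proof -
  have 1: "distr lborel borel (\<lambda>x. a - x) = (lborel :: 'a measure)"
    by (subst lborel_affine[of "-1" a]) (auto simp: density_1 one_ennreal_def[symmetric])
  show "(LINT x|lborel. f (a - x)) = (LINT x|lborel. f x)"
    by (subst (2) 1[symmetric]) (simp add: integral_distr)
  show "integrable lborel (\<lambda>x. f (a - x)) \<longleftrightarrow> integrable lborel f"
    by (subst (2) 1[symmetric]) (simp add: integrable_distr_eq)
qed

text \<open>The Bochner integral of a non-integrable function is 0, so only the integrable case has
  content.\<close>

lemma ennreal_norm_integral_le: "ennreal (norm (integral\<^sup>L M f)) \<le> (\<integral>\<^sup>+x. ennreal (norm (f x)) \<partial>M)"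
  by (cases "integrable M f") (auto simp: integral_norm_bound_ennreal not_integrable_integral_eq)

text \<open>This removes Gaussian regularisations: a bound uniform in the regularisation parameter
  survives the limit.\<close>

lemma nn_integral_Fatou_bound:
  fixes f :: "nat \<Rightarrow> 'a \<Rightarrow> ennreal"
  assumes [measurable]: "\<And>n. f n \<in> borel_measurable M"
    and lim: "AE x in M. (\<lambda>n. f n x) \<longlonglongrightarrow> g x"
    and le: "\<And>n. (\<integral>\<^sup>+x. f n x \<partial>M) \<le> C"
  shows "(\<integral>\<^sup>+x. g x \<partial>M) \<le> C"
proof -
  have "(\<integral>\<^sup>+x. g x \<partial>M) \<le> (\<integral>\<^sup>+x. liminf (\<lambda>n. f n x) \<partial>M)"
    using lim by (intro nn_integral_mono_AE) (auto dest!: lim_imp_Liminf[OF sequentially_bot])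
  also have "\<dots> \<le> liminf (\<lambda>n. \<integral>\<^sup>+x. f n x \<partial>M)"
    by (rule nn_integral_liminf) simp
  also have "\<dots> \<le> C"
    using le by (intro Liminf_le) auto
  finally show ?thesis .
qed

lemma borel_measurable_cnj [measurable (raw)]:
  "f \<in> borel_measurable M \<Longrightarrow> (\<lambda>x. cnj (f x)) \<in> borel_measurable M"
  by (rule borel_measurable_continuous_on[OF continuous_on_cnj[OF continuous_on_id]])

section \<open>The Fourier transform of integrable functions\<close>

lemma borel_measurable_fourier [measurable]:
  fixes F :: "'a::euclidean_space \<Rightarrow> complex"
  assumes [measurable]: "F \<in> borel_measurable borel"
  shows "fourier F \<in> borel_measurable borel"
  unfolding fourier_def by measurable

lemma integrable_cis_mult:
  assumes "integrable M F" and [measurable]: "g \<in> borel_measurable M"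
  shows "integrable M (\<lambda>x. cis (g x) * F x)"
  using assms(1) by (rule Bochner_Integration.integrable_bound) (use assms(1) in \<open>auto simp: norm_mult\<close>)

lemma norm_fourier_le:
  assumes "integrable lborel F"
  shows "norm (fourier F \<xi>) \<le> (LINT x|lborel. norm (F x))"
proof -
  have "norm (fourier F \<xi>) \<le> (LINT x|lborel. norm (cis (- (x \<bullet> \<xi>)) * F x))"
    unfolding fourier_def by (rule integral_norm_bound)
  then show ?thesis by (simp add: norm_mult)
qed

text \<open>Fubini for the kernel cis(- x \<bullet> \<xi>), since F(x) H(\<xi>) is absolutely
  integrable on the product. The formula moves the transform from one factor to the other and is the
  source of the duality arguments below.\<close>

lemma
  fixes F H :: "'a::euclidean_space \<Rightarrow> complex"
  assumes F: "integrable lborel F" and H: "integrable lborel H"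
  shows integrable_mult_fourier: "integrable lborel (\<lambda>x. F x * fourier H x)"
    and fourier_mult_formula: "(LINT x|lborel. F x * fourier H x) = (LINT \<xi>|lborel. fourier F \<xi> * H \<xi>)"
proof -
  have [measurable]: "F \<in> borel_measurable borel" "H \<in> borel_measurable borel"
    using F H by auto
  show "integrable lborel (\<lambda>x. F x * fourier H x)"
  proof (rule Bochner_Integration.integrable_bound)
    show "integrable lborel (\<lambda>x. (LINT x|lborel. norm (H x)) * norm (F x))"
      using F by auto
    show "AE x in lborel. norm (F x * fourier H x) \<le> norm ((LINT x|lborel. norm (H x)) * norm (F x))"
      by (auto simp: norm_mult mult.commute[of _ "cmod (F _)"] intro!: AE_I2 mult_left_mono norm_fourier_le[OF H])
  qed auto
  let ?f = "\<lambda>x \<xi>. F x * (cis (- (\<xi> \<bullet> x)) * H \<xi>)"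
  have int: "integrable (lborel \<Otimes>\<^sub>M lborel) (case_prod ?f)"
  proof (rule lborel_pair.Fubini_integrable)
    have "integrable lborel (\<lambda>x. norm (F x) * (LINT y|lborel. norm (H y)))"
      using F by auto
    then show "integrable lborel (\<lambda>x. LINT y|lborel. norm (case (x, y) of (x, xa) \<Rightarrow> ?f x xa))"
      by (simp add: norm_mult)
    show "AE x in lborel. integrable lborel (\<lambda>y. case (x, y) of (x, xa) \<Rightarrow> ?f x xa)"
      using H by (auto intro!: AE_I2 integrable_mult_right integrable_cis_mult)
  qed measurable
  have "(LINT x|lborel. F x * fourier H x) = (LINT x|lborel. LINT \<xi>|lborel. ?f x \<xi>)"
    by (simp add: fourier_def)
  also have "\<dots> = (LINT \<xi>|lborel. LINT x|lborel. ?f x \<xi>)"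
    by (rule lborel_pair.Fubini_integral[OF int, symmetric])
  also have "(\<lambda>\<xi>. LINT x|lborel. ?f x \<xi>) = (\<lambda>\<xi>. fourier F \<xi> * H \<xi>)"
    unfolding fourier_def
    by (subst integral_mult_left_zero[symmetric]) (simp add: inner_commute mult_ac)
  finally show "(LINT x|lborel. F x * fourier H x) = (LINT \<xi>|lborel. fourier F \<xi> * H \<xi>)" .
qed

lemma fourier_cis_mult: "fourier (\<lambda>x. cis (x \<bullet> a) * F x) \<xi> = fourier F (\<xi> - a)"
  by (simp add: fourier_def inner_diff_right cis_mult mult.assoc[symmetric])

lemma cnj_fourier: "cnj (fourier G \<xi>) = fourier (\<lambda>x. cnj (G x)) (- \<xi>)"
  unfolding fourier_def by (subst Bochner_Integration.integral_cnj[symmetric]) (simp add: cis_cnj)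

lemma fourier_reflect:
  assumes [measurable]: "G \<in> borel_measurable borel"
  shows "fourier (\<lambda>x. G (- x)) \<xi> = fourier G (- \<xi>)"
  using integral_lborel_reflect[of "\<lambda>x. cis (x \<bullet> \<xi>) * G x" 0] by (simp add: fourier_def)

text \<open>This is the T T* identity: a sesquilinear form weighted by w in frequency is a form in
  space whose convolution kernel is the transform of w. The conjugate of a transform is the
  transform of the reflected conjugate, so the multiplication formula applies twice.\<close>

lemma integral_weighted_fourier_product:
  fixes w F G :: "'a::euclidean_space \<Rightarrow> complex"
  assumes w: "integrable lborel w" and F: "integrable lborel F" and G: "integrable lborel G"
  shows "(LINT \<xi>|lborel. w \<xi> * fourier F \<xi> * cnj (fourier G \<xi>))
       = (LINT x|lborel. F x * (LINT y|lborel. cnj (G y) * fourier w (x - y)))"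
proof -
  have [measurable]: "w \<in> borel_measurable borel" "F \<in> borel_measurable borel" "G \<in> borel_measurable borel"
    using w F G by auto
  define H where "H = (\<lambda>x. cnj (G (- x)))"
  have H_meas [measurable]: "H \<in> borel_measurable borel" by (simp add: H_def)
  have H: "integrable lborel H"
    unfolding H_def using integrable_lborel_reflect[of G 0] G by simp
  have cG: "cnj (fourier G \<xi>) = fourier H \<xi>" for \<xi>
    unfolding H_def cnj_fourier by (subst fourier_reflect) auto
  have wH: "integrable lborel (\<lambda>\<xi>. w \<xi> * fourier H \<xi>)"
    by (rule integrable_mult_fourier[OF w H])
  have inner: "fourier (\<lambda>\<xi>. w \<xi> * fourier H \<xi>) x = (LINT y|lborel. cnj (G y) * fourier w (x - y))" for x
  proof -
    have "fourier (\<lambda>\<xi>. w \<xi> * fourier H \<xi>) x = (LINT \<xi>|lborel. (cis (\<xi> \<bullet> - x) * w \<xi>) * fourier H \<xi>)"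
      by (simp add: fourier_def mult_ac)
    also have "\<dots> = (LINT y|lborel. fourier (\<lambda>\<xi>. cis (\<xi> \<bullet> - x) * w \<xi>) y * H y)"
      by (intro fourier_mult_formula integrable_cis_mult w H) measurable
    also have "\<dots> = (LINT y|lborel. fourier w (y + x) * H y)"
      by (simp only: fourier_cis_mult diff_minus_eq_add)
    also have "\<dots> = (LINT y|lborel. fourier w (- y + x) * H (- y))"
      using integral_lborel_reflect[of "\<lambda>y. fourier w (y + x) * H y" 0] by simp
    also have "\<dots> = (LINT y|lborel. cnj (G y) * fourier w (x - y))"
      by (simp add: H_def mult.commute)
    finally show ?thesis .
  qed
  have "(LINT \<xi>|lborel. w \<xi> * fourier F \<xi> * cnj (fourier G \<xi>)) = (LINT \<xi>|lborel. (w \<xi> * fourier H \<xi>) * fourier F \<xi>)"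
    by (simp add: cG mult_ac)
  also have "\<dots> = (LINT x|lborel. fourier (\<lambda>\<xi>. w \<xi> * fourier H \<xi>) x * F x)"
    by (rule fourier_mult_formula[OF wH F])
  finally show ?thesis by (simp add: inner mult.commute)
qed

text \<open>In this form only a majorant k of the kernel has to be supplied later, and F and G enter
  through absolute values.\<close>

lemma norm_integral_weighted_fourier_product_le:
  fixes w F G :: "'a::euclidean_space \<Rightarrow> complex"
  assumes w: "integrable lborel w" and F: "integrable lborel F" and G: "integrable lborel G"
    and k: "\<And>z. ennreal (norm (fourier w z)) \<le> k z"
  shows "ennreal (norm (LINT \<xi>|lborel. w \<xi> * fourier F \<xi> * cnj (fourier G \<xi>)))
       \<le> (\<integral>\<^sup>+x. \<integral>\<^sup>+y. ennreal (norm (F x)) * ennreal (norm (G y)) * k (x - y) \<partial>lborel \<partial>lborel)"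
proof -
  have [measurable]: "w \<in> borel_measurable borel" "F \<in> borel_measurable borel" "G \<in> borel_measurable borel"
    using w F G by auto
  have "ennreal (norm (LINT \<xi>|lborel. w \<xi> * fourier F \<xi> * cnj (fourier G \<xi>)))
     \<le> (\<integral>\<^sup>+x. ennreal (norm (F x * (LINT y|lborel. cnj (G y) * fourier w (x - y)))) \<partial>lborel)"
    unfolding integral_weighted_fourier_product[OF w F G] by (rule ennreal_norm_integral_le)
  also have "\<dots> \<le> (\<integral>\<^sup>+x. ennreal (norm (F x)) * (\<integral>\<^sup>+y. ennreal (norm (cnj (G y) * fourier w (x - y))) \<partial>lborel) \<partial>lborel)"
    unfolding norm_mult[of "F _"]
    by (intro nn_integral_mono) (auto simp: ennreal_mult intro!: mult_left_mono ennreal_norm_integral_le)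
  also have "\<dots> = (\<integral>\<^sup>+x. \<integral>\<^sup>+y. ennreal (norm (F x)) * ennreal (norm (G y)) * ennreal (norm (fourier w (x - y))) \<partial>lborel \<partial>lborel)"
    by (simp add: nn_integral_cmult[symmetric] norm_mult ennreal_mult mult.assoc)
  also have "\<dots> \<le> (\<integral>\<^sup>+x. \<integral>\<^sup>+y. ennreal (norm (F x)) * ennreal (norm (G y)) * k (x - y) \<partial>lborel \<partial>lborel)"
    by (intro nn_integral_mono mult_left_mono k) auto
  finally show ?thesis .
qed

section \<open>Schur's test and the upper half of the Plancherel inequality\<close>

text \<open>The crude inequality a b \<le> a^2 + b^2 splits the form into two terms, in each of
  which the kernel integrates out by translation or reflection invariance.\<close>

lemma Schur_test:
  fixes u v k :: "'a::euclidean_space \<Rightarrow> ennreal"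
  assumes [measurable]: "u \<in> borel_measurable borel" "v \<in> borel_measurable borel" "k \<in> borel_measurable borel"
  shows "(\<integral>\<^sup>+x. \<integral>\<^sup>+y. u x * v y * k (x - y) \<partial>lborel \<partial>lborel)
     \<le> ((\<integral>\<^sup>+x. (u x)\<^sup>2 \<partial>lborel) + (\<integral>\<^sup>+x. (v x)\<^sup>2 \<partial>lborel)) * (\<integral>\<^sup>+x. k x \<partial>lborel)"
proof -
  have le: "a * b \<le> a\<^sup>2 + b\<^sup>2" for a b :: ennreal
  proof (cases "a \<le> b")
    case True
    then have "a * b \<le> b\<^sup>2" by (simp add: power2_eq_square mult_right_mono)
    then show ?thesis by (simp add: add_increasing)
  next
    case False
    then have "a * b \<le> a\<^sup>2" by (simp add: power2_eq_square mult_left_mono)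
    then show ?thesis by (simp add: add_increasing2)
  qed
  have "(\<integral>\<^sup>+x. \<integral>\<^sup>+y. u x * v y * k (x - y) \<partial>lborel \<partial>lborel)
     \<le> (\<integral>\<^sup>+x. \<integral>\<^sup>+y. (u x)\<^sup>2 * k (x - y) + (v y)\<^sup>2 * k (x - y) \<partial>lborel \<partial>lborel)"
    by (intro nn_integral_mono) (auto simp: distrib_right[symmetric] intro!: mult_right_mono le)
  also have "\<dots> = (\<integral>\<^sup>+x. \<integral>\<^sup>+y. (u x)\<^sup>2 * k (x - y) \<partial>lborel \<partial>lborel) + (\<integral>\<^sup>+x. \<integral>\<^sup>+y. (v y)\<^sup>2 * k (x - y) \<partial>lborel \<partial>lborel)"
    by (simp add: nn_integral_add)
  also have "(\<integral>\<^sup>+x. \<integral>\<^sup>+y. (v y)\<^sup>2 * k (x - y) \<partial>lborel \<partial>lborel) = (\<integral>\<^sup>+y. \<integral>\<^sup>+x. (v y)\<^sup>2 * k (x - y) \<partial>lborel \<partial>lborel)"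
    by (rule lborel_pair.Fubini'[symmetric]) measurable
  also have "\<dots> = (\<integral>\<^sup>+y. (v y)\<^sup>2 * (\<integral>\<^sup>+x. k x \<partial>lborel) \<partial>lborel)"
    using nn_integral_lborel_translate[of k "- y" for y]
    by (simp add: nn_integral_cmult)
  also have "\<dots> = (\<integral>\<^sup>+x. (v x)\<^sup>2 \<partial>lborel) * (\<integral>\<^sup>+x. k x \<partial>lborel)"
    by (simp add: nn_integral_multc)
  also have "(\<integral>\<^sup>+x. \<integral>\<^sup>+y. (u x)\<^sup>2 * k (x - y) \<partial>lborel \<partial>lborel) = (\<integral>\<^sup>+x. (u x)\<^sup>2 \<partial>lborel) * (\<integral>\<^sup>+x. k x \<partial>lborel)"
    by (simp add: nn_integral_cmult nn_integral_multc nn_integral_lborel_reflect)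
  finally show ?thesis by (simp add: distrib_right)
qed

text \<open>The squared L2 norm, kept without the root so that it is an integral, and valued in
  [0, \<infinity>] so that estimates make sense before finiteness is known.\<close>

definition sqnorm :: "('a::euclidean_space \<Rightarrow> complex) \<Rightarrow> ennreal" where
  "sqnorm f = (\<integral>\<^sup>+x. ennreal ((norm (f x))\<^sup>2) \<partial>lborel)"

text \<open>The transform of \<open>exp (- e * (norm x)\<^sup>2)\<close>: an unnormalised heat
  kernel, of mass (2 pi)^d for every e > 0, which concentrates at the origin as e tends to
  0.\<close>

definition gauss_kernel :: "real \<Rightarrow> 'a::euclidean_space \<Rightarrow> real" where
  "gauss_kernel e z = sqrt (pi / e) ^ DIM('a) * exp (- (norm z)\<^sup>2 / (4 * e))"

lemma borel_measurable_gauss_kernel [measurable]: "gauss_kernel e \<in> borel_measurable borel"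
  unfolding gauss_kernel_def by measurable

lemma gauss_kernel_nonneg: "e > 0 \<Longrightarrow> gauss_kernel e z \<ge> 0"
  by (simp add: gauss_kernel_def)

lemma
  assumes "e > 0"
  shows integrable_gauss_kernel: "integrable lborel (gauss_kernel e :: 'a::euclidean_space \<Rightarrow> real)"
    and integral_gauss_kernel: "(LINT z|lborel. gauss_kernel e (z::'a)) = (2 * pi) ^ DIM('a)"
proof -
  have eq: "gauss_kernel e = (\<lambda>z::'a. sqrt (pi / e) ^ DIM('a) * exp (- (1 / (4 * e)) * (norm z)\<^sup>2))"
    by (simp add: gauss_kernel_def fun_eq_iff)
  show "integrable lborel (gauss_kernel e :: 'a \<Rightarrow> real)"
    unfolding eq by (intro integrable_mult_right integrable_gaussian) (use assms in auto)
  have "(LINT z|lborel. gauss_kernel e (z::'a)) = sqrt (pi / e) ^ DIM('a) * sqrt (pi / (1 / (4 * e))) ^ DIM('a)"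
    unfolding eq by (subst integral_mult_right_zero, subst integral_gaussian) (use assms in auto)
  also have "\<dots> = (sqrt (pi / e) * sqrt (pi / (1 / (4 * e)))) ^ DIM('a)"
    by (simp only: power_mult_distrib)
  also have "sqrt (pi / e) * sqrt (pi / (1 / (4 * e))) = sqrt ((2 * pi)\<^sup>2)"
    unfolding real_sqrt_mult[symmetric] using assms by (simp add: power2_eq_square)
  also have "\<dots> = 2 * pi" unfolding real_sqrt_abs by simp
  finally show "(LINT z|lborel. gauss_kernel e (z::'a)) = (2 * pi) ^ DIM('a)" .
qed

lemma nn_integral_gauss_kernel:
  "e > 0 \<Longrightarrow> (\<integral>\<^sup>+z. ennreal (gauss_kernel e (z::'a::euclidean_space)) \<partial>lborel) = ennreal ((2 * pi) ^ DIM('a))"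
  by (subst nn_integral_eq_integral) (auto simp: integrable_gauss_kernel integral_gauss_kernel gauss_kernel_nonneg)

lemma fourier_gaussian:
  "e > 0 \<Longrightarrow> fourier (\<lambda>x. of_real (exp (- e * (norm x)\<^sup>2))) \<xi> = of_real (gauss_kernel e \<xi>)"
  using integral_cis_gaussian[of e "- \<xi>"] by (simp add: fourier_def gauss_kernel_def)

text \<open>With a Gaussian weight inserted, the T T* identity turns the left side into a form with
  kernel \<open>gauss_kernel\<close>, whose mass is the same for all e. Schur's test bounds it, the
  2 coming from its two terms, and Fatou removes the weight.\<close>

lemma sqnorm_fourier_le:
  fixes G :: "'a::euclidean_space \<Rightarrow> complex"
  assumes G: "integrable lborel G"
  shows "sqnorm (fourier G) \<le> ennreal (2 * (2 * pi) ^ DIM('a)) * sqnorm G"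
proof -
  have [measurable]: "G \<in> borel_measurable borel" using G by auto
  define e where "e n = 1 / real (Suc n)" for n
  have e: "e n > 0" for n by (simp add: e_def)
  let ?w = "\<lambda>n x. exp (- e n * (norm (x::'a))\<^sup>2)"
  have lim: "(\<lambda>n. ennreal (?w n x * (norm (fourier G x))\<^sup>2)) \<longlonglongrightarrow> ennreal ((norm (fourier G x))\<^sup>2)" for x
  proof -
    have "(\<lambda>n. ?w n x * (norm (fourier G x))\<^sup>2) \<longlonglongrightarrow> exp (- 0 * (norm x)\<^sup>2) * (norm (fourier G x))\<^sup>2"
      unfolding e_def by (intro tendsto_intros LIMSEQ_Suc[OF lim_1_over_n])
    then show ?thesis by simp
  qed
  show ?thesis
    unfolding sqnorm_def[of "fourier G"]
  proof (rule nn_integral_Fatou_bound[OF _ AE_I2[OF lim]])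
    fix n
    have wi: "integrable lborel (\<lambda>x. complex_of_real (?w n x))"
      by (intro integrable_of_real integrable_gaussian e)
    have prod_eq: "complex_of_real (?w n x) * fourier G x * cnj (fourier G x)
        = of_real (?w n x * (norm (fourier G x))\<^sup>2)" for x
      by (simp add: complex_norm_square mult_ac del: of_real_power)
    have "integrable lborel (\<lambda>x. ?w n x * (norm (fourier G x))\<^sup>2)"
    proof (rule Bochner_Integration.integrable_bound)
      show "integrable lborel (\<lambda>x. (LINT x|lborel. norm (G x))\<^sup>2 * ?w n x)"
        by (intro integrable_mult_right integrable_gaussian e)
      show "AE x in lborel. norm (?w n x * (norm (fourier G x))\<^sup>2) \<le> norm ((LINT x|lborel. norm (G x))\<^sup>2 * ?w n x)"
        by (auto simp: abs_mult mult.commute intro!: mult_left_mono power_mono norm_fourier_le G)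
    qed measurable
    then have "(\<integral>\<^sup>+x. ennreal (?w n x * (norm (fourier G x))\<^sup>2) \<partial>lborel)
       = ennreal (LINT x|lborel. ?w n x * (norm (fourier G x))\<^sup>2)"
      by (intro nn_integral_eq_integral) auto
    also have "(LINT x|lborel. ?w n x * (norm (fourier G x))\<^sup>2)
       = norm (LINT x|lborel. complex_of_real (?w n x) * fourier G x * cnj (fourier G x))"
      unfolding prod_eq integral_complex_of_real norm_of_real by (simp add: integral_nonneg)
    also have "ennreal \<dots> \<le> (\<integral>\<^sup>+x. \<integral>\<^sup>+y. ennreal (norm (G x)) * ennreal (norm (G y)) * ennreal (gauss_kernel (e n) (x - y)) \<partial>lborel \<partial>lborel)"
      by (intro norm_integral_weighted_fourier_product_le wi G)
         (simp only: fourier_gaussian[OF e] norm_of_real abs_of_nonneg[OF gauss_kernel_nonneg[OF e]] order_refl)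
    also have "\<dots> \<le> ((\<integral>\<^sup>+x. (ennreal (norm (G x)))\<^sup>2 \<partial>lborel) + (\<integral>\<^sup>+x. (ennreal (norm (G x)))\<^sup>2 \<partial>lborel)) * (\<integral>\<^sup>+x. ennreal (gauss_kernel (e n) (x::'a)) \<partial>lborel)"
      by (rule Schur_test) measurable
    also have "\<dots> = ennreal (2 * (2 * pi) ^ DIM('a)) * sqnorm G"
      by (simp add: nn_integral_gauss_kernel[OF e] sqnorm_def ennreal_power ennreal_mult' mult_2[symmetric] mult_ac)
    finally show "(\<integral>\<^sup>+x. ennreal (?w n x * (norm (fourier G x))\<^sup>2) \<partial>lborel) \<le> ennreal (2 * (2 * pi) ^ DIM('a)) * sqnorm G" .
  qed measurable
qed

lemma
  fixes f :: "'a::euclidean_space \<Rightarrow> 'b::{banach,second_countable_topology}"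
  assumes [measurable]: "f \<in> borel_measurable borel"
  shows integral_lborel_translate: "(LINT x|lborel. f (a + x)) = (LINT x|lborel. f x)"
    and integrable_lborel_translate: "integrable lborel (\<lambda>x. f (a + x)) \<longleftrightarrow> integrable lborel f"
proof -
  show "(LINT x|lborel. f (a + x)) = (LINT x|lborel. f x)"
    by (subst (2) lborel_distr_plus[of a, symmetric]) (simp add: integral_distr)
  show "integrable lborel (\<lambda>x. f (a + x)) \<longleftrightarrow> integrable lborel f"
    by (subst (2) lborel_distr_plus[of a, symmetric]) (simp add: integrable_distr_eq)
qed

section \<open>Continuity of translations\<close>

text \<open>Three-epsilon argument: the approximation error costs the same before and after the
  shift because Lebesgue measure is translation invariant.\<close>

lemma translation_continuous_approx:
  fixes f :: "'a::euclidean_space \<Rightarrow> real" and z :: "nat \<Rightarrow> 'a"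
  assumes f: "integrable lborel f"
    and approx: "\<And>e. e > 0 \<Longrightarrow> \<exists>g. integrable lborel g \<and> (LINT x|lborel. \<bar>f x - g x\<bar>) < e \<and>
        (\<lambda>n. LINT x|lborel. \<bar>g (z n + x) - g x\<bar>) \<longlonglongrightarrow> 0"
  shows "(\<lambda>n. LINT x|lborel. \<bar>f (z n + x) - f x\<bar>) \<longlonglongrightarrow> 0"
proof (rule LIMSEQ_I)
  fix e :: real assume "e > 0"
  then obtain g where g: "integrable lborel g" and fg: "(LINT x|lborel. \<bar>f x - g x\<bar>) < e / 3"
    and lim: "(\<lambda>n. LINT x|lborel. \<bar>g (z n + x) - g x\<bar>) \<longlonglongrightarrow> 0"
    using approx[of "e / 3"] by auto
  have [measurable]: "f \<in> borel_measurable borel" "g \<in> borel_measurable borel" using f g by auto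
  have ft: "integrable lborel (\<lambda>x. f (a + x))" and gt: "integrable lborel (\<lambda>x. g (a + x))" for a
    using f g by (simp_all add: integrable_lborel_translate)
  obtain N where N: "\<And>n. n \<ge> N \<Longrightarrow> norm ((LINT x|lborel. \<bar>g (z n + x) - g x\<bar>) - 0) < e / 3"
    using LIMSEQ_D[OF lim, of "e / 3"] \<open>e > 0\<close> by auto
  have "norm ((LINT x|lborel. \<bar>f (z n + x) - f x\<bar>) - 0) < e" if "n \<ge> N" for n
  proof -
    have "(LINT x|lborel. \<bar>f (z n + x) - f x\<bar>)
       \<le> (LINT x|lborel. \<bar>f (z n + x) - g (z n + x)\<bar> + \<bar>g (z n + x) - g x\<bar> + \<bar>f x - g x\<bar>)"
      using f g ft gt by (intro integral_mono) auto
    also have "\<dots> = (LINT x|lborel. \<bar>f (z n + x) - g (z n + x)\<bar>) + (LINT x|lborel. \<bar>g (z n + x) - g x\<bar>) + (LINT x|lborel. \<bar>f x - g x\<bar>)"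
      using f g ft gt by simp
    also have "(LINT x|lborel. \<bar>f (z n + x) - g (z n + x)\<bar>) = (LINT x|lborel. \<bar>f x - g x\<bar>)"
      using integral_lborel_translate[of "\<lambda>x. \<bar>f x - g x\<bar>" "z n"] by simp
    finally show ?thesis
      using fg N[OF that] by simp
  qed
  then show "\<exists>N. \<forall>n\<ge>N. norm ((LINT x|lborel. \<bar>f (z n + x) - f x\<bar>) - 0) < e" by auto
qed

text \<open>One half of the symmetric difference of U and its shift is enough, since both halves
  have the same measure. A point of the open set U stays in U under small shifts, so dominated
  convergence handles the half of the points that leave U.\<close>

lemma translation_continuous_open:
  fixes z :: "nat \<Rightarrow> 'a::euclidean_space"
  assumes U: "open U" "emeasure lborel U < \<infinity>" and z: "z \<longlonglongrightarrow> 0"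
  shows "(\<lambda>n. LINT x|lborel. \<bar>indicat_real U (z n + x) - indicat_real U x\<bar>) \<longlonglongrightarrow> 0"
proof -
  have [measurable]: "U \<in> sets borel" using U by simp
  let ?g = "indicat_real U"
  have g: "integrable lborel ?g" using U by (simp add: integrable_indicator_iff)
  have gt: "integrable lborel (\<lambda>x. ?g (a + x))" for a
    using integrable_lborel_translate[of ?g a] g by simp
  have gg: "integrable lborel (\<lambda>x. ?g x * (1 - ?g (z n + x)))" for n
    by (rule Bochner_Integration.integrable_bound[OF g]) (auto simp: indicator_def)
  have "(LINT x|lborel. \<bar>?g (z n + x) - ?g x\<bar>) = 2 * (LINT x|lborel. ?g x * (1 - ?g (z n + x)))" for n
  proof -
    have "(LINT x|lborel. \<bar>?g (z n + x) - ?g x\<bar>) = (LINT x|lborel. ?g (z n + x) - ?g x + 2 * (?g x * (1 - ?g (z n + x))))"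
      by (intro Bochner_Integration.integral_cong) (auto simp: indicator_def)
    also have "\<dots> = (LINT x|lborel. ?g (z n + x)) - (LINT x|lborel. ?g x) + 2 * (LINT x|lborel. ?g x * (1 - ?g (z n + x)))"
      using g gt gg by (simp add: Bochner_Integration.integral_add Bochner_Integration.integral_diff)
    also have "(LINT x|lborel. ?g (z n + x)) = (LINT x|lborel. ?g x)"
      by (rule integral_lborel_translate) measurable
    finally show ?thesis by simp
  qed
  moreover have "(\<lambda>n. LINT x|lborel. ?g x * (1 - ?g (z n + x))) \<longlonglongrightarrow> (LINT x|(lborel::'a measure). 0)"
  proof (rule integral_dominated_convergence[where w = ?g])
    show "AE x in lborel. (\<lambda>n. ?g x * (1 - ?g (z n + x))) \<longlonglongrightarrow> 0"
    proof (rule AE_I2)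
      fix x
      show "(\<lambda>n. ?g x * (1 - ?g (z n + x))) \<longlonglongrightarrow> 0"
      proof (cases "x \<in> U")
        case True
        have "(\<lambda>n. z n + x) \<longlonglongrightarrow> 0 + x" by (intro tendsto_intros z)
        then have "eventually (\<lambda>n. z n + x \<in> U) sequentially"
          using topological_tendstoD[of "\<lambda>n. z n + x" x sequentially U] U True by simp
        then have "eventually (\<lambda>n. ?g x * (1 - ?g (z n + x)) = 0) sequentially"
          by eventually_elim simp
        then show ?thesis by (rule tendsto_eventually)
      qed simp
    qed
  qed (use g in \<open>auto simp: indicator_def\<close>)
  ultimately show ?thesis
    using tendsto_mult_right_zero[of _ sequentially 2] by simp
qed

text \<open>Induction over integrable functions. Measurable sets are reduced to open ones by outer
  regularity, and limits are handled by \<open>translation_continuous_approx\<close>.\<close>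

lemma translation_continuous_L1:
  fixes f :: "'a::euclidean_space \<Rightarrow> real"
  assumes f: "integrable lborel f" and z: "z \<longlonglongrightarrow> 0"
  shows "(\<lambda>n. LINT x|lborel. \<bar>f (z n + x) - f x\<bar>) \<longlonglongrightarrow> 0"
  using f
proof (induct rule: integrable_induct)
  case (base A c)
  then have A [measurable]: "A \<in> sets borel" and fin: "emeasure lborel A < \<infinity>" by auto
  have iA: "integrable lborel (indicat_real A)" using fin by (simp add: integrable_indicator_iff)
  have "(\<lambda>n. LINT x|lborel. \<bar>indicat_real A (z n + x) - indicat_real A x\<bar>) \<longlonglongrightarrow> 0"
  proof (rule translation_continuous_approx[OF iA])
    fix e :: real assume "e > 0"
    then obtain U where U: "open U" "A \<subseteq> U" "emeasure lborel (U - A) < e"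
      using outer_regular_lborel[OF A] by blast
    have [measurable]: "U \<in> sets borel" using U by simp
    have "emeasure lborel U = emeasure lborel A + emeasure lborel (U - A)"
      using U by (subst plus_emeasure) (auto intro!: arg_cong[where f="emeasure lborel"])
    also have "\<dots> < \<infinity>" using fin U(3) by (auto simp: less_top[symmetric] intro: less_trans)
    finally have Uf: "emeasure lborel U < \<infinity>" .
    have eq: "\<bar>indicat_real A x - indicat_real U x\<bar> = indicat_real (U - A) x" for x
      using U(2) by (auto simp: indicator_def)
    have "(LINT x|lborel. \<bar>indicat_real A x - indicat_real U x\<bar>) < e"
      unfolding eq using U(3) \<open>e > 0\<close>
      by (cases "emeasure lborel (U - A)") (auto simp: measure_def ennreal_less_iff)
    with Uf show "\<exists>g. integrable lborel g \<and> (LINT x|lborel. \<bar>indicat_real A x - g x\<bar>) < e \<and>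
        (\<lambda>n. LINT x|lborel. \<bar>g (z n + x) - g x\<bar>) \<longlonglongrightarrow> 0"
      by (intro exI[of _ "indicat_real U"])
         (auto intro!: translation_continuous_open U z simp: integrable_indicator_iff)
  qed
  from tendsto_mult_left[OF this, of "\<bar>c\<bar>"] show ?case
    by (simp add: abs_mult left_diff_distrib[symmetric] mult.commute[of "\<bar>c\<bar>"])
next
  case (add f g)
  have [measurable]: "f \<in> borel_measurable borel" "g \<in> borel_measurable borel" using add by auto
  have ft: "integrable lborel (\<lambda>x. f (a + x))" and gt: "integrable lborel (\<lambda>x. g (a + x))" for a
    using add by (simp_all add: integrable_lborel_translate)
  have le: "(LINT x|lborel. \<bar>f (z n + x) + g (z n + x) - (f x + g x)\<bar>)
      \<le> (LINT x|lborel. \<bar>f (z n + x) - f x\<bar>) + (LINT x|lborel. \<bar>g (z n + x) - g x\<bar>)" for n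
  proof -
    have "(LINT x|lborel. \<bar>f (z n + x) + g (z n + x) - (f x + g x)\<bar>)
      \<le> (LINT x|lborel. \<bar>f (z n + x) - f x\<bar> + \<bar>g (z n + x) - g x\<bar>)"
      using add ft gt by (intro integral_mono) auto
    also have "\<dots> = (LINT x|lborel. \<bar>f (z n + x) - f x\<bar>) + (LINT x|lborel. \<bar>g (z n + x) - g x\<bar>)"
      using add ft gt by simp
    finally show ?thesis .
  qed
  show ?case
    by (rule tendsto_sandwich[OF _ _ tendsto_const tendsto_add_zero[OF add(2) add(4)]])
       (auto intro!: always_eventually le)
next
  case (lim f s)
  have [measurable]: "f \<in> borel_measurable borel" "s i \<in> borel_measurable borel" for i
    using lim(1)[of i] lim(5) by auto
  have conv: "(\<lambda>i. LINT x|lborel. \<bar>f x - s i x\<bar>) \<longlonglongrightarrow> (LINT x|(lborel :: 'a measure). 0)"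
  proof (rule integral_dominated_convergence[where w = "\<lambda>x. 3 * \<bar>f x\<bar>"])
    show "AE x in lborel. (\<lambda>i. \<bar>f x - s i x\<bar>) \<longlonglongrightarrow> 0"
      using tendsto_rabs_zero[OF LIM_zero[OF lim(3)]] by (auto simp: abs_minus_commute)
    show "AE x in lborel. norm \<bar>f x - s i x\<bar> \<le> 3 * \<bar>f x\<bar>" for i
    proof (rule AE_I2)
      fix x
      show "norm \<bar>f x - s i x\<bar> \<le> 3 * \<bar>f x\<bar>" using lim(4)[of x i] by auto
    qed
  qed (use lim(5) in auto)
  show ?case
  proof (rule translation_continuous_approx[OF lim(5)])
    fix e :: real assume "e > 0"
    then obtain i where "norm ((LINT x|lborel. \<bar>f x - s i x\<bar>) - 0) < e"
      using LIMSEQ_D[OF conv, of e] by auto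
    then show "\<exists>g. integrable lborel g \<and> (LINT x|lborel. \<bar>f x - g x\<bar>) < e \<and>
        (\<lambda>n. LINT x|lborel. \<bar>g (z n + x) - g x\<bar>) \<longlonglongrightarrow> 0"
      using lim(1,2) by (intro exI[of _ "s i"]) auto
  qed
qed

lemma sqnorm_finite_integrable:
  assumes [measurable]: "P \<in> borel_measurable borel" and "sqnorm P < \<infinity>"
  shows "integrable lborel (\<lambda>x. (norm (P x))\<^sup>2)"
  using assms(2) by (intro integrableI_bounded) (auto simp: sqnorm_def)

lemma power2_diff_le_abs: "a \<ge> 0 \<Longrightarrow> b \<ge> 0 \<Longrightarrow> (a - b)\<^sup>2 \<le> \<bar>a\<^sup>2 - b\<^sup>2\<bar>" for a b :: real
proof -
  assume "a \<ge> 0" "b \<ge> 0"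
  then have "\<bar>a - b\<bar> * \<bar>a - b\<bar> \<le> \<bar>a - b\<bar> * \<bar>a + b\<bar>" by (intro mult_left_mono) auto
  then show "(a - b)\<^sup>2 \<le> \<bar>a\<^sup>2 - b\<^sup>2\<bar>"
    by (simp add: power2_eq_square abs_mult[symmetric] algebra_simps)
qed

lemma power2_diff_le: "(a - b)\<^sup>2 \<le> 2 * a\<^sup>2 + 2 * b\<^sup>2" for a b :: real
  using zero_le_power2[of "a + b"] by (simp add: power2_eq_square algebra_simps)

text \<open>Reduction to L1. For nonnegative reals (a - b)^2 \<le> |a^2 - b^2|, so after splitting P
  into the positive and negative parts of its real and imaginary part, continuity of translations in
  L1 is applied to the four squared parts.\<close>

lemma translation_continuous_L2:
  fixes P :: "'a::euclidean_space \<Rightarrow> complex"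
  assumes P [measurable]: "P \<in> borel_measurable borel" and fin: "sqnorm P < \<infinity>" and z: "z \<longlonglongrightarrow> 0"
  shows "(\<lambda>n. sqnorm (\<lambda>x. P (z n + x) - P x)) \<longlonglongrightarrow> 0"
proof -
  define p :: "nat \<Rightarrow> complex \<Rightarrow> real" where
    "p i w = (if i = 0 then max (Re w) 0 else if i = 1 then max (- Re w) 0
       else if i = 2 then max (Im w) 0 else max (- Im w) 0)" for i w
  have p_meas [measurable]: "p i \<in> borel_measurable borel" for i
    unfolding p_def by measurable
  have p0: "p i w \<ge> 0" for i w by (auto simp: p_def)
  have p_le: "p i w \<le> norm w" for i w
    using abs_Re_le_cmod[of w] abs_Im_le_cmod[of w] by (auto simp: p_def)
  have norm_le: "(norm (v - w))\<^sup>2 \<le> 2 * (\<Sum>i<4. \<bar>(p i v)\<^sup>2 - (p i w)\<^sup>2\<bar>)" for v w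
  proof -
    have Re: "Re u = p 0 u - p 1 u" and Im: "Im u = p 2 u - p 3 u" for u
      by (auto simp: p_def)
    have "(norm (v - w))\<^sup>2 = ((p 0 v - p 0 w) - (p 1 v - p 1 w))\<^sup>2 + ((p 2 v - p 2 w) - (p 3 v - p 3 w))\<^sup>2"
      unfolding cmod_power2 minus_complex.sel Re[of v] Re[of w] Im[of v] Im[of w] by (simp add: algebra_simps)
    also have "\<dots> \<le> (2 * (p 0 v - p 0 w)\<^sup>2 + 2 * (p 1 v - p 1 w)\<^sup>2) + (2 * (p 2 v - p 2 w)\<^sup>2 + 2 * (p 3 v - p 3 w)\<^sup>2)"
      by (intro add_mono power2_diff_le)
    also have "\<dots> = 2 * (\<Sum>i<4. (p i v - p i w)\<^sup>2)"
      by (simp add: eval_nat_numeral)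
    also have "\<dots> \<le> 2 * (\<Sum>i<4. \<bar>(p i v)\<^sup>2 - (p i w)\<^sup>2\<bar>)"
      by (intro mult_left_mono sum_mono power2_diff_le_abs p0) auto
    finally show ?thesis .
  qed
  have i2: "integrable lborel (\<lambda>x. (p i (P x))\<^sup>2)" for i
  proof (rule Bochner_Integration.integrable_bound[OF sqnorm_finite_integrable[OF P fin]])
    show "AE x in lborel. norm ((p i (P x))\<^sup>2) \<le> norm ((norm (P x))\<^sup>2)"
      by (intro AE_I2) (simp add: power_mono p0 p_le)
  qed measurable
  have i2t: "integrable lborel (\<lambda>x. (p i (P (a + x)))\<^sup>2)" for i a
    using integrable_lborel_translate[of "\<lambda>x. (p i (P x))\<^sup>2" a] i2 by simp
  have le: "sqnorm (\<lambda>x. P (z n + x) - P x) \<le> ennreal (2 * (\<Sum>i<4. LINT x|lborel. \<bar>(p i (P (z n + x)))\<^sup>2 - (p i (P x))\<^sup>2\<bar>))" for n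
  proof -
    have "sqnorm (\<lambda>x. P (z n + x) - P x) \<le> (\<integral>\<^sup>+x. ennreal (2 * (\<Sum>i<4. \<bar>(p i (P (z n + x)))\<^sup>2 - (p i (P x))\<^sup>2\<bar>)) \<partial>lborel)"
      unfolding sqnorm_def by (intro nn_integral_mono ennreal_leI norm_le)
    also have "\<dots> = ennreal (LINT x|lborel. 2 * (\<Sum>i<4. \<bar>(p i (P (z n + x)))\<^sup>2 - (p i (P x))\<^sup>2\<bar>))"
      using i2 i2t by (intro nn_integral_eq_integral) (auto intro!: sum_nonneg)
    also have "(LINT x|lborel. 2 * (\<Sum>i<4. \<bar>(p i (P (z n + x)))\<^sup>2 - (p i (P x))\<^sup>2\<bar>))
       = 2 * (\<Sum>i<4. LINT x|lborel. \<bar>(p i (P (z n + x)))\<^sup>2 - (p i (P x))\<^sup>2\<bar>)"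
      using i2 i2t by (subst integral_mult_right_zero, subst Bochner_Integration.integral_sum) auto
    finally show ?thesis .
  qed
  have "(\<lambda>n. ennreal (2 * (\<Sum>i<4. LINT x|lborel. \<bar>(p i (P (z n + x)))\<^sup>2 - (p i (P x))\<^sup>2\<bar>))) \<longlonglongrightarrow> ennreal (2 * (\<Sum>i<4::nat. 0))"
    by (intro tendsto_ennrealI tendsto_mult_left tendsto_sum translation_continuous_L1[where f="\<lambda>x. (p i (P x))\<^sup>2" for i] i2 z)
  then have lim: "(\<lambda>n. ennreal (2 * (\<Sum>i<4. LINT x|lborel. \<bar>(p i (P (z n + x)))\<^sup>2 - (p i (P x))\<^sup>2\<bar>))) \<longlonglongrightarrow> 0"
    by simp
  show ?thesis
    by (rule tendsto_sandwich[OF _ _ tendsto_const lim]) (auto intro!: always_eventually le)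
qed

section \<open>Gaussian approximate identities\<close>

text \<open>The hypothesis \<open>cont\<close> says that A vanishes at the origin and is continuous
  there, which controls the centre of the kernel; the bound B controls the tail.\<close>

lemma gauss_kernel_approximate_identity:
  fixes A :: "'a::euclidean_space \<Rightarrow> real"
  assumes [measurable]: "A \<in> borel_measurable borel" and A0: "\<And>z. 0 \<le> A z" and AB: "\<And>z. A z \<le> B"
    and cont: "\<And>e. e > 0 \<Longrightarrow> \<exists>d>0. \<forall>z. norm z < d \<longrightarrow> A z < e"
    and e: "\<And>n. e n > 0" "e \<longlonglongrightarrow> 0"
  shows "(\<lambda>n. LINT z|lborel. A z * gauss_kernel (e n) z) \<longlonglongrightarrow> 0"
proof (rule LIMSEQ_I)
  fix r :: real assume r: "r > 0"
  define c where "c = (2 * pi) ^ DIM('a)"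
  have c: "c > 0" by (simp add: c_def)
  have B: "B \<ge> 0" using A0[of 0] AB[of 0] by linarith
  obtain d where d: "d > 0" and Ad: "\<And>z. norm z < d \<Longrightarrow> A z < r / (2 * c)"
    using cont[of "r / (2 * c)"] r c by auto
  \<comment> \<open>Away from the origin, half of the Gaussian exponent is spent on the small factor
    with \<open>8 * e n\<close>; the other half is the kernel of parameter \<open>2 * e n\<close>,
    which has the same mass.\<close>
  let ?E = "\<lambda>n. B * sqrt 2 ^ DIM('a) * exp (- d\<^sup>2 / (8 * e n))"
  have pt: "A z * gauss_kernel (e n) z \<le> r / (2 * c) * gauss_kernel (e n) z + ?E n * gauss_kernel (2 * e n) z" for n z
  proof (cases "norm z < d")
    case True
    then have "A z * gauss_kernel (e n) z \<le> r / (2 * c) * gauss_kernel (e n) z"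
      using Ad[OF True] e(1) by (intro mult_right_mono gauss_kernel_nonneg) auto
    moreover have "?E n * gauss_kernel (2 * e n) z \<ge> 0"
      using B e(1)[of n] by (intro mult_nonneg_nonneg gauss_kernel_nonneg) auto
    ultimately show ?thesis by linarith
  next
    case False
    have en: "e n > 0" by (rule e)
    have sq: "sqrt (pi / e n) = sqrt 2 * sqrt (pi / (2 * e n))"
      unfolding real_sqrt_mult[symmetric] by simp
    have "gauss_kernel (e n) z = sqrt 2 ^ DIM('a) * exp (- (norm z)\<^sup>2 / (8 * e n)) * gauss_kernel (2 * e n) z"
      unfolding gauss_kernel_def sq power_mult_distrib
      using en by (simp add: mult_ac exp_add[symmetric] field_simps)
    also have "\<dots> \<le> sqrt 2 ^ DIM('a) * exp (- d\<^sup>2 / (8 * e n)) * gauss_kernel (2 * e n) z"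
      using False d en
      by (intro mult_right_mono mult_left_mono gauss_kernel_nonneg) (auto intro!: divide_right_mono power_mono)
    finally have "B * gauss_kernel (e n) z \<le> B * (sqrt 2 ^ DIM('a) * exp (- d\<^sup>2 / (8 * e n)) * gauss_kernel (2 * e n) z)"
      by (rule mult_left_mono[OF _ B])
    moreover have "A z * gauss_kernel (e n) z \<le> B * gauss_kernel (e n) z"
      by (intro mult_right_mono AB gauss_kernel_nonneg en)
    moreover have "r / (2 * c) * gauss_kernel (e n) z \<ge> 0"
      using r c by (intro mult_nonneg_nonneg gauss_kernel_nonneg en) auto
    ultimately show ?thesis by (simp add: mult.assoc)
  qed
  have iA: "integrable lborel (\<lambda>z. A z * gauss_kernel (e n) z)" for n
  proof (rule Bochner_Integration.integrable_bound)
    show "integrable lborel (\<lambda>z::'a. B * gauss_kernel (e n) z)"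
      by (intro integrable_mult_right integrable_gauss_kernel e)
    show "AE z in lborel. norm (A z * gauss_kernel (e n) z) \<le> norm (B * gauss_kernel (e n) z)"
      using A0 AB B gauss_kernel_nonneg[OF e(1)] by (auto simp: abs_mult intro!: mult_right_mono)
  qed measurable
  have "filterlim (\<lambda>n. (d\<^sup>2 / 8) * inverse (e n)) at_top sequentially"
    using d e by (intro filterlim_tendsto_pos_mult_at_top[OF tendsto_const] filterlim_inverse_at_top) (auto intro: always_eventually)
  then have "filterlim (\<lambda>n. d\<^sup>2 / (8 * e n)) at_top sequentially"
    by (simp add: field_simps)
  then have "(\<lambda>n. exp (- (d\<^sup>2 / (8 * e n)))) \<longlonglongrightarrow> 0"
    by (intro filterlim_compose[OF exp_at_bot] filterlim_compose[OF filterlim_uminus_at_bot_at_top])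
  then have "(\<lambda>n. B * sqrt 2 ^ DIM('a) * exp (- (d\<^sup>2 / (8 * e n))) * c) \<longlonglongrightarrow> B * sqrt 2 ^ DIM('a) * 0 * c"
    by (intro tendsto_intros)
  then have lim: "(\<lambda>n. ?E n * c) \<longlonglongrightarrow> 0" by simp
  obtain N where N: "\<And>n. n \<ge> N \<Longrightarrow> norm (?E n * c - 0) < r / 2"
    using LIMSEQ_D[OF lim half_gt_zero[OF r]] by blast
  have "norm ((LINT z|lborel. A z * gauss_kernel (e n) z) - 0) < r" if "n \<ge> N" for n
  proof -
    have nn: "0 \<le> (LINT z|lborel. A z * gauss_kernel (e n) z)"
      using A0 e by (intro integral_nonneg_AE) (auto intro!: mult_nonneg_nonneg gauss_kernel_nonneg)
    have e2: "2 * e n > 0" using e by simp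
    have "(LINT z|lborel. A z * gauss_kernel (e n) z) \<le> (LINT z|lborel. r / (2 * c) * gauss_kernel (e n) (z::'a) + ?E n * gauss_kernel (2 * e n) z)"
      by (intro integral_mono iA pt Bochner_Integration.integrable_add integrable_mult_right integrable_gauss_kernel e e2)
    also have "\<dots> = r / (2 * c) * c + ?E n * c"
      unfolding c_def
      by (subst Bochner_Integration.integral_add, (intro integrable_mult_right integrable_gauss_kernel e e2)+)
         (simp add: integral_gauss_kernel[OF e(1)] integral_gauss_kernel[OF e2])
    also have "\<dots> < r" using N[OF that] c r by (simp add: abs_less_iff)
    finally show ?thesis using nn by simp
  qed
  then show "\<exists>N. \<forall>n\<ge>N. norm ((LINT z|lborel. A z * gauss_kernel (e n) z) - 0) < r" by auto
qed

lemma integrable_mult_sqnorm: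
  fixes P Q :: "'a::euclidean_space \<Rightarrow> complex"
  assumes [measurable]: "P \<in> borel_measurable borel" "Q \<in> borel_measurable borel"
    and "sqnorm P < \<infinity>" "sqnorm Q < \<infinity>"
  shows "integrable lborel (\<lambda>x. P x * Q x)"
proof (rule Bochner_Integration.integrable_bound)
  show "integrable lborel (\<lambda>x. (norm (P x))\<^sup>2 + (norm (Q x))\<^sup>2)"
    using assms by (intro Bochner_Integration.integrable_add sqnorm_finite_integrable) auto
  have "a * b \<le> a\<^sup>2 + b\<^sup>2" if "a \<ge> 0" "b \<ge> 0" for a b :: real
    using zero_le_power2[of "a - b"] mult_nonneg_nonneg[OF that] unfolding power2_diff by linarith
  then show "AE x in lborel. norm (P x * Q x) \<le> norm ((norm (P x))\<^sup>2 + (norm (Q x))\<^sup>2)"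
    by (auto simp: norm_mult)
qed measurable

lemma sqnorm_cmult: "f \<in> borel_measurable borel \<Longrightarrow> sqnorm (\<lambda>x. c * f x) = ennreal ((norm c)\<^sup>2) * sqnorm f"
  by (simp add: sqnorm_def norm_mult power_mult_distrib ennreal_mult nn_integral_cmult)

lemma norm_power2_add_le: "(norm (a + b))\<^sup>2 \<le> 2 * (norm a)\<^sup>2 + 2 * (norm b)\<^sup>2"
  for a b :: "'b::real_normed_vector"
proof -
  have "(norm (a + b))\<^sup>2 \<le> (norm a + norm b)\<^sup>2"
    by (intro power_mono norm_triangle_ineq) auto
  also have "\<dots> \<le> 2 * (norm a)\<^sup>2 + 2 * (norm b)\<^sup>2"
    using power2_diff_le[of "norm a" "- norm b"] by simp
  finally show ?thesis .
qed

lemma sqnorm_add_le: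
  assumes [measurable]: "f \<in> borel_measurable borel" "g \<in> borel_measurable borel"
  shows "sqnorm (\<lambda>x. f x + g x) \<le> 2 * sqnorm f + 2 * sqnorm g"
proof -
  have "sqnorm (\<lambda>x. f x + g x) \<le> (\<integral>\<^sup>+x. 2 * ennreal ((norm (f x))\<^sup>2) + 2 * ennreal ((norm (g x))\<^sup>2) \<partial>lborel)"
    unfolding sqnorm_def
  proof (intro nn_integral_mono)
    fix x
    have "ennreal ((norm (f x + g x))\<^sup>2) \<le> ennreal (2 * (norm (f x))\<^sup>2 + 2 * (norm (g x))\<^sup>2)"
      by (intro ennreal_leI norm_power2_add_le)
    then show "ennreal ((norm (f x + g x))\<^sup>2) \<le> 2 * ennreal ((norm (f x))\<^sup>2) + 2 * ennreal ((norm (g x))\<^sup>2)"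
      by (simp add: ennreal_mult)
  qed
  also have "\<dots> = 2 * sqnorm f + 2 * sqnorm g"
    by (simp add: nn_integral_add nn_integral_cmult sqnorm_def)
  finally show ?thesis .
qed

lemma sqnorm_minus: "sqnorm (\<lambda>x. - f x) = sqnorm f"
  by (simp add: sqnorm_def)

lemma sqnorm_diff_le:
  assumes [measurable]: "f \<in> borel_measurable borel" "g \<in> borel_measurable borel"
  shows "sqnorm (\<lambda>x. f x - g x) \<le> 2 * sqnorm f + 2 * sqnorm g"
  using sqnorm_add_le[of f "\<lambda>x. - g x"] by (simp add: sqnorm_minus)

lemma sqnorm_translate: "f \<in> borel_measurable borel \<Longrightarrow> sqnorm (\<lambda>x. f (a + x)) = sqnorm f"
  unfolding sqnorm_def using nn_integral_lborel_translate[of "\<lambda>x. ennreal ((norm (f x))\<^sup>2)" a] by simp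

lemma sqnorm_gauss_kernel_finite:
  assumes "e > 0"
  shows "sqnorm (\<lambda>x::'a::euclidean_space. of_real (gauss_kernel e (x - y))) < \<infinity>"
proof -
  define K where "K = sqrt (pi / e) ^ DIM('a)"
  have K: "gauss_kernel e (x::'a) \<le> K" for x
    using assms by (simp add: gauss_kernel_def K_def mult_left_le)
  have "sqnorm (\<lambda>x::'a. of_real (gauss_kernel e (x - y))) = sqnorm (\<lambda>x::'a. of_real (gauss_kernel e x))"
    using sqnorm_translate[of "\<lambda>x::'a. of_real (gauss_kernel e x)" "- y"] by simp
  also have "\<dots> \<le> (\<integral>\<^sup>+x. ennreal K * ennreal (gauss_kernel e (x::'a)) \<partial>lborel)"
    unfolding sqnorm_def
  proof (intro nn_integral_mono)
    fix x :: 'a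
    have "(norm (complex_of_real (gauss_kernel e x)))\<^sup>2 \<le> K * gauss_kernel e x"
      using gauss_kernel_nonneg[OF assms, of x] K[of x] by (simp add: power2_eq_square mult_right_mono)
    then show "ennreal ((norm (complex_of_real (gauss_kernel e x)))\<^sup>2) \<le> ennreal K * ennreal (gauss_kernel e x)"
      using gauss_kernel_nonneg[OF assms, of x] assms by (simp add: ennreal_mult[symmetric] K_def ennreal_leI)
  qed
  also have "\<dots> < \<infinity>"
    by (simp add: nn_integral_cmult nn_integral_gauss_kernel[OF assms] ennreal_mult_less_top)
  finally show ?thesis .
qed

text \<open>The value (2 pi)^d P(y) is the mollified function minus an average of the differences
  P(z + y) - P(y). That average is the term which continuity of translations will make
  small.\<close>

lemma mollification_pointwise_bound:
  fixes P :: "'a::euclidean_space \<Rightarrow> complex"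
  assumes P [measurable]: "P \<in> borel_measurable borel" and fin: "sqnorm P < \<infinity>" and e: "e > 0"
  shows "ennreal (((2 * pi) ^ DIM('a) * norm (P y))\<^sup>2)
     \<le> 2 * ennreal ((norm (LINT x|lborel. P x * of_real (gauss_kernel e (x - y))))\<^sup>2)
       + 2 * ennreal ((2 * pi) ^ DIM('a)) * (\<integral>\<^sup>+z. ennreal ((norm (P (z + y) - P y))\<^sup>2) * ennreal (gauss_kernel e z) \<partial>lborel)"
proof -
  let ?c = "(2 * pi) ^ DIM('a)"
  let ?g = "\<lambda>z::'a. complex_of_real (gauss_kernel e z)"
  have shift: "(LINT x|lborel. P x * of_real (gauss_kernel e (x - y))) = (LINT z|lborel. P (z + y) * ?g z)"
    using integral_lborel_translate[of "\<lambda>x. P x * of_real (gauss_kernel e (x - y))" y] by (simp add: add.commute)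
  have gi: "integrable lborel ?g" by (intro integrable_of_real integrable_gauss_kernel e)
  have Pi: "integrable lborel (\<lambda>z. P (z + y) * ?g z)"
  proof (rule integrable_mult_sqnorm)
    show "sqnorm (\<lambda>z. P (z + y)) < \<infinity>" using sqnorm_translate[OF P, of y] fin by (simp add: add.commute)
    show "sqnorm (\<lambda>x. ?g x) < \<infinity>" using sqnorm_gauss_kernel_finite[OF e, of 0] by simp
  qed measurable
  define D where "D = (LINT z|lborel. (P (z + y) - P y) * ?g z)"
  have gint: "(LINT z|lborel. ?g z) = of_real ?c"
    unfolding integral_complex_of_real integral_gauss_kernel[OF e] by simp
  have "(LINT z|lborel. P (z + y) * ?g z) - D = (LINT z|lborel. P y * ?g z)"
    unfolding D_def using Pi gi
    by (subst Bochner_Integration.integral_diff[symmetric]) (auto simp: left_diff_distrib)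
  also have "\<dots> = P y * of_real ?c"
    by (subst integral_mult_right_zero) (simp only: gint)
  finally have cP: "P y * of_real ?c = (LINT z|lborel. P (z + y) * ?g z) + - D" by simp
  have "(?c * norm (P y))\<^sup>2 = (norm (P y * of_real ?c))\<^sup>2"
    by (simp add: norm_mult mult.commute norm_power)
  also have "\<dots> \<le> 2 * (norm (LINT z|lborel. P (z + y) * ?g z))\<^sup>2 + 2 * (norm D)\<^sup>2"
    unfolding cP using norm_power2_add_le[of "LINT z|lborel. P (z + y) * ?g z" "- D"] by simp
  finally have 1: "ennreal ((?c * norm (P y))\<^sup>2) \<le> 2 * ennreal ((norm (LINT z|lborel. P (z + y) * ?g z))\<^sup>2) + 2 * ennreal ((norm D)\<^sup>2)"
    by (auto dest!: ennreal_leI simp: ennreal_mult)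
  \<comment> \<open>The kernel is split into two square roots, so that Cauchy-Schwarz leaves the
    squared difference against one full kernel and the mass of the kernel as second factor.\<close>
  have "ennreal (norm D) \<le> (\<integral>\<^sup>+z. ennreal (norm ((P (z + y) - P y) * ?g z)) \<partial>lborel)"
    unfolding D_def by (rule ennreal_norm_integral_le)
  also have "\<dots> = (\<integral>\<^sup>+z. ennreal (norm (P (z + y) - P y) * sqrt (gauss_kernel e z)) * ennreal (sqrt (gauss_kernel e z)) \<partial>lborel)"
    using gauss_kernel_nonneg[OF e, where 'a='a]
    by (intro nn_integral_cong, subst ennreal_mult[symmetric]) (auto simp: norm_mult mult.assoc intro!: mult_nonneg_nonneg)
  finally have "ennreal (norm D) \<le> (\<integral>\<^sup>+z. ennreal (norm (P (z + y) - P y) * sqrt (gauss_kernel e z)) * ennreal (sqrt (gauss_kernel e z)) \<partial>lborel)" .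
  then have "ennreal ((norm D)\<^sup>2) \<le> (\<integral>\<^sup>+z. ennreal (norm (P (z + y) - P y) * sqrt (gauss_kernel e z)) * ennreal (sqrt (gauss_kernel e z)) \<partial>lborel)\<^sup>2"
    by (simp add: ennreal_power[symmetric] power_mono)
  also have "\<dots> \<le> (\<integral>\<^sup>+z. (ennreal (norm (P (z + y) - P y) * sqrt (gauss_kernel e z)))\<^sup>2 \<partial>lborel) * (\<integral>\<^sup>+z. (ennreal (sqrt (gauss_kernel e (z::'a))))\<^sup>2 \<partial>lborel)"
    by (rule Cauchy_Schwarz_nn_integral) measurable
  also have "(\<integral>\<^sup>+z. (ennreal (sqrt (gauss_kernel e (z::'a))))\<^sup>2 \<partial>lborel) = ennreal ?c"
  proof -
    have "(ennreal (sqrt (gauss_kernel e z)))\<^sup>2 = ennreal (gauss_kernel e z)" for z :: 'a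
      using gauss_kernel_nonneg[OF e, of z] by (simp add: ennreal_power)
    then show ?thesis by (simp only: nn_integral_gauss_kernel[OF e])
  qed
  also have "(\<integral>\<^sup>+z. (ennreal (norm (P (z + y) - P y) * sqrt (gauss_kernel e z)))\<^sup>2 \<partial>lborel)
     = (\<integral>\<^sup>+z. ennreal ((norm (P (z + y) - P y))\<^sup>2) * ennreal (gauss_kernel e z) \<partial>lborel)"
    using gauss_kernel_nonneg[OF e, where 'a='a]
    by (intro nn_integral_cong) (simp add: ennreal_power ennreal_mult[symmetric] power_mult_distrib)
  finally have 2: "ennreal ((norm D)\<^sup>2) \<le> (\<integral>\<^sup>+z. ennreal ((norm (P (z + y) - P y))\<^sup>2) * ennreal (gauss_kernel e z) \<partial>lborel) * ennreal ?c" .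
  show ?thesis
    unfolding shift using 1 mult_left_mono[OF 2, of 2]
    by (auto simp: mult_ac intro: order_trans add_left_mono)
qed

text \<open>\<open>R e\<close> names the mollification of P at scale e. A uniform L2 bound on the
  mollifications passes to P, because the error is the average of the squared L2 modulus of
  continuity of P against a kernel concentrating at 0. The 2 is that of the pointwise bound.\<close>

lemma sqnorm_le_mollified:
  fixes P :: "'a::euclidean_space \<Rightarrow> complex" and R :: "real \<Rightarrow> 'a \<Rightarrow> complex"
  assumes P [measurable]: "P \<in> borel_measurable borel" and fin: "sqnorm P < \<infinity>"
    and R: "\<And>e y. e > 0 \<Longrightarrow> (LINT x|lborel. P x * of_real (gauss_kernel e (x - y))) = R e y"
    and M: "\<And>e. e > 0 \<Longrightarrow> sqnorm (R e) \<le> M"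
  shows "ennreal (((2 * pi) ^ DIM('a))\<^sup>2) * sqnorm P \<le> 2 * M"
proof -
  define c where "c = (2 * pi) ^ DIM('a)"
  define S where "S = (\<lambda>z. sqnorm (\<lambda>y. P (z + y) - P y))"
  define A where "A = (\<lambda>z. enn2real (S z))"
  define e where "e n = 1 / real (Suc n)" for n
  have e: "e n > 0" for n by (simp add: e_def)
  have e0: "e \<longlonglongrightarrow> 0" unfolding e_def by (rule LIMSEQ_Suc[OF lim_1_over_n])
  have S_meas [measurable]: "S \<in> borel_measurable borel"
    unfolding S_def sqnorm_def by measurable
  have S_le: "S z \<le> 4 * sqnorm P" for z
    unfolding S_def using sqnorm_diff_le[of "\<lambda>y. P (z + y)" P]
    by (simp add: sqnorm_translate[OF P] distrib_right[symmetric])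
  have S_fin: "S z < \<infinity>" for z
    using le_less_trans[OF S_le[of z]] fin by (simp add: ennreal_mult_less_top)
  have SA: "S z = ennreal (A z)" for z using S_fin[of z] by (simp add: A_def)
  have A0: "0 \<le> A z" for z by (simp add: A_def)
  have SAz: "sqnorm (\<lambda>y. P (z + y) - P y) = ennreal (A z)" for z using SA[of z] by (simp only: S_def)
  have A_le: "A z \<le> enn2real (4 * sqnorm P)" for z
    unfolding A_def using fin by (intro enn2real_mono S_le) (simp add: ennreal_mult_less_top)
  have A_seq: "(\<lambda>n. A (z n)) \<longlonglongrightarrow> 0" if "z \<longlonglongrightarrow> 0" for z
  proof -
    have "(\<lambda>n. S (z n)) \<longlonglongrightarrow> ennreal 0"
      unfolding S_def using translation_continuous_L2[OF P fin that] by simp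
    then show ?thesis unfolding A_def by (intro tendsto_enn2real) auto
  qed
  \<comment> \<open>Continuity of translations is available along sequences; a failure at all radii
    \<open>e n\<close> would produce a null sequence that contradicts it.\<close>
  have cont: "\<exists>d>0. \<forall>z. norm z < d \<longrightarrow> A z < r" if "r > 0" for r
  proof (rule ccontr)
    assume "\<not> ?thesis"
    then have "\<exists>z. norm z < e n \<and> A z \<ge> r" for n using e[of n] by (meson not_less)
    then obtain z where z: "\<And>n. norm (z n) < e n" "\<And>n. A (z n) \<ge> r" by metis
    have "z \<longlonglongrightarrow> 0"
      by (rule tendsto_norm_zero_cancel, rule tendsto_sandwich[OF _ _ tendsto_const e0])
         (auto intro!: always_eventually less_imp_le z)
    from LIMSEQ_D[OF A_seq[OF this] that] obtain N where "norm (A (z N) - 0) < r" by blast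
    with z(2)[of N] show False by simp
  qed
  have "(\<lambda>n. LINT z|lborel. A z * gauss_kernel (e n) z) \<longlonglongrightarrow> 0"
    by (rule gauss_kernel_approximate_identity[OF _ _ A_le cont e e0]) (auto simp: A_def)
  then have "(\<lambda>n. ennreal (LINT z|lborel. A z * gauss_kernel (e n) z)) \<longlonglongrightarrow> ennreal 0"
    by (rule tendsto_ennrealI)
  from tendsto_add[OF tendsto_const ennreal_tendsto_cmult[OF _ this], of "2 * ennreal c" "2 * M"]
  have lim: "(\<lambda>n. 2 * M + 2 * ennreal c * ennreal (LINT z|lborel. A z * gauss_kernel (e n) z)) \<longlonglongrightarrow> 2 * M + 2 * ennreal c * ennreal 0"
    by (simp add: ennreal_mult_less_top)
  have le: "ennreal (c\<^sup>2) * sqnorm P \<le> 2 * M + 2 * ennreal c * ennreal (LINT z|lborel. A z * gauss_kernel (e n) z)" for n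
  proof -
    have Rm [measurable]: "R (e n) \<in> borel_measurable borel"
      unfolding R[OF e, symmetric, abs_def] by measurable
    have iA: "integrable lborel (\<lambda>z. A z * gauss_kernel (e n) z)"
    proof (rule Bochner_Integration.integrable_bound)
      show "integrable lborel (\<lambda>z::'a. enn2real (4 * sqnorm P) * gauss_kernel (e n) z)"
        by (intro integrable_mult_right integrable_gauss_kernel e)
      show "AE z in lborel. norm (A z * gauss_kernel (e n) z) \<le> norm (enn2real (4 * sqnorm P) * gauss_kernel (e n) z)"
        using A_le gauss_kernel_nonneg[OF e, where 'a='a] by (auto simp: abs_mult A_def intro!: mult_right_mono)
    qed (simp add: A_def)
    have "ennreal (c\<^sup>2) * sqnorm P = (\<integral>\<^sup>+y. ennreal ((c * norm (P y))\<^sup>2) \<partial>lborel)"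
      by (simp add: sqnorm_def power_mult_distrib ennreal_mult nn_integral_cmult)
    also have "\<dots> \<le> (\<integral>\<^sup>+y. 2 * ennreal ((norm (R (e n) y))\<^sup>2) + 2 * ennreal c * (\<integral>\<^sup>+z. ennreal ((norm (P (z + y) - P y))\<^sup>2) * ennreal (gauss_kernel (e n) z) \<partial>lborel) \<partial>lborel)"
      unfolding c_def R[OF e, symmetric] by (intro nn_integral_mono mollification_pointwise_bound P fin e)
    also have "\<dots> = 2 * sqnorm (R (e n)) + 2 * ennreal c * (\<integral>\<^sup>+y. \<integral>\<^sup>+z. ennreal ((norm (P (z + y) - P y))\<^sup>2) * ennreal (gauss_kernel (e n) z) \<partial>lborel \<partial>lborel)"
      by (simp add: nn_integral_add nn_integral_cmult sqnorm_def)
    also have "(\<integral>\<^sup>+y. \<integral>\<^sup>+z. ennreal ((norm (P (z + y) - P y))\<^sup>2) * ennreal (gauss_kernel (e n) z) \<partial>lborel \<partial>lborel)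
      = (\<integral>\<^sup>+z. \<integral>\<^sup>+y. ennreal ((norm (P (z + y) - P y))\<^sup>2) * ennreal (gauss_kernel (e n) z) \<partial>lborel \<partial>lborel)"
      by (rule lborel_pair.Fubini') measurable
    also have "\<dots> = (\<integral>\<^sup>+z. ennreal (A z * gauss_kernel (e n) z) \<partial>lborel)"
      using gauss_kernel_nonneg[OF e, where 'a='a]
      by (simp add: nn_integral_multc sqnorm_def[symmetric] SAz ennreal_mult A0)
    also have "\<dots> = ennreal (LINT z|lborel. A z * gauss_kernel (e n) z)"
      using gauss_kernel_nonneg[OF e, where 'a='a] by (intro nn_integral_eq_integral iA) (auto simp: A_def)
    finally show ?thesis
      by (rule order_trans) (intro add_right_mono mult_left_mono M e zero_le)
  qed
  show ?thesis
    using LIMSEQ_le_const[OF lim] le unfolding c_def by auto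
qed

section \<open>Schwartz functions\<close>

text \<open>A class closed under directional derivatives and of polynomial growth, which is what the
  prefactors in the derivatives of a Gaussian require.\<close>

inductive polyfun :: "('a::euclidean_space \<Rightarrow> complex) \<Rightarrow> bool" where
  const: "polyfun (\<lambda>x. c)"
| coord: "polyfun (\<lambda>x. of_real (x \<bullet> v))"
| add: "polyfun p \<Longrightarrow> polyfun q \<Longrightarrow> polyfun (\<lambda>x. p x + q x)"
| mult: "polyfun p \<Longrightarrow> polyfun q \<Longrightarrow> polyfun (\<lambda>x. p x * q x)"

lemma polyfun_derivative:
  "polyfun p \<Longrightarrow> \<exists>D. (\<forall>x. (p has_derivative D x) (at x)) \<and> (\<forall>v. polyfun (\<lambda>x. D x v))"
proof (induction rule: polyfun.induct)
  case (const c)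
  show ?case by (intro exI[of _ "\<lambda>x v. 0"]) (auto intro: polyfun.intros)
next
  case (coord v)
  show ?case
    by (intro exI[of _ "\<lambda>x h. of_real (h \<bullet> v)"]) (auto intro!: polyfun.intros derivative_eq_intros)
next
  case (add p q)
  then obtain D E where "\<And>x. (p has_derivative D x) (at x)" "\<And>v. polyfun (\<lambda>x. D x v)"
    "\<And>x. (q has_derivative E x) (at x)" "\<And>v. polyfun (\<lambda>x. E x v)" by blast
  then show ?case
    by (intro exI[of _ "\<lambda>x h. D x h + E x h"]) (auto intro!: polyfun.intros derivative_intros)
next
  case (mult p q)
  then obtain D E where "\<And>x. (p has_derivative D x) (at x)" "\<And>v. polyfun (\<lambda>x. D x v)"
    "\<And>x. (q has_derivative E x) (at x)" "\<And>v. polyfun (\<lambda>x. E x v)" by blast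
  then show ?case using mult
    by (intro exI[of _ "\<lambda>x h. p x * E x h + D x h * q x"]) (auto intro!: polyfun.intros derivative_intros)
qed

lemma polyfun_growth: "polyfun p \<Longrightarrow> \<exists>C k. \<forall>x. norm (p x) \<le> C * (1 + norm x) ^ k"
proof (induction rule: polyfun.induct)
  case (const c)
  show ?case by (intro exI[of _ "norm c"] exI[of _ 0]) simp
next
  case (coord v)
  have "norm (complex_of_real (x \<bullet> v)) \<le> norm v * (1 + norm x) ^ 1" for x
    using norm_cauchy_schwarz[of x v] Cauchy_Schwarz_ineq2[of x v] by (simp add: algebra_simps add_increasing)
  then show ?case by blast
next
  case (add p q)
  then obtain C k D l where *: "\<And>x. norm (p x) \<le> C * (1 + norm x) ^ k" "\<And>x. norm (q x) \<le> D * (1 + norm x) ^ l"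
    by blast
  have "norm (p x + q x) \<le> (\<bar>C\<bar> + \<bar>D\<bar>) * (1 + norm x) ^ (max k l)" for x
  proof -
    have "C * (1 + norm x) ^ k \<le> \<bar>C\<bar> * (1 + norm x) ^ (max k l)"
      by (intro mult_mono power_increasing) auto
    moreover have "D * (1 + norm x) ^ l \<le> \<bar>D\<bar> * (1 + norm x) ^ (max k l)"
      by (intro mult_mono power_increasing) auto
    ultimately show ?thesis
      using *(1)[of x] *(2)[of x] norm_triangle_ineq[of "p x" "q x"] by (simp add: distrib_right)
  qed
  then show ?case by blast
next
  case (mult p q)
  then obtain C k D l where *: "\<And>x. norm (p x) \<le> C * (1 + norm x) ^ k" "\<And>x. norm (q x) \<le> D * (1 + norm x) ^ l"
    by blast
  have "norm (p x * q x) \<le> (C * D) * (1 + norm x) ^ (k + l)" for x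
    using mult_mono[OF *(1)[of x] *(2)[of x]] order_trans[OF norm_ge_zero *(1)[of x]]
    by (simp add: norm_mult power_add mult_ac)
  then show ?case by blast
qed

text \<open>Every iterated derivative is a \<open>polyfun\<close> times the function itself. These
  are the test functions for the Plancherel inequalities: the modulation a yields mollifications of
  a function, the centre b those of its transform.\<close>

lemma schwartz_modulated_gaussian:
  fixes a b :: "'a::euclidean_space"
  assumes s: "s > 0"
  shows "schwartz (\<lambda>x. cis (x \<bullet> a) * of_real (exp (- s * (norm (x - b))\<^sup>2)))" (is "schwartz ?E")
proof -
  have E_deriv: "(?E has_derivative (\<lambda>h. (\<i> * of_real (h \<bullet> a) + of_real (- 2 * s) * of_real ((x - b) \<bullet> h)) * ?E x)) (at x)" for x
  proof -
    have eq: "?E x = exp (\<i> * of_real (x \<bullet> a) + of_real (- s * ((x - b) \<bullet> (x - b))))" for x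
      by (simp only: cis_conv_exp exp_add exp_of_real power2_norm_eq_inner)
    have "((\<lambda>x. \<i> * of_real (x \<bullet> a) + of_real (- s * ((x - b) \<bullet> (x - b)))) has_derivative
        (\<lambda>h. \<i> * of_real (h \<bullet> a) + of_real (- 2 * s) * of_real ((x - b) \<bullet> h))) (at x)"
      by (auto intro!: derivative_eq_intros simp: inner_commute algebra_simps)
    from has_derivative_compose[OF this has_field_derivative_imp_has_derivative[OF DERIV_exp]] show ?thesis
      unfolding eq by (simp only: mult.commute)
  qed
  have form: "\<exists>p. polyfun p \<and> iter_partial bs ?E = (\<lambda>x. p x * ?E x)" for bs
  proof (induction bs)
    case Nil
    show ?case by (intro exI[of _ "\<lambda>x. 1"]) (auto intro: polyfun.intros)
  next
    case (Cons v bs)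
    then obtain p where p: "polyfun p" "iter_partial bs ?E = (\<lambda>x. p x * ?E x)" by blast
    from polyfun_derivative[OF p(1)] obtain D where D: "\<And>x. (p has_derivative D x) (at x)" "\<And>v. polyfun (\<lambda>x. D x v)"
      by blast
    let ?L = "\<lambda>x h. \<i> * of_real (h \<bullet> a) + of_real (- 2 * s) * of_real ((x - b) \<bullet> h)"
    have "((\<lambda>x. p x * ?E x) has_derivative (\<lambda>h. p x * (?L x h * ?E x) + D x h * ?E x)) (at x)" for x
      by (rule has_derivative_mult[OF D(1) E_deriv])
    then have fd: "frechet_derivative (\<lambda>x. p x * ?E x) (at x) v = (p x * ?L x v + D x v) * ?E x" for x
      by (subst frechet_derivative_at[symmetric, of "\<lambda>x. p x * ?E x"]) (auto simp: algebra_simps)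
    have "polyfun (\<lambda>x. \<i> * of_real (v \<bullet> a) + of_real (- 2 * s) * (of_real (x \<bullet> v) + of_real (- (b \<bullet> v))))"
      by (intro polyfun.intros)
    then have "polyfun (\<lambda>x. ?L x v)"
      unfolding inner_diff_left by (simp only: diff_conv_add_uminus of_real_add)
    then have "polyfun (\<lambda>x. p x * ?L x v + D x v)"
      by (rule polyfun.add[OF polyfun.mult[OF p(1)] D(2)])
    with fd p(2) show ?case by auto
  qed
  have bnd: "bounded (range (\<lambda>x. (1 + norm x) ^ k *\<^sub>R (p x * ?E x)))" if "polyfun p" for p k
  proof -
    obtain C m where C: "\<And>x. norm (p x) \<le> C * (1 + norm x) ^ m" using polyfun_growth[OF \<open>polyfun p\<close>] by blast
    have C0: "C \<ge> 0" using order_trans[OF norm_ge_zero C[of 0]] by simp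
    let ?n = "k + m"
    have "norm ((1 + norm x) ^ k *\<^sub>R (p x * ?E x)) \<le> C * (1 + norm b) ^ ?n * exp ((real ?n)\<^sup>2 / (4 * s))" for x
    proof -
      define r where "r = norm (x - b)"
      have r: "r \<ge> 0" by (simp add: r_def)
      have x_le: "1 + norm x \<le> (1 + norm b) * (1 + r)"
        using norm_triangle_ineq[of "x - b" b] mult_nonneg_nonneg[OF norm_ge_zero[of b] r]
        unfolding r_def distrib_left distrib_right mult_1_left mult_1_right diff_add_cancel by linarith
      have "norm ((1 + norm x) ^ k *\<^sub>R (p x * ?E x)) = (1 + norm x) ^ k * norm (p x) * exp (- s * r\<^sup>2)"
        by (simp add: norm_mult r_def)
      also have "\<dots> \<le> (1 + norm x) ^ k * (C * (1 + norm x) ^ m) * exp (- s * r\<^sup>2)"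
        by (intro mult_right_mono mult_left_mono C) auto
      also have "\<dots> = C * (1 + norm x) ^ ?n * exp (- s * r\<^sup>2)"
        by (simp add: power_add)
      also have "\<dots> \<le> C * ((1 + norm b) * (1 + r)) ^ ?n * exp (- s * r\<^sup>2)"
        by (intro mult_right_mono mult_left_mono power_mono x_le C0) auto
      also have "\<dots> = C * (1 + norm b) ^ ?n * ((1 + r) ^ ?n * exp (- s * r\<^sup>2))"
        by (simp add: power_mult_distrib)
      also have "(1 + r) ^ ?n \<le> exp (real ?n * r)"
        unfolding exp_of_nat_mult using r by (intro power_mono) auto
      also have "exp (real ?n * r) * exp (- s * r\<^sup>2) \<le> exp ((real ?n)\<^sup>2 / (4 * s))"
      proof -
        \<comment> \<open>Completing the square bounds n r - s r^2 by n^2 / (4 s), uniformly in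
          r.\<close>
        have "0 \<le> (2 * s * r - real ?n)\<^sup>2 / (4 * s)" using s by simp
        also have "\<dots> = s * r\<^sup>2 - real ?n * r + (real ?n)\<^sup>2 / (4 * s)"
          using s by (simp add: power2_eq_square field_simps)
        finally show ?thesis unfolding exp_add[symmetric] by simp
      qed
      finally show ?thesis using C0 by (simp add: mult_left_mono mult_right_mono)
    qed
    then show ?thesis unfolding bounded_iff by blast
  qed
  show ?thesis
    unfolding schwartz_def
  proof (intro allI impI conjI)
    fix bs :: "'a list" and x :: 'a and k :: nat
    obtain p where p: "polyfun p" "iter_partial bs ?E = (\<lambda>x. p x * ?E x)" using form by blast
    from polyfun_derivative[OF p(1)] obtain D where "(p has_derivative D x) (at x)" by blast
    from has_derivative_mult[OF this E_deriv] show "iter_partial bs ?E differentiable (at x)"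
      unfolding p(2) differentiable_def by blast
    show "bounded (range (\<lambda>x. (1 + norm x) ^ k *\<^sub>R iter_partial bs ?E x))"
      unfolding p(2) by (rule bnd[OF p(1)])
  qed
qed

section \<open>Decay of Schwartz functions and of their transforms\<close>

lemma iter_partial_append: "iter_partial (bs @ cs) f = iter_partial bs (iter_partial cs f)"
  by (induction bs) auto

lemma schwartz_partial:
  assumes "schwartz f" "b \<in> Basis"
  shows "schwartz (\<lambda>x. frechet_derivative f (at x) b)"
proof -
  \<comment> \<open>The head of the list is the outermost derivative, so differentiating first along
    b appends b at the end.\<close>
  have "iter_partial bs (\<lambda>x. frechet_derivative f (at x) b) = iter_partial (bs @ [b]) f" for bs
    by (simp add: iter_partial_append)
  then show ?thesis
    using assms unfolding schwartz_def by simp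
qed

lemma schwartz_differentiable: "schwartz f \<Longrightarrow> f differentiable (at x)"
  unfolding schwartz_def by (auto dest: spec[of _ "[]"])

lemma schwartz_continuous: "schwartz f \<Longrightarrow> continuous_on UNIV f"
  by (auto intro!: continuous_at_imp_continuous_on differentiable_imp_continuous_within schwartz_differentiable)

lemma schwartz_measurable: "schwartz f \<Longrightarrow> f \<in> borel_measurable borel"
  by (rule borel_measurable_continuous_onI[OF schwartz_continuous])

lemma schwartz_bound:
  assumes "schwartz f"
  obtains C where "C \<ge> 0" "\<And>x. norm (f x) \<le> C / (1 + norm x) ^ k"
proof -
  have "bounded (range (\<lambda>x. (1 + norm x) ^ k *\<^sub>R f x))"
    using assms unfolding schwartz_def by (auto dest: spec[of _ "[]"])
  then obtain C where C: "\<And>x. norm ((1 + norm x) ^ k *\<^sub>R f x) \<le> C"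
    unfolding bounded_iff by auto
  have "norm (f x) \<le> C / (1 + norm x) ^ k" for x
    using C[of x] by (simp add: field_simps add_pos_nonneg)
  moreover have "C \<ge> 0" using order_trans[OF norm_ge_zero C[of 0]] .
  ultimately show ?thesis using that by blast
qed

lemma
  fixes f :: "'a::euclidean_space \<Rightarrow> complex"
  assumes [measurable]: "f \<in> borel_measurable borel"
    and le: "\<And>x. norm (f x) \<le> C / (1 + norm x) ^ (2 * DIM('a))"
  shows integrable_decay: "integrable lborel f"
    and sqnorm_decay_finite: "sqnorm f < \<infinity>"
proof -
  show "integrable lborel f"
  proof (rule Bochner_Integration.integrable_bound)
    show "integrable lborel (\<lambda>x::'a. C * (1 / (1 + norm x) ^ (2 * DIM('a))))"
      by (intro integrable_mult_right integrable_polynomial_decay)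
    show "AE x in lborel. norm (f x) \<le> norm (C * (1 / (1 + norm x) ^ (2 * DIM('a))))"
      using le order_trans[OF le abs_ge_self] by (auto simp: abs_mult)
  qed measurable
  have "integrable lborel (\<lambda>x. (norm (f x))\<^sup>2)"
  proof (rule Bochner_Integration.integrable_bound)
    show "integrable lborel (\<lambda>x::'a. C\<^sup>2 * (1 / (1 + norm x) ^ (2 * DIM('a))))"
      by (intro integrable_mult_right integrable_polynomial_decay)
    have "(norm (f x))\<^sup>2 \<le> C\<^sup>2 * (1 / (1 + norm x) ^ (2 * DIM('a)))" for x
    proof -
      have "(norm (f x))\<^sup>2 \<le> (C / (1 + norm x) ^ (2 * DIM('a)))\<^sup>2"
        by (intro power_mono le) auto
      also have "\<dots> = C\<^sup>2 * (1 / (1 + norm x) ^ (2 * DIM('a)))\<^sup>2"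
        by (simp add: power_divide)
      also have "(1 / (1 + norm x) ^ (2 * DIM('a)))\<^sup>2 \<le> 1 / (1 + norm x) ^ (2 * DIM('a))"
        unfolding power2_eq_square by (rule mult_left_le) (auto simp: divide_le_eq one_le_power)
      finally show ?thesis by (simp add: mult_left_mono)
    qed
    then show "AE x in lborel. norm ((norm (f x))\<^sup>2) \<le> norm (C\<^sup>2 * (1 / (1 + norm x) ^ (2 * DIM('a))))"
      by (auto simp: abs_mult)
  qed measurable
  then show "sqnorm f < \<infinity>"
    unfolding sqnorm_def by (subst nn_integral_eq_integral) auto
qed

lemma
  assumes "schwartz f"
  shows schwartz_integrable: "integrable lborel f" and schwartz_sqnorm_finite: "sqnorm f < \<infinity>"
  using schwartz_bound[OF assms, of "2 * DIM('a)"] schwartz_measurable[OF assms]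
  by (metis integrable_decay sqnorm_decay_finite)+

lemma fourier_translate:
  assumes [measurable]: "f \<in> borel_measurable borel"
  shows "fourier (\<lambda>x. f (a + x)) \<xi> = cis (a \<bullet> \<xi>) * fourier f \<xi>"
proof -
  have "fourier f \<xi> = (LINT x|lborel. cis (- ((a + x) \<bullet> \<xi>)) * f (a + x))"
    unfolding fourier_def by (rule integral_lborel_translate[symmetric]) measurable
  also have "\<dots> = cis (- (a \<bullet> \<xi>)) * fourier (\<lambda>x. f (a + x)) \<xi>"
    unfolding fourier_def integral_mult_right_zero[symmetric]
    by (simp add: inner_add_left mult.assoc[symmetric] cis_mult)
  finally show ?thesis by (simp add: cis_mult mult.assoc[symmetric])
qed

lemma tendsto_difference_quotient:
  fixes g :: "real \<Rightarrow> complex"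
  assumes g: "(g has_derivative (\<lambda>h. h *\<^sub>R D)) (at 0)" and h: "\<And>n. h n \<noteq> 0" "h \<longlonglongrightarrow> 0"
  shows "(\<lambda>n. (g (h n) - g 0) /\<^sub>R h n) \<longlonglongrightarrow> D"
proof -
  have lim: "filterlim h (at 0) sequentially"
    using h by (auto simp: filterlim_at intro: always_eventually)
  have "((\<lambda>y. norm ((g y - g 0) - (y - 0) *\<^sub>R D) / norm (y - 0)) \<longlongrightarrow> 0) (at 0)"
    using g unfolding has_derivative_iff_norm by blast
  from filterlim_compose[OF this lim]
  have "(\<lambda>n. norm ((g (h n) - g 0) - h n *\<^sub>R D) / norm (h n)) \<longlonglongrightarrow> 0" by simp
  moreover have "norm ((g (h n) - g 0) - h n *\<^sub>R D) / norm (h n) = norm ((g (h n) - g 0) /\<^sub>R h n - D)" for n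
  proof -
    have "(g (h n) - g 0) /\<^sub>R h n - D = ((g (h n) - g 0) - h n *\<^sub>R D) /\<^sub>R h n"
      using h(1)[of n] by (simp add: scaleR_diff_right)
    then show ?thesis by (simp add: divide_inverse mult.commute)
  qed
  ultimately show ?thesis by (simp add: tendsto_norm_zero_iff LIM_zero_iff)
qed

text \<open>Difference quotients replace integration by parts: the transform of a translate is a
  phase times the transform, and the transforms of the quotients converge by dominated
  convergence.\<close>

lemma fourier_partial:
  fixes f :: "'a::euclidean_space \<Rightarrow> complex"
  assumes f: "schwartz f" and b: "b \<in> Basis"
  shows "fourier (\<lambda>x. frechet_derivative f (at x) b) \<xi> = \<i> * of_real (\<xi> \<bullet> b) * fourier f \<xi>"
proof -
  define D where "D = (\<lambda>x. frechet_derivative f (at x) b)"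
  define h where "h n = 1 / real (Suc n)" for n
  have h: "h n > 0" "h n \<le> 1" for n by (auto simp: h_def)
  have h0: "h \<longlonglongrightarrow> 0" unfolding h_def by (rule LIMSEQ_Suc[OF lim_1_over_n])
  have sD: "schwartz D" unfolding D_def by (rule schwartz_partial[OF f b])
  have [measurable]: "f \<in> borel_measurable borel" "D \<in> borel_measurable borel"
    by (rule schwartz_measurable f sD)+
  note fm = schwartz_measurable[OF f]
  have fi: "integrable lborel f" by (rule schwartz_integrable[OF f])
  have fti: "integrable lborel (\<lambda>x. f (a + x))" for a
    using fi by (simp add: integrable_lborel_translate)
  have line: "((\<lambda>t. f (t *\<^sub>R b + x)) has_derivative (\<lambda>k. k *\<^sub>R D (t *\<^sub>R b + x))) (at t)" for x t
  proof -
    have d: "(f has_derivative frechet_derivative f (at (t *\<^sub>R b + x))) (at (t *\<^sub>R b + x))"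
      using schwartz_differentiable[OF f] frechet_derivative_works by blast
    have "((\<lambda>t. t *\<^sub>R b + x) has_derivative (\<lambda>k. k *\<^sub>R b)) (at t)"
      by (auto intro!: derivative_eq_intros)
    from has_derivative_compose[OF this d]
    have "((\<lambda>t. f (t *\<^sub>R b + x)) has_derivative (\<lambda>k. frechet_derivative f (at (t *\<^sub>R b + x)) (k *\<^sub>R b))) (at t)" .
    then show ?thesis
      using linear_scale[OF has_derivative_linear[OF d]] by (simp add: D_def)
  qed
  define Q where "Q n x = (f (h n *\<^sub>R b + x) - f x) /\<^sub>R h n" for n x
  have [measurable]: "Q n \<in> borel_measurable borel" for n unfolding Q_def by measurable
  obtain C where C: "C \<ge> 0" "\<And>x. norm (D x) \<le> C / (1 + norm x) ^ (2 * DIM('a))"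
    using schwartz_bound[OF sD] by blast
  \<comment> \<open>Mean value bound from the decay of D. A shift by at most one unit changes
    \<open>1 + norm x\<close> by a factor of at most 2, hence the constant 2^(2 d); the bound is
    uniform in n.\<close>
  have Q_le: "norm (Q n x) \<le> C * 2 ^ (2 * DIM('a)) * (1 / (1 + norm x) ^ (2 * DIM('a)))" for n x
  proof -
    let ?B = "C * 2 ^ (2 * DIM('a)) * (1 / (1 + norm x) ^ (2 * DIM('a)))"
    have Db: "norm (D (t *\<^sub>R b + x)) \<le> ?B" if t: "t \<in> {0..1}" for t
    proof -
      have "norm x \<le> norm (t *\<^sub>R b + x) + norm (t *\<^sub>R b)"
        using norm_triangle_ineq4[of "t *\<^sub>R b + x" "t *\<^sub>R b"] by simp
      then have "1 + norm x \<le> 2 * (1 + norm (t *\<^sub>R b + x))"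
        using t b norm_ge_zero[of "t *\<^sub>R b + x"] by (simp del: norm_ge_zero)
      then have "(1 + norm x) ^ (2 * DIM('a)) \<le> 2 ^ (2 * DIM('a)) * (1 + norm (t *\<^sub>R b + x)) ^ (2 * DIM('a))"
        unfolding power_mult_distrib[symmetric] by (intro power_mono) auto
      from mult_left_mono[OF this C(1)] have "C / (1 + norm (t *\<^sub>R b + x)) ^ (2 * DIM('a)) \<le> ?B"
        by (simp add: field_simps add_pos_nonneg)
      with C(2)[of "t *\<^sub>R b + x"] show ?thesis by linarith
    qed
    have on: "onorm (\<lambda>k. k *\<^sub>R D (t *\<^sub>R b + x)) \<le> ?B" if "t \<in> {0..1}" for t
    proof (rule onorm_bound)
      show "norm (k *\<^sub>R D (t *\<^sub>R b + x)) \<le> ?B * norm k" for k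
        using mult_right_mono[OF Db[OF that] norm_ge_zero[of k]] by (simp add: mult.commute)
    qed (use C(1) in auto)
    have "norm (f (h n *\<^sub>R b + x) - f (0 *\<^sub>R b + x)) \<le> ?B * norm (h n - 0)"
      by (rule differentiable_bound[where S = "{0..1}" and f' = "\<lambda>t k. k *\<^sub>R D (t *\<^sub>R b + x)"])
         (use h[of n] on in \<open>auto intro!: has_derivative_at_withinI[OF line]\<close>)
    then have "norm (f (h n *\<^sub>R b + x) - f x) / h n \<le> ?B"
      using h(1)[of n] by (subst pos_divide_le_eq) auto
    then show ?thesis using h(1)[of n] by (simp add: Q_def divide_inverse mult.commute)
  qed
  have bi: "integrable lborel (\<lambda>x::'a. C * 2 ^ (2 * DIM('a)) * (1 / (1 + norm x) ^ (2 * DIM('a))))"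
    by (intro integrable_mult_right integrable_polynomial_decay)
  have "(\<lambda>n. fourier (Q n) \<xi>) \<longlonglongrightarrow> fourier D \<xi>"
    unfolding fourier_def
  proof (rule integral_dominated_convergence[OF _ _ bi])
    show "AE x in lborel. (\<lambda>n. cis (- (x \<bullet> \<xi>)) * Q n x) \<longlonglongrightarrow> cis (- (x \<bullet> \<xi>)) * D x"
    proof (intro AE_I2 tendsto_mult_left)
      fix x
      show "(\<lambda>n. Q n x) \<longlonglongrightarrow> D x"
        using tendsto_difference_quotient[of "\<lambda>t. f (t *\<^sub>R b + x)" "D x" h] line[of x 0] h h0
        unfolding Q_def by (auto simp: less_imp_neq[symmetric])
    qed
  qed (use Q_le in \<open>auto simp: norm_mult\<close>)
  have q: "fourier (Q n) \<xi> = ((cis (h n * (\<xi> \<bullet> b)) - 1) /\<^sub>R h n) * fourier f \<xi>" for n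
  proof -
    have "fourier (Q n) \<xi> = (LINT x|lborel. (cis (- (x \<bullet> \<xi>)) * f (h n *\<^sub>R b + x) - cis (- (x \<bullet> \<xi>)) * f x) /\<^sub>R h n)"
      unfolding fourier_def Q_def by (simp add: algebra_simps)
    also have "\<dots> = (fourier (\<lambda>x. f (h n *\<^sub>R b + x)) \<xi> - fourier f \<xi>) /\<^sub>R h n"
      unfolding fourier_def
      by (subst integral_scaleR_right, subst Bochner_Integration.integral_diff)
         (auto intro!: integrable_cis_mult fti fi)
    finally show ?thesis
      unfolding fourier_translate[OF fm] by (simp add: inner_commute left_diff_distrib)
  qed
  have lim: "(\<lambda>n. (cis (h n * (\<xi> \<bullet> b)) - 1) /\<^sub>R h n) \<longlonglongrightarrow> \<i> * of_real (\<xi> \<bullet> b)"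
  proof -
    have "((\<lambda>t. cis (t * (\<xi> \<bullet> b))) has_derivative (\<lambda>k. k *\<^sub>R (\<i> * of_real (\<xi> \<bullet> b)))) (at 0)"
    proof -
      have "((\<lambda>t. \<i> * of_real (t * (\<xi> \<bullet> b))) has_derivative (\<lambda>k. \<i> * of_real (k * (\<xi> \<bullet> b)))) (at 0)"
        by (auto intro!: derivative_eq_intros)
      from has_derivative_compose[OF this has_field_derivative_imp_has_derivative[OF DERIV_exp]]
      show ?thesis unfolding cis_conv_exp by (simp add: scaleR_conv_of_real mult_ac)
    qed
    from tendsto_difference_quotient[OF this _ h0] h show ?thesis
      by (auto simp: less_imp_neq[symmetric])
  qed
  have "(\<lambda>n. fourier (Q n) \<xi>) \<longlonglongrightarrow> \<i> * of_real (\<xi> \<bullet> b) * fourier f \<xi>"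
    unfolding q by (rule tendsto_mult_right[OF lim])
  then show ?thesis
    using LIMSEQ_unique[OF \<open>(\<lambda>n. fourier (Q n) \<xi>) \<longlonglongrightarrow> fourier D \<xi>\<close>] by (simp add: D_def)
qed

text \<open>Induction on the power for all Schwartz f at once: each factor \<xi> \<bullet> b is
  absorbed into a partial derivative of f, which is again Schwartz.\<close>

lemma schwartz_fourier_coordinate_bound:
  fixes f :: "'a::euclidean_space \<Rightarrow> complex"
  assumes "schwartz f" "b \<in> Basis"
  shows "\<exists>C. \<forall>\<xi>. \<bar>\<xi> \<bullet> b\<bar> ^ n * norm (fourier f \<xi>) \<le> C"
  using assms(1)
proof (induction n arbitrary: f)
  case 0
  then show ?case using norm_fourier_le[OF schwartz_integrable] by auto
next
  case (Suc n)
  from Suc.IH[OF schwartz_partial[OF Suc.prems assms(2)]] obtain C where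
    "\<And>\<xi>. \<bar>\<xi> \<bullet> b\<bar> ^ n * norm (fourier (\<lambda>x. frechet_derivative f (at x) b) \<xi>) \<le> C" by blast
  then show ?case
    unfolding fourier_partial[OF Suc.prems assms(2)]
    by (intro exI[of _ C]) (simp add: norm_mult mult_ac)
qed

lemma schwartz_fourier_decay:
  fixes f :: "'a::euclidean_space \<Rightarrow> complex"
  assumes f: "schwartz f"
  obtains C where "C \<ge> 0" "\<And>\<xi>. norm (fourier f \<xi>) \<le> C / (1 + norm \<xi>) ^ n"
proof -
  obtain C where C: "\<And>b \<xi>. b \<in> Basis \<Longrightarrow> \<bar>\<xi> \<bullet> b\<bar> ^ n * norm (fourier f \<xi>) \<le> C b"
    using bchoice[of Basis "\<lambda>b C. \<forall>\<xi>. \<bar>\<xi> \<bullet> b\<bar> ^ n * norm (fourier f \<xi>) \<le> C"]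
      schwartz_fourier_coordinate_bound[OF f] by blast
  obtain C0 where C0: "\<And>\<xi>. norm (fourier f \<xi>) \<le> C0"
    using norm_fourier_le[OF schwartz_integrable[OF f]] by blast
  define K where "K = (1 + real DIM('a)) ^ n * (C0 + (\<Sum>b\<in>Basis. C b))"
  have le: "(1 + norm \<xi>) ^ n * norm (fourier f \<xi>) \<le> K" for \<xi>
  proof -
    \<comment> \<open>The largest coordinate controls the norm up to the factor d, so bounds in the
      single coordinates give decay in the norm.\<close>
    define m where "m = Max ((\<lambda>b. \<bar>\<xi> \<bullet> b\<bar>) ` Basis)"
    have "m \<in> (\<lambda>b. \<bar>\<xi> \<bullet> b\<bar>) ` Basis"
      unfolding m_def by (rule Max_in) auto
    then obtain b where b: "b \<in> Basis" "m = \<bar>\<xi> \<bullet> b\<bar>" by blast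
    have "norm \<xi> \<le> (\<Sum>b\<in>Basis. \<bar>\<xi> \<bullet> b\<bar>)" by (rule norm_le_l1)
    also have "\<dots> \<le> real DIM('a) * m"
      using sum_bounded_above[of "Basis::'a set" "\<lambda>b. \<bar>\<xi> \<bullet> b\<bar>" m] by (auto simp: m_def)
    finally have nm: "norm \<xi> \<le> real DIM('a) * m" .
    have "1 + norm \<xi> \<le> (1 + real DIM('a)) * max 1 m"
    proof -
      have "real DIM('a) * m \<le> real DIM('a) * max 1 m" by (intro mult_left_mono) auto
      moreover have "1 \<le> max 1 m" by simp
      ultimately show ?thesis using nm unfolding distrib_right by linarith
    qed
    then have "(1 + norm \<xi>) ^ n \<le> (1 + real DIM('a)) ^ n * (max 1 m) ^ n"
      unfolding power_mult_distrib[symmetric] by (intro power_mono) auto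
    also have "(max 1 m) ^ n \<le> 1 + m ^ n"
      using b by (cases "m \<le> 1") (auto simp: max_def)
    finally have "(1 + norm \<xi>) ^ n * norm (fourier f \<xi>) \<le> (1 + real DIM('a)) ^ n * (1 + m ^ n) * norm (fourier f \<xi>)"
      by (intro mult_right_mono) (auto simp: mult_left_mono)
    also have "\<dots> = (1 + real DIM('a)) ^ n * (norm (fourier f \<xi>) + m ^ n * norm (fourier f \<xi>))"
      by (simp add: algebra_simps)
    also have "\<dots> \<le> K"
    proof -
      have "m ^ n * norm (fourier f \<xi>) \<le> C b" using C[OF b(1), of \<xi>] b(2) by simp
      also have "\<dots> \<le> (\<Sum>b\<in>Basis. C b)"
      proof (rule member_le_sum[OF b(1)])
        show "0 \<le> C x" if "x \<in> Basis - {b}" for x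
          using that by (intro order_trans[OF _ C[of x \<xi>]]) auto
      qed simp
      finally show ?thesis unfolding K_def using C0[of \<xi>] by (intro mult_left_mono add_mono) auto
    qed
    finally show ?thesis .
  qed
  have "norm (fourier f \<xi>) \<le> K / (1 + norm \<xi>) ^ n" for \<xi>
    using le[of \<xi>] by (simp add: field_simps add_pos_nonneg)
  moreover have "K \<ge> 0" by (rule order_trans[OF _ le[of 0]]) simp
  ultimately show ?thesis using that by blast
qed

lemma
  assumes "schwartz f"
  shows schwartz_fourier_integrable: "integrable lborel (fourier f)"
    and schwartz_fourier_sqnorm_finite: "sqnorm (fourier f) < \<infinity>"
  using schwartz_fourier_decay[OF assms, of "2 * DIM('a)"] borel_measurable_fourier[OF schwartz_measurable[OF assms]]
  by (metis integrable_decay sqnorm_decay_finite)+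

section \<open>The Fourier transform on square integrable functions\<close>

lemma ennreal_rpow_finite_iff [simp]: "ennreal_rpow x p < top \<longleftrightarrow> x < top"
  by (auto simp: ennreal_rpow_def less_top)

lemma L2_norm_fun_eq: "L2_norm_fun f = ennreal_rpow (sqnorm f) (1 / 2)"
  by (simp add: L2_norm_fun_def Lp_norm_def sqnorm_def ennreal_rpow_def[of "ennreal _"])

lemma L2_space_iff: "f \<in> L2_space \<longleftrightarrow> f \<in> borel_measurable borel \<and> sqnorm f < \<infinity>"
  by (simp add: L2_space_def L2_norm_fun_eq)

text \<open>A Gaussian inserted in the outer integral turns the double transform, by the
  multiplication formula, into a mollification of f, which converges to (2 pi)^d f(x) because f is
  bounded and continuous.\<close>

lemma schwartz_inversion:
  fixes f :: "'a::euclidean_space \<Rightarrow> complex"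
  assumes f: "schwartz f"
  shows "fourier (fourier f) (- x) = of_real ((2 * pi) ^ DIM('a)) * f x"
proof -
  let ?c = "(2 * pi) ^ DIM('a)"
  define e where "e n = 1 / real (Suc n)" for n
  have e: "e n > 0" for n by (simp add: e_def)
  have e0: "e \<longlonglongrightarrow> 0" unfolding e_def by (rule LIMSEQ_Suc[OF lim_1_over_n])
  have [measurable]: "f \<in> borel_measurable borel" by (rule schwartz_measurable[OF f])
  have fi: "integrable lborel f" by (rule schwartz_integrable[OF f])
  let ?g = "\<lambda>n \<xi>. complex_of_real (exp (- e n * (norm (\<xi>::'a))\<^sup>2))"
  let ?F = "\<lambda>n \<xi>. cis (\<xi> \<bullet> x) * ?g n \<xi>"
  have gi: "integrable lborel (?g n)" for n by (intro integrable_of_real integrable_gaussian e)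
  have "(\<lambda>n. LINT \<xi>|lborel. ?F n \<xi> * fourier f \<xi>) \<longlonglongrightarrow> (LINT \<xi>|lborel. cis (- (\<xi> \<bullet> - x)) * fourier f \<xi>)"
  proof (rule integral_dominated_convergence[where w = "\<lambda>\<xi>. norm (fourier f \<xi>)"])
    show "integrable lborel (\<lambda>\<xi>. norm (fourier f \<xi>))"
      using schwartz_fourier_integrable[OF f] by simp
    show "AE \<xi> in lborel. (\<lambda>n. ?F n \<xi> * fourier f \<xi>) \<longlonglongrightarrow> cis (- (\<xi> \<bullet> - x)) * fourier f \<xi>"
    proof (rule AE_I2)
      fix \<xi>
      have "(\<lambda>n. ?F n \<xi> * fourier f \<xi>) \<longlonglongrightarrow> cis (\<xi> \<bullet> x) * complex_of_real (exp (- 0 * (norm \<xi>)\<^sup>2)) * fourier f \<xi>"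
        by (intro tendsto_intros e0)
      then show "(\<lambda>n. ?F n \<xi> * fourier f \<xi>) \<longlonglongrightarrow> cis (- (\<xi> \<bullet> - x)) * fourier f \<xi>" by simp
    qed
    show "AE \<xi> in lborel. norm (?F n \<xi> * fourier f \<xi>) \<le> norm (fourier f \<xi>)" for n
      using e[of n] by (auto simp: norm_mult intro!: mult_left_le_one_le)
  qed measurable
  then have lim1: "(\<lambda>n. LINT \<xi>|lborel. ?F n \<xi> * fourier f \<xi>) \<longlonglongrightarrow> fourier (fourier f) (- x)"
    by (simp only: fourier_def[of "fourier f"])
  obtain B where B: "B \<ge> 0" "\<And>y. norm (f y) \<le> B"
    using schwartz_bound[OF f, of 0] by auto
  define A where "A = (\<lambda>z. norm (f (z + x) - f x))"
  have lim2: "(\<lambda>n. LINT z|lborel. A z * gauss_kernel (e n) z) \<longlonglongrightarrow> 0"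
  proof (rule gauss_kernel_approximate_identity[OF _ _ _ _ e e0])
    show "A \<in> borel_measurable borel" unfolding A_def by measurable
    show "A z \<le> 2 * B" for z
      unfolding A_def using norm_triangle_ineq4[of "f (z + x)" "f x"] B(2)[of "z + x"] B(2)[of x] by linarith
    show "\<exists>d>0. \<forall>z. norm z < d \<longrightarrow> A z < r" if r: "r > 0" for r
    proof -
      have "isCont f x" using schwartz_continuous[OF f] by (simp add: continuous_on_eq_continuous_at)
      then obtain d where d: "d > 0" "\<And>y. dist y x < d \<Longrightarrow> dist (f y) (f x) < r"
        unfolding continuous_at_eps_delta using r by blast
      then show ?thesis
        by (intro exI[of _ d]) (auto simp: A_def dist_norm dest: d(2)[of "_ + x"])
    qed
  qed (simp add: A_def)
  have eq: "(LINT \<xi>|lborel. ?F n \<xi> * fourier f \<xi>) = (LINT z|lborel. of_real (gauss_kernel (e n) z) * f (z + x))" for n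
  proof -
    have "(LINT \<xi>|lborel. ?F n \<xi> * fourier f \<xi>) = (LINT y|lborel. fourier (?F n) y * f y)"
      by (intro fourier_mult_formula integrable_cis_mult gi fi) measurable
    also have "\<dots> = (LINT y|lborel. of_real (gauss_kernel (e n) (y - x)) * f y)"
      unfolding fourier_cis_mult fourier_gaussian[OF e] ..
    also have "\<dots> = (LINT z|lborel. of_real (gauss_kernel (e n) (x + z - x)) * f (x + z))"
      by (rule integral_lborel_translate[symmetric]) measurable
    finally show ?thesis by (simp add: add.commute)
  qed
  have "(\<lambda>n. (LINT \<xi>|lborel. ?F n \<xi> * fourier f \<xi>) - of_real ?c * f x) \<longlonglongrightarrow> 0"
  proof (rule Lim_null_comparison[OF always_eventually[OF allI] lim2])
    fix n
    have ki: "integrable lborel (\<lambda>z::'a. complex_of_real (gauss_kernel (e n) z))"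
      by (intro integrable_of_real integrable_gauss_kernel e)
    have fti: "integrable lborel (\<lambda>z. of_real (gauss_kernel (e n) z) * f (z + x))"
    proof (rule Bochner_Integration.integrable_bound)
      show "integrable lborel (\<lambda>z::'a. B * gauss_kernel (e n) z)"
        by (intro integrable_mult_right integrable_gauss_kernel e)
      show "AE z in lborel. norm (of_real (gauss_kernel (e n) z) * f (z + x)) \<le> norm (B * gauss_kernel (e n) z)"
        using B gauss_kernel_nonneg[OF e, where 'a='a] by (auto simp: norm_mult abs_mult mult.commute[of B] intro!: AE_I2 mult_left_mono)
    qed measurable
    have cf: "of_real ?c * f x = (LINT z|lborel. of_real (gauss_kernel (e n) (z::'a)) * f x)"
      by (simp add: integral_gauss_kernel[OF e])
    have "(LINT \<xi>|lborel. ?F n \<xi> * fourier f \<xi>) - of_real ?c * f x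
        = (LINT z|lborel. of_real (gauss_kernel (e n) z) * f (z + x) - of_real (gauss_kernel (e n) z) * f x)"
      unfolding eq cf by (rule Bochner_Integration.integral_diff[symmetric]) (use fti ki in auto)
    also have "norm \<dots> \<le> (LINT z|lborel. norm (of_real (gauss_kernel (e n) z) * f (z + x) - of_real (gauss_kernel (e n) z) * f x))"
      by (rule integral_norm_bound)
    also have "\<dots> = (LINT z|lborel. A z * gauss_kernel (e n) z)"
      using gauss_kernel_nonneg[OF e, where 'a='a]
      by (intro Bochner_Integration.integral_cong refl, subst right_diff_distrib[symmetric])
         (simp add: norm_mult A_def mult.commute)
    finally show "norm ((LINT \<xi>|lborel. ?F n \<xi> * fourier f \<xi>) - of_real ?c * f x) \<le> (LINT z|lborel. A z * gauss_kernel (e n) z)" .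
  qed
  then have "(\<lambda>n. LINT \<xi>|lborel. ?F n \<xi> * fourier f \<xi>) \<longlonglongrightarrow> of_real ?c * f x"
    by (simp add: LIM_zero_iff)
  from LIMSEQ_unique[OF lim1 this] show ?thesis .
qed

definition inv_fourier :: "('a::euclidean_space \<Rightarrow> complex) \<Rightarrow> 'a \<Rightarrow> complex" where
  "inv_fourier G x = fourier G (- x) / of_real ((2 * pi) ^ DIM('a))"

lemma borel_measurable_inv_fourier [measurable]:
  fixes G :: "'a::euclidean_space \<Rightarrow> complex"
  shows "G \<in> borel_measurable borel \<Longrightarrow> inv_fourier G \<in> borel_measurable borel"
  unfolding inv_fourier_def[abs_def]
  by (intro borel_measurable_divide measurable_compose[OF borel_measurable_uminus borel_measurable_fourier]) auto

lemma sqnorm_reflect: "f \<in> borel_measurable borel \<Longrightarrow> sqnorm (\<lambda>x. f (- x)) = sqnorm f"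
  unfolding sqnorm_def using nn_integral_lborel_reflect[of "\<lambda>x. ennreal ((norm (f x))\<^sup>2)" 0] by simp

lemma sqnorm_inv_fourier_finite:
  fixes G :: "'a::euclidean_space \<Rightarrow> complex"
  assumes "integrable lborel G" "sqnorm G < \<infinity>"
  shows "sqnorm (inv_fourier G) < \<infinity>"
proof -
  have [measurable]: "G \<in> borel_measurable borel" using assms by auto
  have "sqnorm (fourier G) < \<infinity>"
    using le_less_trans[OF sqnorm_fourier_le[OF assms(1)]] assms(2) by (simp add: ennreal_mult_less_top)
  moreover have eq: "inv_fourier G = (\<lambda>x. (1 / of_real ((2 * pi) ^ DIM('a))) * fourier G (- x))"
    by (simp add: inv_fourier_def fun_eq_iff)
  have "sqnorm (inv_fourier G) = ennreal ((norm (1 / complex_of_real ((2 * pi) ^ DIM('a))))\<^sup>2) * sqnorm (\<lambda>x. fourier G (- x))"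
    unfolding eq by (rule sqnorm_cmult) measurable
  moreover have "sqnorm (\<lambda>x. fourier G (- x)) = sqnorm (fourier G)"
    by (rule sqnorm_reflect) measurable
  ultimately show ?thesis
    by (simp add: ennreal_mult_less_top)
qed

text \<open>Integrability of G makes the inverse transform a genuine integral, so the weak
  definition follows from the multiplication formula and Schwartz inversion. The evolutions
  constructed later, first with truncated frequencies, enter through this lemma.\<close>

lemma has_fourier_L2_inv_fourier:
  fixes G :: "'a::euclidean_space \<Rightarrow> complex"
  assumes G: "integrable lborel G" "sqnorm G < \<infinity>"
  shows "has_fourier_L2 (inv_fourier G) G"
  unfolding has_fourier_L2_def L2_space_iff
proof (intro conjI allI impI)
  have [measurable]: "G \<in> borel_measurable borel" using G by auto
  show "inv_fourier G \<in> borel_measurable borel" "G \<in> borel_measurable borel" by measurable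
  show "sqnorm (inv_fourier G) < \<infinity>" by (rule sqnorm_inv_fourier_finite[OF G])
  show "sqnorm G < \<infinity>" by fact
  fix f :: "'a \<Rightarrow> complex" assume f: "schwartz f"
  have [measurable]: "f \<in> borel_measurable borel" by (rule schwartz_measurable[OF f])
  let ?c = "complex_of_real ((2 * pi) ^ DIM('a))"
  have ri: "integrable lborel (\<lambda>x. fourier f (- x))"
    using integrable_lborel_reflect[of "fourier f" 0] schwartz_fourier_integrable[OF f] by simp
  have "(LINT x|lborel. inv_fourier G x * fourier f x) = (LINT x|lborel. inv_fourier G (- x) * fourier f (- x))"
    using integral_lborel_reflect[of "\<lambda>x. inv_fourier G x * fourier f x" 0] by simp
  also have "\<dots> = (LINT x|lborel. fourier G x * fourier f (- x)) / ?c"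
    by (simp add: inv_fourier_def)
  also have "(LINT x|lborel. fourier G x * fourier f (- x)) = (LINT \<xi>|lborel. G \<xi> * fourier (\<lambda>x. fourier f (- x)) \<xi>)"
    by (rule fourier_mult_formula[symmetric, OF G(1) ri])
  also have "\<dots> = (LINT \<xi>|lborel. ?c * (G \<xi> * f \<xi>))"
    by (simp only: fourier_reflect[OF borel_measurable_fourier[OF schwartz_measurable[OF f]]] schwartz_inversion[OF f] mult.left_commute)
  also have "\<dots> = ?c * (LINT \<xi>|lborel. G \<xi> * f \<xi>)" by (rule integral_mult_right_zero)
  finally show "(LINT x|lborel. inv_fourier G x * fourier f x) = (LINT \<xi>|lborel. G \<xi> * f \<xi>)" by simp
qed

lemma has_fourier_L2_schwartz: "schwartz f \<Longrightarrow> has_fourier_L2 f (fourier f)"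
  unfolding has_fourier_L2_def L2_space_iff
  by (intro conjI allI impI fourier_mult_formula schwartz_integrable schwartz_measurable
      schwartz_sqnorm_finite schwartz_fourier_sqnorm_finite borel_measurable_fourier)

lemma
  assumes "has_fourier_L2 h G"
  shows has_fourier_L2_measurable: "h \<in> borel_measurable borel" "G \<in> borel_measurable borel"
    and has_fourier_L2_finite: "sqnorm h < \<infinity>" "sqnorm G < \<infinity>"
    and has_fourier_L2_eq: "schwartz \<phi> \<Longrightarrow> (LINT x|lborel. h x * fourier \<phi> x) = (LINT \<xi>|lborel. G \<xi> * \<phi> \<xi>)"
  using assms unfolding has_fourier_L2_def L2_space_iff by auto

lemma integrable_sqnorm_gaussian:
  fixes h :: "'a::euclidean_space \<Rightarrow> complex"
  assumes [measurable]: "h \<in> borel_measurable borel" and fin: "sqnorm h < \<infinity>" and e: "e > 0"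
  shows "integrable lborel (\<lambda>x. h x * of_real (exp (- e * (norm x)\<^sup>2)))"
    and "sqnorm (\<lambda>x. h x * of_real (exp (- e * (norm x)\<^sup>2))) \<le> sqnorm h"
proof -
  show "integrable lborel (\<lambda>x. h x * of_real (exp (- e * (norm x)\<^sup>2)))"
  proof (rule integrable_mult_sqnorm)
    show "sqnorm (\<lambda>x::'a. complex_of_real (exp (- e * (norm x)\<^sup>2))) < \<infinity>"
      using schwartz_sqnorm_finite[OF schwartz_modulated_gaussian[OF e, of 0 "0::'a"]] by simp
  qed (use fin in measurable)
  show "sqnorm (\<lambda>x. h x * of_real (exp (- e * (norm x)\<^sup>2))) \<le> sqnorm h"
    unfolding sqnorm_def
    using e by (intro nn_integral_mono ennreal_leI power_mono) (auto simp: norm_mult mult_left_le)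
qed

text \<open>Plancherel for the distributional definition, up to constants. Modulated Gaussians as
  test functions express the mollification of h as the transform of a damped G; translated Gaussians
  express the mollification of G as the transform of a damped h. The damped functions are
  integrable, so \<open>sqnorm_fourier_le\<close> applies.\<close>

lemma has_fourier_L2_sqnorm_le:
  fixes h G :: "'a::euclidean_space \<Rightarrow> complex"
  assumes hG: "has_fourier_L2 h G"
  shows "ennreal (((2 * pi) ^ DIM('a))\<^sup>2) * sqnorm h \<le> 2 * (ennreal (2 * (2 * pi) ^ DIM('a)) * sqnorm G)"
    and "ennreal (((2 * pi) ^ DIM('a))\<^sup>2) * sqnorm G
      \<le> 2 * (ennreal (((2 * pi) ^ DIM('a))\<^sup>2) * (ennreal (2 * (2 * pi) ^ DIM('a)) * sqnorm h))"
proof -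
  let ?c = "(2 * pi) ^ DIM('a)"
  note [measurable] = has_fourier_L2_measurable[OF hG]
  note fin = has_fourier_L2_finite[OF hG]
  show "ennreal (?c\<^sup>2) * sqnorm h \<le> 2 * (ennreal (2 * ?c) * sqnorm G)"
  proof (rule sqnorm_le_mollified[OF _ fin(1), where R = "\<lambda>e y. fourier (\<lambda>x. G x * of_real (exp (- e * (norm x)\<^sup>2))) (- y)"])
    fix e :: real and y :: 'a assume e: "e > 0"
    have "schwartz (\<lambda>x. cis (x \<bullet> y) * of_real (exp (- e * (norm x)\<^sup>2)))"
      using schwartz_modulated_gaussian[OF e, of y 0] by simp
    from has_fourier_L2_eq[OF hG this]
    show "(LINT x|lborel. h x * of_real (gauss_kernel e (x - y))) = fourier (\<lambda>x. G x * of_real (exp (- e * (norm x)\<^sup>2))) (- y)"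
      unfolding fourier_cis_mult fourier_gaussian[OF e] by (simp add: fourier_def mult_ac)
  next
    fix e :: real assume e: "e > 0"
    have "sqnorm (\<lambda>y. fourier (\<lambda>x. G x * of_real (exp (- e * (norm x)\<^sup>2))) (- y)) = sqnorm (fourier (\<lambda>x. G x * of_real (exp (- e * (norm x)\<^sup>2))))"
      by (rule sqnorm_reflect) measurable
    also have "\<dots> \<le> ennreal (2 * ?c) * sqnorm (\<lambda>x. G x * of_real (exp (- e * (norm x)\<^sup>2)))"
      by (intro sqnorm_fourier_le integrable_sqnorm_gaussian fin e) measurable
    also have "\<dots> \<le> ennreal (2 * ?c) * sqnorm G"
      by (intro mult_left_mono integrable_sqnorm_gaussian fin e) auto
    finally show "sqnorm (\<lambda>y. fourier (\<lambda>x. G x * of_real (exp (- e * (norm x)\<^sup>2))) (- y)) \<le> ennreal (2 * ?c) * sqnorm G" .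
  qed measurable
  show "ennreal (?c\<^sup>2) * sqnorm G \<le> 2 * (ennreal (?c\<^sup>2) * (ennreal (2 * ?c) * sqnorm h))"
  proof (rule sqnorm_le_mollified[OF _ fin(2), where R = "\<lambda>e y. of_real ?c * fourier (\<lambda>x. h x * of_real (exp (- e * (norm x)\<^sup>2))) y"])
    fix e :: real and y :: 'a assume e: "e > 0"
    \<comment> \<open>With this parameter the translated Gaussian is a multiple of
      \<open>gauss_kernel e\<close>, and its transform is a modulated multiple of the Gaussian of
      parameter e.\<close>
    let ?s = "1 / (4 * e)"
    have s: "?s > 0" using e by simp
    let ?\<phi> = "\<lambda>x. complex_of_real (exp (- ?s * (norm (x - y))\<^sup>2))"
    have sch: "schwartz ?\<phi>"
      using schwartz_modulated_gaussian[OF s, of 0 y] by simp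
    have four: "fourier ?\<phi> x = cis (- (x \<bullet> y)) * of_real (gauss_kernel ?s x)" for x
      using fourier_translate[of "\<lambda>x. complex_of_real (exp (- ?s * (norm x)\<^sup>2))" "- y" x]
      unfolding fourier_gaussian[OF s] by (simp add: inner_commute)
    have sq: "sqrt (pi / e) ^ DIM('a) * sqrt (pi / ?s) ^ DIM('a) = ?c"
    proof -
      have "sqrt (pi / e) * sqrt (pi / ?s) = sqrt ((2 * pi)\<^sup>2)"
        unfolding real_sqrt_mult[symmetric] using e by (simp add: power2_eq_square)
      also have "\<dots> = 2 * pi" unfolding real_sqrt_abs by simp
      finally show ?thesis by (simp only: power_mult_distrib[symmetric])
    qed
    have gk: "sqrt (pi / e) ^ DIM('a) * gauss_kernel ?s x = ?c * exp (- e * (norm (x::'a))\<^sup>2)" for x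
      using e unfolding gauss_kernel_def mult.assoc[symmetric] sq by simp
    have "(LINT x|lborel. G x * of_real (gauss_kernel e (x - y))) = (LINT x|lborel. of_real (sqrt (pi / e) ^ DIM('a)) * (G x * ?\<phi> x))"
      by (simp add: gauss_kernel_def mult_ac)
    also have "\<dots> = of_real (sqrt (pi / e) ^ DIM('a)) * (LINT x|lborel. G x * ?\<phi> x)"
      by (rule integral_mult_right_zero)
    also have "(LINT x|lborel. G x * ?\<phi> x) = (LINT x|lborel. h x * fourier ?\<phi> x)"
      by (rule has_fourier_L2_eq[OF hG sch, symmetric])
    also have "of_real (sqrt (pi / e) ^ DIM('a)) * (LINT x|lborel. h x * fourier ?\<phi> x)
       = (LINT x|lborel. of_real (sqrt (pi / e) ^ DIM('a)) * (h x * fourier ?\<phi> x))"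
      by (rule integral_mult_right_zero[symmetric])
    also have "\<dots> = (LINT x|lborel. of_real ?c * (cis (- (x \<bullet> y)) * (h x * of_real (exp (- e * (norm x)\<^sup>2)))))"
    proof (rule Bochner_Integration.integral_cong[OF refl])
      fix x
      have "of_real (sqrt (pi / e) ^ DIM('a)) * (h x * fourier ?\<phi> x)
         = of_real (sqrt (pi / e) ^ DIM('a) * gauss_kernel ?s x) * (cis (- (x \<bullet> y)) * h x)"
        unfolding four by (simp add: mult_ac)
      also have "\<dots> = of_real ?c * (cis (- (x \<bullet> y)) * (h x * of_real (exp (- e * (norm x)\<^sup>2))))"
        unfolding gk by (simp add: mult_ac)
      finally show "of_real (sqrt (pi / e) ^ DIM('a)) * (h x * fourier ?\<phi> x) = of_real ?c * (cis (- (x \<bullet> y)) * (h x * of_real (exp (- e * (norm x)\<^sup>2))))" .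
    qed
    also have "\<dots> = of_real ?c * fourier (\<lambda>x. h x * of_real (exp (- e * (norm x)\<^sup>2))) y"
      unfolding fourier_def by (rule integral_mult_right_zero)
    finally show "(LINT x|lborel. G x * of_real (gauss_kernel e (x - y))) = of_real ?c * fourier (\<lambda>x. h x * of_real (exp (- e * (norm x)\<^sup>2))) y" .
  next
    fix e :: real assume e: "e > 0"
    have "sqnorm (\<lambda>y. of_real ?c * fourier (\<lambda>x. h x * of_real (exp (- e * (norm x)\<^sup>2))) y)
        = ennreal (?c\<^sup>2) * sqnorm (fourier (\<lambda>x. h x * of_real (exp (- e * (norm x)\<^sup>2))))"
      by (subst sqnorm_cmult) (measurable, simp only: norm_of_real power2_abs)
    also have "\<dots> \<le> ennreal (?c\<^sup>2) * (ennreal (2 * ?c) * sqnorm (\<lambda>x. h x * of_real (exp (- e * (norm x)\<^sup>2))))"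
      by (intro mult_left_mono sqnorm_fourier_le integrable_sqnorm_gaussian fin e) auto
    also have "\<dots> \<le> ennreal (?c\<^sup>2) * (ennreal (2 * ?c) * sqnorm h)"
      by (intro mult_left_mono integrable_sqnorm_gaussian fin e) auto
    finally show "sqnorm (\<lambda>y. of_real ?c * fourier (\<lambda>x. h x * of_real (exp (- e * (norm x)\<^sup>2))) y) \<le> ennreal (?c\<^sup>2) * (ennreal (2 * ?c) * sqnorm h)" .
  qed measurable
qed

lemma ennreal_mult_le_cancel:
  assumes "ennreal a * x \<le> ennreal b * y" "a > 0"
  shows "x \<le> ennreal (b / a) * y"
proof -
  have "ennreal (1 / a) * (ennreal a * x) \<le> ennreal (1 / a) * (ennreal b * y)"
    by (rule mult_left_mono[OF assms(1)]) simp
  moreover have "ennreal (1 / a) * ennreal a = 1"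
    using assms(2) by (simp add: ennreal_mult[symmetric])
  moreover have "ennreal (1 / a) * ennreal b = ennreal (b / a)"
    using assms(2) by (cases "b \<ge> 0") (simp_all add: ennreal_mult[symmetric] ennreal_neg divide_nonpos_pos)
  ultimately show ?thesis by (simp add: mult.assoc[symmetric])
qed

lemma
  fixes h G :: "'a::euclidean_space \<Rightarrow> complex"
  assumes hG: "has_fourier_L2 h G"
  shows sqnorm_le_sqnorm_fourier: "sqnorm h \<le> ennreal (4 / (2 * pi) ^ DIM('a)) * sqnorm G"
    and sqnorm_fourier_le_sqnorm: "sqnorm G \<le> ennreal (4 * (2 * pi) ^ DIM('a)) * sqnorm h"
proof -
  let ?c = "(2 * pi) ^ DIM('a)"
  have c: "?c > 0" by simp
  have "ennreal (?c\<^sup>2) * sqnorm h \<le> ennreal (4 * ?c) * sqnorm G"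
    using has_fourier_L2_sqnorm_le(1)[OF hG]
    by (simp only: mult.assoc[symmetric] ennreal_numeral[symmetric] ennreal_mult''[symmetric] c less_imp_le mult_nonneg_nonneg) simp
  from ennreal_mult_le_cancel[OF this] have "sqnorm h \<le> ennreal (4 * ?c / ?c\<^sup>2) * sqnorm G" by simp
  moreover have "4 * ?c / ?c\<^sup>2 = 4 / ?c" using c by (simp only: power2_eq_square) (simp add: field_simps)
  ultimately show "sqnorm h \<le> ennreal (4 / ?c) * sqnorm G" by simp
  have "ennreal (?c\<^sup>2) * sqnorm G \<le> ennreal (?c\<^sup>2 * (4 * ?c)) * sqnorm h"
  proof -
    have "2 * (ennreal (?c\<^sup>2) * (ennreal (2 * ?c) * sqnorm h)) = (ennreal 2 * ennreal (?c\<^sup>2) * ennreal (2 * ?c)) * sqnorm h"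
      by (simp add: mult.assoc)
    also have "ennreal 2 * ennreal (?c\<^sup>2) * ennreal (2 * ?c) = ennreal (?c\<^sup>2 * (4 * ?c))"
      by (simp only: ennreal_mult[symmetric] mult_nonneg_nonneg zero_le_power2 zero_le_numeral less_imp_le[OF c]) (simp add: mult_ac)
    finally show ?thesis using has_fourier_L2_sqnorm_le(2)[OF hG] by simp
  qed
  from ennreal_mult_le_cancel[OF this] have "sqnorm G \<le> ennreal (?c\<^sup>2 * (4 * ?c) / ?c\<^sup>2) * sqnorm h" by simp
  then show "sqnorm G \<le> ennreal (4 * ?c) * sqnorm h" by simp
qed

lemma sqnorm_eq_0_AE:
  assumes [measurable]: "f \<in> borel_measurable borel" and "sqnorm f = 0"
  shows "AE x in lborel. f x = 0"
  using assms(2) by (simp add: sqnorm_def nn_integral_0_iff_AE)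

lemma has_fourier_L2_diff:
  fixes h G :: "'a::euclidean_space \<Rightarrow> complex"
  assumes 1: "has_fourier_L2 h G" and 2: "has_fourier_L2 h' G'"
  shows "has_fourier_L2 (\<lambda>x. h x - h' x) (\<lambda>x. G x - G' x)"
proof -
  note [measurable] = has_fourier_L2_measurable[OF 1] has_fourier_L2_measurable[OF 2]
  note fin = has_fourier_L2_finite[OF 1] has_fourier_L2_finite[OF 2]
  have "sqnorm (\<lambda>x. h x - h' x) < \<infinity>" "sqnorm (\<lambda>x. G x - G' x) < \<infinity>"
    using le_less_trans[OF sqnorm_diff_le[of h h']] le_less_trans[OF sqnorm_diff_le[of G G']] fin
    by (auto simp: ennreal_mult_less_top)
  moreover have "(LINT x|lborel. (h x - h' x) * fourier \<phi> x) = (LINT \<xi>|lborel. (G \<xi> - G' \<xi>) * \<phi> \<xi>)" if s: "schwartz \<phi>" for \<phi>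
  proof -
    note [measurable] = schwartz_measurable[OF s]
    have "integrable lborel (\<lambda>x. h x * fourier \<phi> x)" "integrable lborel (\<lambda>x. h' x * fourier \<phi> x)"
      "integrable lborel (\<lambda>x. G x * \<phi> x)" "integrable lborel (\<lambda>x. G' x * \<phi> x)"
      by (intro integrable_mult_sqnorm fin schwartz_fourier_sqnorm_finite schwartz_sqnorm_finite s; measurable)+
    then show ?thesis
      using has_fourier_L2_eq[OF 1 s] has_fourier_L2_eq[OF 2 s] by (simp add: left_diff_distrib)
  qed
  ultimately show ?thesis unfolding has_fourier_L2_def L2_space_iff by auto
qed

text \<open>The pair of differences is (0, G - G'), and the norm of G - G' is bounded by that of 0.
  One fixed transform g of f can therefore serve in all multipliers.\<close>

lemma has_fourier_L2_unique_right:
  assumes "has_fourier_L2 h G" "has_fourier_L2 h G'"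
  shows "AE x in lborel. G x = G' x"
proof -
  note d = has_fourier_L2_diff[OF assms]
  have "sqnorm (\<lambda>x. h x - h x) = 0" by (simp add: sqnorm_def)
  with sqnorm_fourier_le_sqnorm[OF d] have "sqnorm (\<lambda>x. G x - G' x) = 0" by simp
  from sqnorm_eq_0_AE[OF has_fourier_L2_measurable(2)[OF d] this] show ?thesis by simp
qed

lemma has_fourier_L2_cong_right:
  assumes "has_fourier_L2 h G" "G' \<in> borel_measurable borel" "AE x in lborel. G x = G' x"
  shows "has_fourier_L2 h G'"
proof -
  note [measurable] = has_fourier_L2_measurable[OF assms(1)] assms(2)
  have "sqnorm G' = sqnorm G"
    unfolding sqnorm_def using assms(3) by (intro nn_integral_cong_AE) auto
  moreover have "(LINT \<xi>|lborel. G' \<xi> * \<phi> \<xi>) = (LINT \<xi>|lborel. G \<xi> * \<phi> \<xi>)" if s: "schwartz \<phi>" for \<phi>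
  proof -
    note [measurable] = schwartz_measurable[OF s]
    show ?thesis using assms(3) by (intro integral_cong_AE) auto
  qed
  ultimately show ?thesis
    using assms(1,2) unfolding has_fourier_L2_def L2_space_iff by auto
qed

lemma has_fourier_L2_unique_left:
  assumes "has_fourier_L2 h G" "has_fourier_L2 h' G"
  shows "AE x in lborel. h x = h' x"
proof -
  note d = has_fourier_L2_diff[OF assms]
  have "sqnorm (\<lambda>x. G x - G x) = 0" by (simp add: sqnorm_def)
  with sqnorm_le_sqnorm_fourier[OF d] have "sqnorm (\<lambda>x. h x - h' x) = 0" by simp
  from sqnorm_eq_0_AE[OF has_fourier_L2_measurable(1)[OF d] this] show ?thesis by simp
qed

lemma integral_mult_power2_le:
  fixes f g :: "'a::euclidean_space \<Rightarrow> complex"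
  assumes [measurable]: "f \<in> borel_measurable borel" "g \<in> borel_measurable borel"
  shows "ennreal ((norm (LINT x|lborel. f x * g x))\<^sup>2) \<le> sqnorm f * sqnorm g"
proof -
  have "ennreal ((norm (LINT x|lborel. f x * g x))\<^sup>2) = (ennreal (norm (LINT x|lborel. f x * g x)))\<^sup>2"
    by (simp add: ennreal_power)
  also have "\<dots> \<le> (\<integral>\<^sup>+x. ennreal (norm (f x * g x)) \<partial>lborel)\<^sup>2"
    by (intro power_mono ennreal_norm_integral_le) auto
  also have "\<dots> = (\<integral>\<^sup>+x. ennreal (norm (f x)) * ennreal (norm (g x)) \<partial>lborel)\<^sup>2"
    by (simp add: norm_mult ennreal_mult)
  also have "\<dots> \<le> (\<integral>\<^sup>+x. (ennreal (norm (f x)))\<^sup>2 \<partial>lborel) * (\<integral>\<^sup>+x. (ennreal (norm (g x)))\<^sup>2 \<partial>lborel)"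
    by (rule Cauchy_Schwarz_nn_integral) measurable
  also have "\<dots> = sqnorm f * sqnorm g"
    by (simp add: sqnorm_def ennreal_power)
  finally show ?thesis .
qed

lemma tendsto_integral_mult_sqnorm:
  fixes f :: "nat \<Rightarrow> 'a::euclidean_space \<Rightarrow> complex"
  assumes [measurable]: "\<And>n. f n \<in> borel_measurable borel" "g \<in> borel_measurable borel" "h \<in> borel_measurable borel"
    and fin: "\<And>n. sqnorm (f n) < \<infinity>" "sqnorm g < \<infinity>" "sqnorm h < \<infinity>"
    and lim: "(\<lambda>n. sqnorm (\<lambda>x. f n x - g x)) \<longlonglongrightarrow> 0"
  shows "(\<lambda>n. LINT x|lborel. f n x * h x) \<longlonglongrightarrow> (LINT x|lborel. g x * h x)"
proof -
  have "(\<lambda>n. sqnorm (\<lambda>x. f n x - g x) * sqnorm h) \<longlonglongrightarrow> 0 * sqnorm h"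
    using ennreal_tendsto_cmult[OF _ lim, of "sqnorm h"] fin(3) by (simp add: mult.commute)
  then have lim0: "(\<lambda>n. sqnorm (\<lambda>x. f n x - g x) * sqnorm h) \<longlonglongrightarrow> 0" by simp
  have eq: "(LINT x|lborel. f n x * h x) - (LINT x|lborel. g x * h x) = (LINT x|lborel. (f n x - g x) * h x)" for n
    unfolding left_diff_distrib
    by (rule Bochner_Integration.integral_diff[symmetric]) (intro integrable_mult_sqnorm fin; measurable)+
  have le: "ennreal ((norm ((LINT x|lborel. f n x * h x) - (LINT x|lborel. g x * h x)))\<^sup>2) \<le> sqnorm (\<lambda>x. f n x - g x) * sqnorm h" for n
    unfolding eq by (rule integral_mult_power2_le) measurable
  have "(\<lambda>n. ennreal ((norm ((LINT x|lborel. f n x * h x) - (LINT x|lborel. g x * h x)))\<^sup>2)) \<longlonglongrightarrow> ennreal 0"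
    using tendsto_sandwich[OF _ _ tendsto_const lim0] le by (auto intro: always_eventually)
  then have "(\<lambda>n. (norm ((LINT x|lborel. f n x * h x) - (LINT x|lborel. g x * h x)))\<^sup>2) \<longlonglongrightarrow> 0"
    by (subst (asm) tendsto_ennreal_iff) (auto intro: always_eventually)
  then have "(\<lambda>n. (LINT x|lborel. f n x * h x) - (LINT x|lborel. g x * h x)) \<longlonglongrightarrow> 0"
    by (simp add: tendsto_norm_zero_iff)
  then show ?thesis by (simp add: LIM_zero_iff)
qed

text \<open>The pointwise limit is identified with the L2 limit: the Plancherel inequality makes u
  Cauchy in L2, and Fatou in the second index turns this into convergence to v. The pairings with
  test functions then converge on both sides.\<close>

lemma has_fourier_L2_limit:
  fixes u :: "nat \<Rightarrow> 'a::euclidean_space \<Rightarrow> complex"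
  assumes F: "\<And>n. has_fourier_L2 (u n) (G n)"
    and conv: "AE x in lborel. (\<lambda>n. u n x) \<longlonglongrightarrow> v x"
    and v [measurable]: "v \<in> borel_measurable borel"
    and H [measurable]: "H \<in> borel_measurable borel" and Hfin: "sqnorm H < \<infinity>"
    and lim: "(\<lambda>n. sqnorm (\<lambda>x. G n x - H x)) \<longlonglongrightarrow> 0"
  shows "has_fourier_L2 v H"
proof -
  note [measurable] = has_fourier_L2_measurable[OF F]
  note fin = has_fourier_L2_finite[OF F]
  let ?k = "ennreal (4 / (2 * pi) ^ DIM('a))"
  have dist: "sqnorm (\<lambda>x. u n x - u m x) \<le> ?k * (2 * sqnorm (\<lambda>x. G n x - H x) + 2 * sqnorm (\<lambda>x. G m x - H x))" for n m
  proof -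
    have "sqnorm (\<lambda>x. u n x - u m x) \<le> ?k * sqnorm (\<lambda>x. G n x - G m x)"
      by (rule sqnorm_le_sqnorm_fourier[OF has_fourier_L2_diff[OF F F]])
    also have "sqnorm (\<lambda>x. G n x - G m x) = sqnorm (\<lambda>x. (G n x - H x) - (G m x - H x))" by simp
    also have "\<dots> \<le> 2 * sqnorm (\<lambda>x. G n x - H x) + 2 * sqnorm (\<lambda>x. G m x - H x)"
      by (rule sqnorm_diff_le) measurable
    finally show ?thesis by (simp add: mult_left_mono)
  qed
  \<comment> \<open>d bounds the tail of G beyond which Fatou is applied; it is sent to 0 only
    afterwards.\<close>
  have tail: "sqnorm (\<lambda>x. u n x - v x) \<le> ?k * (2 * sqnorm (\<lambda>x. G n x - H x) + 2 * ennreal d)"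
    if d: "d > 0" for n d
  proof -
    have "eventually (\<lambda>m. sqnorm (\<lambda>x. G m x - H x) < ennreal d) sequentially"
      using order_tendstoD(2)[OF lim, of "ennreal d"] d by simp
    then obtain N where N: "\<And>m. m \<ge> N \<Longrightarrow> sqnorm (\<lambda>x. G m x - H x) < ennreal d"
      unfolding eventually_sequentially by blast
    show ?thesis
      unfolding sqnorm_def[of "\<lambda>x. u n x - v x"]
    proof (rule nn_integral_Fatou_bound[where f = "\<lambda>m x. ennreal ((norm (u n x - u (m + N) x))\<^sup>2)"])
      show "AE x in lborel. (\<lambda>m. ennreal ((norm (u n x - u (m + N) x))\<^sup>2)) \<longlonglongrightarrow> ennreal ((norm (u n x - v x))\<^sup>2)"
        using conv by eventually_elim (intro tendsto_intros tendsto_ennrealI LIMSEQ_ignore_initial_segment)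
      show "(\<integral>\<^sup>+x. ennreal ((norm (u n x - u (m + N) x))\<^sup>2) \<partial>lborel) \<le> ?k * (2 * sqnorm (\<lambda>x. G n x - H x) + 2 * ennreal d)" for m
      proof -
        have "sqnorm (\<lambda>x. G (m + N) x - H x) \<le> ennreal d" using N[of "m + N"] by (simp add: less_imp_le)
        then have "?k * (2 * sqnorm (\<lambda>x. G n x - H x) + 2 * sqnorm (\<lambda>x. G (m + N) x - H x)) \<le> ?k * (2 * sqnorm (\<lambda>x. G n x - H x) + 2 * ennreal d)"
          by (intro mult_left_mono add_left_mono) auto
        with dist[of n "m + N"] show ?thesis unfolding sqnorm_def[of "\<lambda>x. u n x - u (m + N) x"] by (rule order_trans)
      qed
    qed measurable
  qed
  have Gfin: "sqnorm (\<lambda>x. G n x - H x) < \<infinity>" for n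
    using le_less_trans[OF sqnorm_diff_le[of "G n" H]] fin(2)[of n] Hfin by (simp add: ennreal_mult_less_top)
  have dv_fin: "sqnorm (\<lambda>x. u n x - v x) < \<infinity>" for n
    using le_less_trans[OF tail[of 1 n]] Gfin[of n] by (simp add: ennreal_mult_less_top)
  have vfin: "sqnorm v < \<infinity>"
    using le_less_trans[OF sqnorm_diff_le[of "u 0" "\<lambda>x. u 0 x - v x"]] dv_fin[of 0] fin(1)[of 0]
    by (simp add: ennreal_mult_less_top)
  have ulim: "(\<lambda>n. sqnorm (\<lambda>x. u n x - v x)) \<longlonglongrightarrow> 0"
  proof -
    have le: "sqnorm (\<lambda>x. u n x - v x) \<le> ?k * (2 * sqnorm (\<lambda>x. G n x - H x))" for n
    proof (rule LIMSEQ_le_const)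
      have "(\<lambda>m. ?k * (2 * sqnorm (\<lambda>x. G n x - H x) + 2 * ennreal (1 / real (Suc m)))) \<longlonglongrightarrow> ?k * (2 * sqnorm (\<lambda>x. G n x - H x) + 2 * ennreal 0)"
        by (intro ennreal_tendsto_cmult tendsto_add tendsto_const tendsto_ennrealI LIMSEQ_Suc[OF lim_1_over_n]) auto
      then show "(\<lambda>m. ?k * (2 * sqnorm (\<lambda>x. G n x - H x) + 2 * ennreal (1 / real (Suc m)))) \<longlonglongrightarrow> ?k * (2 * sqnorm (\<lambda>x. G n x - H x))"
        by simp
    qed (use tail[of "1 / real (Suc _)" n] in auto)
    have "(\<lambda>n. ?k * (2 * sqnorm (\<lambda>x. G n x - H x))) \<longlonglongrightarrow> ?k * (2 * 0)"
      by (intro ennreal_tendsto_cmult lim) auto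
    then have "(\<lambda>n. ?k * (2 * sqnorm (\<lambda>x. G n x - H x))) \<longlonglongrightarrow> 0" by simp
    from tendsto_sandwich[OF _ _ tendsto_const this] le show ?thesis by (auto intro: always_eventually)
  qed
  have "(LINT x|lborel. v x * fourier \<phi> x) = (LINT \<xi>|lborel. H \<xi> * \<phi> \<xi>)" if s: "schwartz \<phi>" for \<phi>
  proof (rule LIMSEQ_unique)
    note [measurable] = schwartz_measurable[OF s]
    show "(\<lambda>n. LINT x|lborel. u n x * fourier \<phi> x) \<longlonglongrightarrow> (LINT x|lborel. v x * fourier \<phi> x)"
      by (intro tendsto_integral_mult_sqnorm fin vfin schwartz_fourier_sqnorm_finite[OF s] ulim; measurable)
    show "(\<lambda>n. LINT x|lborel. u n x * fourier \<phi> x) \<longlonglongrightarrow> (LINT \<xi>|lborel. H \<xi> * \<phi> \<xi>)"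
      unfolding has_fourier_L2_eq[OF F s]
      by (intro tendsto_integral_mult_sqnorm fin Hfin schwartz_sqnorm_finite[OF s] lim; measurable)
  qed
  then show ?thesis
    unfolding has_fourier_L2_def L2_space_iff using vfin Hfin by auto
qed

section \<open>The Poisson kernel at complex times\<close>

text \<open>The fundamental theorem of calculus on a neighbourhood of x, with base point x - 1. It
  serves to differentiate the antiderivative of the subordinator, which is built from normal
  distribution functions.\<close>

lemma cdf_std_normal_has_derivative:
  "(cdf std_normal_distribution has_real_derivative std_normal_density x) (at x)"
proof -
  interpret real_distribution std_normal_distribution by (rule real_dist_normal_dist)
  have int: "integrable lborel std_normal_density"
    using std_normal_moment_even[of 0] by (simp add: has_bochner_integral_iff)
  have cont: "continuous_on A std_normal_density" for A
    unfolding std_normal_density_def by (auto intro!: continuous_intros)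
  have eq: "cdf std_normal_distribution y = cdf std_normal_distribution (x - 1) + integral {x - 1..y} std_normal_density"
    if y: "y \<ge> x - 1" for y
  proof -
    have "cdf std_normal_distribution y - cdf std_normal_distribution (x - 1) = measure std_normal_distribution {x - 1<..y}"
      using y by (cases "y = x - 1") (auto intro: cdf_diff_eq)
    also have "\<dots> = (LINT u|std_normal_distribution. indicator {x - 1<..y} u)"
      by simp
    also have "\<dots> = (LINT u|lborel. std_normal_density u *\<^sub>R indicator {x - 1<..y} u)"
      by (rule integral_density) auto
    also have "\<dots> = (LINT u:{x - 1<..y}|lborel. std_normal_density u)"
      unfolding set_lebesgue_integral_def by (simp add: mult.commute)
    also have "\<dots> = integral {x - 1<..y} std_normal_density"
      by (rule set_borel_integral_eq_integral, unfold set_integrable_def, rule integrable_mult_indicator[OF _ int]) simp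
    also have "\<dots> = integral {x - 1..y} std_normal_density"
      by (rule integral_spike_set; rule negligible_subset[OF negligible_sing[of "x - 1"]]; auto)
    finally show ?thesis by simp
  qed
  have "((\<lambda>y. integral {x - 1..y} std_normal_density) has_real_derivative std_normal_density x) (at x within {x - 1..x + 1})"
    by (intro integral_has_real_derivative cont) auto
  then have "((\<lambda>y. integral {x - 1..y} std_normal_density) has_real_derivative std_normal_density x) (at x)"
    by (subst (asm) at_within_interior) auto
  then have "((\<lambda>y. cdf std_normal_distribution (x - 1) + integral {x - 1..y} std_normal_density) has_real_derivative std_normal_density x) (at x)"
    by (auto intro!: derivative_eq_intros)
  moreover have "eventually (\<lambda>y. cdf std_normal_distribution y = cdf std_normal_distribution (x - 1) + integral {x - 1..y} std_normal_density) (nhds x)"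
    using eventually_gt_at_top eventually_nhds_in_open[of "{x - 1<..}" x] by (auto elim!: eventually_mono intro!: eq)
  ultimately show ?thesis
    by (subst DERIV_cong_ev[OF refl _ refl]) auto
qed

text \<open>For a > 0, the density of the one-sided stable law of index 1/2 (the Levy distribution),
  which writes exp(- a \<rho>) as an average of the Gaussians exp(- s \<rho>^2).\<close>

definition subordinator :: "real \<Rightarrow> real \<Rightarrow> real" where
  "subordinator a s = (if s > 0 then a / (2 * sqrt pi) / (s * sqrt s) * exp (- a\<^sup>2 / (4 * s)) else 0)"

lemma borel_measurable_subordinator [measurable]: "subordinator a \<in> borel_measurable borel"
  unfolding subordinator_def[abs_def] by measurable

lemma subordinator_nonneg: "a > 0 \<Longrightarrow> subordinator a s \<ge> 0"
  by (simp add: subordinator_def)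

lemma
  assumes a: "a > 0" and \<rho>: "\<rho> > 0"
  shows integrable_subordinator: "integrable lborel (\<lambda>s. subordinator a s * exp (- s * \<rho>\<^sup>2))"
    and integral_subordinator: "(LINT s|lborel. subordinator a s * exp (- s * \<rho>\<^sup>2)) = exp (- a * \<rho>)"
proof -
  interpret real_distribution std_normal_distribution by (rule real_dist_normal_dist)
  let ?N = "cdf std_normal_distribution"
  \<comment> \<open>An explicit antiderivative. By completing squares, exp(- a \<rho>) times the
    normal density at u equals exp(a \<rho>) times that at v, so F' contains only u' + v', where the
    terms with \<rho> cancel.\<close>
  define u where "u s = sqrt 2 * (a / (2 * sqrt s) - \<rho> * sqrt s)" for s
  define v where "v s = sqrt 2 * (a / (2 * sqrt s) + \<rho> * sqrt s)" for s
  define F where "F s = - (exp (- a * \<rho>) * ?N (u s) + exp (a * \<rho>) * ?N (v s))" for s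
  define f where "f s = a / (2 * sqrt pi) / (s * sqrt s) * exp (- a\<^sup>2 / (4 * s)) * exp (- s * \<rho>\<^sup>2)" for s
  have F: "(F has_real_derivative f s) (at s)" if s: "s > 0" for s
  proof -
    define u' where "u' = sqrt 2 * (- a / (4 * (s * sqrt s)) - \<rho> / (2 * sqrt s))"
    define v' where "v' = sqrt 2 * (- a / (4 * (s * sqrt s)) + \<rho> / (2 * sqrt s))"
    have ss: "sqrt s * sqrt s = s" using s by simp
    have p: "((\<lambda>s. a / (2 * sqrt s)) has_real_derivative (- a / (4 * (s * sqrt s)))) (at s)"
      using s by (auto intro!: derivative_eq_intros simp: field_simps)
    have r: "((\<lambda>s. \<rho> * sqrt s) has_real_derivative (\<rho> / (2 * sqrt s))) (at s)"
      using s by (auto intro!: derivative_eq_intros simp: field_simps)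
    have du: "(u has_real_derivative u') (at s)"
      unfolding u_def[abs_def] u'_def by (rule DERIV_cmult[OF DERIV_diff[OF p r]])
    have dv: "(v has_real_derivative v') (at s)"
      unfolding v_def[abs_def] v'_def by (rule DERIV_cmult[OF DERIV_add[OF p r]])
    have dF: "(F has_real_derivative - (exp (- a * \<rho>) * (std_normal_density (u s) * u') + exp (a * \<rho>) * (std_normal_density (v s) * v'))) (at s)"
      unfolding F_def[abs_def]
      by (intro DERIV_minus DERIV_add DERIV_cmult DERIV_chain2[OF cdf_std_normal_has_derivative] du dv)
    define M where "M = 1 / sqrt (2 * pi) * exp (- a\<^sup>2 / (4 * s)) * exp (- s * \<rho>\<^sup>2)"
    have sq: "(u s)\<^sup>2 / 2 = a\<^sup>2 / (4 * s) + s * \<rho>\<^sup>2 - a * \<rho>" "(v s)\<^sup>2 / 2 = a\<^sup>2 / (4 * s) + s * \<rho>\<^sup>2 + a * \<rho>"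
      using s by (simp_all add: u_def v_def power_mult_distrib power2_diff power2_sum power_divide)
    have M: "exp (- a * \<rho>) * std_normal_density (u s) = M" "exp (a * \<rho>) * std_normal_density (v s) = M"
      unfolding std_normal_density_def M_def
      by (simp_all add: mult_exp_exp sq algebra_simps)
    have "- (exp (- a * \<rho>) * (std_normal_density (u s) * u') + exp (a * \<rho>) * (std_normal_density (v s) * v')) = - (M * (u' + v'))"
      unfolding mult.assoc[symmetric] M by (simp add: algebra_simps)
    also have "u' + v' = - (sqrt 2 * (a / (2 * (s * sqrt s))))"
      unfolding u'_def v'_def distrib_left[symmetric] using s by (simp add: field_simps)
    also have "- (M * - (sqrt 2 * (a / (2 * (s * sqrt s))))) = f s"
      using s by (simp add: M_def f_def real_sqrt_mult field_simps)
    finally show ?thesis using dF by simp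
  qed
  \<comment> \<open>As s runs from 0 to \<infinity>, u falls from \<infinity> to - \<infinity> while
    v is \<infinity> at both ends. Only the term with u changes, which gives exp(- a
    \<rho>).\<close>
  have u0: "filterlim u at_top (at_right 0)" and v0: "filterlim v at_top (at_right 0)"
    and u1: "filterlim u at_bot at_top" and v1: "filterlim v at_top at_top"
    unfolding u_def v_def using a \<rho> by real_asymp+
  have A: "(F \<longlongrightarrow> - (exp (- a * \<rho>) * 1 + exp (a * \<rho>) * 1)) (at_right 0)"
    unfolding F_def by (intro tendsto_intros filterlim_compose[OF cdf_lim_at_top_prob] u0 v0)
  have B: "(F \<longlongrightarrow> - (exp (- a * \<rho>) * 0 + exp (a * \<rho>) * 1)) at_top"
    unfolding F_def by (intro tendsto_intros filterlim_compose[OF cdf_lim_at_top_prob] filterlim_compose[OF cdf_lim_at_bot] u1 v1)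
  have fc: "isCont f s" if "s > 0" for s
    using that unfolding f_def by (auto intro!: continuous_intros)
  have f0: "f s \<ge> 0" if "s > 0" for s
    using that a by (simp add: f_def)
  have 1: "set_integrable lborel (einterval (ereal 0) \<infinity>) f"
    and 2: "(LBINT s=ereal 0..\<infinity>. f s) = - (exp (- a * \<rho>) * 0 + exp (a * \<rho>) * 1) - - (exp (- a * \<rho>) * 1 + exp (a * \<rho>) * 1)"
    by (rule interval_integral_FTC_nonneg[where F = F]; use F fc f0 A B in \<open>auto simp: ereal_tendsto_simps\<close>)+
  have ei: "einterval (ereal 0) \<infinity> = {0<..}" by (auto simp: einterval_def)
  have eq: "indicator {0<..} s *\<^sub>R f s = subordinator a s * exp (- s * \<rho>\<^sup>2)" for s
    by (simp add: subordinator_def f_def)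
  show "integrable lborel (\<lambda>s. subordinator a s * exp (- s * \<rho>\<^sup>2))"
    using 1 unfolding ei set_integrable_def eq .
  have "(LBINT s=ereal 0..\<infinity>. f s) = (LINT s|lborel. subordinator a s * exp (- s * \<rho>\<^sup>2))"
    unfolding interval_lebesgue_integral_def ei set_lebesgue_integral_def eq by simp
  with 2 show "(LINT s|lborel. subordinator a s * exp (- s * \<rho>\<^sup>2)) = exp (- a * \<rho>)" by simp
qed

lemma exp_decay_bound:
  fixes a :: real
  assumes "a > 0"
  obtains C where "C \<ge> 0" "\<And>r. r \<ge> 0 \<Longrightarrow> exp (- a * r) \<le> C / (1 + r) ^ n"
proof -
  \<comment> \<open>With this rate the n-th power of exp(d r) stays below exp(a r), and the division
    is legitimate for n = 0.\<close>
  define d where "d = a / (real n + 1)"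
  define K where "K = max 1 (1 / d)"
  have d: "d > 0" using assms by (simp add: d_def)
  have "exp (- a * r) \<le> K ^ n / (1 + r) ^ n" if r: "r \<ge> 0" for r
  proof -
    have "1 + r \<le> K * (1 + d * r)"
    proof -
      have "1 * 1 \<le> K * 1" by (simp add: K_def)
      moreover have "(1 / d) * (d * r) \<le> K * (d * r)"
        using d r by (intro mult_right_mono) (auto simp: K_def)
      ultimately show ?thesis using d by (simp add: distrib_left)
    qed
    also have "\<dots> \<le> K * exp (d * r)"
      by (intro mult_left_mono exp_ge_add_one_self) (auto simp: K_def)
    finally have "(1 + r) ^ n \<le> (K * exp (d * r)) ^ n"
      using r by (intro power_mono) auto
    also have "\<dots> = K ^ n * exp (real n * (d * r))"
      by (simp add: power_mult_distrib exp_of_nat_mult)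
    also have "\<dots> \<le> K ^ n * exp (a * r)"
    proof -
      have "real n * d \<le> a" using assms by (simp add: d_def field_simps)
      from mult_right_mono[OF this r] show ?thesis by (intro mult_left_mono) (auto simp: K_def mult.assoc)
    qed
    finally show ?thesis using r by (simp add: exp_minus field_simps add_pos_nonneg)
  qed
  moreover have "K ^ n \<ge> 0" by (simp add: K_def)
  ultimately show ?thesis using that by blast
qed

lemma integrable_exp_norm:
  assumes a: "a > 0"
  shows "integrable lborel (\<lambda>x::'a::euclidean_space. exp (- a * norm x))"
proof -
  obtain C where C: "C \<ge> 0" "\<And>r. r \<ge> 0 \<Longrightarrow> exp (- a * r) \<le> C / (1 + r) ^ (2 * DIM('a))"
    using exp_decay_bound[OF a] by blast
  show ?thesis
  proof (rule Bochner_Integration.integrable_bound)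
    show "integrable lborel (\<lambda>x::'a. C * (1 / (1 + norm x) ^ (2 * DIM('a))))"
      by (intro integrable_mult_right integrable_polynomial_decay)
    show "AE x::'a in lborel. norm (exp (- a * norm x)) \<le> norm (C * (1 / (1 + norm x) ^ (2 * DIM('a))))"
      using C by (auto simp: abs_mult)
  qed measurable
qed

lemma integrable_norm_exp_norm:
  assumes a: "a > 0"
  shows "integrable lborel (\<lambda>x::'a::euclidean_space. norm x * exp (- a * norm x))"
proof (rule Bochner_Integration.integrable_bound)
  show "integrable lborel (\<lambda>x::'a. 2 / a * exp (- (a / 2) * norm x))"
    using a by (intro integrable_mult_right integrable_exp_norm) auto
  have "r * exp (- a * r) \<le> 2 / a * exp (- (a / 2) * r)" if "r \<ge> 0" for r
  proof -
    have "a / 2 * r \<le> exp (a / 2 * r)" using exp_ge_add_one_self[of "a / 2 * r"] by linarith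
    then have "r \<le> 2 / a * exp (a / 2 * r)" using a by (simp add: field_simps)
    then have "r * exp (- a * r) \<le> 2 / a * exp (a / 2 * r) * exp (- a * r)"
      by (intro mult_right_mono) auto
    also have "\<dots> = 2 / a * exp (- (a / 2) * r)" by (simp add: mult_exp_exp field_simps)
    finally show ?thesis .
  qed
  then show "AE x::'a in lborel. norm (norm x * exp (- a * norm x)) \<le> norm (2 / a * exp (- (a / 2) * norm x))"
    using a by (auto simp: abs_mult)
qed measurable

text \<open>Subordination replaces the weight by an average of Gaussians, and Fubini leaves the same
  average of their transforms.\<close>

lemma fourier_exp_norm_subordination:
  fixes x :: "'a::euclidean_space"
  assumes a: "a > 0"
  shows "fourier (\<lambda>\<xi>. complex_of_real (exp (- a * norm \<xi>))) x = of_real (LINT s|lborel. subordinator a s * gauss_kernel s x)"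
proof -
  let ?f = "\<lambda>\<xi>::'a. \<lambda>s. cis (- (\<xi> \<bullet> x)) * complex_of_real (subordinator a s * exp (- s * (norm \<xi>)\<^sup>2))"
  \<comment> \<open>The subordination formula is proved for positive arguments, so the origin is set
    aside as a null set.\<close>
  have ae: "AE \<xi>::'a in lborel. \<xi> \<noteq> 0" by (rule AE_lborel_singleton)
  have inner_norm: "(LINT s|lborel. norm (?f \<xi> s)) = exp (- a * norm \<xi>)" if "\<xi> \<noteq> 0" for \<xi>
    using integral_subordinator[OF a, of "norm \<xi>"] that subordinator_nonneg[OF a]
    by (simp add: norm_mult)
  have inner: "(LINT s|lborel. ?f \<xi> s) = cis (- (\<xi> \<bullet> x)) * complex_of_real (exp (- a * norm \<xi>))" if "\<xi> \<noteq> 0" for \<xi>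
    unfolding integral_mult_right_zero integral_complex_of_real
    using integral_subordinator[OF a, of "norm \<xi>"] that by simp
  have int: "integrable (lborel \<Otimes>\<^sub>M lborel) (case_prod ?f)"
  proof (rule lborel_pair.Fubini_integrable)
    have "integrable lborel (\<lambda>\<xi>::'a. exp (- a * norm \<xi>))" by (rule integrable_exp_norm[OF a])
    then show "integrable lborel (\<lambda>\<xi>. LINT s|lborel. norm (case (\<xi>, s) of (\<xi>, s) \<Rightarrow> ?f \<xi> s))"
      by (subst integrable_cong_AE[where g = "\<lambda>\<xi>. exp (- a * norm \<xi>)"])
         (use ae inner_norm in \<open>auto elim!: eventually_mono\<close>)
    show "AE \<xi> in lborel. integrable lborel (\<lambda>s. case (\<xi>, s) of (\<xi>, s) \<Rightarrow> ?f \<xi> s)"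
      using ae
    proof eventually_elim
      case (elim \<xi>)
      then show ?case
        unfolding prod.case by (intro integrable_mult_right integrable_of_real integrable_subordinator a) auto
    qed
  qed measurable
  have "fourier (\<lambda>\<xi>. complex_of_real (exp (- a * norm \<xi>))) x = (LINT \<xi>|lborel. LINT s|lborel. ?f \<xi> s)"
    unfolding fourier_def using ae inner by (intro integral_cong_AE) (auto elim!: eventually_mono)
  also have "\<dots> = (LINT s|lborel. LINT \<xi>|lborel. ?f \<xi> s)"
    by (rule lborel_pair.Fubini_integral[OF int, symmetric])
  also have "\<dots> = (LINT s|lborel. complex_of_real (subordinator a s * gauss_kernel s x))"
  proof (rule Bochner_Integration.integral_cong[OF refl])
    fix s
    show "(LINT \<xi>|lborel. ?f \<xi> s) = complex_of_real (subordinator a s * gauss_kernel s x)"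
    proof (cases "s > 0")
      case True
      have "(LINT \<xi>|lborel. ?f \<xi> s) = (LINT \<xi>|lborel. of_real (subordinator a s) * (cis (- (\<xi> \<bullet> x)) * of_real (exp (- s * (norm \<xi>)\<^sup>2))))"
        by (simp add: mult_ac)
      also have "\<dots> = of_real (subordinator a s) * fourier (\<lambda>\<xi>. of_real (exp (- s * (norm \<xi>)\<^sup>2))) x"
        unfolding fourier_def by (rule integral_mult_right_zero)
      finally show ?thesis unfolding fourier_gaussian[OF True] by simp
    qed (simp add: subordinator_def)
  qed
  also have "\<dots> = of_real (LINT s|lborel. subordinator a s * gauss_kernel s x)"
    by (rule integral_complex_of_real)
  finally show ?thesis .
qed

text \<open>Substituting B s for s, with B = a^2 + |x|^2, merges the two exponentials into exp(- 1 /
  (4 s)). All dependence on a and x comes out as a factor, and c is the remaining integral, which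
  depends on the dimension only.\<close>

lemma fourier_exp_norm_real:
  "\<exists>c\<ge>0. \<forall>a>0. \<forall>x::'a::euclidean_space. fourier (\<lambda>\<xi>. complex_of_real (exp (- a * norm \<xi>))) x
     = of_real (c * a * (a\<^sup>2 + (norm x)\<^sup>2) powr (- (real DIM('a) + 1) / 2))"
proof -
  define \<phi> where "\<phi> s = (if s > 0 then 1 / (2 * sqrt pi) / (s * sqrt s) * sqrt (pi / s) ^ DIM('a) * exp (- 1 / (4 * s)) else 0)" for s
  define c where "c = (LINT s|lborel. \<phi> s)"
  have "c \<ge> 0" unfolding c_def \<phi>_def by (intro integral_nonneg_AE) auto
  moreover have "fourier (\<lambda>\<xi>. complex_of_real (exp (- a * norm \<xi>))) x
     = of_real (c * a * (a\<^sup>2 + (norm x)\<^sup>2) powr (- (real DIM('a) + 1) / 2))" if a: "a > 0" for a and x :: 'a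
  proof -
    define B where "B = a\<^sup>2 + (norm x)\<^sup>2"
    have B: "B > 0" using a by (simp add: B_def add_pos_nonneg)
    have pw: "B powr (- (real DIM('a) + 1) / 2) = 1 / (sqrt B ^ DIM('a) * sqrt B)"
    proof -
      have "B powr (- (real DIM('a) + 1) / 2) = 1 / B powr (1 / 2 * real (DIM('a) + 1))"
      proof -
        have "- (real DIM('a) + 1) / 2 = - (1 / 2 * real (DIM('a) + 1))" by (simp add: field_simps)
        then show ?thesis by (simp only: powr_minus_divide)
      qed
      also have "B powr (1 / 2 * real (DIM('a) + 1)) = (B powr (1 / 2)) powr real (DIM('a) + 1)"
        by (simp only: powr_powr)
      also have "\<dots> = sqrt B ^ (DIM('a) + 1)"
        using B by (simp add: powr_half_sqrt powr_realpow del: of_nat_Suc of_nat_add)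
      finally show ?thesis by simp
    qed
    have "(LINT s|lborel. subordinator a s * gauss_kernel s x) = \<bar>B\<bar> *\<^sub>R (LINT s|lborel. subordinator a (0 + B * s) * gauss_kernel (0 + B * s) x)"
      using B by (intro lborel_integral_real_affine) auto
    also have "(\<lambda>s. subordinator a (0 + B * s) * gauss_kernel (0 + B * s) x) = (\<lambda>s. a / (B * sqrt B * sqrt B ^ DIM('a)) * \<phi> s)"
    proof
      fix s
      show "subordinator a (0 + B * s) * gauss_kernel (0 + B * s) x = a / (B * sqrt B * sqrt B ^ DIM('a)) * \<phi> s"
      proof (cases "s > 0")
        case True
        then have Bs: "B * s > 0" using B by simp
        have e: "exp (- a\<^sup>2 / (4 * (B * s))) * exp (- (norm x)\<^sup>2 / (4 * (B * s))) = exp (- 1 / (4 * s))"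
        proof -
          have "- a\<^sup>2 / (4 * (B * s)) + - (norm x)\<^sup>2 / (4 * (B * s)) = - B / (4 * (B * s))"
            unfolding add_divide_distrib[symmetric] B_def by simp
          also have "\<dots> = - 1 / (4 * s)" using B by simp
          finally show ?thesis by (simp only: mult_exp_exp)
        qed
        have q: "sqrt (pi / (B * s)) = sqrt (pi / s) / sqrt B"
          by (simp add: real_sqrt_divide real_sqrt_mult)
        have "subordinator a (0 + B * s) * gauss_kernel (0 + B * s) x
          = a / (2 * sqrt pi) / (B * s * sqrt (B * s)) * (sqrt (pi / s) / sqrt B) ^ DIM('a)
             * (exp (- a\<^sup>2 / (4 * (B * s))) * exp (- (norm x)\<^sup>2 / (4 * (B * s))))"
          using Bs by (simp add: subordinator_def gauss_kernel_def q mult_ac)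
        also have "\<dots> = a / (B * sqrt B * sqrt B ^ DIM('a)) * \<phi> s"
          unfolding e using True by (simp add: \<phi>_def real_sqrt_mult power_divide mult_ac)
        finally show ?thesis .
      next
        case False
        then have "\<not> B * s > 0" using B by (simp add: zero_less_mult_iff)
        then show ?thesis using False by (simp add: subordinator_def \<phi>_def)
      qed
    qed
    also have "\<bar>B\<bar> *\<^sub>R (LINT s|lborel. a / (B * sqrt B * sqrt B ^ DIM('a)) * \<phi> s) = c * a * (1 / (sqrt B ^ DIM('a) * sqrt B))"
      unfolding integral_mult_right_zero c_def[symmetric] using B by (simp add: field_simps)
    finally have e: "(LINT s|lborel. subordinator a s * gauss_kernel s x) = c * a * (1 / (sqrt B ^ DIM('a) * sqrt B))" .
    show ?thesis
      by (simp only: fourier_exp_norm_subordination[OF a] e B_def[symmetric] pw)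
  qed
  ultimately show ?thesis by blast
qed

lemma norm_exp_minus_1_le: "norm (exp z - 1) \<le> norm z * exp (norm z)" for z :: complex
proof -
  have "norm (exp z - 1) \<le> exp \<bar>Re z\<bar> * norm z" using Taylor_exp[of z 0] by simp
  also have "\<dots> \<le> exp (norm z) * norm z" by (intro mult_right_mono) (auto simp: abs_Re_le_cmod)
  finally show ?thesis by (simp add: mult.commute)
qed

lemma fourier_exp_norm_holomorphic:
  fixes x :: "'a::euclidean_space"
  shows "(\<lambda>z. fourier (\<lambda>\<xi>. exp (- z * of_real (norm \<xi>))) x) holomorphic_on {z. Re z > 0}"
proof (rule holomorphic_onI)
  fix z :: complex assume "z \<in> {z. Re z > 0}"
  then have z: "Re z > 0" by simp
  \<comment> \<open>Half of the decay is reserved: for |h| < d the difference quotient of the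
    exponential is at most |\<xi>| exp(d |\<xi>|), which leaves an integrable majorant of rate
    d.\<close>
  define d where "d = Re z / 2"
  have d: "d > 0" using z by (simp add: d_def)
  let ?K = "\<lambda>z. fourier (\<lambda>\<xi>::'a. exp (- z * of_real (norm \<xi>))) x"
  let ?D = "LINT \<xi>|lborel. cis (- (\<xi> \<bullet> x)) * (- of_real (norm \<xi>) * exp (- z * of_real (norm (\<xi>::'a))))"
  have Ki: "integrable lborel (\<lambda>\<xi>::'a. exp (- w * complex_of_real (norm \<xi>)))" if "Re w > 0" for w
    by (rule Bochner_Integration.integrable_bound[OF integrable_exp_norm[OF that]]) (auto simp: norm_exp_eq_Re)
  have "((\<lambda>h. (?K (z + h) - ?K z) / h) \<longlongrightarrow> ?D) (at 0)"
    unfolding tendsto_at_iff_sequentially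
  proof (intro allI impI)
    fix H :: "nat \<Rightarrow> complex" assume H: "\<forall>i. H i \<in> UNIV - {0}" "H \<longlonglongrightarrow> 0"
    obtain N where N: "\<And>n. n \<ge> N \<Longrightarrow> norm (H n) < d"
      using LIMSEQ_D[OF H(2) d] by auto
    \<comment> \<open>The sequence is shifted so that all its terms are below d in modulus;
      \<open>LIMSEQ_offset\<close> undoes the shift.\<close>
    define h where "h n = H (n + N)" for n
    have h: "h n \<noteq> 0" "norm (h n) < d" for n using H(1) N by (auto simp: h_def)
    have h0: "h \<longlonglongrightarrow> 0" unfolding h_def by (rule LIMSEQ_ignore_initial_segment[OF H(2)])
    have Rh: "Re (z + h n) > 0" for n
      using h(2)[of n] abs_Re_le_cmod[of "h n"] d by (auto simp: d_def)
    let ?q = "\<lambda>n \<xi>. exp (- z * complex_of_real (norm (\<xi>::'a))) * ((exp (- h n * of_real (norm \<xi>)) - 1) / h n)"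
    have eq: "(?K (z + h n) - ?K z) / h n = (LINT \<xi>|lborel. cis (- (\<xi> \<bullet> x)) * ?q n \<xi>)" for n
    proof -
      have "(?K (z + h n) - ?K z) / h n
        = (LINT \<xi>|lborel. (cis (- (\<xi> \<bullet> x)) * exp (- (z + h n) * of_real (norm \<xi>)) - cis (- (\<xi> \<bullet> x)) * exp (- z * of_real (norm \<xi>))) / h n)"
        unfolding fourier_def integral_divide_zero
        by (subst Bochner_Integration.integral_diff, (intro integrable_cis_mult Ki Rh z; measurable)+) (rule refl)
      also have "\<dots> = (LINT \<xi>|lborel. cis (- (\<xi> \<bullet> x)) * ?q n \<xi>)"
        by (intro Bochner_Integration.integral_cong refl) (simp add: exp_add[symmetric] algebra_simps add_divide_distrib diff_divide_distrib)
      finally show ?thesis .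
    qed
    have "(\<lambda>n. LINT \<xi>|lborel. cis (- (\<xi> \<bullet> x)) * ?q n \<xi>) \<longlonglongrightarrow> ?D"
    proof (rule integral_dominated_convergence[where w = "\<lambda>\<xi>::'a. norm \<xi> * exp (- d * norm \<xi>)"])
      show "integrable lborel (\<lambda>\<xi>::'a. norm \<xi> * exp (- d * norm \<xi>))" by (rule integrable_norm_exp_norm[OF d])
      show "AE \<xi> in lborel. (\<lambda>n. cis (- (\<xi> \<bullet> x)) * ?q n \<xi>) \<longlonglongrightarrow> cis (- (\<xi> \<bullet> x)) * (- of_real (norm \<xi>) * exp (- z * of_real (norm \<xi>)))"
      proof (rule AE_I2)
        fix \<xi> :: 'a
        have "((\<lambda>w. exp (- w * complex_of_real (norm \<xi>))) has_field_derivative - of_real (norm \<xi>)) (at 0)"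
          by (auto intro!: derivative_eq_intros)
        then have "((\<lambda>w. (exp (- w * complex_of_real (norm \<xi>)) - 1) / w) \<longlongrightarrow> - of_real (norm \<xi>)) (at 0)"
          unfolding has_field_derivative_iff by simp
        moreover have "filterlim h (at 0) sequentially"
          using h h0 by (auto simp: filterlim_at intro: always_eventually)
        ultimately have "(\<lambda>n. (exp (- h n * complex_of_real (norm \<xi>)) - 1) / h n) \<longlonglongrightarrow> - of_real (norm \<xi>)"
          by (rule filterlim_compose)
        then have "(\<lambda>n. cis (- (\<xi> \<bullet> x)) * ?q n \<xi>) \<longlonglongrightarrow> cis (- (\<xi> \<bullet> x)) * (exp (- z * of_real (norm \<xi>)) * - of_real (norm \<xi>))"
          by (intro tendsto_mult tendsto_const)
        then show "(\<lambda>n. cis (- (\<xi> \<bullet> x)) * ?q n \<xi>) \<longlonglongrightarrow> cis (- (\<xi> \<bullet> x)) * (- of_real (norm \<xi>) * exp (- z * of_real (norm \<xi>)))"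
          by (simp add: mult_ac)
      qed
      show "AE \<xi> in lborel. norm (cis (- (\<xi> \<bullet> x)) * ?q n \<xi>) \<le> norm \<xi> * exp (- d * norm \<xi>)" for n
      proof (rule AE_I2)
        fix \<xi> :: 'a
        have "norm (exp (- h n * complex_of_real (norm \<xi>)) - 1) \<le> norm (h n) * norm \<xi> * exp (norm (h n) * norm \<xi>)"
          using norm_exp_minus_1_le[of "- h n * complex_of_real (norm \<xi>)"] by (simp add: norm_mult)
        also have "\<dots> \<le> norm (h n) * norm \<xi> * exp (d * norm \<xi>)"
          using h(2)[of n] by (intro mult_left_mono) (auto intro!: mult_right_mono)
        finally have "norm ((exp (- h n * complex_of_real (norm \<xi>)) - 1) / h n) \<le> norm \<xi> * exp (d * norm \<xi>)"
          using h(1)[of n] by (simp add: norm_divide field_simps)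
        then have "exp (- Re z * norm \<xi>) * norm ((exp (- h n * complex_of_real (norm \<xi>)) - 1) / h n) \<le> exp (- Re z * norm \<xi>) * (norm \<xi> * exp (d * norm \<xi>))"
          by (rule mult_left_mono) simp
        moreover have "norm (exp (- z * complex_of_real (norm \<xi>))) = exp (- Re z * norm \<xi>)"
          by (simp add: norm_exp_eq_Re)
        ultimately have "norm (cis (- (\<xi> \<bullet> x)) * ?q n \<xi>) \<le> exp (- Re z * norm \<xi>) * (norm \<xi> * exp (d * norm \<xi>))"
          by (simp only: norm_mult norm_cis mult_1_left)
        also have "\<dots> = norm \<xi> * exp (- d * norm \<xi>)"
          by (simp add: mult_exp_exp d_def field_simps)
        finally show "norm (cis (- (\<xi> \<bullet> x)) * ?q n \<xi>) \<le> norm \<xi> * exp (- d * norm \<xi>)" .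
      qed
    qed measurable
    then have "(\<lambda>n. (?K (z + h n) - ?K z) / h n) \<longlonglongrightarrow> ?D"
      unfolding eq .
    then have "(\<lambda>n. ((\<lambda>h. (?K (z + h) - ?K z) / h) \<circ> H) (n + N)) \<longlonglongrightarrow> ?D"
      by (simp only: h_def o_def)
    then show "((\<lambda>h. (?K (z + h) - ?K z) / h) \<circ> H) \<longlonglongrightarrow> ?D"
      by (rule LIMSEQ_offset)
  qed
  then have "(?K has_field_derivative ?D) (at z)"
    by (simp only: DERIV_def)
  then show "?K field_differentiable at z within {z. Re z > 0}"
    by (meson field_differentiable_def has_field_derivative_at_within)
qed

text \<open>Identity theorem on the right half-plane, where both sides are holomorphic and agree on
  the positive reals. The principal branch is the right one because z^2 + |x|^2 avoids the
  nonpositive reals when Re z > 0.\<close>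

lemma fourier_exp_norm_complex:
  "\<exists>c\<ge>0. \<forall>z. Re z > 0 \<longrightarrow> (\<forall>x::'a::euclidean_space. fourier (\<lambda>\<xi>. exp (- z * of_real (norm \<xi>))) x
     = of_real c * z * (z\<^sup>2 + of_real ((norm x)\<^sup>2)) powr (of_real (- (real DIM('a) + 1) / 2)))"
proof -
  obtain c where c: "c \<ge> 0" and real: "\<And>a x. a > 0 \<Longrightarrow> fourier (\<lambda>\<xi>. complex_of_real (exp (- a * norm \<xi>))) (x::'a)
     = of_real (c * a * (a\<^sup>2 + (norm x)\<^sup>2) powr (- (real DIM('a) + 1) / 2))"
    using fourier_exp_norm_real[where 'a='a] by blast
  let ?r = "complex_of_real (- (real DIM('a) + 1) / 2)"
  let ?S = "{z. Re z > 0}"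
  have "fourier (\<lambda>\<xi>. exp (- z * of_real (norm \<xi>))) x = of_real c * z * (z\<^sup>2 + of_real ((norm x)\<^sup>2)) powr ?r"
    if z: "Re z > 0" for z and x :: 'a
  proof -
    let ?K = "\<lambda>z. fourier (\<lambda>\<xi>::'a. exp (- z * of_real (norm \<xi>))) x"
    let ?H = "\<lambda>z. of_real c * z * (z\<^sup>2 + of_real ((norm x)\<^sup>2)) powr ?r"
    have nonneg: "z\<^sup>2 + of_real ((norm x)\<^sup>2) \<notin> \<real>\<^sub>\<le>\<^sub>0" if "Re z > 0" for z
    proof
      assume "z\<^sup>2 + of_real ((norm x)\<^sup>2) \<in> \<real>\<^sub>\<le>\<^sub>0"
      then have re: "Re (z\<^sup>2) + (norm x)\<^sup>2 \<le> 0" and im: "Im (z\<^sup>2) = 0"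
        by (auto simp: complex_nonpos_Reals_iff)
      from im have "Im z = 0" using that by (simp add: Im_power2)
      then have "Re (z\<^sup>2) > 0" using that by (simp add: Re_power2)
      with re zero_le_power2[of "norm x"] show False by linarith
    qed
    have holH: "?H holomorphic_on ?S"
      using nonneg by (auto intro!: holomorphic_intros)
    have "?K z - ?H z = 0"
    proof (rule analytic_continuation[where f = "\<lambda>z. ?K z - ?H z" and w = z and S = ?S and U = "complex_of_real ` {0<..}" and \<xi> = 1])
      show "(\<lambda>z. ?K z - ?H z) holomorphic_on ?S"
        by (intro holomorphic_on_diff fourier_exp_norm_holomorphic holH)
      show "open ?S" by (rule open_halfspace_Re_gt)
      show "connected ?S" by (intro convex_connected convex_halfspace_Re_gt)
      show "complex_of_real ` {0<..} \<subseteq> ?S" by auto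
      show "(1::complex) islimpt complex_of_real ` {0<..}"
        unfolding islimpt_sequential
      proof (intro exI[of _ "\<lambda>n. complex_of_real (1 + 1 / real (Suc n))"] conjI allI)
        show "complex_of_real (1 + 1 / real (Suc n)) \<in> complex_of_real ` {0<..} - {1}" for n
        proof -
          have "1 + 1 / real (Suc n) > 0" "1 + 1 / real (Suc n) \<noteq> 1" by (simp_all add: add_pos_nonneg)
          then show ?thesis by (metis Diff_iff greaterThan_iff imageI of_real_eq_1_iff singletonD)
        qed
        have "(\<lambda>n. 1 + 1 / real (Suc n)) \<longlonglongrightarrow> 1 + 0"
          by (intro tendsto_intros LIMSEQ_Suc[OF lim_1_over_n])
        then have "(\<lambda>n. complex_of_real (1 + 1 / real (Suc n))) \<longlonglongrightarrow> complex_of_real (1 + 0)"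
          by (rule tendsto_of_real)
        then show "(\<lambda>n. complex_of_real (1 + 1 / real (Suc n))) \<longlonglongrightarrow> 1" by (simp only: add_0_right of_real_1)
      qed
      show "?K w - ?H w = 0" if w: "w \<in> complex_of_real ` {0<..}" for w
      proof -
        from w obtain a where a: "a > 0" "w = complex_of_real a" unfolding image_iff by blast
        have B: "a\<^sup>2 + (norm x)\<^sup>2 \<ge> 0" by simp
        have "?K w = fourier (\<lambda>\<xi>. complex_of_real (exp (- a * norm \<xi>))) x"
          unfolding a(2) by (simp add: exp_of_real[symmetric])
        also have "\<dots> = of_real c * w * complex_of_real ((a\<^sup>2 + (norm x)\<^sup>2) powr (- (real DIM('a) + 1) / 2))"
          unfolding real[OF a(1)] a(2) by simp
        also have "\<dots> = ?H w"
          using powr_of_real[OF B, of "- (real DIM('a) + 1) / 2"] unfolding a(2) by simp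
        finally show ?thesis by simp
      qed
    qed (use z in auto)
    then show ?thesis by simp
  qed
  with c show ?thesis by blast
qed

text \<open>The exponential weight at the complex time a - i t; the damping by a takes the place of
  a frequency cutoff at 1 / a.\<close>

definition wave_weight :: "real \<Rightarrow> real \<Rightarrow> 'a::euclidean_space \<Rightarrow> complex" where
  "wave_weight a t \<xi> = of_real (exp (- a * norm \<xi>)) * cis (t * norm \<xi>)"

lemma integrable_wave_weight: "a > 0 \<Longrightarrow> integrable lborel (wave_weight a t :: 'a::euclidean_space \<Rightarrow> complex)"
  unfolding wave_weight_def[abs_def]
  by (rule Bochner_Integration.integrable_bound[OF integrable_exp_norm]) (auto simp: norm_mult)

lemma wave_weight_eq_exp: "wave_weight a t \<xi> = exp (- Complex a (- t) * of_real (norm \<xi>))"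
proof -
  have "- Complex a (- t) * of_real (norm \<xi>) = of_real (- a * norm \<xi>) + \<i> * of_real (t * norm \<xi>)"
    by (simp add: complex_eq_iff)
  then show ?thesis
    unfolding wave_weight_def by (simp only: exp_add exp_of_real cis_conv_exp)
qed

text \<open>In order: the dispersive bound, domination of small times by the positive kernel at time
  0, and the size at the origin. All three are read off from the modulus of the explicit
  kernel.\<close>

lemma wave_kernel_bounds:
  obtains C where "C > 0"
    and "\<And>a t (x::'a::euclidean_space). a > 0 \<Longrightarrow> t \<noteq> 0 \<Longrightarrow>
      norm (fourier (wave_weight a t) x) \<le> C * a powr (- (real DIM('a) + 1) / 2) * \<bar>t\<bar> powr (- (real DIM('a) - 1) / 2)"
    and "\<And>a t (x::'a). a > 0 \<Longrightarrow> \<bar>t\<bar> \<le> a / 2 \<Longrightarrow>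
      norm (fourier (wave_weight a t) x) \<le> C * norm (fourier (wave_weight a 0) x)"
    and "\<And>a. a > 0 \<Longrightarrow> norm (fourier (wave_weight a 0) (0::'a)) \<le> C * a powr (- real DIM('a))"
proof -
  let ?r = "(real DIM('a) + 1) / 2"
  obtain c where c: "c \<ge> 0" and K: "\<And>z x. Re z > 0 \<Longrightarrow> fourier (\<lambda>\<xi>. exp (- z * of_real (norm \<xi>))) (x::'a)
     = of_real c * z * (z\<^sup>2 + of_real ((norm x)\<^sup>2)) powr (of_real (- (real DIM('a) + 1) / 2))"
    using fourier_exp_norm_complex[where 'a='a] by blast
  have K_norm: "norm (fourier (wave_weight a t) x) = c * norm (Complex a (- t)) * norm ((Complex a (- t))\<^sup>2 + of_real ((norm x)\<^sup>2)) powr (- ?r)"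
    if "a > 0" for a t and x :: 'a
  proof -
    have "fourier (wave_weight a t) x = fourier (\<lambda>\<xi>. exp (- Complex a (- t) * of_real (norm \<xi>))) x"
      by (simp only: wave_weight_eq_exp[abs_def])
    moreover have ex: "- ?r = (- real DIM('a) - 1) / 2" by (simp add: field_simps)
    ultimately show ?thesis
      unfolding ex using K[of "Complex a (- t)" x] that c
      by (simp add: norm_mult norm_powr_real_powr')
  qed
  \<comment> \<open>One constant for the three bounds: the first term serves small times, c the
    other two, and 1 ensures positivity.\<close>
  define C where "C = 2 * (4 / 3) powr ?r + c + 1"
  show ?thesis
  proof (rule that)
    show "C > 0" using c by (simp add: C_def add_pos_nonneg)
    show "norm (fourier (wave_weight a t) x) \<le> C * a powr (- (real DIM('a) + 1) / 2) * \<bar>t\<bar> powr (- (real DIM('a) - 1) / 2)"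
      if a: "a > 0" and t: "t \<noteq> 0" for a t and x :: 'a
    proof -
      let ?z = "Complex a (- t)" and ?R = "norm x"
      have z: "norm ?z > 0" "norm ?z \<ge> \<bar>t\<bar>" "norm ?z \<ge> a"
        using a abs_Im_le_cmod[of ?z] complex_Re_le_cmod[of ?z] by (auto simp: complex_eq_iff)
      \<comment> \<open>Both factors have real part a, and the one in which the imaginary parts add
        up has modulus at least |z|. Hence the product is at least a |z|, uniformly in x.\<close>
      have fac: "?z\<^sup>2 + of_real (?R\<^sup>2) = (?z + \<i> * of_real ?R) * (?z - \<i> * of_real ?R)"
        by (simp add: algebra_simps power2_eq_square)
      have one: "a \<le> norm (?z + \<i> * of_real ?R)" "a \<le> norm (?z - \<i> * of_real ?R)"
        using complex_Re_le_cmod[of "?z + \<i> * of_real ?R"] complex_Re_le_cmod[of "?z - \<i> * of_real ?R"] by auto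
      have "a * norm ?z \<le> norm (?z\<^sup>2 + of_real (?R\<^sup>2))"
      proof (cases "t \<ge> 0")
        case True
        have "t \<le> \<bar>- t - norm x\<bar>" using norm_ge_zero[of x] True by linarith
        then have "norm ?z \<le> norm (?z - \<i> * of_real ?R)"
          unfolding cmod_def using True by (auto intro!: power_mono simp: abs_le_square_iff[symmetric])
        then show ?thesis unfolding fac norm_mult using one(1) a by (intro mult_mono) auto
      next
        case False
        have "- t \<le> \<bar>norm x - t\<bar>" using norm_ge_zero[of x] False by linarith
        then have "norm ?z \<le> norm (?z + \<i> * of_real ?R)"
          unfolding cmod_def using False by (auto intro!: power_mono simp: abs_le_square_iff[symmetric])
        then have "norm ?z * a \<le> norm (?z\<^sup>2 + of_real (?R\<^sup>2))"
          unfolding fac norm_mult using one(2) a by (intro mult_mono) auto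
        then show ?thesis by (simp add: mult.commute)
      qed
      then have "norm (?z\<^sup>2 + of_real (?R\<^sup>2)) powr (- ?r) \<le> (a * norm ?z) powr (- ?r)"
        using a z by (intro powr_mono2') (auto simp: divide_nonneg_pos)
      then have "norm (fourier (wave_weight a t) x) \<le> c * norm ?z * (a * norm ?z) powr (- ?r)"
        unfolding K_norm[OF a] using c by (intro mult_left_mono) auto
      also have "\<dots> = c * a powr (- ?r) * (norm ?z powr 1 * norm ?z powr (- ?r))"
        using a z by (simp add: powr_mult)
      also have "norm ?z powr 1 * norm ?z powr (- ?r) = norm ?z powr (- (real DIM('a) - 1) / 2)"
        unfolding powr_add[symmetric] by (simp add: field_simps)
      also have "c * a powr (- ?r) * norm ?z powr (- (real DIM('a) - 1) / 2) \<le> c * a powr (- ?r) * \<bar>t\<bar> powr (- (real DIM('a) - 1) / 2)"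
        using c z t by (intro mult_left_mono powr_mono2') (auto simp: Suc_le_eq)
      also have "\<dots> \<le> C * a powr (- ?r) * \<bar>t\<bar> powr (- (real DIM('a) - 1) / 2)"
        using c by (intro mult_right_mono) (auto simp: C_def)
      finally show ?thesis by (simp only: minus_divide_left)
    qed
    show "norm (fourier (wave_weight a t) x) \<le> C * norm (fourier (wave_weight a 0) x)"
      if a: "a > 0" and t: "\<bar>t\<bar> \<le> a / 2" for a t and x :: 'a
    proof -
      let ?z = "Complex a (- t)" and ?R = "norm x"
      have B: "a\<^sup>2 + ?R\<^sup>2 > 0" using a by (simp add: add_pos_nonneg)
      have "norm ?z \<le> a + \<bar>t\<bar>" using cmod_le[of ?z] a by simp
      then have z: "norm ?z \<le> 2 * a" using t a by linarith
      \<comment> \<open>Since t^2 \<le> a^2 / 4, the real part a^2 - t^2 + |x|^2 is at least three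
        quarters of its value at t = 0, whence the power of 4 / 3; the 2 comes from |z| \<le> 2
        a.\<close>
      have "t\<^sup>2 \<le> (a / 2)\<^sup>2" using t a by (subst abs_le_square_iff[symmetric]) auto
      then have "3 / 4 * (a\<^sup>2 + ?R\<^sup>2) \<le> Re (?z\<^sup>2 + of_real (?R\<^sup>2))"
        by (simp add: Re_power2 power_divide)
      also have "\<dots> \<le> norm (?z\<^sup>2 + of_real (?R\<^sup>2))" by (rule complex_Re_le_cmod)
      finally have "norm (?z\<^sup>2 + of_real (?R\<^sup>2)) powr (- ?r) \<le> (3 / 4 * (a\<^sup>2 + ?R\<^sup>2)) powr (- ?r)"
        using B by (intro powr_mono2') (auto simp: divide_nonneg_pos)
      also have "\<dots> = (4 / 3) powr ?r * (a\<^sup>2 + ?R\<^sup>2) powr (- ?r)"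
        using B by (subst powr_mult) (auto simp: powr_minus powr_divide)
      finally have "norm (fourier (wave_weight a t) x) \<le> c * (2 * a) * ((4 / 3) powr ?r * (a\<^sup>2 + ?R\<^sup>2) powr (- ?r))"
        unfolding K_norm[OF a] using c z a by (intro mult_mono) auto
      also have "\<dots> = (2 * (4 / 3) powr ?r) * norm (fourier (wave_weight a 0) x)"
      proof -
        have e: "(Complex a (- 0))\<^sup>2 + of_real (?R\<^sup>2) = of_real (a\<^sup>2 + ?R\<^sup>2)"
          by (simp add: complex_eq_iff Re_power2 Im_power2 del: of_real_power)
        have n: "norm (Complex a (- 0)) = a" using a by (simp add: cmod_def)
        show ?thesis
          unfolding K_norm[OF a] e n norm_of_real abs_of_pos[OF B] by simp
      qed
      also have "\<dots> \<le> C * norm (fourier (wave_weight a 0) x)"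
        using c by (intro mult_right_mono) (auto simp: C_def)
      finally show ?thesis .
    qed
    show "norm (fourier (wave_weight a 0) (0::'a)) \<le> C * a powr (- real DIM('a))" if a: "a > 0" for a
    proof -
      have n: "norm (Complex a (- 0)) = a" using a by (simp add: cmod_def)
      have "norm (fourier (wave_weight a 0) (0::'a)) = c * a * (a\<^sup>2) powr (- ?r)"
        unfolding K_norm[OF a] n by (simp add: norm_power n[simplified])
      also have "(a\<^sup>2) powr (- ?r) = a powr (- real DIM('a) - 1)"
      proof -
        have "(a\<^sup>2) powr (- ?r) = (a powr 2) powr (- ?r)" using a by simp
        also have "\<dots> = a powr (- real DIM('a) - 1)" proof -
          have "2 * (- ?r) = - real DIM('a) - 1" by (simp add: add_divide_distrib)
          then show ?thesis unfolding powr_powr by (simp only:)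
        qed
        finally show ?thesis .
      qed
      also have "c * a * a powr (- real DIM('a) - 1) = c * (a powr 1 * a powr (- real DIM('a) - 1))"
        using a by simp
      also have "\<dots> = c * a powr (- real DIM('a))"
        unfolding powr_add[symmetric] by simp
      also have "\<dots> \<le> C * a powr (- real DIM('a))"
        by (intro mult_right_mono) (auto simp: C_def)
      finally show ?thesis .
    qed
  qed
qed

lemma fourier_wave_weight_0:
  "fourier (wave_weight a 0) x = complex_of_real (LINT s|lborel. subordinator a s * gauss_kernel s x)" if "a > 0"
  using fourier_exp_norm_subordination[OF that, of x] by (simp add: wave_weight_def[abs_def])

lemma fourier_wave_weight_0_nonneg:
  assumes "a > 0"
  shows "fourier (wave_weight a 0) x = of_real (norm (fourier (wave_weight a 0) x))"
proof -
  have "subordinator a s * gauss_kernel s x \<ge> 0" for s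
    using subordinator_nonneg[OF assms, of s] gauss_kernel_nonneg[of s x]
    by (cases "s > 0") (rule mult_nonneg_nonneg, auto simp: subordinator_def[of a s])
  then have "(LINT s|lborel. subordinator a s * gauss_kernel s x) \<ge> 0"
    by (simp add: integral_nonneg)
  then show ?thesis unfolding fourier_wave_weight_0[OF assms] by simp
qed

text \<open>The kernel at time 0 is nonnegative, being an average of Gaussian kernels, so its L1
  norm is its integral. With a Gaussian inserted, the multiplication formula and the fact that the
  weight is at most 1 bound this by the mass of \<open>gauss_kernel\<close>, uniformly in a.\<close>

lemma nn_integral_fourier_wave_weight_0:
  assumes a: "a > 0"
  shows "(\<integral>\<^sup>+x. ennreal (norm (fourier (wave_weight a 0) (x::'a::euclidean_space))) \<partial>lborel) \<le> ennreal ((2 * pi) ^ DIM('a))"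
proof -
  let ?p = "\<lambda>x::'a. norm (fourier (wave_weight a 0) x)"
  have [measurable]: "(wave_weight a 0 :: 'a \<Rightarrow> complex) \<in> borel_measurable borel"
    using integrable_wave_weight[OF a, of 0, where 'a='a] by auto
  define e where "e n = 1 / real (Suc n)" for n
  have e: "e n > 0" for n by (simp add: e_def)
  have e0: "e \<longlonglongrightarrow> 0" unfolding e_def by (rule LIMSEQ_Suc[OF lim_1_over_n])
  show ?thesis
  proof (rule nn_integral_Fatou_bound[where f = "\<lambda>n x. ennreal (exp (- e n * (norm x)\<^sup>2) * ?p x)"])
    show "AE x in lborel. (\<lambda>n. ennreal (exp (- e n * (norm x)\<^sup>2) * ?p x)) \<longlonglongrightarrow> ennreal (?p x)"
    proof (rule AE_I2)
      fix x :: 'a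
      have "(\<lambda>n. exp (- e n * (norm x)\<^sup>2) * ?p x) \<longlonglongrightarrow> exp (- 0 * (norm x)\<^sup>2) * ?p x"
        by (intro tendsto_intros e0)
      then show "(\<lambda>n. ennreal (exp (- e n * (norm x)\<^sup>2) * ?p x)) \<longlonglongrightarrow> ennreal (?p x)" by simp
    qed
    fix n
    let ?g = "\<lambda>x::'a. complex_of_real (exp (- e n * (norm x)\<^sup>2))"
    have gi: "integrable lborel ?g" by (intro integrable_of_real integrable_gaussian e)
    have wi: "integrable lborel (wave_weight a 0 :: 'a \<Rightarrow> complex)" by (rule integrable_wave_weight[OF a])
    have eq: "complex_of_real (exp (- e n * (norm x)\<^sup>2) * ?p x) = ?g x * fourier (wave_weight a 0) x" for x :: 'a
      using fourier_wave_weight_0_nonneg[OF a, of x] by (metis of_real_mult)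
    have int: "integrable lborel (\<lambda>x::'a. exp (- e n * (norm x)\<^sup>2) * ?p x)"
      using integrable_mult_fourier[OF gi wi] unfolding eq[symmetric] complex_of_real_integrable_eq .
    have "(\<integral>\<^sup>+x. ennreal (exp (- e n * (norm x)\<^sup>2) * ?p x) \<partial>lborel) = ennreal (LINT x|lborel. exp (- e n * (norm x)\<^sup>2) * ?p x)"
      by (rule nn_integral_eq_integral[OF int]) auto
    also have "(LINT x|lborel. exp (- e n * (norm x)\<^sup>2) * ?p x) = norm (LINT x|lborel. ?g x * fourier (wave_weight a 0) x)"
      unfolding eq[symmetric] integral_complex_of_real norm_of_real by (simp add: integral_nonneg)
    also have "(LINT x|lborel. ?g x * fourier (wave_weight a 0) x) = (LINT x|lborel. of_real (gauss_kernel (e n) x) * wave_weight a 0 (x::'a))"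
      unfolding fourier_mult_formula[OF gi wi] fourier_gaussian[OF e] by (rule refl)
    also have "norm \<dots> \<le> (LINT x|lborel. norm (of_real (gauss_kernel (e n) x) * wave_weight a 0 (x::'a)))"
      by (rule integral_norm_bound)
    also have "\<dots> \<le> (LINT x|lborel. gauss_kernel (e n) (x::'a))"
    proof (rule integral_mono_AE')
      show "AE x in lborel. norm (of_real (gauss_kernel (e n) x) * wave_weight a 0 (x::'a)) \<le> gauss_kernel (e n) x"
        using a gauss_kernel_nonneg[OF e, where 'a='a] by (auto simp: wave_weight_def norm_mult intro!: mult_left_le)
    qed (use gauss_kernel_nonneg[OF e, where 'a='a] in \<open>auto intro!: integrable_gauss_kernel e\<close>)
    finally show "(\<integral>\<^sup>+x. ennreal (exp (- e n * (norm x)\<^sup>2) * ?p x) \<partial>lborel) \<le> ennreal ((2 * pi) ^ DIM('a))"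
      unfolding integral_gauss_kernel[OF e] by (simp add: ennreal_leI)
  qed measurable
qed

section \<open>The quadratic form of the linearised maximal operator\<close>

text \<open>The data of the linearised maximal operator: \<open>E t\<close> is the part of the level
  set on which the time t is selected, and \<open>\<omega> t\<close> is a phase supported
  there.\<close>

locale disjoint_slices =
  fixes T :: "real set" and E :: "real \<Rightarrow> 'a::euclidean_space set" and \<omega> :: "real \<Rightarrow> 'a \<Rightarrow> complex"
  assumes finite_T: "finite T"
    and E_sets [measurable]: "\<And>t. E t \<in> sets borel"
    and E_fin: "\<And>t. t \<in> T \<Longrightarrow> emeasure lborel (E t) < \<infinity>"
    and disj: "disjoint_family_on E T"
    and \<omega>_meas [measurable]: "\<And>t. \<omega> t \<in> borel_measurable borel"
    and \<omega>_le: "\<And>t x. norm (\<omega> t x) \<le> indicat_real (E t) x"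
begin

text \<open>The frequency side of the adjoint: paired with G it gives the sum over t of the pairings
  of \<open>\<omega> t\<close> with the evolution at time t.\<close>

definition slice_sum :: "real set \<Rightarrow> 'a \<Rightarrow> complex" where
  "slice_sum A \<xi> = (\<Sum>t\<in>A. cis (t * norm \<xi>) * fourier (\<omega> t) \<xi>)"

text \<open>By the T T* identity its kernel between the slices t and t' is the transform of
  \<open>wave_weight a (t - t')\<close>.\<close>

definition slice_form :: "real \<Rightarrow> real set \<Rightarrow> real set \<Rightarrow> complex" where
  "slice_form a A B = (LINT \<xi>|lborel. of_real (exp (- a * norm \<xi>)) * slice_sum A \<xi> * cnj (slice_sum B \<xi>))"

definition slice_measure :: "real set \<Rightarrow> real" where
  "slice_measure A = measure lborel (\<Union>t\<in>A. E t)"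

lemma slice_sum_measurable [measurable]: "slice_sum A \<in> borel_measurable borel"
  unfolding slice_sum_def[abs_def] by measurable

lemma \<omega>_integrable: "t \<in> T \<Longrightarrow> integrable lborel (\<omega> t)"
  using E_fin[of t]
  by (rule_tac Bochner_Integration.integrable_bound[of lborel "indicat_real (E t)"])
     (use \<omega>_le[of t] in \<open>auto simp: integrable_indicator_iff\<close>)

lemma UN_sets [measurable]: "A \<subseteq> T \<Longrightarrow> (\<Union>t\<in>A. E t) \<in> sets borel"
  using finite_subset[OF _ finite_T] by (intro sets.finite_UN) auto

lemma emeasure_UN: "A \<subseteq> T \<Longrightarrow> emeasure lborel (\<Union>t\<in>A. E t) = ennreal (slice_measure A)"
proof -
  assume A: "A \<subseteq> T"
  have "emeasure lborel (\<Union>t\<in>A. E t) \<le> (\<Sum>t\<in>A. emeasure lborel (E t))"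
    using finite_subset[OF A finite_T] by (intro emeasure_subadditive_finite) auto
  also have "\<dots> < \<infinity>"
    using finite_subset[OF A finite_T] E_fin A by (auto simp: less_top[symmetric] ennreal_sum_less_top)
  finally show ?thesis
    unfolding slice_measure_def by (intro emeasure_eq_ennreal_measure) auto
qed

lemma slice_measure_UN:
  assumes "finite I" "\<And>i. i \<in> I \<Longrightarrow> A i \<subseteq> T" "disjoint_family_on A I"
  shows "slice_measure (\<Union>i\<in>I. A i) = (\<Sum>i\<in>I. slice_measure (A i))"
proof -
  have "(\<Union>t\<in>(\<Union>i\<in>I. A i). E t) = (\<Union>i\<in>I. \<Union>t\<in>A i. E t)" by auto
  moreover have "disjoint_family_on (\<lambda>i. \<Union>t\<in>A i. E t) I"
    unfolding disjoint_family_on_def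
  proof (intro ballI impI)
    fix i j assume ij: "i \<in> I" "j \<in> I" "i \<noteq> j"
    have "E s \<inter> E t = {}" if "s \<in> A i" "t \<in> A j" for s t
    proof (rule disjoint_family_onD[OF disj])
      show "s \<in> T" "t \<in> T" using assms(2) ij that by auto
      show "s \<noteq> t" using disjoint_family_onD[OF assms(3) ij] that by auto
    qed
    then show "(\<Union>t\<in>A i. E t) \<inter> (\<Union>t\<in>A j. E t) = {}" by auto
  qed
  ultimately show ?thesis
    unfolding slice_measure_def using assms(1,2) UN_sets emeasure_UN
    by (subst measure_finite_Union[symmetric]) auto
qed

lemma sum_\<omega>_le:
  assumes A: "A \<subseteq> T"
  shows "(\<Sum>t\<in>A. ennreal (norm (\<omega> t x))) \<le> indicator (\<Union>t\<in>A. E t) x"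
proof -
  have "(\<Sum>t\<in>A. ennreal (norm (\<omega> t x))) \<le> (\<Sum>t\<in>A. indicator (E t) x)"
    using \<omega>_le by (intro sum_mono) (auto simp: ennreal_indicator[symmetric] intro!: ennreal_leI)
  also have "\<dots> = indicator (\<Union>t\<in>A. E t) x"
    using finite_subset[OF A finite_T] disjoint_family_on_mono[OF A disj]
    by (intro indicator_UN_disjoint[symmetric])
  finally show ?thesis .
qed

lemma integrable_weight_product:
  assumes a: "a > 0" and t: "t \<in> T" "t' \<in> T"
  shows "integrable lborel (\<lambda>\<xi>. wave_weight a s \<xi> * fourier (\<omega> t) \<xi> * cnj (fourier (\<omega> t') \<xi>))"
proof (rule Bochner_Integration.integrable_bound)
  let ?I = "\<lambda>t. LINT x|lborel. norm (\<omega> t x)"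
  show "integrable lborel (\<lambda>\<xi>::'a. (?I t * ?I t') * exp (- a * norm \<xi>))"
    by (intro integrable_mult_right integrable_exp_norm a)
  have "norm (wave_weight a s \<xi> * fourier (\<omega> t) \<xi> * cnj (fourier (\<omega> t') \<xi>)) \<le> (?I t * ?I t') * exp (- a * norm \<xi>)" for \<xi> :: 'a
  proof -
    have "norm (fourier (\<omega> t) \<xi>) * norm (fourier (\<omega> t') \<xi>) \<le> ?I t * ?I t'"
      by (intro mult_mono norm_fourier_le \<omega>_integrable t) auto
    then have "exp (- a * norm \<xi>) * (norm (fourier (\<omega> t) \<xi>) * norm (fourier (\<omega> t') \<xi>)) \<le> exp (- a * norm \<xi>) * (?I t * ?I t')"
      by (rule mult_left_mono) simp
    then show ?thesis by (simp add: norm_mult wave_weight_def mult_ac)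
  qed
  then show "AE \<xi> in lborel. norm (wave_weight a s \<xi> * fourier (\<omega> t) \<xi> * cnj (fourier (\<omega> t') \<xi>)) \<le> norm ((?I t * ?I t') * exp (- a * norm (\<xi>::'a)))"
    by (intro AE_I2) (metis abs_ge_self order_trans real_norm_def)
qed (simp add: wave_weight_def)

lemma slice_product_eq:
  "of_real (exp (- a * norm \<xi>)) * slice_sum A \<xi> * cnj (slice_sum B \<xi>)
    = (\<Sum>t\<in>A. \<Sum>t'\<in>B. wave_weight a (t - t') \<xi> * fourier (\<omega> t) \<xi> * cnj (fourier (\<omega> t') \<xi>))"
proof -
  have "cis (t * norm \<xi>) * cnj (cis (t' * norm \<xi>)) = cis ((t - t') * norm \<xi>)" for t t'
    by (simp add: cis_cnj cis_mult left_diff_distrib)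
  then have "wave_weight a (t - t') \<xi> = of_real (exp (- a * norm \<xi>)) * (cis (t * norm \<xi>) * cnj (cis (t' * norm \<xi>)))" for t t'
    by (simp only: wave_weight_def)
  then have "of_real (exp (- a * norm \<xi>)) * (cis (t * norm \<xi>) * fourier (\<omega> t) \<xi>) * cnj (cis (t' * norm \<xi>) * fourier (\<omega> t') \<xi>)
     = wave_weight a (t - t') \<xi> * fourier (\<omega> t) \<xi> * cnj (fourier (\<omega> t') \<xi>)" for t t'
    by (simp only: complex_cnj_mult mult_ac)
  note tt = this
  show ?thesis
    unfolding slice_sum_def cnj_sum sum_distrib_left sum_distrib_right
    by (subst sum.swap) (simp only: tt)
qed

lemma integrable_slice_product:
  assumes "a > 0" "A \<subseteq> T" "B \<subseteq> T"
  shows "integrable lborel (\<lambda>\<xi>. of_real (exp (- a * norm \<xi>)) * slice_sum A \<xi> * cnj (slice_sum B \<xi>))"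
  unfolding slice_product_eq using assms
  by (intro Bochner_Integration.integrable_sum integrable_weight_product) auto

text \<open>One majorant k serves all differences of times. The slices are disjoint, so the phases
  add up to at most one indicator, and the number of times in A and B does not enter.\<close>

lemma slice_form_le:
  assumes a: "a > 0" and A: "A \<subseteq> T" and B: "B \<subseteq> T"
    and [measurable]: "k \<in> borel_measurable borel"
    and k: "\<And>t t' z. t \<in> A \<Longrightarrow> t' \<in> B \<Longrightarrow> ennreal (norm (fourier (wave_weight a (t - t')) (z::'a))) \<le> k z"
  shows "ennreal (norm (slice_form a A B)) \<le>
    (\<integral>\<^sup>+x. \<integral>\<^sup>+y. indicator (\<Union>t\<in>A. E t) x * indicator (\<Union>t\<in>B. E t) y * k (x - y) \<partial>lborel \<partial>lborel)"
proof -
  note [measurable] = UN_sets[OF A] UN_sets[OF B]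
  have "slice_form a A B = (\<Sum>t\<in>A. \<Sum>t'\<in>B. LINT \<xi>|lborel. wave_weight a (t - t') \<xi> * fourier (\<omega> t) \<xi> * cnj (fourier (\<omega> t') \<xi>))"
    unfolding slice_form_def slice_product_eq using A B
    by (subst Bochner_Integration.integral_sum, force intro!: Bochner_Integration.integrable_sum integrable_weight_product a)
       (intro sum.cong refl Bochner_Integration.integral_sum integrable_weight_product a; blast)
  then have "norm (slice_form a A B) \<le> (\<Sum>t\<in>A. \<Sum>t'\<in>B. norm (LINT \<xi>|lborel. wave_weight a (t - t') \<xi> * fourier (\<omega> t) \<xi> * cnj (fourier (\<omega> t') \<xi>)))"
    by (simp add: sum_norm_le order_trans[OF norm_sum sum_mono[OF norm_sum]])
  then have "ennreal (norm (slice_form a A B)) \<le> (\<Sum>t\<in>A. \<Sum>t'\<in>B. ennreal (norm (LINT \<xi>|lborel. wave_weight a (t - t') \<xi> * fourier (\<omega> t) \<xi> * cnj (fourier (\<omega> t') \<xi>))))"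
    by (simp add: sum_nonneg ennreal_leI)
  also have "\<dots> \<le> (\<Sum>t\<in>A. \<Sum>t'\<in>B. \<integral>\<^sup>+x. \<integral>\<^sup>+y. ennreal (norm (\<omega> t x)) * ennreal (norm (\<omega> t' y)) * k (x - y) \<partial>lborel \<partial>lborel)"
    using A B by (intro sum_mono norm_integral_weighted_fourier_product_le integrable_wave_weight[OF a] \<omega>_integrable k) auto
  also have "\<dots> = (\<integral>\<^sup>+x. \<integral>\<^sup>+y. (\<Sum>t\<in>A. \<Sum>t'\<in>B. ennreal (norm (\<omega> t x)) * ennreal (norm (\<omega> t' y)) * k (x - y)) \<partial>lborel \<partial>lborel)"
    by (simp add: nn_integral_sum)
  also have "\<dots> = (\<integral>\<^sup>+x. \<integral>\<^sup>+y. (\<Sum>t\<in>A. ennreal (norm (\<omega> t x))) * (\<Sum>t'\<in>B. ennreal (norm (\<omega> t' y))) * k (x - y) \<partial>lborel \<partial>lborel)"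
    by (unfold sum_product, simp only: sum_distrib_right)
  also have "\<dots> \<le> (\<integral>\<^sup>+x. \<integral>\<^sup>+y. indicator (\<Union>t\<in>A. E t) x * indicator (\<Union>t\<in>B. E t) y * k (x - y) \<partial>lborel \<partial>lborel)"
    by (intro nn_integral_mono mult_right_mono mult_mono sum_\<omega>_le A B) auto
  finally show ?thesis .
qed

lemma slice_measure_nonneg: "slice_measure A \<ge> 0"
  by (simp add: slice_measure_def)

text \<open>A bounded kernel makes the bound quadratic in the measures; this is the regime of
  distant times.\<close>

lemma slice_form_far:
  assumes a: "a > 0" and A: "A \<subseteq> T" and B: "B \<subseteq> T" and D: "D \<ge> 0"
    and k: "\<And>t t' z. t \<in> A \<Longrightarrow> t' \<in> B \<Longrightarrow> norm (fourier (wave_weight a (t - t')) (z::'a)) \<le> D"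
  shows "norm (slice_form a A B) \<le> D * (slice_measure A * slice_measure B)"
proof -
  note [measurable] = UN_sets[OF A] UN_sets[OF B]
  have "ennreal (norm (slice_form a A B)) \<le>
    (\<integral>\<^sup>+x. \<integral>\<^sup>+y. indicator (\<Union>t\<in>A. E t) x * indicator (\<Union>t\<in>B. E t) y * ennreal D \<partial>lborel \<partial>lborel)"
    by (rule slice_form_le[OF a A B, where k = "\<lambda>_. ennreal D"]) (auto intro!: ennreal_leI k)
  also have "\<dots> = ennreal (D * (slice_measure A * slice_measure B))"
    using D by (simp add: nn_integral_cmult nn_integral_multc emeasure_UN A B ennreal_mult slice_measure_nonneg mult_ac)
  finally show ?thesis using D by (simp add: slice_measure_nonneg)
qed

text \<open>Here the majorant is the positive kernel at time 0, whose mass is bounded independently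
  of a, so Schur's test gives a bound linear in the measure.\<close>

lemma slice_form_near:
  assumes a: "a > 0" and A: "A \<subseteq> T" and C: "C \<ge> 0"
    and k: "\<And>t t' z. t \<in> A \<Longrightarrow> t' \<in> A \<Longrightarrow> norm (fourier (wave_weight a (t - t')) (z::'a)) \<le> C * norm (fourier (wave_weight a 0) z)"
  shows "norm (slice_form a A A) \<le> 2 * C * (2 * pi) ^ DIM('a) * slice_measure A"
proof -
  note [measurable] = UN_sets[OF A]
  have [measurable]: "(wave_weight a 0 :: 'a \<Rightarrow> complex) \<in> borel_measurable borel"
    using integrable_wave_weight[OF a, of 0, where 'a='a] by auto
  let ?k = "\<lambda>z::'a. ennreal (C * norm (fourier (wave_weight a 0) z))"
  have "ennreal (norm (slice_form a A A)) \<le>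
    (\<integral>\<^sup>+x. \<integral>\<^sup>+y. indicator (\<Union>t\<in>A. E t) x * indicator (\<Union>t\<in>A. E t) y * ?k (x - y) \<partial>lborel \<partial>lborel)"
    by (rule slice_form_le[OF a A A]) (auto intro!: ennreal_leI k)
  also have "\<dots> \<le> ((\<integral>\<^sup>+x. (indicator (\<Union>t\<in>A. E t) (x::'a))\<^sup>2 \<partial>lborel) + (\<integral>\<^sup>+x. (indicator (\<Union>t\<in>A. E t) (x::'a))\<^sup>2 \<partial>lborel)) * (\<integral>\<^sup>+x. ?k x \<partial>lborel)"
    by (rule Schur_test) measurable
  also have "(\<integral>\<^sup>+x. (indicator (\<Union>t\<in>A. E t) (x::'a) :: ennreal)\<^sup>2 \<partial>lborel) = (\<integral>\<^sup>+x. indicator (\<Union>t\<in>A. E t) x \<partial>lborel)"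
    by (intro nn_integral_cong) (auto simp: indicator_def)
  also have "\<dots> = ennreal (slice_measure A)" by (simp add: emeasure_UN A)
  also have "(\<integral>\<^sup>+x. ?k x \<partial>lborel) = ennreal C * (\<integral>\<^sup>+x. ennreal (norm (fourier (wave_weight a 0) (x::'a))) \<partial>lborel)"
    using C by (simp add: ennreal_mult nn_integral_cmult)
  also have "(ennreal (slice_measure A) + ennreal (slice_measure A)) * (ennreal C * (\<integral>\<^sup>+x. ennreal (norm (fourier (wave_weight a 0) (x::'a))) \<partial>lborel))
     \<le> (ennreal (slice_measure A) + ennreal (slice_measure A)) * (ennreal C * ennreal ((2 * pi) ^ DIM('a)))"
    by (intro mult_left_mono nn_integral_fourier_wave_weight_0 a) auto
  also have "\<dots> = ennreal ((slice_measure A + slice_measure A) * (C * (2 * pi) ^ DIM('a)))"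
    using C slice_measure_nonneg[of A]
    by (subst ennreal_mult, simp, simp, subst ennreal_mult, simp, simp, subst ennreal_plus, simp_all)
  finally have "norm (slice_form a A A) \<le> (slice_measure A + slice_measure A) * (C * (2 * pi) ^ DIM('a))"
    using C slice_measure_nonneg[of A] by (subst (asm) ennreal_le_iff) auto
  then show ?thesis by (simp add: algebra_simps)
qed

lemma slice_form_eq_real:
  "slice_form a A A = of_real (LINT \<xi>|lborel. exp (- a * norm \<xi>) * (norm (slice_sum A \<xi>))\<^sup>2)"
proof -
  have "of_real (exp (- a * norm \<xi>)) * slice_sum A \<xi> * cnj (slice_sum A \<xi>) = complex_of_real (exp (- a * norm \<xi>) * (norm (slice_sum A \<xi>))\<^sup>2)" for \<xi>
    by (simp add: complex_norm_square mult.assoc del: of_real_power)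
  then show ?thesis unfolding slice_form_def by (simp only: integral_complex_of_real)
qed

lemma integrable_slice_square:
  assumes "a > 0" "A \<subseteq> T"
  shows "integrable lborel (\<lambda>\<xi>. exp (- a * norm \<xi>) * (norm (slice_sum A \<xi>))\<^sup>2)"
proof -
  have eq: "of_real (exp (- a * norm \<xi>)) * slice_sum A \<xi> * cnj (slice_sum A \<xi>) = complex_of_real (exp (- a * norm \<xi>) * (norm (slice_sum A \<xi>))\<^sup>2)" for \<xi>
    by (simp add: complex_norm_square mult.assoc del: of_real_power)
  show ?thesis
    using integrable_slice_product[OF assms(1,2,2)] unfolding eq complex_of_real_integrable_eq .
qed

lemma norm_slice_form_diag: "norm (slice_form a A A) = (LINT \<xi>|lborel. exp (- a * norm \<xi>) * (norm (slice_sum A \<xi>))\<^sup>2)"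
  unfolding slice_form_eq_real norm_of_real by (simp add: integral_nonneg)

text \<open>The weight is positive, so the form is positive semidefinite and an off-diagonal block
  is controlled by the two diagonal ones.\<close>

lemma slice_form_Cauchy_Schwarz:
  assumes a: "a > 0" and A: "A \<subseteq> T" and B: "B \<subseteq> T"
  shows "norm (slice_form a A B) \<le> norm (slice_form a A A) + norm (slice_form a B B)"
proof -
  have "norm (slice_form a A B) \<le> (LINT \<xi>|lborel. norm (of_real (exp (- a * norm \<xi>)) * slice_sum A \<xi> * cnj (slice_sum B \<xi>)))"
    unfolding slice_form_def by (rule integral_norm_bound)
  also have "\<dots> \<le> (LINT \<xi>|lborel. exp (- a * norm \<xi>) * (norm (slice_sum A \<xi>))\<^sup>2 + exp (- a * norm \<xi>) * (norm (slice_sum B \<xi>))\<^sup>2)"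
  proof (rule integral_mono)
    show "norm (of_real (exp (- a * norm \<xi>)) * slice_sum A \<xi> * cnj (slice_sum B \<xi>))
       \<le> exp (- a * norm \<xi>) * (norm (slice_sum A \<xi>))\<^sup>2 + exp (- a * norm \<xi>) * (norm (slice_sum B \<xi>))\<^sup>2" for \<xi>
    proof -
      have "u * v \<le> u\<^sup>2 + v\<^sup>2" if "u \<ge> 0" "v \<ge> 0" for u v :: real
        using zero_le_power2[of "u - v"] mult_nonneg_nonneg[OF that] unfolding power2_diff by linarith
      then have "norm (slice_sum A \<xi>) * norm (slice_sum B \<xi>) \<le> (norm (slice_sum A \<xi>))\<^sup>2 + (norm (slice_sum B \<xi>))\<^sup>2" by simp
      then have "exp (- a * norm \<xi>) * (norm (slice_sum A \<xi>) * norm (slice_sum B \<xi>)) \<le> exp (- a * norm \<xi>) * ((norm (slice_sum A \<xi>))\<^sup>2 + (norm (slice_sum B \<xi>))\<^sup>2)"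
        by (rule mult_left_mono) simp
      then show ?thesis by (simp add: norm_mult distrib_left mult.assoc)
    qed
  qed (intro integrable_norm integrable_slice_product Bochner_Integration.integrable_add integrable_slice_square a A B)+
  also have "\<dots> = norm (slice_form a A A) + norm (slice_form a B B)"
    unfolding norm_slice_form_diag
    by (intro Bochner_Integration.integral_add integrable_slice_square a A B)
  finally show ?thesis .
qed

lemma slice_form_partition:
  assumes a: "a > 0"
  shows "slice_form a T T = (\<Sum>i\<in>f ` T. \<Sum>j\<in>f ` T. slice_form a {t \<in> T. f t = i} {t \<in> T. f t = j})"
proof -
  have "slice_sum T \<xi> = (\<Sum>i\<in>f ` T. slice_sum {t \<in> T. f t = i} \<xi>)" for \<xi>
    unfolding slice_sum_def by (rule sum.image_gen[OF finite_T])
  then have eq: "of_real (exp (- a * norm \<xi>)) * slice_sum T \<xi> * cnj (slice_sum T \<xi>)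
     = (\<Sum>i\<in>f ` T. \<Sum>j\<in>f ` T. of_real (exp (- a * norm \<xi>)) * slice_sum {t \<in> T. f t = i} \<xi> * cnj (slice_sum {t \<in> T. f t = j} \<xi>))" for \<xi>
    by (simp add: sum_distrib_left sum_distrib_right mult.assoc) (rule sum.swap)
  have int: "integrable lborel (\<lambda>\<xi>. of_real (exp (- a * norm \<xi>)) * slice_sum {t \<in> T. f t = i} \<xi> * cnj (slice_sum {t \<in> T. f t = j} \<xi>))" for i j
    by (intro integrable_slice_product a) auto
  show ?thesis
    unfolding slice_form_def eq
    by (simp only: Bochner_Integration.integral_sum int Bochner_Integration.integrable_sum)
qed

end

context disjoint_slices
begin

text \<open>Time is cut into blocks of length a / 2. Pairs of blocks with numbers at most N apart
  are reduced to the diagonal, all others see the kernel bound D. The 12 is 2 * 3 * 2: two diagonal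
  terms per near pair, at most 2 N + 1 \<le> 3 N neighbours, and the 2 of Schur's test.\<close>

lemma slice_form_bound:
  assumes a: "a > 0" and K0: "K0 \<ge> 0" and D: "D \<ge> 0" and N: "N \<ge> 1"
    and near: "\<And>t t' z. t \<in> T \<Longrightarrow> t' \<in> T \<Longrightarrow> \<bar>t - t'\<bar> \<le> a / 2 \<Longrightarrow>
      norm (fourier (wave_weight a (t - t')) (z::'a)) \<le> K0 * norm (fourier (wave_weight a 0) z)"
    and far: "\<And>t t' z. t \<in> T \<Longrightarrow> t' \<in> T \<Longrightarrow> \<bar>t - t'\<bar> \<ge> real N * (a / 2) \<Longrightarrow> \<lfloor>2 * t / a\<rfloor> \<noteq> \<lfloor>2 * t' / a\<rfloor> \<Longrightarrow>
      norm (fourier (wave_weight a (t - t')) (z::'a)) \<le> D"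
  shows "norm (slice_form a T T) \<le> 12 * K0 * (2 * pi) ^ DIM('a) * real N * slice_measure T + D * (slice_measure T)\<^sup>2"
proof -
  define f where "f t = \<lfloor>2 * t / a\<rfloor>" for t
  define M where "M = f ` T"
  define S where "S i = {t \<in> T. f t = i}" for i
  define e where "e i = slice_measure (S i)" for i
  define L where "L = 2 * K0 * (2 * pi) ^ DIM('a)"
  have L: "L \<ge> 0" using K0 by (simp add: L_def)
  have M: "finite M" using finite_T by (simp add: M_def)
  have S: "S i \<subseteq> T" for i by (auto simp: S_def)
  have e0: "e i \<ge> 0" for i by (simp add: e_def slice_measure_nonneg)
  have "(\<Union>i\<in>M. S i) = T" by (auto simp: M_def S_def)
  moreover have "disjoint_family_on S M" by (auto simp: disjoint_family_on_def S_def)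
  ultimately have esum: "slice_measure T = (\<Sum>i\<in>M. e i)"
    using slice_measure_UN[OF M, of S] S by (simp add: e_def)
  have scale: "\<bar>t - t'\<bar> = \<bar>2 * t / a - 2 * t' / a\<bar> * (a / 2)" for t t'
  proof -
    have "2 * t / a - 2 * t' / a = (t - t') / (a / 2)" using a by (simp add: field_simps)
    moreover have "\<bar>(t - t') / (a / 2)\<bar> * (a / 2) = \<bar>t - t'\<bar>"
      using a by (subst abs_divide) simp
    ultimately show ?thesis by simp
  qed
  have diag: "norm (slice_form a (S i) (S i)) \<le> L * e i" for i
    unfolding L_def e_def
  proof (rule slice_form_near[OF a S K0])
    fix t t' :: real and z :: 'a assume t: "t \<in> S i" "t' \<in> S i"
    then have "f t = f t'" by (simp add: S_def)
    then have "\<bar>2 * t / a - 2 * t' / a\<bar> \<le> 1"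
      unfolding f_def by linarith
    then have "\<bar>2 * t / a - 2 * t' / a\<bar> * (a / 2) \<le> 1 * (a / 2)"
      using a by (intro mult_right_mono) auto
    then have le: "\<bar>t - t'\<bar> \<le> a / 2"
      by (simp only: scale[symmetric] mult_1_left)
    have tt: "t \<in> T" "t' \<in> T" using t S by auto
    show "norm (fourier (wave_weight a (t - t')) z) \<le> K0 * norm (fourier (wave_weight a 0) z)"
      by (rule near[OF tt le])
  qed
  \<comment> \<open>Numbers that differ by more than N differ by at least N + 1, and rounding down
    changes a difference by less than 1; this leaves the distance N a / 2.\<close>
  have off: "norm (slice_form a (S i) (S j)) \<le> D * (e i * e j)" if ij: "\<bar>i - j\<bar> > int N" for i j
    unfolding e_def
  proof (rule slice_form_far[OF a S S D])
    fix t t' :: real and z :: 'a assume t: "t \<in> S i" "t' \<in> S j"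
    then have ft: "f t = i" "f t' = j" by (auto simp: S_def)
    have "int N + 1 \<le> \<bar>f t - f t'\<bar>" using ij ft by simp
    then have "real N + 1 \<le> \<bar>of_int (f t) - of_int (f t')\<bar>"
      using of_int_le_iff[of "int N + 1" "\<bar>f t - f t'\<bar>", where 'a = real] by simp
    then have "real N \<le> \<bar>2 * t / a - 2 * t' / a\<bar>"
      unfolding f_def using floor_correct[of "2 * t / a"] floor_correct[of "2 * t' / a"] by linarith
    then have "real N * (a / 2) \<le> \<bar>2 * t / a - 2 * t' / a\<bar> * (a / 2)"
      using a by (intro mult_right_mono) auto
    then have ge: "\<bar>t - t'\<bar> \<ge> real N * (a / 2)"
      by (simp only: scale[symmetric])
    have ne: "\<lfloor>2 * t / a\<rfloor> \<noteq> \<lfloor>2 * t' / a\<rfloor>" using ij ft unfolding f_def by auto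
    have tt: "t \<in> T" "t' \<in> T" using t S by auto
    show "norm (fourier (wave_weight a (t - t')) z) \<le> D"
      by (rule far[OF tt ge ne])
  qed
  have pair: "norm (slice_form a (S i) (S j)) \<le> (if \<bar>i - j\<bar> \<le> int N then L * e i else 0) + (if \<bar>i - j\<bar> \<le> int N then L * e j else 0) + D * (e i * e j)" for i j
  proof (cases "\<bar>i - j\<bar> \<le> int N")
    case True
    have "norm (slice_form a (S i) (S j)) \<le> L * e i + L * e j"
      using slice_form_Cauchy_Schwarz[OF a S S, of i j] diag[of i] diag[of j] by linarith
    moreover have "0 \<le> D * (e i * e j)" using D e0 by simp
    ultimately show ?thesis using True by simp
  qed (use off in auto)
  have count: "(\<Sum>j\<in>M. if \<bar>i - j\<bar> \<le> int N then c else 0) \<le> 3 * real N * c" if c: "c \<ge> 0" for i and c :: real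
  proof -
    have "(\<Sum>j\<in>M. if \<bar>i - j\<bar> \<le> int N then c else 0) = (\<Sum>j\<in>{j \<in> M. \<bar>i - j\<bar> \<le> int N}. c)"
      by (rule sum.inter_filter[OF M, symmetric])
    also have "\<dots> \<le> (\<Sum>j\<in>{i - int N..i + int N}. c)"
      using c by (intro sum_mono2) auto
    also have "\<dots> = (2 * real N + 1) * c" by simp
    also have "\<dots> \<le> 3 * real N * c" using N c by (intro mult_right_mono) auto
    finally show ?thesis .
  qed
  have "slice_form a T T = (\<Sum>i\<in>M. \<Sum>j\<in>M. slice_form a (S i) (S j))"
    unfolding M_def S_def by (rule slice_form_partition[OF a])
  then have "norm (slice_form a T T) \<le> (\<Sum>i\<in>M. \<Sum>j\<in>M. norm (slice_form a (S i) (S j)))"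
    by (simp only:) (intro order_trans[OF norm_sum] sum_mono norm_sum)
  also have "\<dots> \<le> (\<Sum>i\<in>M. \<Sum>j\<in>M. (if \<bar>i - j\<bar> \<le> int N then L * e i else 0) + (if \<bar>i - j\<bar> \<le> int N then L * e j else 0) + D * (e i * e j))"
    by (intro sum_mono pair)
  also have "\<dots> = (\<Sum>i\<in>M. \<Sum>j\<in>M. if \<bar>i - j\<bar> \<le> int N then L * e i else 0) + (\<Sum>i\<in>M. \<Sum>j\<in>M. if \<bar>i - j\<bar> \<le> int N then L * e j else 0)
       + (\<Sum>i\<in>M. \<Sum>j\<in>M. D * (e i * e j))"
    by (simp only: sum.distrib)
  also have "(\<Sum>i\<in>M. \<Sum>j\<in>M. if \<bar>i - j\<bar> \<le> int N then L * e j else 0) = (\<Sum>i\<in>M. \<Sum>j\<in>M. if \<bar>i - j\<bar> \<le> int N then L * e i else 0)"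
    by (subst sum.swap) (simp only: abs_minus_commute)
  also have "(\<Sum>i\<in>M. \<Sum>j\<in>M. D * (e i * e j)) = D * (slice_measure T)\<^sup>2"
    unfolding esum power2_eq_square sum_product by (simp only: sum_distrib_left)
  also have "(\<Sum>i\<in>M. \<Sum>j\<in>M. if \<bar>i - j\<bar> \<le> int N then L * e i else 0) \<le> (\<Sum>i\<in>M. 3 * real N * (L * e i))"
    by (intro sum_mono count mult_nonneg_nonneg L e0)
  also have "\<dots> = 3 * real N * L * slice_measure T"
    unfolding esum by (simp only: sum_distrib_left mult.assoc)
  finally show ?thesis by (simp add: L_def algebra_simps)
qed

end

section \<open>Weak type estimates for a frequency localised wave\<close>

text \<open>The T T* argument by duality: \<alpha> times the measure of E is at most the integral of
  the selected evolution against its phase, that is, the pairing of \<open>slice_sum\<close> with G.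
  Cauchy-Schwarz then separates the form, bounded by Q, from the L2 norm of G.\<close>

lemma linearised_maximal_bound:
  fixes G :: "'a::euclidean_space \<Rightarrow> complex"
  assumes G: "integrable lborel G" "sqnorm G < \<infinity>" and supp: "\<And>\<xi>. G \<xi> \<noteq> 0 \<Longrightarrow> norm \<xi> \<le> l"
    and l: "l > 0" and T: "finite T" and \<alpha>: "\<alpha> > 0"
    and E [measurable]: "E \<in> sets borel" and fin: "emeasure lborel E < \<infinity>"
    and sub: "E \<subseteq> {x. \<exists>t\<in>T. \<alpha> < norm (fourier (\<lambda>\<xi>. cis (t * norm \<xi>) * G \<xi>) x)}"
    and Q: "\<And>E' \<omega>. disjoint_slices T E' \<omega> \<Longrightarrow> (\<Union>t\<in>T. E' t) = E \<Longrightarrow> norm (disjoint_slices.slice_form \<omega> (1 / l) T T) \<le> Q"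
  shows "(\<alpha> * measure lborel E)\<^sup>2 \<le> Q * (exp 1 * enn2real (sqnorm G))"
proof -
  have [measurable]: "G \<in> borel_measurable borel" using G by auto
  define F where "F t = (\<lambda>\<xi>. cis (t * norm \<xi>) * G \<xi>)" for t
  have [measurable]: "F t \<in> borel_measurable borel" for t unfolding F_def by measurable
  have Fi: "integrable lborel (F t)" for t
    unfolding F_def by (intro integrable_cis_mult G) measurable
  define v where "v t = fourier (F t)" for t
  have [measurable]: "v t \<in> borel_measurable borel" for t unfolding v_def by measurable
  define B where "B = (LINT \<xi>|lborel. norm (G \<xi>))"
  have v_le: "norm (v t x) \<le> B" for t x
    unfolding v_def B_def using norm_fourier_le[OF Fi[of t], of x] by (simp add: F_def norm_mult)
  have B0: "B \<ge> 0" unfolding B_def by simp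
  \<comment> \<open>Selecting the least time in T that exceeds the threshold makes the slices
    disjoint while they still exhaust E.\<close>
  define E' where "E' t = (if t \<in> T then {x \<in> E. \<alpha> < norm (v t x) \<and> (\<forall>s\<in>T. s < t \<longrightarrow> norm (v s x) \<le> \<alpha>)} else {})" for t
  have E'_sets [measurable]: "E' t \<in> sets borel" for t
  proof -
    have "{x \<in> E. \<alpha> < norm (v t x) \<and> (\<forall>s\<in>T. s < t \<longrightarrow> norm (v s x) \<le> \<alpha>)}
       = E \<inter> {x. \<alpha> < norm (v t x)} \<inter> (\<Inter>s\<in>T. {x. s < t \<longrightarrow> norm (v s x) \<le> \<alpha>})" by auto
    moreover have "{x. \<alpha> < norm (v t x)} \<in> sets borel" by measurable
    moreover have "(\<Inter>s\<in>T. {x. s < t \<longrightarrow> norm (v s x) \<le> \<alpha>}) \<in> sets borel"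
    proof (cases "T = {}")
      case False
      have "{x. s < t \<longrightarrow> norm (v s x) \<le> \<alpha>} \<in> sets borel" for s by measurable
      then show ?thesis using T False by (intro sets.finite_INT) auto
    qed simp
    ultimately show ?thesis unfolding E'_def using E by auto
  qed
  have UE: "(\<Union>t\<in>T. E' t) = E"
  proof
    show "(\<Union>t\<in>T. E' t) \<subseteq> E" by (auto simp: E'_def)
    show "E \<subseteq> (\<Union>t\<in>T. E' t)"
    proof
      fix x assume x: "x \<in> E"
      define A where "A = {t \<in> T. \<alpha> < norm (v t x)}"
      have A: "finite A" "A \<noteq> {}" using T sub x by (auto simp: A_def v_def F_def)
      then have "Min A \<in> A" by (rule Min_in)
      moreover have "norm (v s x) \<le> \<alpha>" if "s \<in> T" "s < Min A" for s
        using Min_le[OF A(1), of s] that by (force simp: A_def)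
      ultimately have "x \<in> E' (Min A)" "Min A \<in> T" using x by (auto simp: E'_def A_def)
      then show "x \<in> (\<Union>t\<in>T. E' t)" by blast
    qed
  qed
  \<comment> \<open>The conjugate phase turns the integrand into |v|; where v vanishes, division by
    zero gives the value 0.\<close>
  define \<omega> where "\<omega> t x = of_real (indicator (E' t) x) * (cnj (v t x) / of_real (norm (v t x)))" for t x
  have slices: "disjoint_slices T E' \<omega>"
  proof
    show "emeasure lborel (E' t) < \<infinity>" if "t \<in> T" for t
      using le_less_trans[OF emeasure_mono[of "E' t" E] fin] by (auto simp: E'_def)
    show "disjoint_family_on E' T"
      unfolding disjoint_family_on_def
    proof (intro ballI impI)
      fix s t assume "s \<in> T" "t \<in> T" "s \<noteq> t"
      then show "E' s \<inter> E' t = {}" by (cases "s < t") (fastforce simp: E'_def not_less)+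
    qed
    show "\<omega> t \<in> borel_measurable borel" for t unfolding \<omega>_def[abs_def] by measurable
    show "norm (\<omega> t x) \<le> indicat_real (E' t) x" for t x
      by (auto simp: \<omega>_def norm_mult norm_divide indicator_def divide_le_eq)
  qed (use T in auto)
  interpret disjoint_slices T E' \<omega> by (rule slices)
  have mE: "slice_measure T = measure lborel E" unfolding slice_measure_def UE ..
  have \<omega>v: "\<omega> t x * v t x = complex_of_real (indicator (E' t) x * norm (v t x))" for t x
  proof -
    have e: "cnj (v t x) / of_real (norm (v t x)) * v t x = of_real (norm (v t x))"
    proof (cases "v t x = 0")
      case False
      have "cnj (v t x) * v t x = of_real (norm (v t x)) * of_real (norm (v t x))"
        using complex_norm_square[of "v t x"] by (simp add: power2_eq_square mult.commute)
      then show ?thesis using False by (simp add: field_simps)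
    qed simp
    show ?thesis unfolding \<omega>_def mult.assoc e of_real_mult ..
  qed
  have ind_int: "integrable lborel (\<lambda>x. indicat_real (E' t) x * norm (v t x))" if "t \<in> T" for t
  proof (rule Bochner_Integration.integrable_bound)
    show "integrable lborel (\<lambda>x. B * indicat_real (E' t) x)"
      using E_fin[OF that] by (intro integrable_mult_right) (simp add: integrable_indicator_iff)
    show "AE x in lborel. norm (indicat_real (E' t) x * norm (v t x)) \<le> norm (B * indicat_real (E' t) x)"
      using v_le B0 by (auto simp: indicator_def)
  qed measurable
  have "\<alpha> * measure lborel E = \<alpha> * (\<Sum>t\<in>T. measure lborel (E' t))"
  proof -
    have "measure lborel (\<Union>t\<in>T. E' t) = (\<Sum>t\<in>T. measure lborel (E' t))"
      using E_fin disj T by (intro measure_finite_Union) (auto simp: less_top)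
    then show ?thesis unfolding UE by simp
  qed
  also have "\<dots> = (\<Sum>t\<in>T. LINT x|lborel. \<alpha> * indicat_real (E' t) x)"
    by (simp add: sum_distrib_left)
  also have "\<dots> \<le> (\<Sum>t\<in>T. LINT x|lborel. indicat_real (E' t) x * norm (v t x))"
  proof (intro sum_mono integral_mono)
    fix t assume t: "t \<in> T"
    show "integrable lborel (\<lambda>x. \<alpha> * indicat_real (E' t) x)"
      using E_fin[OF t] by (intro integrable_mult_right) (simp add: integrable_indicator_iff)
    show "integrable lborel (\<lambda>x. indicat_real (E' t) x * norm (v t x))" by (rule ind_int[OF t])
    show "\<alpha> * indicat_real (E' t) x \<le> indicat_real (E' t) x * norm (v t x)" for x
      by (auto simp: indicator_def E'_def)
  qed
  also have "\<dots> \<le> norm (complex_of_real (\<Sum>t\<in>T. LINT x|lborel. indicat_real (E' t) x * norm (v t x)))"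
    by (simp del: of_real_sum)
  also have "complex_of_real (\<Sum>t\<in>T. LINT x|lborel. indicat_real (E' t) x * norm (v t x)) = (\<Sum>t\<in>T. LINT x|lborel. \<omega> t x * v t x)"
    unfolding \<omega>v integral_complex_of_real by simp
  also have "\<dots> = (\<Sum>t\<in>T. LINT \<xi>|lborel. fourier (\<omega> t) \<xi> * F t \<xi>)"
    unfolding v_def by (intro sum.cong refl fourier_mult_formula \<omega>_integrable Fi)
  also have "\<dots> = (LINT \<xi>|lborel. (\<Sum>t\<in>T. fourier (\<omega> t) \<xi> * F t \<xi>))"
  proof (rule Bochner_Integration.integral_sum[symmetric])
    fix t assume "t \<in> T"
    then show "integrable lborel (\<lambda>\<xi>. fourier (\<omega> t) \<xi> * F t \<xi>)"
      using integrable_mult_fourier[OF Fi[of t] \<omega>_integrable[of t]] by (simp add: mult.commute)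
  qed
  \<comment> \<open>The weight is inserted as two reciprocal halves. The square of the decaying half
    is the weight of \<open>slice_form\<close>; the square of the growing half is at most e on the
    support |\<xi>| \<le> l.\<close>
  also have "(\<lambda>\<xi>. \<Sum>t\<in>T. fourier (\<omega> t) \<xi> * F t \<xi>) = (\<lambda>\<xi>. (of_real (exp (- (1 / l) * norm \<xi> / 2)) * slice_sum T \<xi>) * (of_real (exp ((1 / l) * norm \<xi> / 2)) * G \<xi>))"
  proof
    fix \<xi> :: 'a
    have e1: "complex_of_real (exp (- (1 / l) * norm \<xi> / 2)) * of_real (exp ((1 / l) * norm \<xi> / 2)) = 1"
      unfolding of_real_mult[symmetric] mult_exp_exp by simp
    have "(of_real (exp (- (1 / l) * norm \<xi> / 2)) * slice_sum T \<xi>) * (of_real (exp ((1 / l) * norm \<xi> / 2)) * G \<xi>)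
       = (complex_of_real (exp (- (1 / l) * norm \<xi> / 2)) * of_real (exp ((1 / l) * norm \<xi> / 2))) * (slice_sum T \<xi> * G \<xi>)"
      by (simp only: mult_ac)
    also have "\<dots> = slice_sum T \<xi> * G \<xi>"
      by (simp only: e1 mult_1_left)
    finally have "(of_real (exp (- (1 / l) * norm \<xi> / 2)) * slice_sum T \<xi>) * (of_real (exp ((1 / l) * norm \<xi> / 2)) * G \<xi>) = slice_sum T \<xi> * G \<xi>" .
    then show "(\<Sum>t\<in>T. fourier (\<omega> t) \<xi> * F t \<xi>) = (of_real (exp (- (1 / l) * norm \<xi> / 2)) * slice_sum T \<xi>) * (of_real (exp ((1 / l) * norm \<xi> / 2)) * G \<xi>)"
      by (simp only: slice_sum_def sum_distrib_right F_def) (simp add: mult_ac)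
  qed
  finally have le: "\<alpha> * measure lborel E \<le> norm (LINT \<xi>|lborel. (of_real (exp (- (1 / l) * norm \<xi> / 2)) * slice_sum T \<xi>) * (of_real (exp ((1 / l) * norm \<xi> / 2)) * G \<xi>))" .
  have "ennreal ((\<alpha> * measure lborel E)\<^sup>2) \<le> ennreal ((norm (LINT \<xi>|lborel. (of_real (exp (- (1 / l) * norm \<xi> / 2)) * slice_sum T \<xi>) * (of_real (exp ((1 / l) * norm \<xi> / 2)) * G \<xi>)))\<^sup>2)"
    using le \<alpha> by (intro ennreal_leI power_mono) auto
  also have "\<dots> \<le> sqnorm (\<lambda>\<xi>. of_real (exp (- (1 / l) * norm \<xi> / 2)) * slice_sum T \<xi>) * sqnorm (\<lambda>\<xi>. of_real (exp ((1 / l) * norm \<xi> / 2)) * G \<xi>)"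
    by (rule integral_mult_power2_le) measurable
  also have "sqnorm (\<lambda>\<xi>. of_real (exp (- (1 / l) * norm \<xi> / 2)) * slice_sum T \<xi>) = ennreal (LINT \<xi>|lborel. exp (- (1 / l) * norm \<xi>) * (norm (slice_sum T \<xi>))\<^sup>2)"
  proof -
    have "(norm (of_real (exp (- (1 / l) * norm \<xi> / 2)) * slice_sum T \<xi>))\<^sup>2 = exp (- (1 / l) * norm \<xi>) * (norm (slice_sum T \<xi>))\<^sup>2" for \<xi>
      by (simp add: norm_mult power_mult_distrib exp_double[symmetric])
    then show ?thesis
      unfolding sqnorm_def using l by (simp only:) (intro nn_integral_eq_integral integrable_slice_square; simp)
  qed
  also have "(LINT \<xi>|lborel. exp (- (1 / l) * norm \<xi>) * (norm (slice_sum T \<xi>))\<^sup>2) = norm (slice_form (1 / l) T T)"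
    by (rule norm_slice_form_diag[symmetric])
  also have "ennreal (norm (slice_form (1 / l) T T)) * sqnorm (\<lambda>\<xi>. of_real (exp ((1 / l) * norm \<xi> / 2)) * G \<xi>) \<le> ennreal Q * (ennreal (exp 1) * sqnorm G)"
  proof (intro mult_mono ennreal_leI Q[OF slices UE])
    have "(norm (of_real (exp ((1 / l) * norm \<xi> / 2)) * G \<xi>))\<^sup>2 \<le> exp 1 * (norm (G \<xi>))\<^sup>2" for \<xi>
    proof (cases "G \<xi> = 0")
      case False
      then have "(1 / l) * norm \<xi> \<le> 1" using supp[OF False] l by simp
      then show ?thesis
        by (simp add: norm_mult power_mult_distrib exp_double[symmetric] mult_right_mono)
    qed simp
    then have "sqnorm (\<lambda>\<xi>. of_real (exp ((1 / l) * norm \<xi> / 2)) * G \<xi>) \<le> (\<integral>\<^sup>+\<xi>. ennreal (exp 1 * (norm (G \<xi>))\<^sup>2) \<partial>lborel)"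
      unfolding sqnorm_def by (intro nn_integral_mono ennreal_leI)
    also have "\<dots> = ennreal (exp 1) * sqnorm G"
      by (simp add: ennreal_mult nn_integral_cmult sqnorm_def)
    finally show "sqnorm (\<lambda>\<xi>. of_real (exp ((1 / l) * norm \<xi> / 2)) * G \<xi>) \<le> ennreal (exp 1) * sqnorm G" .
  qed auto
  also have "\<dots> = ennreal (Q * (exp 1 * enn2real (sqnorm G)))"
  proof -
    have "Q \<ge> 0" using order_trans[OF norm_ge_zero Q[OF slices UE]] .
    moreover have "sqnorm G = ennreal (enn2real (sqnorm G))" using G(2) by simp
    ultimately show ?thesis by (metis ennreal_mult enn2real_nonneg exp_ge_zero mult_nonneg_nonneg)
  qed
  finally show ?thesis
    using order_trans[OF norm_ge_zero Q[OF slices UE]] by (subst (asm) ennreal_le_iff) auto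
qed

text \<open>Three regimes at scale a = 1 / l: in the first all pairs of times count as near, in the
  second the evolution is bounded in the sup norm instead of through the form, and in the third the
  number N of near blocks is free.\<close>

lemma weak_type_bounds:
  obtains K where "K > 0"
    and "\<And>(G :: 'a::euclidean_space \<Rightarrow> complex) l T \<alpha> E. integrable lborel G \<Longrightarrow> sqnorm G < \<infinity> \<Longrightarrow> (\<And>\<xi>. G \<xi> \<noteq> 0 \<Longrightarrow> norm \<xi> \<le> l) \<Longrightarrow> l \<ge> 1 \<Longrightarrow>
      finite T \<Longrightarrow> T \<subseteq> {0..1} \<Longrightarrow> \<alpha> > 0 \<Longrightarrow> E \<in> sets borel \<Longrightarrow> emeasure lborel E < \<infinity> \<Longrightarrow>
      E \<subseteq> {x. \<exists>t\<in>T. \<alpha> < norm (fourier (\<lambda>\<xi>. cis (t * norm \<xi>) * G \<xi>) x)} \<Longrightarrow>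
      \<alpha>\<^sup>2 * measure lborel E \<le> K * enn2real (sqnorm G) * l \<and>
      \<alpha>\<^sup>2 * measure lborel E \<le> K * enn2real (sqnorm G) * (l powr real DIM('a) * measure lborel E) \<and>
      (\<forall>N\<ge>1. \<alpha>\<^sup>2 * measure lborel E \<le> K * enn2real (sqnorm G) * (real N + l powr real DIM('a) * real N powr (- (real DIM('a) - 1) / 2) * measure lborel E))"
proof -
  let ?d = "real DIM('a)"
  obtain C where C: "C > 0"
    and far: "\<And>a t (x::'a). a > 0 \<Longrightarrow> t \<noteq> 0 \<Longrightarrow>
      norm (fourier (wave_weight a t) x) \<le> C * a powr (- (?d + 1) / 2) * \<bar>t\<bar> powr (- (?d - 1) / 2)"
    and near: "\<And>a t (x::'a). a > 0 \<Longrightarrow> \<bar>t\<bar> \<le> a / 2 \<Longrightarrow>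
      norm (fourier (wave_weight a t) x) \<le> C * norm (fourier (wave_weight a 0) x)"
    and zero: "\<And>a. a > 0 \<Longrightarrow> norm (fourier (wave_weight a 0) (0::'a)) \<le> C * a powr (- ?d)"
    by (rule wave_kernel_bounds[where 'a='a]) (rule that; assumption)
  \<comment> \<open>c1 is the constant of \<open>slice_form_bound\<close> with K0 = C; c2 combines
    the dispersive constant with the 2 of the block length 1 / (2 l).\<close>
  define c1 where "c1 = 12 * C * (2 * pi) ^ DIM('a)"
  define c2 where "c2 = C * 2 powr ((?d - 1) / 2)"
  define K where "K = exp 1 * (4 * c1 + c2 + C)"
  have c: "c1 > 0" "c2 > 0" using C by (auto simp: c1_def c2_def)
  have K: "K > 0" using C c by (simp add: K_def)
  show ?thesis
  proof (rule that[OF K])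
    fix G :: "'a \<Rightarrow> complex" and l :: real and T :: "real set" and \<alpha> :: real and E :: "'a set"
    assume G: "integrable lborel G" "sqnorm G < \<infinity>" and supp: "\<And>\<xi>. G \<xi> \<noteq> 0 \<Longrightarrow> norm \<xi> \<le> l"
      and l: "l \<ge> 1" and T: "finite T" "T \<subseteq> {0..1}" and \<alpha>: "\<alpha> > 0"
      and E: "E \<in> sets borel" "emeasure lborel E < \<infinity>"
      and sub: "E \<subseteq> {x. \<exists>t\<in>T. \<alpha> < norm (fourier (\<lambda>\<xi>. cis (t * norm \<xi>) * G \<xi>) x)}"
    let ?m = "measure lborel E" and ?g = "enn2real (sqnorm G)" and ?a = "1 / l"
    have a: "?a > 0" using l by simp
    have [measurable]: "G \<in> borel_measurable borel" using G by auto
    \<comment> \<open>One factor of the measure cancels; for a null set E the claim is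
      trivial.\<close>
    have div: "\<alpha>\<^sup>2 * ?m \<le> exp 1 * ?g * q" if le: "(\<alpha> * ?m)\<^sup>2 \<le> q * ?m * (exp 1 * ?g)" and q: "q \<ge> 0" for q
    proof (cases "?m = 0")
      case True
      then show ?thesis using q by simp
    next
      case False
      then have m: "?m > 0" using zero_less_measure_iff by auto
      have "(\<alpha>\<^sup>2 * ?m) * ?m \<le> (exp 1 * ?g * q) * ?m" using le by (simp add: power2_eq_square mult_ac)
      then show ?thesis using m by (simp only: mult_le_cancel_right_pos)
    qed
    have form: "norm (disjoint_slices.slice_form \<omega> ?a T T) \<le> c1 * real N * ?m + D * ?m\<^sup>2"
      if "disjoint_slices T E' \<omega>" "(\<Union>t\<in>T. E' t) = E" "N \<ge> 1" "D \<ge> 0"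
        "\<And>t t' z. t \<in> T \<Longrightarrow> t' \<in> T \<Longrightarrow> \<bar>t - t'\<bar> \<ge> real N * (?a / 2) \<Longrightarrow> norm (fourier (wave_weight ?a (t - t')) (z::'a)) \<le> D"
      for E' \<omega> N D
    proof -
      interpret disjoint_slices T E' \<omega> by fact
      have "slice_measure T = ?m" unfolding slice_measure_def that(2) ..
      then show ?thesis
        using slice_form_bound[OF a less_imp_le[OF C] that(4,3)] near[OF a] that(5) unfolding c1_def by simp
    qed
    have lin: "(\<alpha> * ?m)\<^sup>2 \<le> Q * (exp 1 * ?g)"
      if "\<And>E' \<omega>. disjoint_slices T E' \<omega> \<Longrightarrow> (\<Union>t\<in>T. E' t) = E \<Longrightarrow> norm (disjoint_slices.slice_form \<omega> ?a T T) \<le> Q" for Q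
      using linearised_maximal_bound[OF G supp _ T(1) \<alpha> E sub that] l by simp
    have g0: "?g \<ge> 0" by simp
    have 1: "\<alpha>\<^sup>2 * ?m \<le> K * ?g * l"
    proof -
      \<comment> \<open>N blocks of length 1 / (2 l) are longer than the unit interval, so no pair
        of times is distant and D = 0 is admissible. The bound by 4 l uses l \<ge> 1.\<close>
      define N where "N = nat \<lceil>2 * l\<rceil> + 1"
      have N: "N \<ge> 1" "real N > 2 * l" "real N \<le> 4 * l" using l unfolding N_def by linarith+
      have "(\<alpha> * ?m)\<^sup>2 \<le> (c1 * real N * ?m) * (exp 1 * ?g)"
      proof (rule lin)
        fix E' \<omega> assume s: "disjoint_slices T E' \<omega>" "(\<Union>t\<in>T. E' t) = E"
        have "norm (disjoint_slices.slice_form \<omega> ?a T T) \<le> c1 * real N * ?m + 0 * ?m\<^sup>2"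
        proof (rule form[OF s N(1)])
          fix t t' :: real and z :: 'a assume t: "t \<in> T" "t' \<in> T" "\<bar>t - t'\<bar> \<ge> real N * (?a / 2)"
          have "\<bar>t - t'\<bar> \<le> 1" using t T(2) by (auto simp: abs_le_iff subset_iff) (smt (verit))+
          moreover have "real N * (?a / 2) > 1" using N l by (simp add: field_simps)
          ultimately show "norm (fourier (wave_weight ?a (t - t')) (z::'a)) \<le> 0" using t(3) by linarith
        qed simp
        then show "norm (disjoint_slices.slice_form \<omega> ?a T T) \<le> c1 * real N * ?m" by simp
      qed
      then have "\<alpha>\<^sup>2 * ?m \<le> exp 1 * ?g * (c1 * real N)" using c by (intro div) auto
      also have "\<dots> \<le> exp 1 * ?g * (c1 * (4 * l))" using N c by (intro mult_left_mono) auto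
      also have "\<dots> = (exp 1 * (4 * c1)) * (?g * l)" by simp
      also have "\<dots> \<le> K * (?g * l)" unfolding K_def using c C l by (intro mult_right_mono) auto
      finally show ?thesis by (simp add: mult.assoc)
    qed
    \<comment> \<open>A Bernstein inequality: if E is nonempty, \<alpha> is below the L1 norm of G.
      Cauchy-Schwarz bounds that norm with the help of the weight, whose integral is the kernel at
      the origin and so of order l^d.\<close>
    have 2: "\<alpha>\<^sup>2 * ?m \<le> K * ?g * (l powr ?d * ?m)"
    proof (cases "E = {}")
      case False
      then obtain x t where t: "\<alpha> < norm (fourier (\<lambda>\<xi>. cis (t * norm \<xi>) * G \<xi>) x)" using sub by blast
      also have "\<dots> \<le> (LINT \<xi>|lborel. norm (cis (t * norm \<xi>) * G \<xi>))"
        by (intro norm_fourier_le integrable_cis_mult G) measurable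
      also have "\<dots> = norm (LINT \<xi>|lborel. complex_of_real (norm (G \<xi>)))"
        by (simp add: norm_mult)
      also have "(LINT \<xi>|lborel. complex_of_real (norm (G \<xi>))) = (LINT \<xi>|lborel. of_real (exp (- ?a * norm \<xi> / 2)) * (of_real (exp (?a * norm \<xi> / 2)) * of_real (norm (G \<xi>))))"
      proof (intro Bochner_Integration.integral_cong refl)
        fix \<xi> :: 'a
        have "complex_of_real (exp (- ?a * norm \<xi> / 2)) * of_real (exp (?a * norm \<xi> / 2)) = 1"
          unfolding of_real_mult[symmetric] mult_exp_exp by simp
        then show "complex_of_real (norm (G \<xi>)) = of_real (exp (- ?a * norm \<xi> / 2)) * (of_real (exp (?a * norm \<xi> / 2)) * of_real (norm (G \<xi>)))"
          by (simp only: mult.assoc[symmetric] mult_1_left)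
      qed
      finally have "\<alpha> \<le> norm (LINT \<xi>|lborel. of_real (exp (- ?a * norm \<xi> / 2)) * (complex_of_real (exp (?a * norm \<xi> / 2)) * of_real (norm (G \<xi>))))" by simp
      then have "ennreal (\<alpha>\<^sup>2) \<le> ennreal ((norm (LINT \<xi>|lborel. of_real (exp (- ?a * norm \<xi> / 2)) * (complex_of_real (exp (?a * norm \<xi> / 2)) * of_real (norm (G \<xi>)))))\<^sup>2)"
        using \<alpha> by (intro ennreal_leI power_mono) auto
      also have "\<dots> \<le> sqnorm (\<lambda>\<xi>::'a. of_real (exp (- ?a * norm \<xi> / 2))) * sqnorm (\<lambda>\<xi>. complex_of_real (exp (?a * norm \<xi> / 2)) * of_real (norm (G \<xi>)))"
        by (rule integral_mult_power2_le) measurable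
      also have "\<dots> \<le> ennreal (C * ?a powr (- ?d)) * (ennreal (exp 1) * ennreal ?g)"
      proof (rule mult_mono)
        have "sqnorm (\<lambda>\<xi>::'a. of_real (exp (- ?a * norm \<xi> / 2))) = (\<integral>\<^sup>+\<xi>. ennreal (exp (- ?a * norm (\<xi>::'a))) \<partial>lborel)"
          unfolding sqnorm_def by (intro nn_integral_cong) (simp add: exp_double[symmetric])
        also have "\<dots> = ennreal (LINT \<xi>|lborel. exp (- ?a * norm (\<xi>::'a)))"
          by (intro nn_integral_eq_integral integrable_exp_norm a) auto
        also have "(LINT \<xi>|lborel. exp (- ?a * norm (\<xi>::'a))) = norm (fourier (wave_weight ?a 0) (0::'a))"
        proof -
          have "fourier (wave_weight ?a 0) (0::'a) = (LINT \<xi>|lborel. complex_of_real (exp (- ?a * norm (\<xi>::'a))))"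
            by (simp add: fourier_def wave_weight_def)
          then show ?thesis unfolding integral_complex_of_real norm_of_real by (simp add: integral_nonneg)
        qed
        finally show "sqnorm (\<lambda>\<xi>::'a. of_real (exp (- ?a * norm \<xi> / 2))) \<le> ennreal (C * ?a powr (- ?d))"
          using zero[OF a] by (simp add: ennreal_leI)
        have "(norm (complex_of_real (exp (?a * norm \<xi> / 2)) * of_real (norm (G \<xi>))))\<^sup>2 \<le> exp 1 * (norm (G \<xi>))\<^sup>2" for \<xi>
        proof (cases "G \<xi> = 0")
          case False
          then have "?a * norm \<xi> \<le> 1" using supp[OF False] l by simp
          then show ?thesis
            by (simp add: norm_mult power_mult_distrib exp_double[symmetric] mult_right_mono)
        qed simp
        then have "sqnorm (\<lambda>\<xi>. complex_of_real (exp (?a * norm \<xi> / 2)) * of_real (norm (G \<xi>))) \<le> (\<integral>\<^sup>+\<xi>. ennreal (exp 1 * (norm (G \<xi>))\<^sup>2) \<partial>lborel)"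
          unfolding sqnorm_def by (intro nn_integral_mono ennreal_leI)
        also have "\<dots> = ennreal (exp 1) * sqnorm G"
          by (simp add: ennreal_mult nn_integral_cmult sqnorm_def)
        also have "sqnorm G = ennreal ?g" using G(2) by simp
        finally show "sqnorm (\<lambda>\<xi>. complex_of_real (exp (?a * norm \<xi> / 2)) * of_real (norm (G \<xi>))) \<le> ennreal (exp 1) * ennreal ?g" .
      qed auto
      also have "\<dots> = ennreal (C * ?a powr (- ?d) * (exp 1 * ?g))"
        using C by (simp add: ennreal_mult)
      finally have "\<alpha>\<^sup>2 \<le> C * ?a powr (- ?d) * (exp 1 * ?g)" using C by (subst (asm) ennreal_le_iff) auto
      also have "?a powr (- ?d) = l powr ?d" using l by (simp add: powr_minus powr_divide)
      finally have "\<alpha>\<^sup>2 * ?m \<le> C * l powr ?d * (exp 1 * ?g) * ?m" by (intro mult_right_mono) auto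
      also have "\<dots> = (exp 1 * C) * (?g * (l powr ?d * ?m))" by simp
      also have "\<dots> \<le> K * (?g * (l powr ?d * ?m))" unfolding K_def using c C by (intro mult_right_mono) auto
      finally show ?thesis by (simp add: mult.assoc)
    qed simp
    have 3: "\<alpha>\<^sup>2 * ?m \<le> K * ?g * (real N + l powr ?d * real N powr (- (?d - 1) / 2) * ?m)" if N: "N \<ge> 1" for N
    proof -
      \<comment> \<open>The dispersive bound at the least distance N / (2 l) of distant times; the
        powers of l combine because (d + 1) / 2 + (d - 1) / 2 = d.\<close>
      define D where "D = c2 * (l powr ?d * real N powr (- (?d - 1) / 2))"
      have D0: "D \<ge> 0" using c by (simp add: D_def)
      have d1: "- (?d - 1) / 2 \<le> 0" by (simp add: Suc_le_eq)
      have Deq: "C * ?a powr (- (?d + 1) / 2) * (real N * (?a / 2)) powr (- (?d - 1) / 2) = D"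
      proof -
        have h1: "(real N * (?a / 2)) powr (- (?d - 1) / 2) = real N powr (- (?d - 1) / 2) * (?a powr (- (?d - 1) / 2) * (1 / 2) powr (- (?d - 1) / 2))"
          using l by (simp add: powr_mult[symmetric])
        have h2: "(1 / 2 :: real) powr (- (?d - 1) / 2) = 2 powr ((?d - 1) / 2)"
        proof -
          have "(1 / 2 :: real) powr (- x) = 2 powr x" for x
            by (simp add: powr_divide powr_minus_divide)
          then show ?thesis by (simp only: minus_divide_left[symmetric])
        qed
        have h3: "?a powr (- (?d + 1) / 2) * ?a powr (- (?d - 1) / 2) = l powr ?d"
        proof -
          have "- (?d + 1) / 2 + - (?d - 1) / 2 = - ?d" by (simp add: field_simps)
          then have "?a powr (- (?d + 1) / 2) * ?a powr (- (?d - 1) / 2) = ?a powr (- ?d)"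
            by (simp only: powr_add[symmetric])
          also have "\<dots> = l powr ?d" using l by (simp add: powr_minus powr_divide)
          finally show ?thesis .
        qed
        have "C * A1 * (Nn * (A2 * T2)) = C * T2 * ((A1 * A2) * Nn)" for A1 Nn A2 T2 :: real
          by (simp only: mult_ac)
        then show ?thesis unfolding D_def c2_def h1 by (simp only: h2 h3)
      qed
      have "(\<alpha> * ?m)\<^sup>2 \<le> (c1 * real N * ?m + D * ?m\<^sup>2) * (exp 1 * ?g)"
      proof (rule lin)
        fix E' \<omega> assume s: "disjoint_slices T E' \<omega>" "(\<Union>t\<in>T. E' t) = E"
        show "norm (disjoint_slices.slice_form \<omega> ?a T T) \<le> c1 * real N * ?m + D * ?m\<^sup>2"
        proof (rule form[OF s N D0])
          fix t t' :: real and z :: 'a assume t: "t \<in> T" "t' \<in> T" "\<bar>t - t'\<bar> \<ge> real N * (?a / 2)"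
          have pos: "real N * (?a / 2) > 0" using N l by simp
          then have "t - t' \<noteq> 0" using t(3) by auto
          from far[OF a this, of z] have "norm (fourier (wave_weight ?a (t - t')) z) \<le> C * ?a powr (- (?d + 1) / 2) * \<bar>t - t'\<bar> powr (- (?d - 1) / 2)" .
          also have "\<dots> \<le> C * ?a powr (- (?d + 1) / 2) * (real N * (?a / 2)) powr (- (?d - 1) / 2)"
            using C t(3) pos d1 by (intro mult_left_mono powr_mono2') auto
          also have "\<dots> = D" by (rule Deq)
          finally show "norm (fourier (wave_weight ?a (t - t')) z) \<le> D" .
        qed
      qed
      also have "\<dots> = (c1 * real N + D * ?m) * ?m * (exp 1 * ?g)" by (simp add: power2_eq_square algebra_simps)
      finally have f1: "\<alpha>\<^sup>2 * ?m \<le> exp 1 * ?g * (c1 * real N + D * ?m)" using c D0 by (intro div) auto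
      have "c1 * real N + D * ?m \<le> (4 * c1 + c2 + C) * real N + (4 * c1 + c2 + C) * (l powr ?d * real N powr (- (?d - 1) / 2) * ?m)"
        unfolding D_def mult.assoc using c C by (intro add_mono mult_right_mono) auto
      also have "\<dots> = (4 * c1 + c2 + C) * (real N + l powr ?d * real N powr (- (?d - 1) / 2) * ?m)"
        by (simp only: distrib_left)
      finally have "exp 1 * ?g * (c1 * real N + D * ?m) \<le> exp 1 * ?g * ((4 * c1 + c2 + C) * (real N + l powr ?d * real N powr (- (?d - 1) / 2) * ?m))"
        by (rule mult_left_mono) simp
      with f1 have "\<alpha>\<^sup>2 * ?m \<le> exp 1 * ?g * ((4 * c1 + c2 + C) * (real N + l powr ?d * real N powr (- (?d - 1) / 2) * ?m))"
        by (rule order_trans)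
      then show ?thesis unfolding K_def by (simp only: mult_ac)
    qed
    show "\<alpha>\<^sup>2 * ?m \<le> K * ?g * l \<and> \<alpha>\<^sup>2 * ?m \<le> K * ?g * (l powr ?d * ?m) \<and>
      (\<forall>N\<ge>1. \<alpha>\<^sup>2 * ?m \<le> K * ?g * (real N + l powr ?d * real N powr (- (?d - 1) / 2) * ?m))"
      using 1 2 3 by blast
  qed
qed

text \<open>Finite sets of times and sets E of finite measure keep the linearisation elementary;
  \<open>weak_type_maximal_fun\<close> passes to the full supremum. The type argument fixes the
  underlying space, which the numbers K, s and p do not determine.\<close>

definition weak_type :: "'a::euclidean_space itself \<Rightarrow> real \<Rightarrow> real \<Rightarrow> real \<Rightarrow> bool" where
  "weak_type _ K s p \<longleftrightarrow> (\<forall>(G :: 'a \<Rightarrow> complex) l T \<alpha> E. integrable lborel G \<longrightarrow> sqnorm G < \<infinity> \<longrightarrow>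
     (\<forall>\<xi>. G \<xi> \<noteq> 0 \<longrightarrow> norm \<xi> \<le> l) \<longrightarrow> l \<ge> 1 \<longrightarrow> finite T \<longrightarrow> T \<subseteq> {0..1} \<longrightarrow> \<alpha> > 0 \<longrightarrow>
     E \<in> sets borel \<longrightarrow> emeasure lborel E < \<infinity> \<longrightarrow>
     E \<subseteq> {x. \<exists>t\<in>T. \<alpha> < norm (fourier (\<lambda>\<xi>. cis (t * norm \<xi>) * G \<xi>) x)} \<longrightarrow>
     measure lborel E \<le> K * (l powr s * sqrt (enn2real (sqnorm G)) / \<alpha>) powr p)"

lemma weak_type_2:
  obtains K where "K > 0" "weak_type TYPE('a::euclidean_space) K (1 / 2) 2"
proof (rule weak_type_bounds[where 'a='a])
  fix K :: real
  assume K: "K > 0"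
    and w: "\<And>(G :: 'a \<Rightarrow> complex) l T \<alpha> E. integrable lborel G \<Longrightarrow> sqnorm G < \<infinity> \<Longrightarrow> (\<And>\<xi>. G \<xi> \<noteq> 0 \<Longrightarrow> norm \<xi> \<le> l) \<Longrightarrow> l \<ge> 1 \<Longrightarrow>
      finite T \<Longrightarrow> T \<subseteq> {0..1} \<Longrightarrow> \<alpha> > 0 \<Longrightarrow> E \<in> sets borel \<Longrightarrow> emeasure lborel E < \<infinity> \<Longrightarrow>
      E \<subseteq> {x. \<exists>t\<in>T. \<alpha> < norm (fourier (\<lambda>\<xi>. cis (t * norm \<xi>) * G \<xi>) x)} \<Longrightarrow>
      \<alpha>\<^sup>2 * measure lborel E \<le> K * enn2real (sqnorm G) * l \<and>
      \<alpha>\<^sup>2 * measure lborel E \<le> K * enn2real (sqnorm G) * (l powr real DIM('a) * measure lborel E) \<and>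
      (\<forall>N\<ge>1. \<alpha>\<^sup>2 * measure lborel E \<le> K * enn2real (sqnorm G) * (real N + l powr real DIM('a) * real N powr (- (real DIM('a) - 1) / 2) * measure lborel E))"
  have "weak_type TYPE('a) K (1 / 2) 2"
    unfolding weak_type_def
  proof (intro allI impI)
    fix G :: "'a \<Rightarrow> complex" and l T \<alpha> E
    assume h: "integrable lborel G" "sqnorm G < \<infinity>" "\<forall>\<xi>. G \<xi> \<noteq> 0 \<longrightarrow> norm \<xi> \<le> l" "l \<ge> 1"
      "finite T" "T \<subseteq> {0..1}" "\<alpha> > 0" "E \<in> sets borel" "emeasure lborel E < \<infinity>"
      "E \<subseteq> {x. \<exists>t\<in>T. \<alpha> < norm (fourier (\<lambda>\<xi>. cis (t * norm \<xi>) * G \<xi>) x)}"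
    have "\<And>\<xi>. G \<xi> \<noteq> 0 \<Longrightarrow> norm \<xi> \<le> l" using h(3) by blast
    from w[OF h(1,2) this h(4-10)] have "\<alpha>\<^sup>2 * measure lborel E \<le> K * enn2real (sqnorm G) * l"
      by (rule conjunct1)
    then have "measure lborel E \<le> K * (l * enn2real (sqnorm G) / \<alpha>\<^sup>2)"
      using h(7) by (simp add: field_simps)
    also have "l * enn2real (sqnorm G) / \<alpha>\<^sup>2 = (l powr (1 / 2) * sqrt (enn2real (sqnorm G)) / \<alpha>) powr 2"
      using h(4,7) by (simp add: powr_half_sqrt power_divide power_mult_distrib)
    finally show "measure lborel E \<le> K * (l powr (1 / 2) * sqrt (enn2real (sqnorm G)) / \<alpha>) powr 2" .
  qed
  with K show ?thesis using that by blast
qed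

text \<open>A = l^d m is the scale-invariant size of the level set. For A \<le> 1 the sup norm bound
  is used; for A > 1, N is chosen to balance N against A N^(-(d-1)/2). In both cases \<alpha>^2 m is
  bounded by a multiple of g A^\<theta>, which is the weak type bound at p.\<close>

lemma weak_type_q_circ:
  assumes d: "DIM('a::euclidean_space) \<ge> 2" and p: "p \<ge> q_circ DIM('a)"
  obtains K where "K > 0" "weak_type TYPE('a) K (real DIM('a) / 2 - real DIM('a) / p) p"
proof (rule weak_type_bounds[where 'a='a])
  let ?d = "real DIM('a)"
  fix K :: real
  assume K: "K > 0"
    and w: "\<And>(G :: 'a \<Rightarrow> complex) l T \<alpha> E. integrable lborel G \<Longrightarrow> sqnorm G < \<infinity> \<Longrightarrow> (\<And>\<xi>. G \<xi> \<noteq> 0 \<Longrightarrow> norm \<xi> \<le> l) \<Longrightarrow> l \<ge> 1 \<Longrightarrow>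
      finite T \<Longrightarrow> T \<subseteq> {0..1} \<Longrightarrow> \<alpha> > 0 \<Longrightarrow> E \<in> sets borel \<Longrightarrow> emeasure lborel E < \<infinity> \<Longrightarrow>
      E \<subseteq> {x. \<exists>t\<in>T. \<alpha> < norm (fourier (\<lambda>\<xi>. cis (t * norm \<xi>) * G \<xi>) x)} \<Longrightarrow>
      \<alpha>\<^sup>2 * measure lborel E \<le> K * enn2real (sqnorm G) * l \<and>
      \<alpha>\<^sup>2 * measure lborel E \<le> K * enn2real (sqnorm G) * (l powr real DIM('a) * measure lborel E) \<and>
      (\<forall>N\<ge>1. \<alpha>\<^sup>2 * measure lborel E \<le> K * enn2real (sqnorm G) * (real N + l powr real DIM('a) * real N powr (- (real DIM('a) - 1) / 2) * measure lborel E))"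
  \<comment> \<open>p \<ge> \<open>q_circ\<close> means \<theta> \<ge> 2 / (d + 1), the exponent
    reached by balancing. A larger \<theta> only weakens the bound when A > 1, and \<theta> < 1 is
    what the case A \<le> 1 uses.\<close>
  define \<theta> where "\<theta> = 1 - 2 / p"
  have d1: "?d > 1" using d by linarith
  have qc: "q_circ DIM('a) > 2" unfolding q_circ_def using d1 by (simp add: field_simps)
  have p2: "p > 2" using p qc by linarith
  have \<theta>1: "\<theta> < 1" using p2 by (simp add: \<theta>_def)
  have \<theta>0: "2 / (?d + 1) \<le> \<theta>"
  proof -
    have "2 / p \<le> 2 / q_circ DIM('a)" using p qc by (intro divide_left_mono) auto
    also have "\<dots> = (?d - 1) / (?d + 1)" unfolding q_circ_def using d1 by (simp add: field_simps)
    also have "\<dots> = 1 - 2 / (?d + 1)" using d1 by (simp add: field_simps)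
    finally show ?thesis by (simp add: \<theta>_def)
  qed
  have \<theta>pos: "\<theta> > 0" using \<theta>0 d1 by (smt (verit) divide_pos_pos)
  define K' where "K' = (3 * K) powr (p / 2)"
  have "weak_type TYPE('a) K' (?d / 2 - ?d / p) p"
    unfolding weak_type_def
  proof (intro allI impI)
    fix G :: "'a \<Rightarrow> complex" and l T \<alpha> E
    assume h: "integrable lborel G" "sqnorm G < \<infinity>" "\<forall>\<xi>. G \<xi> \<noteq> 0 \<longrightarrow> norm \<xi> \<le> l" "l \<ge> 1"
      "finite T" "T \<subseteq> {0..1}" "\<alpha> > 0" "E \<in> sets borel" "emeasure lborel E < \<infinity>"
      "E \<subseteq> {x. \<exists>t\<in>T. \<alpha> < norm (fourier (\<lambda>\<xi>. cis (t * norm \<xi>) * G \<xi>) x)}"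
    define m where "m = measure lborel E"
    define g where "g = enn2real (sqnorm G)"
    define A where "A = l powr ?d * m"
    have g0: "g \<ge> 0" by (simp add: g_def)
    have w1: "\<alpha>\<^sup>2 * m \<le> K * g * A"
      and w2: "\<And>N. N \<ge> 1 \<Longrightarrow> \<alpha>\<^sup>2 * m \<le> K * g * (real N + l powr ?d * real N powr (- (?d - 1) / 2) * m)"
    proof -
      have "\<And>\<xi>. G \<xi> \<noteq> 0 \<Longrightarrow> norm \<xi> \<le> l" using h(3) by blast
      note w' = w[OF h(1,2) this h(4-10)]
      show "\<alpha>\<^sup>2 * m \<le> K * g * A" unfolding m_def g_def A_def using w' by simp
      show "\<And>N. N \<ge> 1 \<Longrightarrow> \<alpha>\<^sup>2 * m \<le> K * g * (real N + l powr ?d * real N powr (- (?d - 1) / 2) * m)"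
        unfolding m_def g_def using w' by simp
    qed
    have "m \<le> K' * (l powr (?d / 2 - ?d / p) * sqrt g / \<alpha>) powr p"
    proof (cases "m = 0")
      case True
      then show ?thesis by (simp add: K'_def)
    next
      case False
      then have m: "m > 0" unfolding m_def using zero_less_measure_iff by blast
      then have A: "A > 0" using h(4) by (simp add: A_def)
      have main: "\<alpha>\<^sup>2 * m \<le> 3 * K * g * A powr \<theta>"
      proof (cases "A \<le> 1")
        case True
        have "A powr 1 \<le> A powr \<theta>" using True A \<theta>1 by (intro powr_mono') auto
        then have "K * g * A \<le> K * g * A powr \<theta>" using A K g0 by (intro mult_left_mono) auto
        moreover have "0 \<le> K * g * A powr \<theta>" using K g0 by simp
        ultimately show ?thesis using w1 by simp
      next
        case False
        \<comment> \<open>The solution of B = A B^(-(d-1)/2). Rounding it up costs a factor of at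
          most 2 since B \<ge> 1.\<close>
        define B where "B = A powr (2 / (?d + 1))"
        have B: "B \<ge> 1" unfolding B_def using False d1 by (intro ge_one_powr_ge_zero) auto
        define N where "N = nat \<lceil>B\<rceil>"
        have N: "N \<ge> 1" "B \<le> real N" "real N \<le> 2 * B" using B unfolding N_def by linarith+
        have "l powr ?d * real N powr (- (?d - 1) / 2) * m = A * real N powr (- (?d - 1) / 2)"
          by (simp add: A_def)
        also have "\<dots> \<le> A * B powr (- (?d - 1) / 2)"
          using A B N d1 by (intro mult_left_mono powr_mono2') auto
        also have "\<dots> = A powr 1 * A powr (2 / (?d + 1) * (- (?d - 1) / 2))"
          using A by (simp add: B_def powr_powr)
        also have "\<dots> = B"
        proof -
          have "1 + 2 / (?d + 1) * (- (?d - 1) / 2) = 2 / (?d + 1)" using d1 by (simp add: field_simps)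
          then show ?thesis unfolding powr_add[symmetric] B_def by simp
        qed
        finally have "real N + l powr ?d * real N powr (- (?d - 1) / 2) * m \<le> 3 * B" using N(3) by linarith
        also have "\<dots> \<le> 3 * A powr \<theta>" unfolding B_def using False \<theta>0 by simp
        finally have "K * g * (real N + l powr ?d * real N powr (- (?d - 1) / 2) * m) \<le> K * g * (3 * A powr \<theta>)"
          using K g0 by (intro mult_left_mono) auto
        with w2[OF N(1)] show ?thesis by (simp add: mult_ac)
      qed
      define y where "y = l powr (?d / 2 - ?d / p) * sqrt g / \<alpha>"
      have y: "y \<ge> 0" using h(7) g0 by (simp add: y_def)
      have y2: "y\<^sup>2 = l powr (?d * \<theta>) * g / \<alpha>\<^sup>2"
      proof -
        have "(l powr (?d / 2 - ?d / p))\<^sup>2 = l powr (?d * \<theta>)"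
        proof -
          have "?d / 2 - ?d / p + (?d / 2 - ?d / p) = ?d * \<theta>" by (simp add: \<theta>_def algebra_simps)
          then show ?thesis unfolding power2_eq_square powr_add[symmetric] by simp
        qed
        then show ?thesis using g0 by (simp add: y_def power_divide power_mult_distrib)
      qed
      have Apow: "A powr \<theta> = l powr (?d * \<theta>) * m powr \<theta>"
        using m h(4) by (simp add: A_def powr_mult powr_powr)
      \<comment> \<open>The factor \<open>m powr \<theta>\<close> cancels; the remaining exponent 1
        - \<theta> = 2 / p is removed by the power p / 2.\<close>
      have "\<alpha>\<^sup>2 * (m powr (1 - \<theta>) * m powr \<theta>) \<le> 3 * K * g * (l powr (?d * \<theta>) * m powr \<theta>)"
        using main m unfolding Apow powr_add[symmetric] by simp
      then have "m powr \<theta> * (\<alpha>\<^sup>2 * m powr (1 - \<theta>)) \<le> m powr \<theta> * (3 * K * g * l powr (?d * \<theta>))"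
        by (simp add: mult_ac)
      then have "\<alpha>\<^sup>2 * m powr (1 - \<theta>) \<le> 3 * K * g * l powr (?d * \<theta>)"
        using m by (simp only: mult_le_cancel_left_pos powr_gt_zero)
      then have "m powr (1 - \<theta>) \<le> 3 * K * y\<^sup>2"
        using h(7) by (simp add: y2 field_simps)
      then have "(m powr (1 - \<theta>)) powr (p / 2) \<le> (3 * K * y\<^sup>2) powr (p / 2)"
        using p2 by (intro powr_mono2) auto
      also have "(m powr (1 - \<theta>)) powr (p / 2) = m"
        using m p2 by (simp add: powr_powr \<theta>_def)
      also have "(3 * K * y\<^sup>2) powr (p / 2) = K' * (y\<^sup>2) powr (p / 2)"
        using K by (simp add: K'_def powr_mult)
      also have "(y\<^sup>2) powr (p / 2) = y powr p"
      proof -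
        have "y\<^sup>2 = y powr 2" using y by simp
        then show ?thesis by (simp only: powr_powr) simp
      qed
      finally show ?thesis by (simp add: y_def)
    qed
    then show "measure lborel E \<le> K' * (l powr (?d / 2 - ?d / p) * sqrt (enn2real (sqnorm G)) / \<alpha>) powr p"
      by (simp add: m_def g_def)
  qed
  moreover have "K' > 0" using K by (simp add: K'_def)
  ultimately show ?thesis using that by blast
qed

section \<open>Rational times and the passage from finitely many times to the full supremum\<close>

text \<open>Every t is approached from the right by rational times inside the interval. The
  countable supremum is measurable and tolerates one null set for each time.\<close>

lemma maximal_fun_rational:
  assumes cont: "continuous_on {0<..<1} (\<lambda>t. u t x)"
  shows "maximal_fun u x = (SUP t\<in>{0<..<1} \<inter> \<rat>. ennreal (cmod (u t x)))"
proof (rule antisym)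
  let ?S = "SUP t\<in>{0<..<1} \<inter> \<rat>. ennreal (cmod (u t x))"
  show "maximal_fun u x \<le> ?S"
    unfolding maximal_fun_def
  proof (rule SUP_least)
    fix t :: real assume t: "t \<in> {0<..<1}"
    have "\<exists>r\<in>\<rat>. t < r \<and> r < min 1 (t + 1 / real (Suc n))" for n
      using t by (intro Rats_dense_in_real) auto
    then obtain r where r: "\<And>n. r n \<in> \<rat>" "\<And>n. t < r n" "\<And>n. r n < min 1 (t + 1 / real (Suc n))" by metis
    have r01: "r n \<in> {0<..<1} \<inter> \<rat>" for n using r[of n] t by auto
    have "(\<lambda>n. t + 1 / real (Suc n)) \<longlonglongrightarrow> t + 0"
      by (intro tendsto_intros LIMSEQ_Suc[OF lim_1_over_n])
    then have lim: "(\<lambda>n. t + 1 / real (Suc n)) \<longlonglongrightarrow> t" by simp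
    have rt: "r \<longlonglongrightarrow> t"
    proof (rule tendsto_sandwich[OF _ _ tendsto_const lim])
      show "\<forall>\<^sub>F n in sequentially. t \<le> r n" using r(2) by (auto intro!: always_eventually less_imp_le)
      show "\<forall>\<^sub>F n in sequentially. r n \<le> t + 1 / real (Suc n)" using r(3) by (auto intro!: always_eventually less_imp_le)
    qed
    have "isCont (\<lambda>t. u t x) t" using cont t by (simp add: continuous_on_eq_continuous_at)
    then have "(\<lambda>n. u (r n) x) \<longlonglongrightarrow> u t x" by (rule isCont_tendsto_compose[OF _ rt])
    then have "(\<lambda>n. ennreal (cmod (u (r n) x))) \<longlonglongrightarrow> ennreal (cmod (u t x))"
      by (intro tendsto_ennrealI tendsto_norm)
    then show "ennreal (cmod (u t x)) \<le> ?S"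
      by (rule LIMSEQ_le_const2) (auto intro!: SUP_upper r01)
  qed
  show "?S \<le> maximal_fun u x"
    unfolding maximal_fun_def by (rule SUP_subset_mono) auto
qed

lemma countable_unit_rationals: "countable ({0<..<1} \<inter> \<rat> :: real set)"
  by (rule countable_subset[OF _ countable_rat]) auto

lemma borel_measurable_maximal_fun:
  fixes u :: "real \<Rightarrow> 'a::euclidean_space \<Rightarrow> complex"
  assumes [measurable]: "\<And>t. t \<in> {0<..<1} \<Longrightarrow> u t \<in> borel_measurable borel"
    and cont: "\<And>x. continuous_on {0<..<1} (\<lambda>t. u t x)"
  shows "maximal_fun u \<in> borel_measurable borel"
proof -
  have "maximal_fun u x = (SUP t\<in>{0<..<1} \<inter> \<rat>. ennreal (cmod (u t x)))" for x
    by (rule maximal_fun_rational[OF cont])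
  then have "maximal_fun u = (\<lambda>x. SUP t\<in>{0<..<1} \<inter> \<rat>. ennreal (cmod (u t x)))"
    by (rule ext)
  also have "\<dots> \<in> borel_measurable borel"
    by (intro borel_measurable_SUP countable_unit_rationals) auto
  finally show ?thesis .
qed

lemma continuous_on_fourier_modulated:
  fixes G :: "'a::euclidean_space \<Rightarrow> complex"
  assumes G: "integrable lborel G"
  shows "continuous_on A (\<lambda>t. fourier (\<lambda>\<xi>. cis (t * norm \<xi>) * G \<xi>) x)"
  unfolding continuous_on_sequentially
proof (intro allI ballI impI)
  have [measurable]: "G \<in> borel_measurable borel" using G by auto
  fix r :: "nat \<Rightarrow> real" and t assume r: "(\<forall>n. r n \<in> A) \<and> r \<longlonglongrightarrow> t"
  show "((\<lambda>t. fourier (\<lambda>\<xi>. cis (t * norm \<xi>) * G \<xi>) x) \<circ> r) \<longlonglongrightarrow> fourier (\<lambda>\<xi>. cis (t * norm \<xi>) * G \<xi>) x"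
    unfolding o_def fourier_def
  proof (rule integral_dominated_convergence[where w = "\<lambda>\<xi>. norm (G \<xi>)"])
    show "AE \<xi> in lborel. (\<lambda>n. cis (- (\<xi> \<bullet> x)) * (cis (r n * norm \<xi>) * G \<xi>)) \<longlonglongrightarrow> cis (- (\<xi> \<bullet> x)) * (cis (t * norm \<xi>) * G \<xi>)"
    proof (intro AE_I2 tendsto_mult tendsto_const)
      fix \<xi> :: 'a
      have "isCont cis s" for s :: real
        unfolding cis_conv_exp[abs_def] by (auto intro!: continuous_intros)
      moreover have "(\<lambda>n. r n * norm \<xi>) \<longlonglongrightarrow> t * norm \<xi>" using r by (intro tendsto_intros) auto
      ultimately show "(\<lambda>n. cis (r n * norm \<xi>)) \<longlonglongrightarrow> cis (t * norm \<xi>)"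
        by (rule isCont_tendsto_compose)
    qed
  qed (use G in \<open>auto simp: norm_mult\<close>)
qed

lemma weak_type_maximal_fun:
  fixes G :: "'a::euclidean_space \<Rightarrow> complex"
  assumes w: "weak_type TYPE('a) K s p"
    and G: "integrable lborel G" "sqnorm G < \<infinity>" and supp: "\<And>\<xi>. G \<xi> \<noteq> 0 \<Longrightarrow> norm \<xi> \<le> l"
    and l: "l \<ge> 1" and \<alpha>: "\<alpha> > 0"
  shows "emeasure lborel {x. ennreal \<alpha> < maximal_fun (\<lambda>t. fourier (\<lambda>\<xi>. cis (t * norm \<xi>) * G \<xi>)) x}
    \<le> ennreal (K * (l powr s * sqrt (enn2real (sqnorm G)) / \<alpha>) powr p)"
proof -
  have [measurable]: "G \<in> borel_measurable borel" using G by auto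
  let ?v = "\<lambda>t. fourier (\<lambda>\<xi>. cis (t * norm \<xi>) * G \<xi>)"
  let ?C = "ennreal (K * (l powr s * sqrt (enn2real (sqnorm G)) / \<alpha>) powr p)"
  have vm [measurable]: "?v t \<in> borel_measurable borel" for t by measurable
  have ne: "{0<..<1} \<inter> \<rat> \<noteq> ({} :: real set)"
    using Rats_dense_in_real[of 0 1] by auto
  define r where "r = from_nat_into ({0<..<1} \<inter> \<rat> :: real set)"
  have r: "range r = {0<..<1} \<inter> \<rat>" unfolding r_def by (rule range_from_nat_into[OF ne countable_unit_rationals])
  \<comment> \<open>The level set is exhausted by sets that lie in a ball and involve only the first
    n rational times, so each of them satisfies the assumptions of \<open>weak_type\<close>.\<close>
  define E where "E n = ball 0 (real n) \<inter> (\<Union>i<n. {x. \<alpha> < norm (?v (r i) x)})" for n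
  have Em [measurable]: "E n \<in> sets borel" for n
  proof -
    have "{x. \<alpha> < norm (?v (r i) x)} \<in> sets borel" for i by measurable
    then show ?thesis unfolding E_def by (intro sets.Int sets.finite_UN) auto
  qed
  have "incseq E"
    unfolding E_def by (intro incseq_SucI) (auto simp: less_Suc_eq)
  have U: "{x. ennreal \<alpha> < maximal_fun ?v x} = (\<Union>n. E n)"
  proof (rule set_eqI)
    fix x
    have "ennreal \<alpha> < maximal_fun ?v x \<longleftrightarrow> (\<exists>t\<in>{0<..<1} \<inter> \<rat>. ennreal \<alpha> < ennreal (cmod (?v t x)))"
      unfolding maximal_fun_rational[OF continuous_on_fourier_modulated[OF G(1)]] less_SUP_iff ..
    also have "\<dots> \<longleftrightarrow> (\<exists>i. \<alpha> < cmod (?v (r i) x))"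
      unfolding r[symmetric] using \<alpha> by (simp add: ennreal_less_iff)
    also have "\<dots> \<longleftrightarrow> x \<in> (\<Union>n. E n)"
    proof
      assume "\<exists>i. \<alpha> < cmod (?v (r i) x)"
      then obtain i where i: "\<alpha> < cmod (?v (r i) x)" by blast
      obtain n :: nat where n: "norm x < real n" using reals_Archimedean2 by blast
      \<comment> \<open>The successor appears because \<open>E n\<close> uses the times with index
        strictly below n.\<close>
      have "x \<in> E (max n (Suc i))"
        unfolding E_def using i n by (auto intro!: bexI[of _ i])
      then show "x \<in> (\<Union>n. E n)" by blast
    qed (auto simp: E_def)
    finally show "x \<in> {x. ennreal \<alpha> < maximal_fun ?v x} \<longleftrightarrow> x \<in> (\<Union>n. E n)" by simp
  qed
  have "emeasure lborel (E n) \<le> ?C" for n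
  proof -
    have fin: "emeasure lborel (E n) < \<infinity>"
      by (rule le_less_trans[OF emeasure_mono emeasure_lborel_ball_finite[of 0 "real n"]]) (auto simp: E_def)
    have "measure lborel (E n) \<le> K * (l powr s * sqrt (enn2real (sqnorm G)) / \<alpha>) powr p"
    proof (rule w[unfolded weak_type_def, rule_format, of G l "r ` {..<n}" \<alpha> "E n"])
      have "r i \<in> {0<..<1}" for i using r by blast
      then show "r ` {..<n} \<subseteq> {0..1}" by (force simp: less_imp_le)
      show "E n \<subseteq> {x. \<exists>t\<in>r ` {..<n}. \<alpha> < norm (?v t x)}" by (auto simp: E_def)
    qed (use G supp l \<alpha> fin in auto)
    then show ?thesis using fin by (subst emeasure_eq_ennreal_measure) (auto intro: ennreal_leI)
  qed
  then have "(SUP n. emeasure lborel (E n)) \<le> ?C" by (rule SUP_least)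
  then show ?thesis
    unfolding U using SUP_emeasure_incseq[of E lborel] \<open>incseq E\<close> by (simp add: image_subset_iff)
qed

section \<open>Summation of weak type estimates\<close>

text \<open>Two one-sided geometric series, with the index k counted in both. The sum is written as
  an integral over counting measure so that Tonelli applies to it later.\<close>

lemma nn_integral_geometric_int:
  fixes \<rho> :: real and k :: int
  assumes \<rho>: "0 < \<rho>" "\<rho> < 1"
  shows "(\<integral>\<^sup>+l. ennreal (\<rho> powr \<bar>real_of_int l - real_of_int k\<bar>) \<partial>count_space UNIV) \<le> ennreal (2 / (1 - \<rho>))"
proof -
  let ?h = "\<lambda>l. ennreal (\<rho> powr \<bar>real_of_int l - real_of_int k\<bar>)"
  have geo: "(\<Sum>n. ennreal (\<rho> ^ n)) = ennreal (1 / (1 - \<rho>))"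
    using geometric_sums[of \<rho>] \<rho> by (intro suminf_ennreal_eq) auto
  have half: "(\<integral>\<^sup>+l. ?h l \<partial>count_space (range g)) \<le> ennreal (1 / (1 - \<rho>))"
    if g: "inj g" "\<And>n. real n \<le> \<bar>real_of_int (g n) - real_of_int k\<bar>" for g :: "nat \<Rightarrow> int"
  proof -
    have "(\<integral>\<^sup>+l. ?h l \<partial>count_space (range g)) = (\<integral>\<^sup>+n. ?h (g n) \<partial>count_space UNIV)"
      by (rule nn_integral_bij_count_space[symmetric]) (use g(1) in \<open>simp add: bij_betw_def\<close>)
    also have "\<dots> \<le> (\<integral>\<^sup>+n. ennreal (\<rho> ^ n) \<partial>count_space UNIV)"
    proof (intro nn_integral_mono ennreal_leI)
      fix n :: nat
      have "\<rho> powr \<bar>real_of_int (g n) - real_of_int k\<bar> \<le> \<rho> powr real n"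
        using \<rho> g(2)[of n] by (intro powr_mono') auto
      then show "\<rho> powr \<bar>real_of_int (g n) - real_of_int k\<bar> \<le> \<rho> ^ n"
        using \<rho> by (simp add: powr_realpow)
    qed
    also have "\<dots> = ennreal (1 / (1 - \<rho>))" unfolding nn_integral_count_space_nat by (rule geo)
    finally show ?thesis .
  qed
  define g1 where "g1 = (\<lambda>n. k + int n)"
  define g2 where "g2 = (\<lambda>n. k - int n)"
  have cover: "l \<in> range g1 \<or> l \<in> range g2" for l
  proof (cases "l \<ge> k")
    case True
    then have "l = g1 (nat (l - k))" by (simp add: g1_def)
    then show ?thesis by blast
  next
    case False
    then have "l = g2 (nat (k - l))" by (simp add: g2_def)
    then show ?thesis by blast
  qed
  have "(\<integral>\<^sup>+l. ?h l \<partial>count_space UNIV) \<le> (\<integral>\<^sup>+l. ?h l * indicator (range g1) l + ?h l * indicator (range g2) l \<partial>count_space UNIV)"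
    using cover by (intro nn_integral_mono) (auto simp: indicator_def)
  also have "\<dots> = (\<integral>\<^sup>+l. ?h l * indicator (range g1) l \<partial>count_space UNIV) + (\<integral>\<^sup>+l. ?h l * indicator (range g2) l \<partial>count_space UNIV)"
    by (rule nn_integral_add) auto
  also have "\<dots> = (\<integral>\<^sup>+l. ?h l \<partial>count_space (range g1)) + (\<integral>\<^sup>+l. ?h l \<partial>count_space (range g2))"
    by (simp add: nn_integral_count_space_indicator)
  also have "\<dots> \<le> ennreal (1 / (1 - \<rho>)) + ennreal (1 / (1 - \<rho>))"
    by (intro add_mono half) (auto simp: g1_def g2_def inj_on_def)
  also have "\<dots> = ennreal (2 / (1 - \<rho>))"
    using \<rho> by (simp add: ennreal_plus[symmetric] del: ennreal_plus)
  finally show ?thesis .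
qed

lemma suminf_geometric_int:
  fixes \<rho> :: real and l :: int
  assumes \<rho>: "0 < \<rho>" "\<rho> < 1"
  shows "(\<Sum>k. ennreal (\<rho> powr \<bar>real k - real_of_int l\<bar>)) \<le> ennreal (2 / (1 - \<rho>))"
proof -
  let ?h = "\<lambda>j. ennreal (\<rho> powr \<bar>real_of_int j - real_of_int l\<bar>)"
  have "(\<Sum>k. ennreal (\<rho> powr \<bar>real k - real_of_int l\<bar>)) = (\<integral>\<^sup>+k. ?h (int k) \<partial>count_space UNIV)"
    unfolding nn_integral_count_space_nat by simp
  also have "\<dots> = (\<integral>\<^sup>+j. ?h j \<partial>count_space (range int))"
    by (rule nn_integral_bij_count_space) (simp add: bij_betw_def inj_on_def)
  also have "\<dots> = (\<integral>\<^sup>+j. ?h j * indicator (range int) j \<partial>count_space UNIV)"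
    by (simp add: nn_integral_count_space_indicator)
  also have "\<dots> \<le> (\<integral>\<^sup>+j. ?h j \<partial>count_space UNIV)"
    by (intro nn_integral_mono) (auto simp: indicator_def)
  also have "\<dots> \<le> ennreal (2 / (1 - \<rho>))" by (rule nn_integral_geometric_int[OF \<rho>])
  finally show ?thesis .
qed

lemma nn_integral_count_space_ge:
  fixes h :: "'b \<Rightarrow> ennreal"
  shows "h x \<le> (\<integral>\<^sup>+y. h y \<partial>count_space UNIV)"
proof -
  have "h x = (\<integral>\<^sup>+y. h y * indicator {x} y \<partial>count_space UNIV)"
    by (simp add: nn_integral_count_space_indicator[symmetric] nn_integral_count_space_finite)
  also have "\<dots> \<le> (\<integral>\<^sup>+y. h y \<partial>count_space UNIV)"
    by (intro nn_integral_mono) (auto simp: indicator_def)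
  finally show ?thesis .
qed

text \<open>Discrete layer cake formula with ratio b: for finite positive F, the single l with B b^l
  < F \<le> B b^(l+1) already supplies all of F^q.\<close>

lemma dyadic_layer_bound:
  fixes F :: ennreal
  assumes b: "b > 1" and B: "B > 0" and q: "q > 0"
  shows "ennreal_rpow F q \<le> (\<integral>\<^sup>+l. ennreal ((B * b powr (real_of_int l + 1)) powr q) * indicator {l. ennreal (B * b powr real_of_int l) < F} l \<partial>count_space UNIV)"
    (is "_ \<le> ?R")
proof -
  have key: "ennreal (y powr q) \<le> ?R" if y: "y > 0" "ennreal y \<le> F" for y
  proof -
    \<comment> \<open>The ceiling minus one makes the lower inequality strict, as the indicator
      requires, and allows equality in the upper one.\<close>
    define l where "l = \<lceil>log b (y / B)\<rceil> - 1"
    have l: "real_of_int l < log b (y / B)" "log b (y / B) \<le> real_of_int l + 1"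
      unfolding l_def by linarith+
    have yB: "y / B > 0" using y B by simp
    have "b powr real_of_int l < y / B" using l(1) yB b by (simp add: less_log_iff)
    then have 1: "B * b powr real_of_int l < y" using B by (simp add: field_simps)
    have "y / B \<le> b powr (real_of_int l + 1)" using l(2) yB b by (simp add: log_le_iff)
    then have 2: "y \<le> B * b powr (real_of_int l + 1)" using B by (simp add: field_simps)
    have "ennreal (B * b powr real_of_int l) < F"
      using 1 y B by (intro less_le_trans[OF _ y(2)] ennreal_lessI) auto
    then have "ennreal (y powr q) \<le> ennreal ((B * b powr (real_of_int l + 1)) powr q) * indicator {l. ennreal (B * b powr real_of_int l) < F} l"
      using 2 y q by (auto intro!: ennreal_leI powr_mono2)
    also have "\<dots> \<le> ?R" by (rule nn_integral_count_space_ge)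
    finally show ?thesis .
  qed
  show ?thesis
  proof (cases "F = \<infinity>")
    case True
    \<comment> \<open>Every finite y is below F here, so \<open>key\<close> makes the right side
      exceed every real number.\<close>
    have "?R = \<infinity>"
    proof (rule ccontr)
      assume "?R \<noteq> \<infinity>"
      then obtain r where r: "?R = ennreal r" "r \<ge> 0" by (cases ?R) auto
      have "ennreal (((r + 1) powr (1 / q)) powr q) \<le> ?R" using r True by (intro key) auto
      then have "r + 1 \<le> r" using r q by (simp add: powr_powr)
      then show False by simp
    qed
    then show ?thesis by simp
  next
    case False
    then obtain y where y: "F = ennreal y" "y \<ge> 0" by (cases F) auto
    show ?thesis
    proof (cases "y = 0")
      case True
      then show ?thesis using y by (simp add: ennreal_rpow_def)
    next
      case False
      then show ?thesis using key[of y] y by (simp add: ennreal_rpow_def)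
    qed
  qed
qed

text \<open>Since a \<le> B and p \<ge> 2, the power p of a / B may be lowered to 2, which makes the
  bound summable over the shells by orthogonality. All powers are first brought to the base b, where
  2^(- k m / p) = b^(- k q / p).\<close>

lemma level_bound:
  fixes a B \<gamma> b m p q \<epsilon> \<eta> k l K :: real
  assumes a: "0 \<le> a" "a \<le> B" and B: "B > 0" and \<gamma>: "\<gamma> > 0" and b: "b = 2 powr (m / q)" and q: "q > 0"
    and p: "p \<ge> 2" and K: "K \<ge> 0"
    and ex: "(k - l) * (p - q) + \<epsilon> * \<bar>k - l\<bar> * p \<le> - \<eta> * \<bar>k - l\<bar>" and m: "m > 0"
  shows "K * (2 powr (- (k * m / p)) * (a * b powr k) / (\<gamma> * B * b powr l * b powr (- (\<epsilon> * \<bar>k - l\<bar>)))) powr p * b powr (l * q)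
    \<le> K * \<gamma> powr (- p) * (a / B)\<^sup>2 * b powr (- (\<eta> * \<bar>k - l\<bar>))"
proof (cases "a = 0")
  case True
  then show ?thesis using K by simp
next
  case False
  then have a0: "a > 0" using a by simp
  have b1: "b > 1" unfolding b using m q by (intro gr_one_powr) auto
  have two: "2 powr (- (k * m / p)) = b powr (- (k * q / p))"
    unfolding b powr_powr using q p by (simp add: field_simps)
  have "2 powr (- (k * m / p)) * (a * b powr k) / (\<gamma> * B * b powr l * b powr (- (\<epsilon> * \<bar>k - l\<bar>)))
     = (a / B) * (1 / \<gamma>) * (b powr (- (k * q / p)) * b powr k * (1 / b powr l) * (1 / b powr (- (\<epsilon> * \<bar>k - l\<bar>))))"
    unfolding two by (simp add: mult_ac)
  also have "b powr (- (k * q / p)) * b powr k * (1 / b powr l) * (1 / b powr (- (\<epsilon> * \<bar>k - l\<bar>))) = b powr (- (k * q / p) + k + - l + \<epsilon> * \<bar>k - l\<bar>)"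
    using b1 by (simp only: powr_minus_divide[symmetric] powr_add[symmetric] minus_minus)
  finally have "(2 powr (- (k * m / p)) * (a * b powr k) / (\<gamma> * B * b powr l * b powr (- (\<epsilon> * \<bar>k - l\<bar>)))) powr p
     = (a / B) powr p * (1 / \<gamma>) powr p * (b powr (- (k * q / p) + k + - l + \<epsilon> * \<bar>k - l\<bar>)) powr p"
    using a0 B \<gamma> b1 by (simp only: powr_mult)
  also have "(1 / \<gamma>) powr p = \<gamma> powr (- p)" using \<gamma> by (simp add: powr_minus_divide powr_divide)
  finally have X: "(2 powr (- (k * m / p)) * (a * b powr k) / (\<gamma> * B * b powr l * b powr (- (\<epsilon> * \<bar>k - l\<bar>)))) powr p * b powr (l * q)
     = (a / B) powr p * \<gamma> powr (- p) * (b powr ((- (k * q / p) + k + - l + \<epsilon> * \<bar>k - l\<bar>) * p) * b powr (l * q))"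
    by (simp only: powr_powr mult.assoc)
  have e: "(- (k * q / p) + k + - l + \<epsilon> * \<bar>k - l\<bar>) * p + l * q = (k - l) * (p - q) + \<epsilon> * \<bar>k - l\<bar> * p"
    using p by (simp add: field_simps)
  have "b powr ((- (k * q / p) + k + - l + \<epsilon> * \<bar>k - l\<bar>) * p) * b powr (l * q) \<le> b powr (- (\<eta> * \<bar>k - l\<bar>))"
    unfolding powr_add[symmetric] e using ex b1 by simp
  moreover have "(a / B) powr p \<le> (a / B)\<^sup>2"
  proof -
    have "(a / B) powr p \<le> (a / B) powr 2"
      using a0 a B p by (intro powr_mono') auto
    then show ?thesis using a0 B by simp
  qed
  ultimately have "(a / B) powr p * \<gamma> powr (- p) * (b powr ((- (k * q / p) + k + - l + \<epsilon> * \<bar>k - l\<bar>) * p) * b powr (l * q))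
     \<le> (a / B)\<^sup>2 * \<gamma> powr (- p) * b powr (- (\<eta> * \<bar>k - l\<bar>))"
    by (intro mult_mono mult_right_mono) auto
  from mult_left_mono[OF this K] show ?thesis
    unfolding X[symmetric] by (simp only: mult_ac)
qed

text \<open>At height b^l the shell k is estimated with p0 if k \<ge> l and with p1 otherwise. Both
  choices gain b^(- \<eta> |k - l|), because the two bounds obey one affine law in 1 / p with slope
  m \<noteq> 0. The shells decouple, and only the sum of the squares of a remains.\<close>

lemma weak_type_summation:
  fixes p0 p1 q m K :: real
  assumes p: "2 \<le> p0" "p0 < q" "q < p1" and m: "m > 0" and K: "K > 0"
  obtains C where "C > 0" "\<And>(M :: 'a measure) (f :: nat \<Rightarrow> 'a \<Rightarrow> ennreal) a B. (\<And>k. f k \<in> borel_measurable M) \<Longrightarrow> (\<And>k. a k \<ge> 0) \<Longrightarrow> B > 0 \<Longrightarrow>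
     (\<Sum>k. ennreal ((a k)\<^sup>2)) \<le> ennreal (B\<^sup>2) \<Longrightarrow>
     (\<And>k \<alpha>. \<alpha> > 0 \<Longrightarrow> emeasure M {x\<in>space M. ennreal \<alpha> < f k x} \<le> ennreal (K * (2 powr (- (real k * m / p0)) * (a k * (2 powr (m / q)) powr real k) / \<alpha>) powr p0)) \<Longrightarrow>
     (\<And>k \<alpha>. \<alpha> > 0 \<Longrightarrow> emeasure M {x\<in>space M. ennreal \<alpha> < f k x} \<le> ennreal (K * (2 powr (- (real k * m / p1)) * (a k * (2 powr (m / q)) powr real k) / \<alpha>) powr p1)) \<Longrightarrow>
     (\<integral>\<^sup>+x. ennreal_rpow (\<Sum>k. f k x) q \<partial>M) \<le> ennreal (C * B powr q)"
proof -
  define b where "b = 2 powr (m / q)"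
  \<comment> \<open>\<epsilon> lets the thresholds decay away from k = l. It is so small that this
    loss, raised to the power p, consumes at most half of the gain q - p0 or p1 - q; what remains is
    at least \<eta>.\<close>
  define \<epsilon> where "\<epsilon> = min ((q - p0) / (2 * p0)) ((p1 - q) / (2 * p1))"
  define \<eta> where "\<eta> = min ((q - p0) / 2) ((p1 - q) / 2)"
  \<comment> \<open>Chosen with 2 \<gamma> / (1 - b^(- \<epsilon>)) = 1, so that the thresholds of
    all shells together sum to at most B b^l.\<close>
  define \<gamma> where "\<gamma> = (1 - b powr (- \<epsilon>)) / 2"
  define K' where "K' = K * max (\<gamma> powr (- p0)) (\<gamma> powr (- p1))"
  define C where "C = b powr q * K' * (2 / (1 - b powr (- \<eta>)))"
  have q: "q > 0" using p by simp
  have b1: "b > 1" unfolding b_def using m q by (intro gr_one_powr) auto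
  have \<epsilon>: "\<epsilon> > 0" and \<eta>: "\<eta> > 0" using p by (auto simp: \<epsilon>_def \<eta>_def)
  have b\<epsilon>: "0 < b powr (- \<epsilon>)" "b powr (- \<epsilon>) < 1" using b1 \<epsilon> by (auto simp: powr_less_one)
  have b\<eta>: "0 < b powr (- \<eta>)" "b powr (- \<eta>) < 1" using b1 \<eta> by (auto simp: powr_less_one)
  have \<gamma>: "\<gamma> > 0" using b\<epsilon> by (simp add: \<gamma>_def)
  have K': "K' > 0" using K \<gamma> by (auto simp: K'_def less_max_iff_disj)
  have C: "C > 0" using b1 K' b\<eta> by (simp add: C_def)
  have \<epsilon>p: "\<epsilon> * p0 \<le> (q - p0) / 2" "\<epsilon> * p1 \<le> (p1 - q) / 2"
  proof -
    have "\<epsilon> * p0 \<le> (q - p0) / (2 * p0) * p0" using p by (intro mult_right_mono) (auto simp: \<epsilon>_def)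
    also have "(q - p0) / (2 * p0) * p0 = (q - p0) / 2" using p by simp
    finally show "\<epsilon> * p0 \<le> (q - p0) / 2" .
    have "\<epsilon> * p1 \<le> (p1 - q) / (2 * p1) * p1" using p by (intro mult_right_mono) (auto simp: \<epsilon>_def)
    also have "(p1 - q) / (2 * p1) * p1 = (p1 - q) / 2" using p by simp
    finally show "\<epsilon> * p1 \<le> (p1 - q) / 2" .
  qed
  show ?thesis
  proof (rule that[OF C])
    fix M :: "'a measure" and f :: "nat \<Rightarrow> 'a \<Rightarrow> ennreal" and a :: "nat \<Rightarrow> real" and B :: real
    assume f [measurable]: "\<And>k. f k \<in> borel_measurable M" and a0: "\<And>k. a k \<ge> 0" and B: "B > 0"
      and sum: "(\<Sum>k. ennreal ((a k)\<^sup>2)) \<le> ennreal (B\<^sup>2)"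
      and w0: "\<And>k \<alpha>. \<alpha> > 0 \<Longrightarrow> emeasure M {x\<in>space M. ennreal \<alpha> < f k x} \<le> ennreal (K * (2 powr (- (real k * m / p0)) * (a k * (2 powr (m / q)) powr real k) / \<alpha>) powr p0)"
      and w1: "\<And>k \<alpha>. \<alpha> > 0 \<Longrightarrow> emeasure M {x\<in>space M. ennreal \<alpha> < f k x} \<le> ennreal (K * (2 powr (- (real k * m / p1)) * (a k * (2 powr (m / q)) powr real k) / \<alpha>) powr p1)"
    have aB: "a k \<le> B" for k
    proof -
      have "ennreal ((a k)\<^sup>2) = (\<Sum>i\<in>{k}. ennreal ((a i)\<^sup>2))" by simp
      also have "\<dots> \<le> (\<Sum>k. ennreal ((a k)\<^sup>2))" by (rule sum_le_suminf) auto
      also have "\<dots> \<le> ennreal (B\<^sup>2)" by (rule sum)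
      finally have "(a k)\<^sup>2 \<le> B\<^sup>2" by (simp add: ennreal_le_iff)
      then show ?thesis by (rule power2_le_imp_le) (use B in simp)
    qed
    \<comment> \<open>The height B b^l is distributed over the shells, the largest share going to
      those with k near l.\<close>
    define th where "th k l = \<gamma> * B * b powr real_of_int l * b powr (- (\<epsilon> * \<bar>real k - real_of_int l\<bar>))" for k :: nat and l
    have th: "th k l > 0" for k l using \<gamma> B b1 by (simp add: th_def)
    have level: "emeasure M {x\<in>space M. ennreal (th k l) < f k x} * ennreal (b powr (real_of_int l * q))
       \<le> ennreal (K' * (a k / B)\<^sup>2 * b powr (- (\<eta> * \<bar>real k - real_of_int l\<bar>)))" for k l
    proof -
      have gen: "emeasure M {x\<in>space M. ennreal (th k l) < f k x} * ennreal (b powr (real_of_int l * q))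
       \<le> ennreal (K' * (a k / B)\<^sup>2 * b powr (- (\<eta> * \<bar>real k - real_of_int l\<bar>)))"
        if w: "emeasure M {x\<in>space M. ennreal (th k l) < f k x} \<le> ennreal (K * (2 powr (- (real k * m / p)) * (a k * b powr real k) / th k l) powr p)"
          and ex: "(real k - real_of_int l) * (p - q) + \<epsilon> * \<bar>real k - real_of_int l\<bar> * p \<le> - \<eta> * \<bar>real k - real_of_int l\<bar>"
          and pp: "p \<ge> 2" "\<gamma> powr (- p) \<le> max (\<gamma> powr (- p0)) (\<gamma> powr (- p1))" for p
      proof -
        have "emeasure M {x\<in>space M. ennreal (th k l) < f k x} * ennreal (b powr (real_of_int l * q))
           \<le> ennreal (K * (2 powr (- (real k * m / p)) * (a k * b powr real k) / th k l) powr p) * ennreal (b powr (real_of_int l * q))"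
          by (rule mult_right_mono[OF w]) simp
        also have "\<dots> = ennreal (K * (2 powr (- (real k * m / p)) * (a k * b powr real k) / th k l) powr p * b powr (real_of_int l * q))"
          using K by (subst ennreal_mult) auto
        also have "\<dots> \<le> ennreal (K * \<gamma> powr (- p) * (a k / B)\<^sup>2 * b powr (- (\<eta> * \<bar>real k - real_of_int l\<bar>)))"
          unfolding th_def
          by (intro ennreal_leI level_bound a0 aB B \<gamma> b_def q pp less_imp_le[OF K] ex m)
        also have "\<dots> \<le> ennreal (K' * (a k / B)\<^sup>2 * b powr (- (\<eta> * \<bar>real k - real_of_int l\<bar>)))"
          unfolding K'_def using K pp(2) by (intro ennreal_leI mult_right_mono mult_left_mono) auto
        finally show ?thesis .
      qed
      show ?thesis
      proof (cases "real k \<ge> real_of_int l")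
        case True
        have "(real k - l) * (p0 - q) + \<epsilon> * (real k - l) * p0 = (real k - l) * (p0 - q + \<epsilon> * p0)" by (simp add: algebra_simps)
        also have "\<dots> \<le> (real k - l) * (- \<eta>)" using True \<epsilon>p(1) by (intro mult_left_mono) (auto simp: \<eta>_def field_simps min_def)
        finally show ?thesis
          using True p by (intro gen[of p0] w0[OF th, folded b_def]) (auto simp: mult.commute)
      next
        case False
        have "(real k - l) * (p1 - q) + \<epsilon> * (l - real k) * p1 = (l - real k) * (q - p1 + \<epsilon> * p1)" by (simp add: algebra_simps)
        also have "\<dots> \<le> (l - real k) * (- \<eta>)" using False \<epsilon>p(2) by (intro mult_left_mono) (auto simp: \<eta>_def field_simps min_def)
        finally show ?thesis
          using False p by (intro gen[of p1] w1[OF th, folded b_def]) (auto simp: mult.commute abs_if)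
      qed
    qed
    let ?F = "\<lambda>x. \<Sum>k. f k x"
    \<comment> \<open>Pigeonhole: if no shell exceeds its own threshold, the whole sum stays within
      B b^l.\<close>
    have big: "emeasure M {x\<in>space M. ennreal (B * b powr real_of_int l) < ?F x} \<le> (\<Sum>k. emeasure M {x\<in>space M. ennreal (th k l) < f k x})" for l
    proof -
      have "{x\<in>space M. ennreal (B * b powr real_of_int l) < ?F x} \<subseteq> (\<Union>k. {x\<in>space M. ennreal (th k l) < f k x})"
      proof (rule subsetI, rule ccontr)
        fix x assume x: "x \<in> {x\<in>space M. ennreal (B * b powr real_of_int l) < ?F x}"
          and n: "x \<notin> (\<Union>k. {x\<in>space M. ennreal (th k l) < f k x})"
        then have le: "f k x \<le> ennreal (th k l)" for k by (force simp: not_less)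
        have "?F x \<le> (\<Sum>k. ennreal (th k l))" by (intro suminf_le le) auto
        also have "\<dots> = (\<Sum>k. ennreal (\<gamma> * B * b powr real_of_int l) * ennreal ((b powr (- \<epsilon>)) powr \<bar>real k - real_of_int l\<bar>))"
          using \<gamma> B by (simp add: th_def ennreal_mult[symmetric] powr_powr)
        also have "\<dots> = ennreal (\<gamma> * B * b powr real_of_int l) * (\<Sum>k. ennreal ((b powr (- \<epsilon>)) powr \<bar>real k - real_of_int l\<bar>))"
          by (rule ennreal_suminf_cmult)
        also have "\<dots> \<le> ennreal (\<gamma> * B * b powr real_of_int l) * ennreal (2 / (1 - b powr (- \<epsilon>)))"
          by (intro mult_left_mono suminf_geometric_int b\<epsilon>) auto
        also have "\<dots> = ennreal (\<gamma> * B * b powr real_of_int l * (2 / (1 - b powr (- \<epsilon>))))"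
          using \<gamma> B b\<epsilon> by (subst ennreal_mult) auto
        also have "\<gamma> * B * b powr real_of_int l * (2 / (1 - b powr (- \<epsilon>))) = B * b powr real_of_int l"
          using b\<epsilon> by (simp add: \<gamma>_def)
        finally show False using x by (simp add: not_less[symmetric])
      qed
      then have "emeasure M {x\<in>space M. ennreal (B * b powr real_of_int l) < ?F x} \<le> emeasure M (\<Union>k. {x\<in>space M. ennreal (th k l) < f k x})"
        by (intro emeasure_mono) auto
      also have "\<dots> \<le> (\<Sum>k. emeasure M {x\<in>space M. ennreal (th k l) < f k x})"
        by (intro emeasure_subadditive_countably) auto
      finally show ?thesis .
    qed
    have "(\<integral>\<^sup>+x. ennreal_rpow (?F x) q \<partial>M)
       \<le> (\<integral>\<^sup>+x. \<integral>\<^sup>+l. ennreal ((B * b powr (real_of_int l + 1)) powr q) * indicator {l. ennreal (B * b powr real_of_int l) < ?F x} l \<partial>count_space UNIV \<partial>M)"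
      by (intro nn_integral_mono dyadic_layer_bound b1 B q)
    also have "\<dots> = (\<integral>\<^sup>+x. \<integral>\<^sup>+l. ennreal ((B * b powr (real_of_int l + 1)) powr q) * indicator {x\<in>space M. ennreal (B * b powr real_of_int l) < ?F x} x \<partial>count_space UNIV \<partial>M)"
      by (intro nn_integral_cong) (auto simp: indicator_def)
    also have "\<dots> = (\<integral>\<^sup>+l. \<integral>\<^sup>+x. ennreal ((B * b powr (real_of_int l + 1)) powr q) * indicator {x\<in>space M. ennreal (B * b powr real_of_int l) < ?F x} x \<partial>M \<partial>count_space UNIV)"
      by (rule nn_integral_count_space_nn_integral) auto
    also have "\<dots> = (\<integral>\<^sup>+l. ennreal ((B * b powr (real_of_int l + 1)) powr q) * emeasure M {x\<in>space M. ennreal (B * b powr real_of_int l) < ?F x} \<partial>count_space UNIV)"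
      by (intro nn_integral_cong) (subst nn_integral_cmult_indicator, auto)
    \<comment> \<open>After the union bound the sums over l and k are exchanged. For fixed k the sum
      over l is geometric about k, and what is left is the sum of the squares of a, at most
      B^2.\<close>
    also have "\<dots> \<le> (\<integral>\<^sup>+l. (\<Sum>k. ennreal (B powr q * b powr q * K' * (a k / B)\<^sup>2) * ennreal ((b powr (- \<eta>)) powr \<bar>real_of_int l - real_of_int (int k)\<bar>)) \<partial>count_space UNIV)"
    proof (rule nn_integral_mono)
      fix l :: int
      have pw: "(B * b powr (real_of_int l + 1)) powr q = (B powr q * b powr q) * b powr (real_of_int l * q)"
        using B b1 by (simp add: powr_mult powr_add powr_powr)
      have "ennreal ((B * b powr (real_of_int l + 1)) powr q) * emeasure M {x\<in>space M. ennreal (B * b powr real_of_int l) < ?F x}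
        \<le> (ennreal (B powr q * b powr q) * ennreal (b powr (real_of_int l * q))) * (\<Sum>k. emeasure M {x\<in>space M. ennreal (th k l) < f k x})"
        unfolding pw by (intro mult_mono big) (auto simp: ennreal_mult)
      also have "\<dots> = (\<Sum>k. ennreal (B powr q * b powr q) * (emeasure M {x\<in>space M. ennreal (th k l) < f k x} * ennreal (b powr (real_of_int l * q))))"
        unfolding ennreal_suminf_cmult[symmetric] by (simp only: mult_ac)
      also have "\<dots> \<le> (\<Sum>k. ennreal (B powr q * b powr q) * ennreal (K' * (a k / B)\<^sup>2 * b powr (- (\<eta> * \<bar>real k - real_of_int l\<bar>))))"
        by (intro suminf_le mult_left_mono level) auto
      also have "\<dots> = (\<Sum>k. ennreal (B powr q * b powr q * K' * (a k / B)\<^sup>2) * ennreal ((b powr (- \<eta>)) powr \<bar>real_of_int l - real_of_int (int k)\<bar>))"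
      proof (intro arg_cong[where f = suminf] ext)
        fix k
        have "(b powr (- \<eta>)) powr \<bar>real_of_int l - real_of_int (int k)\<bar> = b powr (- (\<eta> * \<bar>real k - real_of_int l\<bar>))"
          unfolding powr_powr by (simp add: abs_minus_commute)
        then show "ennreal (B powr q * b powr q) * ennreal (K' * (a k / B)\<^sup>2 * b powr (- (\<eta> * \<bar>real k - real_of_int l\<bar>)))
          = ennreal (B powr q * b powr q * K' * (a k / B)\<^sup>2) * ennreal ((b powr (- \<eta>)) powr \<bar>real_of_int l - real_of_int (int k)\<bar>)"
          using K' by (simp only:) (subst (1 2) ennreal_mult[symmetric], auto simp: mult.assoc)
      qed
      finally show "ennreal ((B * b powr (real_of_int l + 1)) powr q) * emeasure M {x\<in>space M. ennreal (B * b powr real_of_int l) < ?F x}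
        \<le> (\<Sum>k. ennreal (B powr q * b powr q * K' * (a k / B)\<^sup>2) * ennreal ((b powr (- \<eta>)) powr \<bar>real_of_int l - real_of_int (int k)\<bar>))" .
    qed
    also have "\<dots> = (\<Sum>k. \<integral>\<^sup>+l. ennreal (B powr q * b powr q * K' * (a k / B)\<^sup>2) * ennreal ((b powr (- \<eta>)) powr \<bar>real_of_int l - real_of_int (int k)\<bar>) \<partial>count_space UNIV)"
      by (rule nn_integral_suminf) auto
    also have "\<dots> = (\<Sum>k. ennreal (B powr q * b powr q * K' * (a k / B)\<^sup>2) * (\<integral>\<^sup>+l. ennreal ((b powr (- \<eta>)) powr \<bar>real_of_int l - real_of_int (int k)\<bar>) \<partial>count_space UNIV))"
      by (simp only: nn_integral_cmult borel_measurable_count_space)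
    also have "\<dots> \<le> (\<Sum>k. ennreal (B powr q * b powr q * K' * (a k / B)\<^sup>2) * ennreal (2 / (1 - b powr (- \<eta>))))"
      by (intro suminf_le mult_left_mono nn_integral_geometric_int b\<eta>) auto
    also have "\<dots> = (\<Sum>k. ennreal (C * B powr q / B\<^sup>2) * ennreal ((a k)\<^sup>2))"
    proof (intro arg_cong[where f = suminf] ext)
      fix k
      show "ennreal (B powr q * b powr q * K' * (a k / B)\<^sup>2) * ennreal (2 / (1 - b powr (- \<eta>))) = ennreal (C * B powr q / B\<^sup>2) * ennreal ((a k)\<^sup>2)"
        using K' b\<eta> C by (subst (1 2) ennreal_mult[symmetric]) (auto simp: C_def power_divide mult_ac)
    qed
    also have "\<dots> = ennreal (C * B powr q / B\<^sup>2) * (\<Sum>k. ennreal ((a k)\<^sup>2))"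
      by (rule ennreal_suminf_cmult)
    also have "\<dots> \<le> ennreal (C * B powr q / B\<^sup>2) * ennreal (B\<^sup>2)"
      by (intro mult_left_mono sum) auto
    also have "\<dots> = ennreal (C * B powr q)"
      using C B by (subst ennreal_mult[symmetric]) auto
    finally show "(\<integral>\<^sup>+x. ennreal_rpow (\<Sum>k. f k x) q \<partial>M) \<le> ennreal (C * B powr q)" .
  qed
qed

section \<open>Dyadic decomposition in frequency\<close>

text \<open>Index 0 is the closed unit ball, index k > 0 the shell 2^(k-1) < |\<xi>| \<le> 2^k.
  Sharp cutoffs are harmless, as the shell estimates see the data only through an L2 norm and a
  support radius.\<close>

definition shell_index :: "'a::real_normed_vector \<Rightarrow> nat" where
  "shell_index \<xi> = (LEAST k. norm \<xi> \<le> 2 ^ k)"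

definition shell_part :: "('a::real_normed_vector \<Rightarrow> complex) \<Rightarrow> nat \<Rightarrow> 'a \<Rightarrow> complex" where
  "shell_part g k \<xi> = (if shell_index \<xi> = k then g \<xi> else 0)"

lemma norm_le_shell: "norm \<xi> \<le> 2 ^ shell_index \<xi>"
proof -
  obtain n where "norm \<xi> < 2 ^ n" using real_arch_pow[of 2 "norm \<xi>"] by auto
  then have "norm \<xi> \<le> 2 ^ n" by simp
  then show ?thesis unfolding shell_index_def by (rule LeastI)
qed

lemma shell_index_le_iff: "shell_index \<xi> \<le> k \<longleftrightarrow> norm \<xi> \<le> 2 ^ k"
proof
  assume "shell_index \<xi> \<le> k"
  then have "(2::real) ^ shell_index \<xi> \<le> 2 ^ k" by (intro power_increasing) auto
  then show "norm \<xi> \<le> 2 ^ k" using norm_le_shell[of \<xi>] by linarith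
next
  assume "norm \<xi> \<le> 2 ^ k"
  then show "shell_index \<xi> \<le> k" unfolding shell_index_def by (rule Least_le)
qed

lemma shell_sets [measurable]: "{\<xi>::'a::euclidean_space. shell_index \<xi> = k} \<in> sets borel"
proof -
  have le: "{\<xi>::'a. shell_index \<xi> \<le> j} \<in> sets borel" for j
    unfolding shell_index_le_iff by measurable
  show ?thesis
  proof (cases k)
    case 0
    then show ?thesis using le[of 0] by simp
  next
    case (Suc j)
    then have "{\<xi>::'a. shell_index \<xi> = k} = {\<xi>. shell_index \<xi> \<le> Suc j} - {\<xi>. shell_index \<xi> \<le> j}" by auto
    then show ?thesis using le[of "Suc j"] le[of j] by simp
  qed
qed

lemma shell_part_eq_indicator: "shell_part g k = (\<lambda>\<xi>. indicator {\<xi>. shell_index \<xi> = k} \<xi> * g \<xi>)"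
  by (auto simp: shell_part_def indicator_def)

lemma borel_measurable_shell_part [measurable]:
  fixes g :: "'a::euclidean_space \<Rightarrow> complex"
  assumes [measurable]: "g \<in> borel_measurable borel"
  shows "shell_part g k \<in> borel_measurable borel"
  unfolding shell_part_eq_indicator by measurable

lemma sum_shell_part: "(\<Sum>k<n. shell_part g k \<xi>) = (if shell_index \<xi> < n then g \<xi> else 0)"
  unfolding shell_part_def by (simp add: sum.delta')

lemma
  fixes g :: "'a::euclidean_space \<Rightarrow> complex"
  assumes [measurable]: "g \<in> borel_measurable borel" and fin: "sqnorm g < \<infinity>"
  shows sqnorm_shell_part_finite: "sqnorm (shell_part g k) < \<infinity>"
    and integrable_shell_part: "integrable lborel (shell_part g k)"
proof -
  show "sqnorm (shell_part g k) < \<infinity>"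
    by (rule le_less_trans[OF _ fin]) (auto simp: sqnorm_def shell_part_def intro!: nn_integral_mono)
  let ?I = "\<lambda>\<xi>::'a. complex_of_real (indicator {\<xi>. shell_index \<xi> = k} \<xi>)"
  have "sqnorm ?I \<le> (\<integral>\<^sup>+\<xi>. indicator (cball 0 (2 ^ k)) (\<xi>::'a) \<partial>lborel)"
    unfolding sqnorm_def using norm_le_shell[where 'a='a] by (intro nn_integral_mono) (auto simp: indicator_def)
  also have "\<dots> < \<infinity>" using emeasure_lborel_cball_finite[of "0::'a" "2 ^ k"] by simp
  finally have "integrable lborel (\<lambda>\<xi>. ?I \<xi> * g \<xi>)"
    using fin by (intro integrable_mult_sqnorm) measurable
  moreover have "shell_part g k = (\<lambda>\<xi>. ?I \<xi> * g \<xi>)"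
    by (auto simp: shell_part_def indicator_def)
  ultimately show "integrable lborel (shell_part g k)" by simp
qed

lemma norm_bessel_symbol: "norm (bessel_symbol s \<xi>) = (1 + (norm \<xi>)\<^sup>2) powr (s / 2)"
  by (simp add: bessel_symbol_def)

lemma borel_measurable_bessel_symbol [measurable]: "bessel_symbol s \<in> borel_measurable borel"
  unfolding bessel_symbol_def[abs_def] by measurable

text \<open>On a shell k > 0 the Bessel symbol is at least 2^((k-1) s), which accounts for the
  factor 2^s; on the unit ball it is at least 1 as s \<ge> 0. The shells are disjoint, so the
  squares add up without loss.\<close>

lemma sum_sqnorm_shell_part_le:
  fixes g :: "'a::euclidean_space \<Rightarrow> complex"
  assumes [measurable]: "g \<in> borel_measurable borel" and s: "s \<ge> 0"
  shows "(\<Sum>k. ennreal ((2 powr (real k * s))\<^sup>2) * sqnorm (shell_part g k)) \<le> ennreal ((2 powr s)\<^sup>2) * sqnorm (\<lambda>\<xi>. bessel_symbol s \<xi> * g \<xi>)"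
proof -
  have pt: "2 powr (real (shell_index \<xi>) * s) \<le> 2 powr s * norm (bessel_symbol s \<xi>)" for \<xi> :: 'a
  proof (cases "shell_index \<xi>")
    case 0
    have "1 * 1 \<le> 2 powr s * norm (bessel_symbol s \<xi>)"
      unfolding norm_bessel_symbol using s by (intro mult_mono ge_one_powr_ge_zero) auto
    then show ?thesis using 0 by simp
  next
    case (Suc j)
    then have "\<not> shell_index \<xi> \<le> j" by simp
    then have j: "2 ^ j < norm \<xi>" unfolding shell_index_le_iff by simp
    have "2 powr (real (shell_index \<xi>) * s) = 2 powr s * (2 ^ j) powr s"
      unfolding Suc by (simp add: powr_realpow[symmetric] powr_powr powr_add[symmetric] algebra_simps)
    also have "(2 ^ j) powr s \<le> (norm \<xi>) powr s" using j s by (intro powr_mono2) auto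
    also have "(norm \<xi>) powr s = ((norm \<xi>) powr 2) powr (s / 2)" by (simp only: powr_powr) simp
    also have "\<dots> \<le> norm (bessel_symbol s \<xi>)"
      unfolding norm_bessel_symbol using s by (intro powr_mono2) auto
    finally show ?thesis by (simp add: mult_left_mono)
  qed
  have "(\<Sum>k. ennreal ((2 powr (real k * s))\<^sup>2) * sqnorm (shell_part g k))
     = (\<Sum>k. \<integral>\<^sup>+\<xi>. ennreal ((2 powr (real k * s) * norm (g \<xi>))\<^sup>2) * indicator {\<xi>. shell_index \<xi> = k} \<xi> \<partial>lborel)"
  proof (intro arg_cong[where f = suminf] ext)
    fix k
    have "ennreal ((2 powr (real k * s))\<^sup>2) * sqnorm (shell_part g k) = (\<integral>\<^sup>+\<xi>. ennreal ((2 powr (real k * s))\<^sup>2) * ennreal ((norm (shell_part g k \<xi>))\<^sup>2) \<partial>lborel)"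
      unfolding sqnorm_def by (rule nn_integral_cmult[symmetric]) measurable
    also have "\<dots> = (\<integral>\<^sup>+\<xi>. ennreal ((2 powr (real k * s) * norm (g \<xi>))\<^sup>2) * indicator {\<xi>. shell_index \<xi> = k} \<xi> \<partial>lborel)"
      by (intro nn_integral_cong) (auto simp: shell_part_def indicator_def ennreal_mult[symmetric] power_mult_distrib)
    finally show "ennreal ((2 powr (real k * s))\<^sup>2) * sqnorm (shell_part g k) = \<dots>" .
  qed
  also have "\<dots> = (\<integral>\<^sup>+\<xi>. (\<Sum>k. ennreal ((2 powr (real k * s) * norm (g \<xi>))\<^sup>2) * indicator {\<xi>. shell_index \<xi> = k} \<xi>) \<partial>lborel)"
    by (rule nn_integral_suminf[symmetric]) measurable
  also have "\<dots> = (\<integral>\<^sup>+\<xi>. ennreal ((2 powr (real (shell_index \<xi>) * s) * norm (g \<xi>))\<^sup>2) \<partial>lborel)"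
  proof (rule nn_integral_cong)
    fix \<xi> :: 'a
    have "disjoint_family (\<lambda>k. {\<xi>::'a. shell_index \<xi> = k})" by (auto simp: disjoint_family_on_def)
    then show "(\<Sum>k. ennreal ((2 powr (real k * s) * norm (g \<xi>))\<^sup>2) * indicator {\<xi>. shell_index \<xi> = k} \<xi>) = ennreal ((2 powr (real (shell_index \<xi>) * s) * norm (g \<xi>))\<^sup>2)"
      by (rule suminf_cmult_indicator) auto
  qed
  also have "\<dots> \<le> (\<integral>\<^sup>+\<xi>. ennreal ((2 powr s)\<^sup>2) * ennreal ((norm (bessel_symbol s \<xi> * g \<xi>))\<^sup>2) \<partial>lborel)"
  proof (rule nn_integral_mono)
    fix \<xi> :: 'a
    have "2 powr (real (shell_index \<xi>) * s) * norm (g \<xi>) \<le> 2 powr s * norm (bessel_symbol s \<xi> * g \<xi>)"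
      using mult_right_mono[OF pt[of \<xi>] norm_ge_zero[of "g \<xi>"]] by (simp add: norm_mult mult.assoc)
    then have "(2 powr (real (shell_index \<xi>) * s) * norm (g \<xi>))\<^sup>2 \<le> (2 powr s * norm (bessel_symbol s \<xi> * g \<xi>))\<^sup>2"
      by (intro power_mono) auto
    then show "ennreal ((2 powr (real (shell_index \<xi>) * s) * norm (g \<xi>))\<^sup>2) \<le> ennreal ((2 powr s)\<^sup>2) * ennreal ((norm (bessel_symbol s \<xi> * g \<xi>))\<^sup>2)"
      by (simp only: ennreal_mult[symmetric] zero_le_power2 power_mult_distrib[symmetric] ennreal_leI)
  qed
  also have "\<dots> = ennreal ((2 powr s)\<^sup>2) * sqnorm (\<lambda>\<xi>. bessel_symbol s \<xi> * g \<xi>)"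
    unfolding sqnorm_def by (rule nn_integral_cmult) measurable
  finally show ?thesis .
qed

text \<open>Built with the forward transform: compared with the wave evolution the point is
  reflected and the normalising factor is omitted. Both are restored in
  \<open>wave_version_exists\<close>.\<close>

definition shell_maximal :: "('a::euclidean_space \<Rightarrow> complex) \<Rightarrow> nat \<Rightarrow> 'a \<Rightarrow> ennreal" where
  "shell_maximal g k = maximal_fun (\<lambda>t. fourier (\<lambda>\<xi>. cis (t * norm \<xi>) * shell_part g k \<xi>))"

lemma borel_measurable_shell_maximal [measurable]:
  fixes g :: "'a::euclidean_space \<Rightarrow> complex"
  assumes [measurable]: "g \<in> borel_measurable borel" and "sqnorm g < \<infinity>"
  shows "shell_maximal g k \<in> borel_measurable borel"
  unfolding shell_maximal_def
  by (intro borel_measurable_maximal_fun continuous_on_fourier_modulated integrable_shell_part assms) measurable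

lemma weak_type_mono: "weak_type X K s p \<Longrightarrow> K \<le> K' \<Longrightarrow> weak_type X K' s p"
  unfolding weak_type_def by (meson mult_right_mono order_trans powr_ge_zero)

text \<open>\<sigma> - m / q is the affine law of the segment containing q. The exponents around q
  are 2 and \<open>q_circ\<close> on the first segment, \<open>q_circ\<close> and q + 1 on the
  second, where every larger exponent is available.\<close>

lemma s_c_interpolation:
  assumes d: "DIM('a::euclidean_space) \<ge> 2" and q: "2 < q" "q \<noteq> q_circ DIM('a)"
  obtains K p0 p1 m \<sigma> where "K > 0" "2 \<le> p0" "p0 < q" "q < p1" "m > 0" "s_c q DIM('a) = \<sigma> - m / q"
    "weak_type TYPE('a) K (\<sigma> - m / p0) p0" "weak_type TYPE('a) K (\<sigma> - m / p1) p1"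
proof -
  let ?d = "real DIM('a)"
  let ?c = "q_circ DIM('a)"
  have d1: "?d > 1" using d by linarith
  have c2: "?c > 2" unfolding q_circ_def using d1 by (simp add: field_simps)
  obtain Kc where Kc: "Kc > 0" "weak_type TYPE('a) Kc (?d / 2 - ?d / ?c) ?c"
    using weak_type_q_circ[OF d order_refl] .
  show ?thesis
  proof (cases "q < ?c")
    case True
    obtain K2 where K2: "K2 > 0" "weak_type TYPE('a) K2 (1 / 2) 2" by (rule weak_type_2)
    have e0: "(?d + 1) / 4 - (?d - 1) / 2 / 2 = 1 / 2" by (simp add: field_simps)
    \<comment> \<open>The two formulas for the critical exponent agree at \<open>q_circ\<close>, so
      the bound proved there also fits the law of the first segment.\<close>
    have "(?d - 1) / 2 / ?c = (?d - 1)\<^sup>2 / (4 * (?d + 1))"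
      unfolding q_circ_def using d1 by (simp add: field_simps power2_eq_square)
    moreover have "?d / ?c = ?d * (?d - 1) / (2 * (?d + 1))"
      unfolding q_circ_def using d1 by (simp add: field_simps)
    moreover have "(?d + 1) / 4 - (?d - 1)\<^sup>2 / (4 * (?d + 1)) = ?d / 2 - ?d * (?d - 1) / (2 * (?d + 1))"
      using d1 by (simp add: field_simps power2_eq_square)
    ultimately have e1: "(?d + 1) / 4 - (?d - 1) / 2 / ?c = ?d / 2 - ?d / ?c" by simp
    show ?thesis
    proof (rule that[of "max K2 Kc" 2 ?c "(?d - 1) / 2" "(?d + 1) / 4"])
      show "weak_type TYPE('a) (max K2 Kc) ((?d + 1) / 4 - (?d - 1) / 2 / 2) 2"
        unfolding e0 by (rule weak_type_mono[OF K2(2)]) simp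
      show "weak_type TYPE('a) (max K2 Kc) ((?d + 1) / 4 - (?d - 1) / 2 / ?c) ?c"
        unfolding e1 by (rule weak_type_mono[OF Kc(2)]) simp
      show "s_c q DIM('a) = (?d + 1) / 4 - (?d - 1) / 2 / q" using True by (simp add: s_c_def)
    qed (use K2 Kc True q d1 in auto)
  next
    case False
    then have qc: "q > ?c" using q by simp
    obtain K1 where K1: "K1 > 0" "weak_type TYPE('a) K1 (?d / 2 - ?d / (q + 1)) (q + 1)"
      using weak_type_q_circ[OF d, of "q + 1"] qc by auto
    show ?thesis
    proof (rule that[of "max K1 Kc" ?c "q + 1" ?d "?d / 2"])
      show "weak_type TYPE('a) (max K1 Kc) (?d / 2 - ?d / ?c) ?c"
        by (rule weak_type_mono[OF Kc(2)]) simp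
      show "weak_type TYPE('a) (max K1 Kc) (?d / 2 - ?d / (q + 1)) (q + 1)"
        by (rule weak_type_mono[OF K1(2)]) simp
      show "s_c q DIM('a) = ?d / 2 - ?d / q" using qc by (simp add: s_c_def)
    qed (use K1 Kc qc c2 d1 in auto)
  qed
qed

lemma s_c_nonneg: "d \<ge> 2 \<Longrightarrow> q > 2 \<Longrightarrow> s_c q d \<ge> 0"
proof -
  assume d: "d \<ge> 2" and q: "q > 2"
  have "(real d - 1) / (2 * q) \<le> (real d - 1) / (2 * 2)" using d q by (intro divide_left_mono) auto
  moreover have "real d / q \<le> real d / 2" using q by (intro divide_left_mono) auto
  ultimately show ?thesis unfolding s_c_def by (auto simp: field_simps)
qed

lemma ennreal_rpow_mono: "x \<le> y \<Longrightarrow> p \<ge> 0 \<Longrightarrow> ennreal_rpow x p \<le> ennreal_rpow y p"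
  unfolding ennreal_rpow_def
  by (auto simp: top_unique less_top intro!: ennreal_leI powr_mono2 enn2real_mono)

lemma shell_maximal_sum_bound:
  assumes d: "DIM('a::euclidean_space) \<ge> 2" and q: "2 < q" "q \<noteq> q_circ DIM('a)"
  obtains C where "C > 0" "\<And>g :: 'a \<Rightarrow> complex. g \<in> borel_measurable borel \<Longrightarrow> sqnorm g < \<infinity> \<Longrightarrow>
     sqnorm (\<lambda>\<xi>. bessel_symbol (s_c q DIM('a)) \<xi> * g \<xi>) < \<infinity> \<Longrightarrow>
     Lp_norm q (\<lambda>x. \<Sum>k. shell_maximal g k x) \<le> ennreal C * L2_norm_fun (\<lambda>\<xi>. bessel_symbol (s_c q DIM('a)) \<xi> * g \<xi>)"
proof -
  define s where "s = s_c q DIM('a)"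
  have s0: "s \<ge> 0" unfolding s_def by (rule s_c_nonneg[OF d q(1)])
  obtain K p0 p1 m \<sigma> where K: "K > 0" and p: "2 \<le> p0" "p0 < q" "q < p1" and m: "m > 0" and s: "s = \<sigma> - m / q"
    and w0: "weak_type TYPE('a) K (\<sigma> - m / p0) p0" and w1: "weak_type TYPE('a) K (\<sigma> - m / p1) p1"
    unfolding s_def by (rule s_c_interpolation[OF d q])
  show ?thesis
  proof (rule weak_type_summation[OF p m K, where 'a = 'a])
    fix C :: real
    assume C: "C > 0" and bound: "\<And>(M :: 'a measure) (f :: nat \<Rightarrow> 'a \<Rightarrow> ennreal) a B. (\<And>k. f k \<in> borel_measurable M) \<Longrightarrow> (\<And>k. a k \<ge> 0) \<Longrightarrow> B > 0 \<Longrightarrow>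
     (\<Sum>k. ennreal ((a k)\<^sup>2)) \<le> ennreal (B\<^sup>2) \<Longrightarrow>
     (\<And>k \<alpha>. \<alpha> > 0 \<Longrightarrow> emeasure M {x\<in>space M. ennreal \<alpha> < f k x} \<le> ennreal (K * (2 powr (- (real k * m / p0)) * (a k * (2 powr (m / q)) powr real k) / \<alpha>) powr p0)) \<Longrightarrow>
     (\<And>k \<alpha>. \<alpha> > 0 \<Longrightarrow> emeasure M {x\<in>space M. ennreal \<alpha> < f k x} \<le> ennreal (K * (2 powr (- (real k * m / p1)) * (a k * (2 powr (m / q)) powr real k) / \<alpha>) powr p1)) \<Longrightarrow>
     (\<integral>\<^sup>+x. ennreal_rpow (\<Sum>k. f k x) q \<partial>M) \<le> ennreal (C * B powr q)"
    define C' where "C' = C powr (1 / q)"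
    have C': "C' > 0" using C by (simp add: C'_def)
    show ?thesis
    proof (rule that[of "C' * 2 powr s"])
      show "C' * 2 powr s > 0" using C' by simp
      fix g :: "'a \<Rightarrow> complex"
      assume g [measurable]: "g \<in> borel_measurable borel" and fin: "sqnorm g < \<infinity>"
        and bfin: "sqnorm (\<lambda>\<xi>. bessel_symbol (s_c q DIM('a)) \<xi> * g \<xi>) < \<infinity>"
      define X where "X = enn2real (sqnorm (\<lambda>\<xi>. bessel_symbol s \<xi> * g \<xi>))"
      have X: "sqnorm (\<lambda>\<xi>. bessel_symbol s \<xi> * g \<xi>) = ennreal X" "X \<ge> 0"
        using bfin by (auto simp: X_def s_def)
      define A where "A k = sqrt (enn2real (sqnorm (shell_part g k)))" for k
      \<comment> \<open>The Sobolev-weighted norm of a shell. With s = \<sigma> - m / q the factor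
        2^(k (\<sigma> - m / p)) of the weak type bound takes the form that the summation lemma
        expects.\<close>
      define a where "a k = 2 powr (real k * s) * A k" for k
      have A0: "A k \<ge> 0" for k by (simp add: A_def)
      have a0: "a k \<ge> 0" for k by (simp add: a_def A0)
      have A2: "ennreal ((A k)\<^sup>2) = sqnorm (shell_part g k)" for k
        using sqnorm_shell_part_finite[OF g fin, of k] by (simp add: A_def)
      have "(\<Sum>k. ennreal ((a k)\<^sup>2)) = (\<Sum>k. ennreal ((2 powr (real k * s))\<^sup>2) * sqnorm (shell_part g k))"
        unfolding A2[symmetric] a_def by (simp add: power_mult_distrib ennreal_mult)
      also have "\<dots> \<le> ennreal ((2 powr s)\<^sup>2) * sqnorm (\<lambda>\<xi>. bessel_symbol s \<xi> * g \<xi>)"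
        by (rule sum_sqnorm_shell_part_le[OF g s0])
      also have "\<dots> = ennreal ((2 powr s * sqrt X)\<^sup>2)"
        unfolding X(1) using X(2) by (simp add: ennreal_mult power_mult_distrib)
      finally have asum: "(\<Sum>k. ennreal ((a k)\<^sup>2)) \<le> ennreal ((2 powr s * sqrt X)\<^sup>2)" .
      have wk: "emeasure lborel {x\<in>space lborel. ennreal \<alpha> < shell_maximal g k x}
          \<le> ennreal (K * (2 powr (- (real k * m / p')) * (a k * (2 powr (m / q)) powr real k) / \<alpha>) powr p')"
        if w: "weak_type TYPE('a) K (\<sigma> - m / p') p'" and \<alpha>: "\<alpha> > 0" for k \<alpha> p'
      proof -
        have supp: "norm \<xi> \<le> 2 ^ k" if "shell_part g k \<xi> \<noteq> 0" for \<xi>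
          using that norm_le_shell[of \<xi>] by (auto simp: shell_part_def split: if_splits)
        have "emeasure lborel {x. ennreal \<alpha> < shell_maximal g k x} \<le> ennreal (K * ((2 ^ k) powr (\<sigma> - m / p') * A k / \<alpha>) powr p')"
          unfolding shell_maximal_def A_def
          by (rule weak_type_maximal_fun[OF w integrable_shell_part[OF g fin] sqnorm_shell_part_finite[OF g fin] supp _ \<alpha>]) auto
        also have "(2 ^ k) powr (\<sigma> - m / p') * A k = 2 powr (- (real k * m / p')) * (a k * (2 powr (m / q)) powr real k)"
        proof -
          have "real k * (\<sigma> - m / p') = - (real k * m / p') + (real k * s + m / q * real k)"
            by (simp add: s algebra_simps)
          then have "(2 ^ k) powr (\<sigma> - m / p') = 2 powr (- (real k * m / p')) * (2 powr (real k * s) * (2 powr (m / q)) powr real k)"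
            by (simp only: powr_realpow[symmetric] zero_less_numeral powr_powr powr_add)
          then show ?thesis by (simp add: a_def mult_ac)
        qed
        finally show ?thesis by simp
      qed
      \<comment> \<open>The summation lemma asks for B > 0, which would fail if X = 0; the margin e
        is removed at the end.\<close>
      have est: "Lp_norm q (\<lambda>x. \<Sum>k. shell_maximal g k x) \<le> ennreal (C' * (2 powr s * sqrt X + e))" if e: "e > 0" for e
      proof -
        define B where "B = 2 powr s * sqrt X + e"
        have B: "B > 0" using e X by (simp add: B_def add_nonneg_pos)
        have "(\<Sum>k. ennreal ((a k)\<^sup>2)) \<le> ennreal (B\<^sup>2)"
          by (rule order_trans[OF asum]) (use e X in \<open>auto simp: B_def intro!: ennreal_leI power_mono\<close>)
        then have "(\<integral>\<^sup>+x. ennreal_rpow (\<Sum>k. shell_maximal g k x) q \<partial>lborel) \<le> ennreal (C * B powr q)"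
          using borel_measurable_shell_maximal[OF g fin]
          by (intro bound[where a = a] a0 B wk[OF w0] wk[OF w1]) auto
        then have "Lp_norm q (\<lambda>x. \<Sum>k. shell_maximal g k x) \<le> ennreal_rpow (ennreal (C * B powr q)) (1 / q)"
          unfolding Lp_norm_def using q by (intro ennreal_rpow_mono) auto
        also have "\<dots> = ennreal (C' * B)"
          using C B q by (simp add: ennreal_rpow_def C'_def powr_mult powr_powr)
        finally show ?thesis by (simp add: B_def)
      qed
      have "Lp_norm q (\<lambda>x. \<Sum>k. shell_maximal g k x) \<le> ennreal (C' * (2 powr s * sqrt X))"
      proof (rule ennreal_le_epsilon)
        fix e :: real assume e: "e > 0"
        have "Lp_norm q (\<lambda>x. \<Sum>k. shell_maximal g k x) \<le> ennreal (C' * (2 powr s * sqrt X + e / C'))"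
          using e C' by (intro est) auto
        also have "C' * (2 powr s * sqrt X + e / C') = C' * (2 powr s * sqrt X) + e"
          using C' by (simp add: field_simps)
        finally show "Lp_norm q (\<lambda>x. \<Sum>k. shell_maximal g k x) \<le> ennreal (C' * (2 powr s * sqrt X)) + ennreal e"
          using e C' X by (simp add: ennreal_plus)
      qed
      also have "\<dots> = ennreal (C' * 2 powr s) * L2_norm_fun (\<lambda>\<xi>. bessel_symbol (s_c q DIM('a)) \<xi> * g \<xi>)"
        unfolding L2_norm_fun_eq s_def[symmetric] X(1) using C' X(2)
        by (simp add: ennreal_rpow_def ennreal_mult[symmetric] powr_half_sqrt mult.assoc)
      finally show "Lp_norm q (\<lambda>x. \<Sum>k. shell_maximal g k x) \<le> ennreal (C' * 2 powr s) * L2_norm_fun (\<lambda>\<xi>. bessel_symbol (s_c q DIM('a)) \<xi> * g \<xi>)" .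
    qed
  qed
qed

section \<open>Continuous versions of the wave evolution\<close>

lemma sqnorm_cis_mult: "sqnorm (\<lambda>\<xi>. cis (c \<xi>) * g \<xi>) = sqnorm g"
  by (simp add: sqnorm_def norm_mult)

lemma ennreal_norm_le_shell_maximal:
  "t \<in> {0<..<1} \<Longrightarrow> ennreal (cmod (fourier (\<lambda>\<xi>. cis (t * norm \<xi>) * shell_part g k \<xi>) x)) \<le> shell_maximal g k x"
  unfolding shell_maximal_def maximal_fun_def by (rule SUP_upper)

lemma AE_lborel_reflect:
  fixes P :: "'a::euclidean_space \<Rightarrow> bool"
  assumes [measurable]: "Measurable.pred borel P" and P: "AE x in lborel. P x"
  shows "AE x in lborel. P (- x)"
proof -
  have "AE x in distr lborel borel uminus. P (x::'a)" unfolding distr_uminus_lborel by (rule P)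
  then show ?thesis by (subst (asm) AE_distr_iff) auto
qed

lemma ennreal_rpow_eq_top_iff: "ennreal_rpow x p = top \<longleftrightarrow> x = top"
  by (auto simp: ennreal_rpow_def)

text \<open>Finiteness of the norm also yields existence: at almost every point the shell maxima are
  summable, so the shell series converges uniformly in t by the Weierstrass test and inherits
  continuity. Its transform is found as the limit of those of the partial sums.\<close>

lemma wave_version_exists:
  fixes f g :: "'a::euclidean_space \<Rightarrow> complex"
  assumes fg: "has_fourier_L2 f g" and q: "q > 0"
    and fin: "Lp_norm q (\<lambda>x. \<Sum>k. shell_maximal g k x) < \<infinity>"
  obtains u where "is_wave_version f u"
    "\<And>x. maximal_fun u x \<le> (\<Sum>k. shell_maximal g k (- x))"
    "\<And>t. t \<in> {0<..<1} \<Longrightarrow> has_fourier_L2 (u t) (\<lambda>\<xi>. cis (t * norm \<xi>) * g \<xi>)"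
proof -
  note g [measurable] = has_fourier_L2_measurable(2)[OF fg]
  note gfin = has_fourier_L2_finite(2)[OF fg]
  note [measurable] = borel_measurable_shell_maximal[OF g gfin]
  define F where "F x = (\<Sum>k. shell_maximal g k x)" for x
  have F_meas [measurable]: "F \<in> borel_measurable borel" unfolding F_def[abs_def] by measurable
  define v where "v k t x = fourier (\<lambda>\<xi>. cis (t * norm \<xi>) * shell_part g k \<xi>) x" for k t x
  have vm [measurable]: "v k t \<in> borel_measurable borel" for k t unfolding v_def[abs_def] by measurable
  \<comment> \<open>Dividing by c restores the normalisation; since |c| \<ge> 1, this can only
    decrease the maximal function.\<close>
  define c where "c = complex_of_real ((2 * pi) ^ DIM('a))"
  have c: "norm c \<ge> 1"
  proof -
    have "1 \<le> (2 * pi) ^ DIM('a)" using pi_gt3 by (intro one_le_power) auto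
    then show ?thesis unfolding c_def norm_of_real by simp
  qed
  \<comment> \<open>The value 0 on the exceptional set keeps u measurable for each t and continuous
    in t at every x.\<close>
  define u where "u t x = (if F (- x) < top then (\<Sum>k. v k t (- x)) / c else 0)" for t x
  have um [measurable]: "u t \<in> borel_measurable borel" for t
    unfolding u_def[abs_def] by measurable
  have good: "summable (\<lambda>k. enn2real (shell_maximal g k x)) \<and> (\<forall>k. \<forall>t\<in>{0<..<1}. norm (v k t x) \<le> enn2real (shell_maximal g k x))"
    and Fsum: "ennreal (\<Sum>k. enn2real (shell_maximal g k x)) = F x"
    if x: "F x < top" for x
  proof -
    have k: "shell_maximal g k x < top" for k
    proof -
      have "shell_maximal g k x = (\<Sum>i\<in>{k}. shell_maximal g i x)" by simp
      also have "\<dots> \<le> F x" unfolding F_def by (rule sum_le_suminf) auto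
      finally show ?thesis using x by (rule le_less_trans)
    qed
    have eq: "ennreal (enn2real (shell_maximal g k x)) = shell_maximal g k x" for k using k[of k] by simp
    have "(\<Sum>k. ennreal (enn2real (shell_maximal g k x))) \<noteq> top" unfolding eq using x by (simp add: F_def)
    then have s: "summable (\<lambda>k. enn2real (shell_maximal g k x))" by (intro summable_suminf_not_top) auto
    have "norm (v k t x) \<le> enn2real (shell_maximal g k x)" if "t \<in> {0<..<1}" for k t
      using ennreal_norm_le_shell_maximal[OF that, of g k x] eq[of k] unfolding v_def
      by (metis enn2real_nonneg ennreal_le_iff)
    with s show "summable (\<lambda>k. enn2real (shell_maximal g k x)) \<and> (\<forall>k. \<forall>t\<in>{0<..<1}. norm (v k t x) \<le> enn2real (shell_maximal g k x))"
      by blast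
    show "ennreal (\<Sum>k. enn2real (shell_maximal g k x)) = F x"
      unfolding F_def using suminf_ennreal2[OF _ s] by (simp add: eq)
  qed
  have AEF: "AE x in lborel. F (- x) < top"
  proof (rule AE_lborel_reflect)
    have "(\<integral>\<^sup>+x. ennreal_rpow (F x) q \<partial>lborel) < \<infinity>"
      using fin unfolding Lp_norm_def F_def[symmetric] by simp
    moreover have "(\<lambda>x. ennreal_rpow (F x) q) \<in> borel_measurable borel"
      unfolding ennreal_rpow_def by measurable
    ultimately have "AE x in lborel. ennreal_rpow (F x) q \<noteq> \<infinity>"
      by (intro nn_integral_PInf_AE) auto
    then show "AE x in lborel. F x < top" by eventually_elim (simp add: ennreal_rpow_eq_top_iff less_top)
  qed measurable
  have cont: "continuous_on {0<..<1} (\<lambda>t. u t x)" for x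
  proof (cases "F (- x) < top")
    case True
    have "uniform_limit {0<..<1} (\<lambda>n t. \<Sum>k<n. v k t (- x)) (\<lambda>t. \<Sum>k. v k t (- x)) sequentially"
      using good[OF True] by (intro Weierstrass_m_test) auto
    then have "continuous_on {0<..<1} (\<lambda>t. \<Sum>k. v k t (- x))"
      by (rule uniform_limit_theorem[rotated])
         (auto intro!: always_eventually continuous_on_sum continuous_on_fourier_modulated integrable_shell_part g gfin simp: v_def)
    then have "continuous_on {0<..<1} (\<lambda>t. (\<Sum>k. v k t (- x)) / c)"
      using c by (intro continuous_on_divide continuous_on_const) auto
    then show ?thesis using True by (simp add: u_def)
  qed (simp add: u_def)
  have max: "maximal_fun u x \<le> F (- x)" for x
    unfolding maximal_fun_def
  proof (rule SUP_least)
    fix t :: real assume t: "t \<in> {0<..<1}"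
    show "ennreal (cmod (u t x)) \<le> F (- x)"
    proof (cases "F (- x) < top")
      case True
      note gd = good[OF True]
      have sn: "summable (\<lambda>k. norm (v k t (- x)))"
        by (rule summable_comparison_test'[OF conjunct1[OF gd], of 0]) (use gd t in auto)
      have "norm (u t x) \<le> norm (\<Sum>k. v k t (- x))"
        using True c by (simp add: u_def norm_divide divide_le_eq mult_left_mono[of 1 "norm c" "norm (\<Sum>k. v k t (- x))", simplified])
      also have "\<dots> \<le> (\<Sum>k. norm (v k t (- x)))" by (rule summable_norm[OF sn])
      also have "\<dots> \<le> (\<Sum>k. enn2real (shell_maximal g k (- x)))"
        using gd t by (intro suminf_le sn) auto
      finally show ?thesis unfolding Fsum[OF True, symmetric] by (rule ennreal_leI)
    qed (simp add: u_def)
  qed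
  have four: "has_fourier_L2 (u t) (\<lambda>\<xi>. cis (t * norm \<xi>) * g \<xi>)" if t: "t \<in> {0<..<1}" for t
  proof -
    \<comment> \<open>Data with truncated frequencies are integrable, unlike g in general, so their
      inverse transforms are explicit integrals.\<close>
    define H where "H n \<xi> = (\<Sum>k<n. cis (t * norm \<xi>) * shell_part g k \<xi>)" for n :: nat and \<xi> :: 'a
    have H_eq: "H n \<xi> = cis (t * norm \<xi>) * (if shell_index \<xi> < n then g \<xi> else 0)" for n \<xi>
      unfolding H_def sum_distrib_left[symmetric] sum_shell_part ..
    have Hm [measurable]: "H n \<in> borel_measurable borel" for n unfolding H_def[abs_def] by measurable
    have pi: "integrable lborel (\<lambda>\<xi>. cis (t * norm \<xi>) * shell_part g k \<xi>)" for k
      by (intro integrable_cis_mult integrable_shell_part g gfin) measurable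
    have Hi: "integrable lborel (H n)" for n
      unfolding H_def[abs_def] by (intro Bochner_Integration.integrable_sum pi)
    have Hfin: "sqnorm (H n) < \<infinity>" for n
      by (rule le_less_trans[OF _ gfin]) (auto simp: sqnorm_def H_eq norm_mult intro!: nn_integral_mono)
    have Hf: "inv_fourier (H n) x = (\<Sum>k<n. v k t (- x)) / c" for n x
    proof -
      have "fourier (H n) y = (\<Sum>k<n. v k t y)" for y
        unfolding fourier_def v_def H_def sum_distrib_left
        by (rule Bochner_Integration.integral_sum) (intro integrable_cis_mult pi; measurable)
      then show ?thesis by (simp add: inv_fourier_def c_def)
    qed
    show ?thesis
    proof (rule has_fourier_L2_limit[where u = "\<lambda>n. inv_fourier (H n)" and G = H])
      show "has_fourier_L2 (inv_fourier (H n)) (H n)" for n by (rule has_fourier_L2_inv_fourier[OF Hi Hfin])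
      show "AE x in lborel. (\<lambda>n. inv_fourier (H n) x) \<longlonglongrightarrow> u t x"
        using AEF
      proof eventually_elim
        case (elim x)
        note gd = good[OF elim]
        have "summable (\<lambda>k. v k t (- x))"
          by (rule summable_comparison_test'[OF conjunct1[OF gd], of 0]) (use gd t in auto)
        then have "(\<lambda>n. \<Sum>k<n. v k t (- x)) \<longlonglongrightarrow> (\<Sum>k. v k t (- x))" by (rule summable_LIMSEQ)
        then have "(\<lambda>n. (\<Sum>k<n. v k t (- x)) / c) \<longlonglongrightarrow> (\<Sum>k. v k t (- x)) / c"
          using c by (intro tendsto_divide tendsto_const) auto
        then show ?case using elim by (simp add: Hf u_def)
      qed
      show "sqnorm (\<lambda>\<xi>. cis (t * norm \<xi>) * g \<xi>) < \<infinity>" using gfin by (simp add: sqnorm_cis_mult)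
      \<comment> \<open>At each frequency H is eventually equal to the phase times g, and |g|^2
        dominates.\<close>
      have "(\<lambda>n. \<integral>\<^sup>+\<xi>. ennreal ((norm (H n \<xi> - cis (t * norm \<xi>) * g \<xi>))\<^sup>2) \<partial>lborel) \<longlonglongrightarrow> (\<integral>\<^sup>+\<xi>. 0 \<partial>(lborel :: 'a measure))"
      proof (rule nn_integral_dominated_convergence[where w = "\<lambda>\<xi>. ennreal ((norm (g \<xi>))\<^sup>2)"])
        show "(\<integral>\<^sup>+\<xi>. ennreal ((norm (g \<xi>))\<^sup>2) \<partial>lborel) < \<infinity>" using gfin by (simp add: sqnorm_def)
        show "AE \<xi> in lborel. ennreal ((norm (H n \<xi> - cis (t * norm \<xi>) * g \<xi>))\<^sup>2) \<le> ennreal ((norm (g \<xi>))\<^sup>2)" for n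
          by (intro AE_I2) (auto simp: H_eq norm_mult)
        show "AE \<xi> in lborel. (\<lambda>n. ennreal ((norm (H n \<xi> - cis (t * norm \<xi>) * g \<xi>))\<^sup>2)) \<longlonglongrightarrow> 0"
        proof (rule AE_I2)
          fix \<xi> :: 'a
          have "eventually (\<lambda>n. shell_index \<xi> < n) sequentially" by (rule eventually_gt_at_top)
          then have "eventually (\<lambda>n. ennreal ((norm (H n \<xi> - cis (t * norm \<xi>) * g \<xi>))\<^sup>2) = 0) sequentially"
            by eventually_elim (simp add: H_eq)
          then show "(\<lambda>n. ennreal ((norm (H n \<xi> - cis (t * norm \<xi>) * g \<xi>))\<^sup>2)) \<longlonglongrightarrow> 0" by (rule tendsto_eventually)
        qed
      qed measurable
      then show "(\<lambda>n. sqnorm (\<lambda>\<xi>. H n \<xi> - cis (t * norm \<xi>) * g \<xi>)) \<longlonglongrightarrow> 0" by (simp add: sqnorm_def)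
    qed measurable
  qed
  have "is_wave_version f u"
    unfolding is_wave_version_def is_fourier_multiplier_def using fg four cont by auto
  then show ?thesis using that[of u] max four unfolding F_def by blast
qed

text \<open>A version may come with its own transform g' of f at each time, but g' = g almost
  everywhere. Two versions then agree at each time off a null set, hence at all rational times off a
  single null set, and continuity does the rest.\<close>

lemma wave_version_unique:
  fixes f g :: "'a::euclidean_space \<Rightarrow> complex"
  assumes fg: "has_fourier_L2 f g" and u: "is_wave_version f u"
    and uf: "\<And>t. t \<in> {0<..<1} \<Longrightarrow> has_fourier_L2 (u t) (\<lambda>\<xi>. cis (t * norm \<xi>) * g \<xi>)"
    and u': "is_wave_version f u'"
  shows "AE x in lborel. maximal_fun u' x = maximal_fun u x"
proof -
  note [measurable] = has_fourier_L2_measurable(2)[OF fg]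
  have eq: "AE x in lborel. u' t x = u t x" if t: "t \<in> {0<..<1}" for t
  proof -
    obtain g' where g': "has_fourier_L2 f g'" "has_fourier_L2 (u' t) (\<lambda>\<xi>. cis (t * norm \<xi>) * g' \<xi>)"
      using u' t unfolding is_wave_version_def is_fourier_multiplier_def by blast
    have "AE \<xi> in lborel. g' \<xi> = g \<xi>" by (rule has_fourier_L2_unique_right[OF g'(1) fg])
    then have "AE \<xi> in lborel. cis (t * norm \<xi>) * g' \<xi> = cis (t * norm \<xi>) * g \<xi>" by eventually_elim simp
    then have "has_fourier_L2 (u' t) (\<lambda>\<xi>. cis (t * norm \<xi>) * g \<xi>)"
      by (intro has_fourier_L2_cong_right[OF g'(2)]) measurable
    then show ?thesis using uf[OF t] by (rule has_fourier_L2_unique_left)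
  qed
  have "AE x in lborel. \<forall>t\<in>{0<..<1} \<inter> \<rat>. u' t x = u t x"
    by (subst AE_ball_countable[OF countable_unit_rationals]) (use eq in auto)
  moreover have "AE x in lborel. continuous_on {0<..<1} (\<lambda>t. u t x)" "AE x in lborel. continuous_on {0<..<1} (\<lambda>t. u' t x)"
    using u u' unfolding is_wave_version_def by auto
  ultimately show ?thesis
  proof eventually_elim
    case (elim x)
    have "maximal_fun u' x = (SUP t\<in>{0<..<1} \<inter> \<rat>. ennreal (cmod (u' t x)))" by (rule maximal_fun_rational[of u' x, OF elim(3)])
    also have "\<dots> = (SUP t\<in>{0<..<1} \<inter> \<rat>. ennreal (cmod (u t x)))" using elim(1) by (intro SUP_cong) auto
    also have "\<dots> = maximal_fun u x" by (rule maximal_fun_rational[of u x, OF elim(2), symmetric])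
    finally show ?case .
  qed
qed

lemma L2_norm_fun_le:
  assumes "sqnorm f \<le> ennreal k * sqnorm h" "k > 0" "sqnorm h < \<infinity>"
  shows "L2_norm_fun f \<le> ennreal (sqrt k) * L2_norm_fun h"
proof -
  obtain y where y: "sqnorm h = ennreal y" "y \<ge> 0" using assms(3) by (cases "sqnorm h") auto
  have "L2_norm_fun f \<le> ennreal_rpow (ennreal (k * y)) (1 / 2)"
    unfolding L2_norm_fun_eq using assms(1,2) y by (intro ennreal_rpow_mono) (auto simp: ennreal_mult)
  also have "\<dots> = ennreal (sqrt k) * L2_norm_fun h"
    unfolding L2_norm_fun_eq y(1) using assms(2) y(2)
    by (simp add: ennreal_rpow_def ennreal_mult[symmetric] powr_half_sqrt real_sqrt_mult)
  finally show ?thesis .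
qed

lemma sobolev_maximal_bound:
  assumes d: "DIM('a::euclidean_space) \<ge> 2" and q: "2 < q" "q \<noteq> q_circ DIM('a)"
  obtains C :: real where "\<And>f :: 'a \<Rightarrow> complex. f \<in> sobolev_space (s_c q DIM('a)) \<Longrightarrow>
       (\<exists>u. is_wave_version f u) \<and>
       (\<forall>u. is_wave_version f u \<longrightarrow> Lp_norm q (maximal_fun u) \<le> ennreal C * sobolev_norm (s_c q DIM('a)) f)"
proof (rule shell_maximal_sum_bound[OF d q])
  let ?s = "s_c q DIM('a)"
  fix C :: real
  assume C: "C > 0" and bound: "\<And>g :: 'a \<Rightarrow> complex. g \<in> borel_measurable borel \<Longrightarrow> sqnorm g < \<infinity> \<Longrightarrow>
     sqnorm (\<lambda>\<xi>. bessel_symbol ?s \<xi> * g \<xi>) < \<infinity> \<Longrightarrow>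
     Lp_norm q (\<lambda>x. \<Sum>k. shell_maximal g k x) \<le> ennreal C * L2_norm_fun (\<lambda>\<xi>. bessel_symbol ?s \<xi> * g \<xi>)"
  \<comment> \<open>The constant of \<open>sqnorm_fourier_le_sqnorm\<close>, which leads from the
    weighted transform back to (1 - \<Delta>)^(s/2) f.\<close>
  define k where "k = 4 * (2 * pi) ^ DIM('a)"
  have k: "k > 0" by (simp add: k_def)
  show ?thesis
  proof (rule that[of "C * sqrt k"])
    fix f :: "'a \<Rightarrow> complex" assume f: "f \<in> sobolev_space ?s"
    \<comment> \<open>The same choice as inside \<open>sobolev_norm\<close>, so that the Sobolev
      norm is literally the L2 norm of h.\<close>
    define h where "h = (SOME h. is_fourier_multiplier (bessel_symbol ?s) f h)"
    have "\<exists>h. is_fourier_multiplier (bessel_symbol ?s) f h"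
      using f by (simp add: sobolev_space_def)
    then have "is_fourier_multiplier (bessel_symbol ?s) f h"
      unfolding h_def by (rule someI_ex)
    then obtain g where fg: "has_fourier_L2 f g" and hg: "has_fourier_L2 h (\<lambda>\<xi>. bessel_symbol ?s \<xi> * g \<xi>)"
      unfolding is_fourier_multiplier_def by blast
    have norm: "sobolev_norm ?s f = L2_norm_fun h" by (simp add: sobolev_norm_def h_def)
    note g [measurable] = has_fourier_L2_measurable(2)[OF fg]
    note gfin = has_fourier_L2_finite(2)[OF fg]
    note [measurable] = borel_measurable_shell_maximal[OF g gfin]
    have b: "Lp_norm q (\<lambda>x. \<Sum>k. shell_maximal g k x) \<le> ennreal C * L2_norm_fun (\<lambda>\<xi>. bessel_symbol ?s \<xi> * g \<xi>)"
      by (rule bound[OF g gfin has_fourier_L2_finite(2)[OF hg]])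
    have "L2_norm_fun (\<lambda>\<xi>. bessel_symbol ?s \<xi> * g \<xi>) \<le> ennreal (sqrt k) * L2_norm_fun h"
      using sqnorm_fourier_le_sqnorm[OF hg] k has_fourier_L2_finite(1)[OF hg] unfolding k_def by (intro L2_norm_fun_le) auto
    then have "ennreal C * L2_norm_fun (\<lambda>\<xi>. bessel_symbol ?s \<xi> * g \<xi>) \<le> ennreal C * (ennreal (sqrt k) * L2_norm_fun h)"
      by (rule mult_left_mono) simp
    with b have main: "Lp_norm q (\<lambda>x. \<Sum>k. shell_maximal g k x) \<le> ennreal (C * sqrt k) * sobolev_norm ?s f"
      unfolding norm using C k by (simp add: ennreal_mult mult.assoc)
    have hfin: "L2_norm_fun h < \<infinity>" using has_fourier_L2_finite(1)[OF hg] by (simp add: L2_norm_fun_eq)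
    have fin: "Lp_norm q (\<lambda>x. \<Sum>k. shell_maximal g k x) < \<infinity>"
      by (rule le_less_trans[OF main]) (use hfin in \<open>simp add: norm ennreal_mult_less_top\<close>)
    have q0: "q > 0" using q by simp
    obtain u where u: "is_wave_version f u" "\<And>x. maximal_fun u x \<le> (\<Sum>k. shell_maximal g k (- x))"
      "\<And>t. t \<in> {0<..<1} \<Longrightarrow> has_fourier_L2 (u t) (\<lambda>\<xi>. cis (t * norm \<xi>) * g \<xi>)"
      by (rule wave_version_exists[OF fg q0 fin]) (rule that; assumption)
    have "Lp_norm q (maximal_fun u') \<le> ennreal (C * sqrt k) * sobolev_norm ?s f" if u': "is_wave_version f u'" for u'
    proof -
      have "AE x in lborel. maximal_fun u' x = maximal_fun u x" by (rule wave_version_unique[OF fg u(1,3) u'])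
      \<comment> \<open>A comparison almost everywhere is enough here; the reflection it introduces
        is undone by the invariance of Lebesgue measure.\<close>
      then have "(\<integral>\<^sup>+x. ennreal_rpow (maximal_fun u' x) q \<partial>lborel) \<le> (\<integral>\<^sup>+x. ennreal_rpow (\<Sum>k. shell_maximal g k (- x)) q \<partial>lborel)"
        using u(2) q by (intro nn_integral_mono_AE) (auto elim!: eventually_mono intro!: ennreal_rpow_mono)
      also have "\<dots> = (\<integral>\<^sup>+x. ennreal_rpow (\<Sum>k. shell_maximal g k x) q \<partial>lborel)"
      proof -
        have "(\<lambda>x. ennreal_rpow (\<Sum>k. shell_maximal g k x) q) \<in> borel_measurable borel"
          unfolding ennreal_rpow_def by measurable
        from nn_integral_lborel_reflect[OF this, of 0] show ?thesis by (simp only: diff_0)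
      qed
      finally have "Lp_norm q (maximal_fun u') \<le> Lp_norm q (\<lambda>x. \<Sum>k. shell_maximal g k x)"
        unfolding Lp_norm_def using q by (intro ennreal_rpow_mono) auto
      with main show ?thesis by (rule order_trans[rotated])
    qed
    with u(1) show "(\<exists>u. is_wave_version f u) \<and> (\<forall>u. is_wave_version f u \<longrightarrow> Lp_norm q (maximal_fun u) \<le> ennreal (C * sqrt k) * sobolev_norm ?s f)"
      by blast
  qed
qed

section \<open>Schwartz data\<close>

text \<open>Rapid decay of the transform absorbs the growth of the symbol, so the product is
  integrable and square integrable and has an inverse transform given by an integral.\<close>

lemma schwartz_in_sobolev_space:
  fixes f :: "'a::euclidean_space \<Rightarrow> complex"
  assumes f: "schwartz f"
  shows "f \<in> sobolev_space s"
proof -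
  note [measurable] = schwartz_measurable[OF f]
  \<comment> \<open>An integer at least s, so that the symbol grows at most like (1 + |\<xi>|)^n; a
    further decay of order 2 d secures integrability.\<close>
  define n where "n = nat \<lceil>\<bar>s\<bar>\<rceil>"
  have n: "s \<le> real n" unfolding n_def by linarith
  obtain C where C: "C \<ge> 0" "\<And>\<xi>. norm (fourier f \<xi>) \<le> C / (1 + norm \<xi>) ^ (n + 2 * DIM('a))"
    using schwartz_fourier_decay[OF f] by blast
  define G where "G \<xi> = bessel_symbol s \<xi> * fourier f \<xi>" for \<xi>
  have Gm: "G \<in> borel_measurable borel" unfolding G_def[abs_def] by measurable
  have G_le: "norm (G \<xi>) \<le> C / (1 + norm \<xi>) ^ (2 * DIM('a))" for \<xi>
  proof -
    have "(1 + (norm \<xi>)\<^sup>2) powr (s / 2) \<le> (1 + (norm \<xi>)\<^sup>2) powr (real n / 2)"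
      using n by (intro powr_mono) auto
    also have "\<dots> \<le> ((1 + norm \<xi>) powr 2) powr (real n / 2)"
      by (intro powr_mono2) (auto simp: power2_sum)
    also have "\<dots> = (1 + norm \<xi>) ^ n" unfolding powr_powr by (simp add: powr_realpow add_pos_nonneg)
    finally have b: "norm (bessel_symbol s \<xi>) \<le> (1 + norm \<xi>) ^ n" unfolding norm_bessel_symbol .
    have "norm (G \<xi>) \<le> (1 + norm \<xi>) ^ n * (C / (1 + norm \<xi>) ^ (n + 2 * DIM('a)))"
      unfolding G_def norm_mult by (intro mult_mono b C) auto
    also have "\<dots> = C / (1 + norm \<xi>) ^ (2 * DIM('a))"
    proof -
      have "1 + norm \<xi> \<noteq> 0" using norm_ge_zero[of \<xi>] by linarith
      then show ?thesis by (simp add: power_add)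
    qed
    finally show ?thesis .
  qed
  have "has_fourier_L2 (inv_fourier G) G"
    by (rule has_fourier_L2_inv_fourier[OF integrable_decay[OF Gm G_le] sqnorm_decay_finite[OF Gm G_le]])
  then show ?thesis
    unfolding sobolev_space_def is_fourier_multiplier_def G_def[abs_def]
    using has_fourier_L2_schwartz[OF f] by blast
qed

text \<open>The integral defining \<open>wave\<close> is the inverse transform of an integrable
  function, so its continuity in t holds at every x by dominated convergence.\<close>

lemma wave_is_wave_version:
  fixes f :: "'a::euclidean_space \<Rightarrow> complex"
  assumes f: "schwartz f"
  shows "is_wave_version f (\<lambda>t. wave t f)"
proof -
  note [measurable] = schwartz_measurable[OF f]
  note fi = schwartz_fourier_integrable[OF f]
  have eq: "wave t f x = inv_fourier (\<lambda>\<xi>. cis (t * norm \<xi>) * fourier f \<xi>) x" for t x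
    unfolding wave_def inv_fourier_def fourier_def[of "\<lambda>\<xi>. cis (t * norm \<xi>) * fourier f \<xi>"]
    by (simp add: cis_mult[symmetric] mult.assoc inner_commute scaleR_conv_of_real divide_inverse mult_ac)
  have "has_fourier_L2 (wave t f) (\<lambda>\<xi>. cis (t * norm \<xi>) * fourier f \<xi>)" for t
  proof -
    have "wave t f = inv_fourier (\<lambda>\<xi>. cis (t * norm \<xi>) * fourier f \<xi>)" by (rule ext) (rule eq)
    moreover have "has_fourier_L2 (inv_fourier (\<lambda>\<xi>. cis (t * norm \<xi>) * fourier f \<xi>)) (\<lambda>\<xi>. cis (t * norm \<xi>) * fourier f \<xi>)"
    proof (rule has_fourier_L2_inv_fourier)
      show "integrable lborel (\<lambda>\<xi>. cis (t * norm \<xi>) * fourier f \<xi>)"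
        by (intro integrable_cis_mult fi) measurable
      show "sqnorm (\<lambda>\<xi>. cis (t * norm \<xi>) * fourier f \<xi>) < \<infinity>"
        unfolding sqnorm_cis_mult by (rule schwartz_fourier_sqnorm_finite[OF f])
    qed
    ultimately show ?thesis by simp
  qed
  moreover have "continuous_on {0<..<1} (\<lambda>t. wave t f x)" for x
    unfolding eq inv_fourier_def
    by (intro continuous_on_divide continuous_on_fourier_modulated fi continuous_on_const) simp
  ultimately show ?thesis
    unfolding is_wave_version_def is_fourier_multiplier_def using has_fourier_L2_schwartz[OF f] by auto
qed

theorem theorem1p1:
  fixes q :: real
  assumes "CARD('n::finite) \<ge> 2"
    and "2 < q"
    and "q \<noteq> q_circ CARD('n)"
  shows "\<exists>C::real.
    (\<forall>f :: real^'n \<Rightarrow> complex. schwartz f \<longrightarrow>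
       Lp_norm q (maximal_fun (\<lambda>t. wave t f))
         \<le> ennreal C * sobolev_norm (s_c q CARD('n)) f) \<and>
    (\<forall>f :: real^'n \<Rightarrow> complex. f \<in> sobolev_space (s_c q CARD('n)) \<longrightarrow>
       (\<exists>u. is_wave_version f u) \<and>
       (\<forall>u. is_wave_version f u \<longrightarrow>
          Lp_norm q (maximal_fun u) \<le> ennreal C * sobolev_norm (s_c q CARD('n)) f))"
proof -
  have dim: "DIM(real^'n) = CARD('n)" by simp
  obtain C where C: "\<And>f :: real^'n \<Rightarrow> complex. f \<in> sobolev_space (s_c q CARD('n)) \<Longrightarrow>
       (\<exists>u. is_wave_version f u) \<and>
       (\<forall>u. is_wave_version f u \<longrightarrow> Lp_norm q (maximal_fun u) \<le> ennreal C * sobolev_norm (s_c q CARD('n)) f)"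
    using sobolev_maximal_bound[where 'a = "real^'n", unfolded dim, OF assms] by blast
  \<comment> \<open>The estimate for Schwartz data is the general one applied to the particular
    version given by \<open>wave\<close>.\<close>
  then show ?thesis
    using schwartz_in_sobolev_space wave_is_wave_version by blast
qed

end
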